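(* For any commutative integral domain $R$ with $1$, the left and right generalized Schur algebras $LGS_R(M,\mathbf G)=R\otimes_{\mathbb Z}A_L^{\mathbb Z}$ and $RGS_R(M,\mathbf G)=R\otimes_{\mathbb Z}A_R^{\mathbb Z}$ are cell algebras with cell basis $\{{}_{(O_\mu,S)}C^\lambda_{(O_\nu,T)} : \lambda\in\Lambda,\ (O_\mu,S)\in L(\lambda),\ (O_\nu,T)\in R(\lambda)\}$ (with poset $\Lambda$ and index sets $L(\lambda),R(\lambda)$).
   Context: **Cell algebras.** Let $R$ be a commutative integral domain with $1$, $A$ an associative unital $R$-algebra, $\Lambda$ a finite poset, and for each $\lambda\in\Lambda$ let $L(\lambda),R(\lambda)$ be finite sets. Suppose given elements ${}_sC_t^\lambda\in A$ ($\lambda\in\Lambda$, $s\in L(\lambda)$, $t\in R(\lambda)$) such that $(\lambda,s,t)\mapsto{}_sC^\lambda_t$ is injective with image a free $R$-basis of $A$. Let $\hat A^\lambda$ be the $R$-span of all ${}_sC_t^\mu$ with $\mu>\lambda$. The basis is a cell basis, and $A$ is a cell algebra with poset $\Lambda$, if (i) for all $a\in A$, $\lambda\in\Lambda$, $s,s'\in L(\lambda)$ there is $r_L(a,\lambda,s,s')\in R$ such that for every $t\in R(\lambda)$, $a\cdot{}_sC_t^\lambda\equiv\sum_{s'\in L(\lambda)}r_L(a,\lambda,s,s')\,{}_{s'}C_t^\lambda \bmod \hat A^\lambda$; and (ii) for all $a\in A$, $\lambda\in\Lambda$, $t,t'\in R(\lambda)$ there is $r_R(a,\lambda,t,t')\in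 R$ such that for every $s\in L(\lambda)$, ${}_sC_t^\lambda\cdot a\equiv\sum_{t'\in R(\lambda)}r_R(a,\lambda,t,t')\,{}_sC_{t'}^\lambda\bmod\hat A^\lambda$. **Monoids.** $r\ge1$ and $n\ge r$ are integers; $\bar m=\{1,\dots,m\}$. $\bar\tau_r$ is the monoid (under composition) of all maps $\alpha:\bar r\cup\{0\}\to\bar r\cup\{0\}$ with $\alpha(0)=0$. Permutations of $\bar i$ are extended by $0\mapsto0$, so $\mathfrak S_r\subseteq\bar\tau_r$. $M$ is a monoid with $\mathfrak S_r\subseteq M\subseteq\bar\tau_r$. The index of $\alpha$ is $|\mathrm{image}(\alpha)\setminus\{0\}|$, and $I(M)$ is the set of indices of elements of $M$. $\Lambda(r,n)$ is the set of compositions of $r$ with $n$ (nonnegative) parts; for $\mu\in\Lambda(r,n)$, $b^\mu_1,b^\mu_2,\dots$ are the consecutive blocks of $\bar r$ with $|b^\mu_j|=\mu_j$, and $\mathfrak S_\mu$ is the Young subgroup preserving each block (similarly for compositions of $i$). $\mathbf G=\{\mathfrak S_\mu:\mu\in\Lambda(r,n)\}$. **Combinatorial data.** $C(i,r)$ is the set of $i$-element subsets of $\bar r$; for $C=\{c_1<\dots<c_i\}$, $\phi_C:\bar i\cup\{0\}\to\bar r\cup\{0\}$ is $\phi_C(j)=c_j$, $\phi_C(0)=0$. $P_r$ is the set of all subsets of $\bar r$; $\mathfrak S_\nu$ acts on the right by $S\pi=\pi^{-1}(S)$. For each $\nu\in\Lambda(r,n)$ choose a total order $O_1<\dots<O_{N_\nu}$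 on the $\mathfrak S_\nu$-orbits in $P_r$ and a total order on $P_r$ compatible with it (sets in a smaller orbit are smaller). $D(i,r)$ is the collection of sets $D$ of $i$ nonempty pairwise disjoint subsets of $\bar r$; writing $D=\{S_{a_1}<\dots<S_{a_i}\}$ in the order chosen for $\nu$, $\psi_D:\bar r\cup\{0\}\to\bar i\cup\{0\}$ sends $x\in S_{a_j}$ to $j$ and all other $x$ to $0$. Each $\alpha\in\bar\tau_r$ of index $i$ is uniquely $\alpha=\phi_{C_\alpha}\circ\sigma_\alpha\circ\psi_{D_\alpha}$ with $C_\alpha\in C(i,r)$, $\sigma_\alpha\in\mathfrak S_i$, $D_\alpha\in D(i,r)$. $D(M,i,r)=\{D_\alpha:\alpha\in M\text{ of index }i\}$. $\mathfrak S_\mu$ acts on the left on $C(i,r)$ by $\rho C=\rho(C)$, with orbits $O(\mu,C)$; $\mathfrak S_\nu$ acts on the right on $D(M,i,r)$ by $D\pi=\{\pi^{-1}(d):d\in D\}$, with orbits $O(\nu,D)$. For $C\in C(i,r)$, $\mu(C)$ is the composition of $i$ with $\mu(C)_j=|b^\mu_j\cap C|$; for $D\in D(M,i,r)$, $\nu(D)$ is the composition of $i$ with $N_\nu$ parts $\nu(D)_j=|D\cap O_j|$. These depend only on the orbits; write $\mu(O_\mu)$, $\nu(O_\nu)$. **The module $\bar A$.** For $\mu,\nu\in\Lambda(r,n)$, ${}^\mu A^\nu$ is the $\mathbb Z$-submodule of $\mathbb Z[M]$ of elements invariant under left multiplication by $\mathfrak S_\mu$ and right multiplication by $\mathfrak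 S_\nu$. ${}_\mu M_\nu$ is the set of double cosets $\mathbf D=\mathfrak S_\mu m\mathfrak S_\nu$, $m\in M$; the sums $X(\mathbf D)=\sum_{m\in\mathbf D}m$ form a $\mathbb Z$-basis of ${}^\mu A^\nu$. $\bar A=\bigoplus_{\mu,\nu\in\Lambda(r,n)}{}^\mu A^\nu$ (external direct sum) has $\mathbb Z$-basis the elements $b_{\mathbf D}=X(\mathbf D)$. **Left and right products.** For $\mathbf D_1\in{}_\mu M_\nu$, $\mathbf D_2\in{}_\nu M_\pi$ write, in $\mathbb Z[M]$, $X(\mathbf D_1)X(\mathbf D_2)=\sum_{\mathbf D\in{}_\mu M_\pi}a(\mathbf D_1,\mathbf D_2,\mathbf D)X(\mathbf D)$. For $\mathbf D\in{}_\mu M_\nu$ let $n_L(\mathbf D)=|\mathfrak S_\mu m|$ and $n_R(\mathbf D)=|m\mathfrak S_\nu|$ for any $m\in\mathbf D$. For $*\in\{L,R\}$ define bilinear products on $\bar A$ by $b_{\mathbf D_1}*_{*}b_{\mathbf D_2}=\sum_{\mathbf D}\frac{n_*(\mathbf D)}{n_*(\mathbf D_1)n_*(\mathbf D_2)}a(\mathbf D_1,\mathbf D_2,\mathbf D)b_{\mathbf D}$ for $\mathbf D_1\in{}_\mu M_\nu,\mathbf D_2\in{}_\nu M_\pi$, and $0$ for $\mathbf D_1\in{}_\mu M_\nu,\mathbf D_2\in{}_\rho M_\pi$ with $\nu\ne\rho$. It is known that the structure constants are integers and the products are associative with identity. $A_L^{\mathbb Z}$, $A_R^{\mathbb Z}$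 denote $\bar A$ with product $*_L$, $*_R$ respectively. **The basis.** $\Lambda(i)$ is the set of partitions of $i$ ($\Lambda(0)=\{\lambda_0\}$, the empty partition), $\Lambda=\bigcup_{i\in I(M)}\Lambda(i)$, ordered by $\lambda\ge\mu$ iff $\mathrm{index}(\lambda)<\mathrm{index}(\mu)$, or the indices agree and $\lambda$ dominates $\mu$ (index of $\lambda\in\Lambda(i)$ is $i$). For $\lambda\in\Lambda(i)$, $L(\lambda)$ is the set of pairs $(O_\mu,S)$ with $\mu\in\Lambda(r,n)$ (part of the data), $O_\mu$ an $\mathfrak S_\mu$-orbit in $C(i,r)$, $S$ a semistandard $\lambda$-tableau of type $\mu(O_\mu)$; $R(\lambda)$ is the set of pairs $(O_\nu,T)$ with $\nu\in\Lambda(r,n)$ (part of the data), $O_\nu$ an $\mathfrak S_\nu$-orbit in $D(M,i,r)$, $T$ a semistandard $\lambda$-tableau of type $\nu(O_\nu)$. The Murphy basis of $\mathbb Z[\mathfrak S_i]$: for a standard $\lambda$-tableau $s$ let $d(s)\in\mathfrak S_i$ be the permutation taking the entries of the row-reading tableau $t^\lambda$ to those of $s$, $r_\lambda=\sum_{\sigma\in\mathfrak S_\lambda}\sigma$, and ${}_sC_t^\lambda=d(s)\,r_\lambda\,d(t)^{-1}$. A standard tableau has type $S$ with respect to a composition if replacing each entry by the number of the block containing it gives $S$. Set ${}_SC_T^\lambda=\sum_{s,t}{}_sC_t^\lambda$, over standard $s$ of type $S$ (w.r.t. $\mu(O_\mu)$) and standard $t$ of type $T$ (w.r.t. $\nu(O_\nu)$),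 and ${}_{(O_\mu,S)}C^\lambda_{(O_\nu,T)}=\sum_{C\in O_\mu}\sum_{D\in O_\nu}\phi_C\circ{}_SC_T^\lambda\circ\psi_D\in{}^\mu A^\nu\subseteq\bar A$ (composition extended linearly, $\psi_D$ formed with the order for $\nu$; for $\lambda_0$ this is the zero map in ${}^\mu A^\nu$). In $R\otimes_{\mathbb Z}\bar A$ the same symbol denotes $1\otimes{}_{(O_\mu,S)}C^\lambda_{(O_\nu,T)}$. *)

theory Defs
  imports "HOL-Algebra.Algebra" "HOL-Algebra.Free_Abelian_Groups"
    "HOL-Combinatorics.Permutations" "HOL-Library.Disjoint_Sets"
begin

section \<open>Cell algebras\<close>

text \<open>The library locale \<^locale>\<open>algebra\<close> is for commutative algebras only.\<close>

locale unital_algebra = module R A + A?: ring A for R (structure) and A (structure) +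
  assumes smult_mult_left:
      "\<lbrakk>r \<in> carrier R; x \<in> carrier A; y \<in> carrier A\<rbrakk>
        \<Longrightarrow> (r \<odot>\<^bsub>A\<^esub> x) \<otimes>\<^bsub>A\<^esub> y = r \<odot>\<^bsub>A\<^esub> (x \<otimes>\<^bsub>A\<^esub> y)"
    and smult_mult_right:
      "\<lbrakk>r \<in> carrier R; x \<in> carrier A; y \<in> carrier A\<rbrakk>
        \<Longrightarrow> x \<otimes>\<^bsub>A\<^esub> (r \<odot>\<^bsub>A\<^esub> y) = r \<odot>\<^bsub>A\<^esub> (x \<otimes>\<^bsub>A\<^esub> y)"

text \<open>Span and free basis are only used for finite sets \<open>B\<close>, where
  \<^const>\<open>finsum\<close> is the actual sum.\<close>

definition lin_span ::
    "('a, 'm) ring_scheme \<Rightarrow> ('a, 'b, 'q) module_scheme \<Rightarrow> 'b set \<Rightarrow> 'b set" where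
  "lin_span R A B =
    {\<Oplus>\<^bsub>A\<^esub>b\<in>B. f b \<odot>\<^bsub>A\<^esub> b | f. f \<in> B \<rightarrow> carrier R}"

definition finite_free_basis ::
    "('a, 'm) ring_scheme \<Rightarrow> ('a, 'b, 'q) module_scheme \<Rightarrow> 'b set \<Rightarrow> bool" where
  "finite_free_basis R A B \<longleftrightarrow>
    finite B \<and> B \<subseteq> carrier A \<and>
    (\<forall>x\<in>carrier A. \<exists>!f. f \<in> B \<rightarrow>\<^sub>E carrier R \<and> x = (\<Oplus>\<^bsub>A\<^esub>b\<in>B. f b \<odot>\<^bsub>A\<^esub> b))"

text \<open>\<open>leq\<close> is the order of the poset \<open>\<Lambda>\<close> as a relation: \<open>(\<xi>, \<mu>) \<in> leq\<close>
  means \<open>\<xi> \<le> \<mu>\<close>.  The letter \<open>\<xi>\<close> is used for elements of \<open>\<Lambda>\<close> throughout.\<close>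

definition upper_span ::
    "('a, 'm) ring_scheme \<Rightarrow> ('a, 'b, 'q) module_scheme \<Rightarrow> 'p rel \<Rightarrow> 'p set \<Rightarrow>
     ('p \<Rightarrow> 's set) \<Rightarrow> ('p \<Rightarrow> 't set) \<Rightarrow> ('p \<Rightarrow> 's \<Rightarrow> 't \<Rightarrow> 'b) \<Rightarrow> 'p \<Rightarrow> 'b set" where
  "upper_span R A leq \<Lambda> L Rt C \<xi> =
    lin_span R A {C \<mu> s t | \<mu> s t.
      \<mu> \<in> \<Lambda> \<and> (\<xi>, \<mu>) \<in> leq \<and> \<xi> \<noteq> \<mu> \<and> s \<in> L \<mu> \<and> t \<in> Rt \<mu>}"

locale cell_algebra = unital_algebra R A + domain R
  for R :: "('a, 'm) ring_scheme" (structure)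
    and A :: "('a, 'b, 'q) module_scheme" (structure) +
  fixes \<Lambda> :: "'p set" and leq :: "'p rel"
    and L :: "'p \<Rightarrow> 's set" and Rt :: "'p \<Rightarrow> 't set"
    and C :: "'p \<Rightarrow> 's \<Rightarrow> 't \<Rightarrow> 'b"
  assumes finite_poset: "finite \<Lambda>" "partial_order_on \<Lambda> leq"
    and finite_index: "\<And>\<xi>. \<xi> \<in> \<Lambda> \<Longrightarrow> finite (L \<xi>)" "\<And>\<xi>. \<xi> \<in> \<Lambda> \<Longrightarrow> finite (Rt \<xi>)"
    and cell_inj: "inj_on (\<lambda>(\<xi>, s, t). C \<xi> s t) (SIGMA \<xi>:\<Lambda>. L \<xi> \<times> Rt \<xi>)"
    and cell_basis:
      "finite_free_basis R A ((\<lambda>(\<xi>, s, t). C \<xi> s t) ` (SIGMA \<xi>:\<Lambda>. L \<xi> \<times> Rt \<xi>))"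
    and cell_left: "\<And>a \<xi> s. a \<in> carrier A \<Longrightarrow> \<xi> \<in> \<Lambda> \<Longrightarrow> s \<in> L \<xi> \<Longrightarrow>
      \<exists>\<rho> \<in> L \<xi> \<rightarrow> carrier R. \<forall>t \<in> Rt \<xi>.
        (a \<otimes>\<^bsub>A\<^esub> C \<xi> s t) \<ominus>\<^bsub>A\<^esub> (\<Oplus>\<^bsub>A\<^esub>s'\<in>L \<xi>. \<rho> s' \<odot>\<^bsub>A\<^esub> C \<xi> s' t)
          \<in> upper_span R A leq \<Lambda> L Rt C \<xi>"
    and cell_right: "\<And>a \<xi> t. a \<in> carrier A \<Longrightarrow> \<xi> \<in> \<Lambda> \<Longrightarrow> t \<in> Rt \<xi> \<Longrightarrow>
      \<exists>\<rho> \<in> Rt \<xi> \<rightarrow> carrier R. \<forall>s \<in> L \<xi>.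
        (C \<xi> s t \<otimes>\<^bsub>A\<^esub> a) \<ominus>\<^bsub>A\<^esub> (\<Oplus>\<^bsub>A\<^esub>t'\<in>Rt \<xi>. \<rho> t' \<odot>\<^bsub>A\<^esub> C \<xi> s t')
          \<in> upper_span R A leq \<Lambda> L Rt C \<xi>"


section \<open>Base change of a ring along the integers\<close>

text \<open>\<open>R \<otimes>\<^sub>\<int> A\<close> is the free abelian group on \<open>R \<times> A\<close> modulo the subgroup
  generated by the biadditivity relations.  The multiplication
  \<open>(r \<otimes> a) (s \<otimes> b) = rs \<otimes> ab\<close> is induced by the one of the monoid ring \<open>\<int>[R \<times> A]\<close>
  (in which the relations subgroup is an ideal), and \<open>R\<close> acts through \<open>s \<mapsto> s \<otimes> 1\<close>.\<close>

definition pair_ring ::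
    "('a, 'm) ring_scheme \<Rightarrow> ('b, 'q) ring_scheme \<Rightarrow> (('a \<times> 'b) \<Rightarrow>\<^sub>0 int) ring" where
  "pair_ring R A =
    \<lparr>carrier = {c. Poly_Mapping.keys c \<subseteq> carrier R \<times> carrier A},
     monoid.mult = (\<lambda>x y. frag_extend (\<lambda>(r, a).
       frag_extend (\<lambda>(s, b). frag_of (r \<otimes>\<^bsub>R\<^esub> s, a \<otimes>\<^bsub>A\<^esub> b)) y) x),
     one = frag_of (\<one>\<^bsub>R\<^esub>, \<one>\<^bsub>A\<^esub>),
     ring.zero = 0,
     ring.add = (+)\<rparr>"

definition tensor_relations ::
    "('a, 'm) ring_scheme \<Rightarrow> ('b, 'q) ring_scheme \<Rightarrow> (('a \<times> 'b) \<Rightarrow>\<^sub>0 int) set" where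
  "tensor_relations R A = generate (free_Abelian_group (carrier R \<times> carrier A))
    ({frag_of (r \<oplus>\<^bsub>R\<^esub> s, a) - frag_of (r, a) - frag_of (s, a) | r s a.
        r \<in> carrier R \<and> s \<in> carrier R \<and> a \<in> carrier A} \<union>
     {frag_of (r, a \<oplus>\<^bsub>A\<^esub> b) - frag_of (r, a) - frag_of (r, b) | r a b.
        r \<in> carrier R \<and> a \<in> carrier A \<and> b \<in> carrier A})"

definition pure_tensor ::
    "('a, 'm) ring_scheme \<Rightarrow> ('b, 'q) ring_scheme \<Rightarrow> 'a \<Rightarrow> 'b \<Rightarrow> (('a \<times> 'b) \<Rightarrow>\<^sub>0 int) set" where
  "pure_tensor R A r a = tensor_relations R A +>\<^bsub>pair_ring R A\<^esub> frag_of (r, a)"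

definition base_change ::
    "('a, 'm) ring_scheme \<Rightarrow> ('b, 'q) ring_scheme \<Rightarrow>
     ('a, (('a \<times> 'b) \<Rightarrow>\<^sub>0 int) set) module" where
  "base_change R A = (let Q = pair_ring R A Quot tensor_relations R A in
    \<lparr>carrier = carrier Q, monoid.mult = monoid.mult Q, one = one Q,
     ring.zero = ring.zero Q, ring.add = ring.add Q,
     smult = (\<lambda>s x. pure_tensor R A s \<one>\<^bsub>A\<^esub> \<otimes>\<^bsub>Q\<^esub> x)\<rparr>)"


section \<open>Maps, permutations and compositions\<close>

text \<open>A map \<open>{0..m} \<rightarrow> {0..k}\<close> fixing \<open>0\<close> is represented by the function on all of
  \<^typ>\<open>nat\<close> that is \<open>0\<close> beyond \<open>m\<close>, so that composition of maps is plain \<open>\<circ>\<close>.\<close>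

definition tau :: "nat \<Rightarrow> (nat \<Rightarrow> nat) set" where
  "tau r = {\<alpha>. \<alpha> ` {0..r} \<subseteq> {0..r} \<and> \<alpha> 0 = 0 \<and> (\<forall>x>r. \<alpha> x = 0)}"

text \<open>Permutations of \<open>{1..i}\<close> are taken in the library sense (\<open>p permutes {1..i}\<close>, the
  identity elsewhere); \<open>perm_map i p\<close> is the corresponding element of \<^term>\<open>tau i\<close>.\<close>

definition perm_map :: "nat \<Rightarrow> (nat \<Rightarrow> nat) \<Rightarrow> nat \<Rightarrow> nat" where
  "perm_map i p = (\<lambda>x. if x \<le> i then p x else 0)"

definition intermediate_monoid :: "nat \<Rightarrow> (nat \<Rightarrow> nat) set \<Rightarrow> bool" where
  "intermediate_monoid r M \<longleftrightarrow>
    perm_map r ` {p. p permutes {1..r}} \<subseteq> M \<and> M \<subseteq> tau r \<and>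
    (\<forall>\<alpha>\<in>M. \<forall>\<beta>\<in>M. \<alpha> \<circ> \<beta> \<in> M)"

definition map_index :: "nat \<Rightarrow> (nat \<Rightarrow> nat) \<Rightarrow> nat" where
  "map_index r \<alpha> = card (\<alpha> ` {0..r} - {0})"

definition index_set :: "nat \<Rightarrow> (nat \<Rightarrow> nat) set \<Rightarrow> nat set" where
  "index_set r M = map_index r ` M"

definition compositions :: "nat \<Rightarrow> nat \<Rightarrow> nat list set" where
  "compositions r n = {\<mu>. length \<mu> = n \<and> sum_list \<mu> = r}"

text \<open>Blocks, and below the entries of tableaux of a given type, are numbered from \<open>0\<close>,
  following list indexing.\<close>

definition block :: "nat list \<Rightarrow> nat \<Rightarrow> nat set" where
  "block \<mu> j = {sum_list (take j \<mu>) <.. sum_list (take (Suc j) \<mu>)}"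

definition young :: "nat list \<Rightarrow> (nat \<Rightarrow> nat) set" where
  "young \<mu> = {p. p permutes {1..sum_list \<mu>} \<and> (\<forall>j<length \<mu>. p ` block \<mu> j = block \<mu> j)}"


section \<open>Orbits and compositions attached to them\<close>

definition subsets :: "nat \<Rightarrow> nat \<Rightarrow> nat set set" where
  "subsets i r = {C. C \<subseteq> {1..r} \<and> card C = i}"

definition phi :: "nat set \<Rightarrow> nat \<Rightarrow> nat" where
  "phi C j = (if j \<in> {1..card C} then sorted_list_of_set C ! (j - 1) else 0)"

definition power_orbits :: "nat \<Rightarrow> nat list \<Rightarrow> nat set set set" where
  "power_orbits r \<nu> = (\<lambda>S. {\<pi> -` S | \<pi>. \<pi> \<in> young \<nu>}) ` Pow {1..r}"

text \<open>For every \<open>\<nu>\<close>, \<open>orbs \<nu>\<close> lists the orbits on the power set in the chosen order, and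
  \<open>ord \<nu>\<close> is the chosen total order on the power set.\<close>

definition compatible_orders ::
    "nat \<Rightarrow> nat \<Rightarrow> (nat list \<Rightarrow> nat set set list) \<Rightarrow> (nat list \<Rightarrow> nat set rel) \<Rightarrow> bool" where
  "compatible_orders r n orbs ord \<longleftrightarrow> (\<forall>\<nu>\<in>compositions r n.
    distinct (orbs \<nu>) \<and> set (orbs \<nu>) = power_orbits r \<nu> \<and>
    linear_order_on (Pow {1..r}) (ord \<nu>) \<and>
    (\<forall>j k S T. j < k \<and> k < length (orbs \<nu>) \<and> S \<in> orbs \<nu> ! j \<and> T \<in> orbs \<nu> ! k
      \<longrightarrow> (S, T) \<in> ord \<nu>))"

definition disjoint_families :: "nat \<Rightarrow> nat \<Rightarrow> nat set set set" where
  "disjoint_families i r =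
    {D. D \<subseteq> Pow {1..r} - {{}} \<and> disjoint D \<and> card D = i}"

text \<open>The position of \<open>S\<close> in \<open>D\<close> is the number of members of \<open>D\<close> that are \<open>\<le> S\<close>.\<close>

definition psi :: "nat set rel \<Rightarrow> nat set set \<Rightarrow> nat \<Rightarrow> nat" where
  "psi leq D x = (if x \<in> \<Union>D
     then card {S' \<in> D. (S', THE S. S \<in> D \<and> x \<in> S) \<in> leq} else 0)"

definition monoid_families ::
    "nat set rel \<Rightarrow> (nat \<Rightarrow> nat) set \<Rightarrow> nat \<Rightarrow> nat \<Rightarrow> nat set set set" where
  "monoid_families leq M i r = {D \<in> disjoint_families i r.
    \<exists>\<alpha>\<in>M. map_index r \<alpha> = i \<and>
      (\<exists>C\<in>subsets i r. \<exists>\<sigma>. \<sigma> permutes {1..i} \<and> \<alpha> = phi C \<circ> \<sigma> \<circ> psi leq D)}"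

definition left_orbits :: "nat list \<Rightarrow> nat \<Rightarrow> nat \<Rightarrow> nat set set set" where
  "left_orbits \<mu> i r = (\<lambda>C. {\<rho> ` C | \<rho>. \<rho> \<in> young \<mu>}) ` subsets i r"

definition right_orbits ::
    "nat set rel \<Rightarrow> (nat \<Rightarrow> nat) set \<Rightarrow> nat list \<Rightarrow> nat \<Rightarrow> nat \<Rightarrow> nat set set set set" where
  "right_orbits leq M \<nu> i r =
    (\<lambda>D. {(\<lambda>d. \<pi> -` d) ` D | \<pi>. \<pi> \<in> young \<nu>}) ` monoid_families leq M i r"

definition left_comp :: "nat list \<Rightarrow> nat set \<Rightarrow> nat list" where
  "left_comp \<mu> C = map (\<lambda>j. card (block \<mu> j \<inter> C)) [0..<length \<mu>]"

definition right_comp :: "nat set set list \<Rightarrow> nat set set \<Rightarrow> nat list" where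
  "right_comp os D = map (\<lambda>Q. card (D \<inter> Q)) os"

definition left_orbit_comp :: "nat list \<Rightarrow> nat set set \<Rightarrow> nat list" where
  "left_orbit_comp \<mu> Q = left_comp \<mu> (SOME C. C \<in> Q)"

definition right_orbit_comp :: "nat set set list \<Rightarrow> nat set set set \<Rightarrow> nat list" where
  "right_orbit_comp os Q = right_comp os (SOME D. D \<in> Q)"


section \<open>The monoid ring and its double coset modules\<close>

text \<open>Elements of the integral monoid ring of \<open>M\<close> are integer functions vanishing
  outside \<open>M\<close>.\<close>

definition single :: "'c \<Rightarrow> 'c \<Rightarrow> int" where
  "single m = (\<lambda>x. if x = m then 1 else 0)"

definition conv ::
    "(nat \<Rightarrow> nat) set \<Rightarrow> ((nat \<Rightarrow> nat) \<Rightarrow> int) \<Rightarrow> ((nat \<Rightarrow> nat) \<Rightarrow> int) \<Rightarrow> (nat \<Rightarrow> nat) \<Rightarrow> int" where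
  "conv M f g = (\<lambda>m. \<Sum>(a, b) \<in> {(a, b). a \<in> M \<and> b \<in> M \<and> a \<circ> b = m}. f a * g b)"

definition invariants ::
    "nat \<Rightarrow> (nat \<Rightarrow> nat) set \<Rightarrow> nat list \<Rightarrow> nat list \<Rightarrow> ((nat \<Rightarrow> nat) \<Rightarrow> int) set" where
  "invariants r M \<mu> \<nu> = {f. (\<forall>m. m \<notin> M \<longrightarrow> f m = 0) \<and>
    (\<forall>\<rho>\<in>young \<mu>. conv M (single (perm_map r \<rho>)) f = f) \<and>
    (\<forall>\<pi>\<in>young \<nu>. conv M f (single (perm_map r \<pi>)) = f)}"

definition dcoset :: "nat list \<Rightarrow> nat list \<Rightarrow> (nat \<Rightarrow> nat) \<Rightarrow> (nat \<Rightarrow> nat) set" where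
  "dcoset \<mu> \<nu> m = {\<rho> \<circ> m \<circ> \<pi> | \<rho> \<pi>. \<rho> \<in> young \<mu> \<and> \<pi> \<in> young \<nu>}"

definition dcosets ::
    "(nat \<Rightarrow> nat) set \<Rightarrow> nat list \<Rightarrow> nat list \<Rightarrow> (nat \<Rightarrow> nat) set set" where
  "dcosets M \<mu> \<nu> = dcoset \<mu> \<nu> ` M"

definition coset_sum :: "(nat \<Rightarrow> nat) set \<Rightarrow> (nat \<Rightarrow> nat) \<Rightarrow> int" where
  "coset_sum D = (\<lambda>x. \<Sum>m\<in>D. single m x)"

text \<open>The coordinates of an element of \<^term>\<open>invariants r M \<mu> \<nu>\<close> in the basis of double
  coset sums.\<close>

definition dcoord ::
    "(nat \<Rightarrow> nat) set \<Rightarrow> nat list \<Rightarrow> nat list \<Rightarrow> ((nat \<Rightarrow> nat) \<Rightarrow> int) \<Rightarrow>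
     (nat \<Rightarrow> nat) set \<Rightarrow> int" where
  "dcoord M \<mu> \<nu> f = (THE a. (\<forall>D. D \<notin> dcosets M \<mu> \<nu> \<longrightarrow> a D = 0) \<and>
    f = (\<lambda>x. \<Sum>D\<in>dcosets M \<mu> \<nu>. a D * coset_sum D x))"

definition n_left :: "nat list \<Rightarrow> nat list \<Rightarrow> (nat \<Rightarrow> nat) set \<Rightarrow> nat" where
  "n_left \<mu> \<nu> D = card {\<rho> \<circ> (SOME m. m \<in> D) | \<rho>. \<rho> \<in> young \<mu>}"

definition n_right :: "nat list \<Rightarrow> nat list \<Rightarrow> (nat \<Rightarrow> nat) set \<Rightarrow> nat" where
  "n_right \<mu> \<nu> D = card {(SOME m. m \<in> D) \<circ> \<pi> | \<pi>. \<pi> \<in> young \<nu>}"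

text \<open>In the next three definitions the weight \<open>w\<close> stands for \<^const>\<open>n_left\<close> or
  \<^const>\<open>n_right\<close>.  For these two the structure constants are integers, i.e. the
  division \<open>div\<close> is exact.\<close>

definition struct_const ::
    "(nat list \<Rightarrow> nat list \<Rightarrow> (nat \<Rightarrow> nat) set \<Rightarrow> nat) \<Rightarrow> (nat \<Rightarrow> nat) set \<Rightarrow>
     nat list \<Rightarrow> nat list \<Rightarrow> nat list \<Rightarrow>
     (nat \<Rightarrow> nat) set \<Rightarrow> (nat \<Rightarrow> nat) set \<Rightarrow> (nat \<Rightarrow> nat) set \<Rightarrow> int" where
  "struct_const w M \<mu> \<nu> \<pi> D1 D2 D =
    (int (w \<mu> \<pi> D) * dcoord M \<mu> \<pi> (conv M (coset_sum D1) (coset_sum D2)) D)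
      div (int (w \<mu> \<nu> D1) * int (w \<nu> \<pi> D2))"

text \<open>An element \<open>x\<close> of the external direct sum has the component \<open>x \<mu> \<nu>\<close> at \<open>(\<mu>, \<nu>)\<close>.\<close>

definition star_mult ::
    "(nat list \<Rightarrow> nat list \<Rightarrow> (nat \<Rightarrow> nat) set \<Rightarrow> nat) \<Rightarrow> nat \<Rightarrow> nat \<Rightarrow> (nat \<Rightarrow> nat) set \<Rightarrow>
     (nat list \<Rightarrow> nat list \<Rightarrow> (nat \<Rightarrow> nat) \<Rightarrow> int) \<Rightarrow>
     (nat list \<Rightarrow> nat list \<Rightarrow> (nat \<Rightarrow> nat) \<Rightarrow> int) \<Rightarrow>
     nat list \<Rightarrow> nat list \<Rightarrow> (nat \<Rightarrow> nat) \<Rightarrow> int" where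
  "star_mult w r n M x y = (\<lambda>\<mu> \<pi> m.
    if \<mu> \<in> compositions r n \<and> \<pi> \<in> compositions r n then
      \<Sum>\<nu>\<in>compositions r n. \<Sum>D1\<in>dcosets M \<mu> \<nu>. \<Sum>D2\<in>dcosets M \<nu> \<pi>.
        dcoord M \<mu> \<nu> (x \<mu> \<nu>) D1 * dcoord M \<nu> \<pi> (y \<nu> \<pi>) D2 *
          (\<Sum>D\<in>dcosets M \<mu> \<pi>. struct_const w M \<mu> \<nu> \<pi> D1 D2 D * coset_sum D m)
    else 0)"

text \<open>The identity is the sum over \<open>\<mu>\<close> of the basis elements given by the double
  cosets \<open>\<SS>\<^sub>\<mu> 1 \<SS>\<^sub>\<mu> = \<SS>\<^sub>\<mu>\<close>.\<close>

definition double_coset_ring ::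
    "(nat list \<Rightarrow> nat list \<Rightarrow> (nat \<Rightarrow> nat) set \<Rightarrow> nat) \<Rightarrow> nat \<Rightarrow> nat \<Rightarrow> (nat \<Rightarrow> nat) set \<Rightarrow>
     (nat list \<Rightarrow> nat list \<Rightarrow> (nat \<Rightarrow> nat) \<Rightarrow> int) ring" where
  "double_coset_ring w r n M =
    \<lparr>carrier = {x. \<forall>\<mu> \<nu>. if \<mu> \<in> compositions r n \<and> \<nu> \<in> compositions r n
        then x \<mu> \<nu> \<in> invariants r M \<mu> \<nu> else x \<mu> \<nu> = (\<lambda>m. 0)},
     monoid.mult = star_mult w r n M,
     one = (\<lambda>\<mu> \<nu>. if \<mu> \<in> compositions r n \<and> \<mu> = \<nu>
        then coset_sum (dcoset \<mu> \<mu> (perm_map r id)) else (\<lambda>m. 0)),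
     ring.zero = (\<lambda>\<mu> \<nu> m. 0),
     ring.add = (\<lambda>x y \<mu> \<nu> m. x \<mu> \<nu> m + y \<mu> \<nu> m)\<rparr>"

definition A_L :: "nat \<Rightarrow> nat \<Rightarrow> (nat \<Rightarrow> nat) set \<Rightarrow>
    (nat list \<Rightarrow> nat list \<Rightarrow> (nat \<Rightarrow> nat) \<Rightarrow> int) ring" where
  "A_L = double_coset_ring n_left"

definition A_R :: "nat \<Rightarrow> nat \<Rightarrow> (nat \<Rightarrow> nat) set \<Rightarrow>
    (nat list \<Rightarrow> nat list \<Rightarrow> (nat \<Rightarrow> nat) \<Rightarrow> int) ring" where
  "A_R = double_coset_ring n_right"

definition LGS :: "('a, 'm) ring_scheme \<Rightarrow> nat \<Rightarrow> nat \<Rightarrow> (nat \<Rightarrow> nat) set \<Rightarrow>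
    ('a, (('a \<times> (nat list \<Rightarrow> nat list \<Rightarrow> (nat \<Rightarrow> nat) \<Rightarrow> int)) \<Rightarrow>\<^sub>0 int) set) module" where
  "LGS R r n M = base_change R (A_L r n M)"

definition RGS :: "('a, 'm) ring_scheme \<Rightarrow> nat \<Rightarrow> nat \<Rightarrow> (nat \<Rightarrow> nat) set \<Rightarrow>
    ('a, (('a \<times> (nat list \<Rightarrow> nat list \<Rightarrow> (nat \<Rightarrow> nat) \<Rightarrow> int)) \<Rightarrow>\<^sub>0 int) set) module" where
  "RGS R r n M = base_change R (A_R r n M)"


section \<open>Partitions, tableaux and the Murphy basis\<close>

definition partitions :: "nat \<Rightarrow> nat list set" where
  "partitions i = {\<xi>. sorted_wrt (\<ge>) \<xi> \<and> 0 \<notin> set \<xi> \<and> sum_list \<xi> = i}"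

definition dominates :: "nat list \<Rightarrow> nat list \<Rightarrow> bool" where
  "dominates \<xi> \<mu> \<longleftrightarrow> (\<forall>k. sum_list (take k \<mu>) \<le> sum_list (take k \<xi>))"

definition Lam :: "nat \<Rightarrow> (nat \<Rightarrow> nat) set \<Rightarrow> nat list set" where
  "Lam r M = (\<Union>i\<in>index_set r M. partitions i)"

definition Lam_le :: "nat \<Rightarrow> (nat \<Rightarrow> nat) set \<Rightarrow> nat list rel" where
  "Lam_le r M = {(\<mu>, \<xi>). \<mu> \<in> Lam r M \<and> \<xi> \<in> Lam r M \<and>
    (sum_list \<xi> < sum_list \<mu> \<or> sum_list \<xi> = sum_list \<mu> \<and> dominates \<xi> \<mu>)}"

definition diagram :: "nat list \<Rightarrow> (nat \<times> nat) set" where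
  "diagram \<xi> = {(i, j). i < length \<xi> \<and> j < \<xi> ! i}"

definition standard :: "nat list \<Rightarrow> (nat \<times> nat \<Rightarrow> nat) \<Rightarrow> bool" where
  "standard \<xi> s \<longleftrightarrow> s \<in> extensional (diagram \<xi>) \<and>
    bij_betw s (diagram \<xi>) {1..sum_list \<xi>} \<and>
    (\<forall>i j j'. (i, j) \<in> diagram \<xi> \<and> (i, j') \<in> diagram \<xi> \<and> j < j' \<longrightarrow> s (i, j) < s (i, j')) \<and>
    (\<forall>i i' j. (i, j) \<in> diagram \<xi> \<and> (i', j) \<in> diagram \<xi> \<and> i < i' \<longrightarrow> s (i, j) < s (i', j))"

definition semistandard :: "nat list \<Rightarrow> nat list \<Rightarrow> (nat \<times> nat \<Rightarrow> nat) \<Rightarrow> bool" where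
  "semistandard \<xi> \<kappa> S \<longleftrightarrow> S \<in> diagram \<xi> \<rightarrow>\<^sub>E {..<length \<kappa>} \<and>
    (\<forall>k<length \<kappa>. card {p \<in> diagram \<xi>. S p = k} = \<kappa> ! k) \<and>
    (\<forall>i j j'. (i, j) \<in> diagram \<xi> \<and> (i, j') \<in> diagram \<xi> \<and> j < j' \<longrightarrow> S (i, j) \<le> S (i, j')) \<and>
    (\<forall>i i' j. (i, j) \<in> diagram \<xi> \<and> (i', j) \<in> diagram \<xi> \<and> i < i' \<longrightarrow> S (i, j) < S (i', j))"

definition row_reading :: "nat list \<Rightarrow> nat \<times> nat \<Rightarrow> nat" where
  "row_reading \<xi> = (\<lambda>(i, j) \<in> diagram \<xi>. sum_list (take i \<xi>) + j + 1)"

definition tab_perm :: "nat list \<Rightarrow> (nat \<times> nat \<Rightarrow> nat) \<Rightarrow> nat \<Rightarrow> nat" where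
  "tab_perm \<xi> s = (THE d. d permutes {1..sum_list \<xi>} \<and>
    (\<forall>p\<in>diagram \<xi>. d (row_reading \<xi> p) = s p))"

definition tab_type :: "nat list \<Rightarrow> nat list \<Rightarrow> (nat \<times> nat \<Rightarrow> nat) \<Rightarrow> nat \<times> nat \<Rightarrow> nat" where
  "tab_type \<kappa> \<xi> s = (\<lambda>p \<in> diagram \<xi>. THE k. k < length \<kappa> \<and> s p \<in> block \<kappa> k)"

text \<open>The elements of the group ring of the symmetric group on \<open>{1..i}\<close> are integer functions
  on the set of \<open>p\<close> with \<open>p permutes {1..i}\<close>.\<close>

definition murphy ::
    "nat list \<Rightarrow> (nat \<times> nat \<Rightarrow> nat) \<Rightarrow> (nat \<times> nat \<Rightarrow> nat) \<Rightarrow> (nat \<Rightarrow> nat) \<Rightarrow> int" where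
  "murphy \<xi> s t = (\<lambda>p. \<Sum>\<sigma>\<in>young \<xi>. single (tab_perm \<xi> s \<circ> \<sigma> \<circ> inv_into UNIV (tab_perm \<xi> t)) p)"

definition semi_murphy ::
    "nat list \<Rightarrow> nat list \<Rightarrow> nat list \<Rightarrow> (nat \<times> nat \<Rightarrow> nat) \<Rightarrow> (nat \<times> nat \<Rightarrow> nat) \<Rightarrow>
     (nat \<Rightarrow> nat) \<Rightarrow> int" where
  "semi_murphy \<xi> \<kappa> \<kappa>' S T = (\<lambda>p.
    \<Sum>s\<in>{s. standard \<xi> s \<and> tab_type \<kappa> \<xi> s = S}.
      \<Sum>t\<in>{t. standard \<xi> t \<and> tab_type \<kappa>' \<xi> t = T}. murphy \<xi> s t p)"


section \<open>The cell basis\<close>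

text \<open>In the index triples \<open>Q\<close> is an orbit, whose composition is part of the data.\<close>

definition L_set ::
    "nat \<Rightarrow> nat \<Rightarrow> nat list \<Rightarrow> (nat list \<times> nat set set \<times> (nat \<times> nat \<Rightarrow> nat)) set" where
  "L_set r n \<xi> = {(\<mu>, Q, S). \<mu> \<in> compositions r n \<and> Q \<in> left_orbits \<mu> (sum_list \<xi>) r \<and>
    semistandard \<xi> (left_orbit_comp \<mu> Q) S}"

definition R_set ::
    "nat \<Rightarrow> nat \<Rightarrow> (nat \<Rightarrow> nat) set \<Rightarrow> (nat list \<Rightarrow> nat set set list) \<Rightarrow>
     (nat list \<Rightarrow> nat set rel) \<Rightarrow> nat list \<Rightarrow>
     (nat list \<times> nat set set set \<times> (nat \<times> nat \<Rightarrow> nat)) set" where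
  "R_set r n M orbs ord \<xi> = {(\<nu>, Q, T). \<nu> \<in> compositions r n \<and>
    Q \<in> right_orbits (ord \<nu>) M \<nu> (sum_list \<xi>) r \<and>
    semistandard \<xi> (right_orbit_comp (orbs \<nu>) Q) T}"

definition cell_elt ::
    "(nat list \<Rightarrow> nat set set list) \<Rightarrow> (nat list \<Rightarrow> nat set rel) \<Rightarrow> nat list \<Rightarrow>
     nat list \<times> nat set set \<times> (nat \<times> nat \<Rightarrow> nat) \<Rightarrow>
     nat list \<times> nat set set set \<times> (nat \<times> nat \<Rightarrow> nat) \<Rightarrow>
     nat list \<Rightarrow> nat list \<Rightarrow> (nat \<Rightarrow> nat) \<Rightarrow> int" where
  "cell_elt orbs ord \<xi> = (\<lambda>(\<mu>, Q, S) (\<nu>, Q', T) \<mu>' \<nu>' m.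
    if \<mu>' = \<mu> \<and> \<nu>' = \<nu> then
      \<Sum>C\<in>Q. \<Sum>D\<in>Q'. \<Sum>p\<in>{p. p permutes {1..sum_list \<xi>}}.
        semi_murphy \<xi> (left_orbit_comp \<mu> Q) (right_orbit_comp (orbs \<nu>) Q') S T p *
          single (phi C \<circ> p \<circ> psi (ord \<nu>) D) m
    else 0)"

end

theory Submission
  imports Defs "Jordan_Normal_Form.Determinant"
begin

text \<open>The double coset of \<open>m\<close> is determined by its colour matrix, which counts the points \<open>y\<close>
of the image of \<open>m\<close> by the block of \<open>y\<close> (left colour) and the orbit of the fibre over \<open>y\<close>
(right colour).  Unwinding the Murphy basis, the cell element of a pair of semistandard tableaux
takes at \<open>m\<close> the number of ways to assign the image points to the rows of \<open>\<xi>\<close> such that the left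
and right colours are distributed over the rows as in the two tableaux.  On matrices with given
margins there are as many such functions as matrices (RSK), and pairing them with the alternating
sum over column permutations gives a matrix that is unitriangular for the dominance order; hence
they are a \<open>\<int>\<close>-basis of the functions on those matrices.

After division by the weights \<open>n\<^sub>L\<close> or \<open>n\<^sub>R\<close> the product becomes ordinary convolution.  Multiplying a cell
element from the left replaces its left row distribution by a combination of others and leaves the
right one alone, up to maps of smaller index.  The alternating pairing then shows that only
tableaux of dominating shape occur, and that the coefficients at \<open>\<xi>\<close> do not depend on the right
tableau.  The right-hand side is symmetric, and everything survives the base change from \<open>\<int>\<close> to \<open>R\<close>.\<close>

text \<open>No straightening of tableaux is carried out. A product with a cell element is only known
  as a combination of counting functions whose left row contents \<open>A\<close> need not come from
  semistandard tableaux. At the shape \<open>l\<close> itself the alternating pairing with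
  \<open>(U, V)\<close> splits off the factor \<open>polar l V (rt l T)\<close> from every term. The
  right tableau \<open>T\<close> can therefore be cancelled, and the coefficients, never computed,
  solve a triangular system whose right-hand side does not mention \<open>T\<close>. This is all
  that the cell axioms ask for. The unitriangular pairing alone gives independence and a one-sided
  integral inverse. That the inverse is two-sided, and hence that the functions span over the
  integers, is where equality of the two counts enters. The two products are treated together:
  either weight of a double coset is a factor depending on the image times a factor depending on the
  family of fibres, one of them being 1. Left multiplication that keeps the index keeps the fibres,
  right multiplication that keeps the index keeps the image, so on the side that is left alone the
  factor cancels.\<close>

lemmas sum_eq = sum.cong[OF refl]

abbreviation "pinv == inv_into UNIV"

section \<open>Base change of an integral cell datum\<close>

lemma frag_extend_fun_add:
 "frag_extend (%p. f p + g p) x = frag_extend f x + frag_extend g x"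
 by (simp add: frag_extend_def frag_cmul_distrib2 sum.distrib)

lemma frag_extend_fun_diff:
 "frag_extend (%p. f p - g p) x = frag_extend f x - frag_extend g x"
 using frag_extend_fun_add[of "%p. f p - g p" g x] by simp

lemma frag_extend_fun_0: "frag_extend (%p. 0) x = 0" by (simp add: frag_extend_def)

locale base_change_setting =
 fixes R :: "('a, 'm) ring_scheme" and A :: "('b, 'q) ring_scheme"
 assumes R_cring: "cring R" and A_ring: "ring A"
begin

sublocale R: cring R by (rule R_cring)
sublocale A: ring A by (rule A_ring)

abbreviation "S == carrier R \<times> carrier A"
abbreviation "P == pair_ring R A"
abbreviation "T == tensor_relations R A"
abbreviation "B == base_change R A"
abbreviation "pt == pure_tensor R A"
abbreviation multA (infixl "\<otimes>A" 70) where "x \<otimes>A y == x \<otimes>\<^bsub>A\<^esub> y"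
abbreviation addA (infixl "\<oplus>A" 65) where "x \<oplus>A y == x \<oplus>\<^bsub>A\<^esub> y"
abbreviation oneA ("\<one>A") where "\<one>A == \<one>\<^bsub>A\<^esub>"
abbreviation zeroA ("\<zero>A") where "\<zero>A == \<zero>\<^bsub>A\<^esub>"
abbreviation multR (infixl "\<otimes>R" 70) where "x \<otimes>R y == x \<otimes>\<^bsub>R\<^esub> y"
abbreviation addR (infixl "\<oplus>R" 65) where "x \<oplus>R y == x \<oplus>\<^bsub>R\<^esub> y"
abbreviation oneR ("\<one>R") where "\<one>R == \<one>\<^bsub>R\<^esub>"
abbreviation zeroR ("\<zero>R") where "\<zero>R == \<zero>\<^bsub>R\<^esub>"
abbreviation multB (infixl "\<otimes>B" 70) where "x \<otimes>B y == x \<otimes>\<^bsub>B\<^esub> y"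
abbreviation addB (infixl "\<oplus>B" 65) where "x \<oplus>B y == x \<oplus>\<^bsub>B\<^esub> y"
abbreviation smultB (infixl "\<odot>B" 75) where "x \<odot>B y == x \<odot>\<^bsub>B\<^esub> y"
abbreviation zeroB ("\<zero>B") where "\<zero>B == \<zero>\<^bsub>B\<^esub>"

definition C :: "(('a \<times> 'b) \<Rightarrow>\<^sub>0 int) set" where
 "C = {c. Poly_Mapping.keys c <= S}"

definition gm :: "'a \<times> 'b => 'a \<times> 'b => ('a \<times> 'b) \<Rightarrow>\<^sub>0 int" where
 "gm p q = frag_of (fst p \<otimes>R fst q, snd p \<otimes>A snd q)"

text \<open>The product of \<open>pair_ring\<close> with projections in place of case expressions,
  so that additivity in both arguments can be read off from \<open>frag_extend\<close>.\<close>

definition pm :: "(('a \<times> 'b) \<Rightarrow>\<^sub>0 int) => (('a \<times> 'b) \<Rightarrow>\<^sub>0 int) => ('a \<times> 'b) \<Rightarrow>\<^sub>0 int" where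
 "pm x y = frag_extend (%p. frag_extend (gm p) y) x"

lemma P_simps [simp]:
 "carrier P = C" "ring.add P = (+)" "monoid.mult P = pm" "\<one>\<^bsub>P\<^esub> = frag_of (\<one>R, \<one>A)" "\<zero>\<^bsub>P\<^esub> = 0"
proof -
 show "monoid.mult P = pm" unfolding pair_ring_def pm_def[abs_def] gm_def[abs_def] split_def by simp
qed (simp_all add: pair_ring_def C_def)

lemma add_monoid_P: "add_monoid P = free_Abelian_group S" by (simp add: free_Abelian_group_def C_def)

lemma free_carrier: "carrier (free_Abelian_group S) = C" by (auto simp: C_def)

lemma pm_simps [simp]:
 "pm 0 y = 0" "pm x 0 = 0"
 "pm (frag_of (r, a)) (frag_of (s, b)) = frag_of (r \<otimes>R s, a \<otimes>A b)"
 by (simp_all add: pm_def gm_def frag_extend_fun_0)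

lemma pm_add:
 "pm (x + x') y = pm x y + pm x' y" "pm x (y + y') = pm x y + pm x y'"
 "pm (x - x') y = pm x y - pm x' y" "pm x (y - y') = pm x y - pm x y'"
 unfolding pm_def frag_extend_add frag_extend_diff frag_extend_fun_add frag_extend_fun_diff by (rule refl)+

lemma C_simps [simp]:
 "0 : C" "x : C ==> y : C ==> x - y : C" "x : C ==> y : C ==> x + y : C" "- x : C \<longleftrightarrow> x : C"
 "frag_of (r, a) : C \<longleftrightarrow> r : carrier R & a : carrier A"
 unfolding C_def using keys_diff[of x y] keys_add[of x y] by auto

text \<open>Single pairs generate the free abelian group, and closure under differences covers sums
  and negatives. Every additive identity below is checked on pairs in this way.\<close>

lemma C_induct [consumes 1, case_names zero diff of]:
 assumes "x : C" and "Q 0" and "!!x y. x : C ==> y : C ==> Q x ==> Q y ==> Q (x - y)"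
  and "!!r a. r : carrier R ==> a : carrier A ==> Q (frag_of (r, a))"
 shows "Q x"
proof (rule free_Abelian_group_induct[of x S Q])
 show "Poly_Mapping.keys x <= S" using assms(1) by (simp add: C_def)
 show "Q (x - y)" if "Poly_Mapping.keys x <= S" "Poly_Mapping.keys y <= S" "Q x" "Q y" for x y
  using assms(3)[of x y] that by (simp add: C_def)
 show "Q (frag_of p)" if "p : S" for p using assms(4) that by auto
qed (rule assms(2))

lemma pm_closed [simp]:
 assumes "x : C" "y : C" shows "pm x y : C" using assms(1)
proof (induction rule: C_induct)
 case (of r a)
 show ?case using assms(2) by (induction rule: C_induct) (use of in \<open>simp_all add: pm_add\<close>)
qed (simp_all add: pm_add)

lemma pm_assoc:
 assumes "x : C" "y : C" "z : C"
 shows "pm (pm x y) z = pm x (pm y z)" using assms(1)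
proof (induction rule: C_induct)
 case (of r a)
 note 1 = this
 show ?case using assms(2)
 proof (induction rule: C_induct)
  case (of s b)
  note 2 = this
  show ?case using assms(3)
   by (induction rule: C_induct) (use 1 2 in \<open>simp_all add: pm_add R.m_assoc A.m_assoc\<close>)
 qed (simp_all add: pm_add)
qed (simp_all add: pm_add)

lemma pm_one:
 assumes "x : C"
 shows "pm (frag_of (\<one>R, \<one>A)) x = x" "pm x (frag_of (\<one>R, \<one>A)) = x"
proof -
 show "pm (frag_of (\<one>R, \<one>A)) x = x" using assms by (induction rule: C_induct) (simp_all add: pm_add)
 show "pm x (frag_of (\<one>R, \<one>A)) = x" using assms by (induction rule: C_induct) (simp_all add: pm_add)
qed

lemma P_ring: "ring P"
proof (rule ringI)
 show "abelian_group P" by (rule comm_group_abelian_groupI) (simp only: add_monoid_P abelian_free_Abelian_group)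
 show "Group.monoid P" by (rule monoidI) (simp_all add: pm_assoc pm_one)
qed (simp_all add: pm_add)

sublocale Pr: ring P by (rule P_ring)

section \<open>The tensor relations form an ideal\<close>

definition gens :: "(('a \<times> 'b) \<Rightarrow>\<^sub>0 int) set" where
 "gens = {frag_of (r \<oplus>R s, a) - frag_of (r, a) - frag_of (s, a) | r s a.
    r : carrier R & s : carrier R & a : carrier A} \<union>
  {frag_of (r, a \<oplus>A b) - frag_of (r, a) - frag_of (r, b) | r a b.
    r : carrier R & a : carrier A & b : carrier A}"

lemma T_gens: "T = generate (free_Abelian_group S) gens" by (simp add: tensor_relations_def gens_def)

lemma gens_carrier: "gens <= C" unfolding gens_def by auto

lemma T_subgroup: "subgroup T (free_Abelian_group S)" unfolding T_gens
 by (rule group.generate_is_subgroup[OF group_free_Abelian_group]) (simp only: free_carrier gens_carrier)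

lemma T_keys: "x : T ==> x : C" using subgroup.subset[OF T_subgroup] unfolding free_carrier by blast

lemma T_add: "x : T ==> y : T ==> x + y : T" using subgroup.m_closed[OF T_subgroup, of x y] by simp

lemma T_0: "0 : T" using subgroup.one_closed[OF T_subgroup] by simp

lemma T_uminus: "x : T ==> - x : T" using subgroup.m_inv_closed[OF T_subgroup, of x] T_keys[of x] by (simp add: C_def)

lemma T_diff: "x : T ==> y : T ==> x - y : T" using T_add[of x "- y"] T_uminus[of y] by simp

lemma gens_T: "x : gens ==> x : T" unfolding T_gens by (rule generate.incl)

text \<open>Differences are the only group operation here, in accordance with the additivity rules
  \<open>pm_add\<close>; the sum \<open>h1 + h2\<close> produced by \<open>generate\<close> is
  rewritten as \<open>h1 - (0 - h2)\<close>.\<close>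

lemma T_induct [consumes 1, case_names gen zero diff]:
 assumes "x : T" "!!x. x : gens ==> Q x" "Q 0" "!!x y. x : T ==> y : T ==> Q x ==> Q y ==> Q (x - y)"
 shows "Q x" using assms(1)[unfolded T_gens]
proof (induction rule: generate.induct)
 case (inv h)
 have "h : C" using inv gens_carrier by auto
 then have "inv\<^bsub>free_Abelian_group S\<^esub> h = 0 - h" by (simp add: C_def)
 then show ?case using assms(4)[OF T_0 gens_T[OF inv] assms(3) assms(2)[OF inv]] by simp
next
 case (eng h1 h2)
 have t: "h1 : T" "h2 : T" using eng by (simp_all add: T_gens)
 have "Q (0 - h2)" by (rule assms(4)[OF T_0 t(2) assms(3) eng(4)])
 from assms(4)[OF t(1) T_diff[OF T_0 t(2)] eng(3) this] have "Q (h1 - (0 - h2))" .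
 moreover have "h1 - (0 - h2) = h1 \<otimes>\<^bsub>free_Abelian_group S\<^esub> h2" by simp
 ultimately show ?case by (simp only:)
qed (use assms in auto)

text \<open>Distributivity in \<open>R\<close> and in \<open>A\<close> turns a biadditivity relation
  times a single pair into a relation of the same kind. Hence the subgroup generated by the
  relations absorbs products.\<close>

lemma gens_mult:
 assumes "g : gens" "p : S" shows "pm (frag_of p) g : gens" "pm g (frag_of p) : gens"
proof -
 obtain t e where p: "p = (t, e)" "t : carrier R" "e : carrier A" using assms(2) by auto
 have "pm (frag_of p) g : gens & pm g (frag_of p) : gens" using assms(1)[unfolded gens_def]
 proof (elim UnE CollectE exE conjE)
  fix r s a assume g: "g = frag_of (r \<oplus>R s, a) - frag_of (r, a) - frag_of (s, a)"
   "r : carrier R" "s : carrier R" "a : carrier A"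
  have "pm (frag_of p) g = frag_of (t \<otimes>R r \<oplus>R t \<otimes>R s, e \<otimes>A a) - frag_of (t \<otimes>R r, e \<otimes>A a) - frag_of (t \<otimes>R s, e \<otimes>A a)"
   "pm g (frag_of p) = frag_of (r \<otimes>R t \<oplus>R s \<otimes>R t, a \<otimes>A e) - frag_of (r \<otimes>R t, a \<otimes>A e) - frag_of (s \<otimes>R t, a \<otimes>A e)"
   using g p by (simp_all add: pm_add R.r_distr R.l_distr)
  moreover have "t \<otimes>R r : carrier R" "t \<otimes>R s : carrier R" "r \<otimes>R t : carrier R" "s \<otimes>R t : carrier R"
   "e \<otimes>A a : carrier A" "a \<otimes>A e : carrier A" using g p by simp_all
  ultimately show ?thesis unfolding gens_def by blast
 next
  fix r a b assume g: "g = frag_of (r, a \<oplus>A b) - frag_of (r, a) - frag_of (r, b)"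
   "r : carrier R" "a : carrier A" "b : carrier A"
  have "pm (frag_of p) g = frag_of (t \<otimes>R r, e \<otimes>A a \<oplus>A e \<otimes>A b) - frag_of (t \<otimes>R r, e \<otimes>A a) - frag_of (t \<otimes>R r, e \<otimes>A b)"
   "pm g (frag_of p) = frag_of (r \<otimes>R t, a \<otimes>A e \<oplus>A b \<otimes>A e) - frag_of (r \<otimes>R t, a \<otimes>A e) - frag_of (r \<otimes>R t, b \<otimes>A e)"
   using g p by (simp_all add: pm_add A.r_distr A.l_distr)
  moreover have "t \<otimes>R r : carrier R" "r \<otimes>R t : carrier R"
   "e \<otimes>A a : carrier A" "a \<otimes>A e : carrier A" "e \<otimes>A b : carrier A" "b \<otimes>A e : carrier A"
   using g p by simp_all
  ultimately show ?thesis unfolding gens_def by blast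
 qed
 then show "pm (frag_of p) g : gens" "pm g (frag_of p) : gens" by auto
qed

lemma T_mult:
 assumes "g : T" "x : C" shows "pm x g : T" "pm g x : T"
proof -
 have "pm x g : T & pm g x : T" using assms(1)
 proof (induction rule: T_induct)
  case (gen g)
  show ?case using assms(2) by (induction rule: C_induct) (simp_all add: pm_add T_0 T_diff gens_T gens_mult gen)
 qed (auto simp: pm_add T_0 T_diff)
 then show "pm x g : T" "pm g x : T" by auto
qed

lemma T_ideal: "ideal T P"
proof (rule idealI)
 show "subgroup T (add_monoid P)" unfolding add_monoid_P by (rule T_subgroup)
qed (auto intro: P_ring T_mult)

sublocale Ti: ideal T P by (rule T_ideal)

definition pr :: "(('a \<times> 'b) \<Rightarrow>\<^sub>0 int) => (('a \<times> 'b) \<Rightarrow>\<^sub>0 int) set" where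
 "pr x = T +>\<^bsub>P\<^esub> x"

lemma pr_eq_iff:
 assumes "x : C" "y : C"
 shows "pr x = pr y \<longleftrightarrow> x - y : T"
proof
 assume "pr x = pr y"
 then have "x : pr y" using Ti.a_rcos_self[of x] assms by (simp add: pr_def)
 then show "x - y : T" by (auto simp: pr_def a_r_coset_def r_coset_def)
next
 assume "x - y : T"
 then have "x : pr y" by (force simp: pr_def a_r_coset_def r_coset_def)
 then show "pr x = pr y" unfolding pr_def     using Pr.a_repr_independence[of x T y] assms T_subgroup[folded add_monoid_P] by simp
qed

lemma B_carrier: "carrier B = pr ` C"
 by (auto simp: base_change_def Let_def FactRing_def A_RCOSETS_defs pr_def a_r_coset_def)

lemma B_add: "x : C ==> y : C ==> pr x \<oplus>B pr y = pr (x + y)"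
 using Ti.a_rcos_sum[of x y] by (simp add: base_change_def Let_def FactRing_def pr_def)

lemma B_mult: "x : C ==> y : C ==> pr x \<otimes>B pr y = pr (pm x y)"
 using Ti.rcoset_mult_add[of x y] by (simp add: base_change_def Let_def FactRing_def pr_def)

lemma B_zero: "\<zero>B = pr 0"
proof -
 have "pr 0 = T" using Ti.a_rcos_const[OF T_0] by (simp add: pr_def)
 then show ?thesis by (simp add: base_change_def Let_def FactRing_def)
qed

lemma B_one: "\<one>\<^bsub>B\<^esub> = pt \<one>R \<one>A"
 by (simp add: base_change_def Let_def FactRing_def pure_tensor_def)

lemma pt_pr: "pt r a = pr (frag_of (r, a))" by (simp add: pure_tensor_def pr_def)

lemma B_smult: "s \<odot>B x = pt s \<one>A \<otimes>B x" by (simp add: base_change_def Let_def)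

lemma B_ring: "ring B"
proof (rule ringI)
 show "abelian_group B"
 proof (rule abelian_groupI)
  fix x assume "x : carrier B"
  then obtain f where f: "x = pr f" "f : C" by (auto simp: B_carrier)
  then have "pr (- f) \<oplus>B x = \<zero>B" "pr (- f) : carrier B" by (auto simp: B_add B_zero B_carrier)
  then show "\<exists>y\<in>carrier B. y \<oplus>B x = \<zero>B" by blast
 qed (auto simp: B_carrier B_add B_zero ac_simps)
 show "Group.monoid B" by (rule monoidI) (auto simp: B_carrier B_mult B_one pt_pr pm_closed pm_assoc pm_one)
qed (auto simp: B_carrier B_add B_mult  pm_closed pm_add)

sublocale Br: ring B by (rule B_ring)

lemma pt_closed [simp]: "r : carrier R ==> a : carrier A ==> pt r a : carrier B" by (auto simp: pt_pr B_carrier)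

lemma pt_mult [simp]:
 "r : carrier R ==> a : carrier A ==> s : carrier R ==> b : carrier A ==>
  pt r a \<otimes>B pt s b = pt (r \<otimes>R s) (a \<otimes>A b)" by (simp add: pt_pr B_mult)

lemma pt_add_left:
 assumes "r : carrier R" "s : carrier R" "a : carrier A"
 shows "pt (r \<oplus>R s) a = pt r a \<oplus>B pt s a"
proof -
 have "frag_of (r \<oplus>R s, a) - (frag_of (r, a) + frag_of (s, a)) : gens"
  unfolding gens_def using assms by (auto simp: diff_diff_eq[symmetric] simp del: diff_diff_eq)
 then show ?thesis using assms gens_T by (simp add: pt_pr B_add pr_eq_iff )
qed

lemma pt_add_right:
 assumes "r : carrier R" "a : carrier A" "b : carrier A"
 shows "pt r (a \<oplus>A b) = pt r a \<oplus>B pt r b"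
proof -
 have "frag_of (r, a \<oplus>A b) - (frag_of (r, a) + frag_of (r, b)) : gens"
  unfolding gens_def using assms by (auto simp: diff_diff_eq[symmetric] simp del: diff_diff_eq)
 then show ?thesis using assms gens_T by (simp add: pt_pr B_add pr_eq_iff )
qed

lemma pt_zero_left [simp]: assumes "a : carrier A" shows "pt \<zero>R a = \<zero>B"
proof -
 have "pt \<zero>R a \<oplus>B pt \<zero>R a = pt \<zero>R a" using pt_add_left[of "\<zero>R" "\<zero>R" a] assms by simp
 then show ?thesis using Br.add.l_cancel_one[of "pt \<zero>R a" "pt \<zero>R a"] pt_closed[OF R.zero_closed assms] by simp
qed

lemma pt_zero_right [simp]: assumes "r : carrier R" shows "pt r \<zero>A = \<zero>B"
proof -
 have "pt r \<zero>A \<oplus>B pt r \<zero>A = pt r \<zero>A" using pt_add_right[of r "\<zero>A" "\<zero>A"] assms by simp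
 then show ?thesis using Br.add.l_cancel_one[of "pt r \<zero>A" "pt r \<zero>A"] pt_closed[OF assms A.zero_closed] by simp
qed

lemma pt_minus_left: assumes "r : carrier R" "a : carrier A" shows "pt (\<ominus>\<^bsub>R\<^esub> r) a = \<ominus>\<^bsub>B\<^esub> pt r a"
proof -
 have "pt (\<ominus>\<^bsub>R\<^esub> r) a \<oplus>B pt r a = \<zero>B"
  using pt_add_left[of "\<ominus>\<^bsub>R\<^esub> r" r a] assms by (simp add: R.l_neg)
 then show ?thesis using assms Br.minus_equality[of "pt (\<ominus>\<^bsub>R\<^esub> r) a" "pt r a"] by simp
qed

text \<open>Sums of pure tensors suffice, without negatives, because a sign can be moved into the
  scalar by \<open>pt_minus_left\<close>.\<close>

lemma B_induct [consumes 1, case_names pure add]: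
 assumes "x : carrier B"
  and pure: "!!r a. r : carrier R ==> a : carrier A ==> Q (pt r a)"
  and add: "!!x y. x : carrier B ==> y : carrier B ==> Q x ==> Q y ==> Q (x \<oplus>B y)"
 shows "Q x"
proof -
 \<comment> \<open>Carrying the claim for the negative along turns the difference step of
   \<open>C_induct\<close> into a sum.\<close>
 have neg: "Q (\<ominus>\<^bsub>B\<^esub> pr f) & Q (pr f)" if "f : C" for f using that
 proof (induction rule: C_induct)
  case zero
  have "Q (pt \<zero>R \<zero>A)" by (rule pure) auto
  then show ?case by (simp add: B_zero[symmetric])
 next
  case (diff f g)
  note 2 = diff
  have c: "pr f : carrier B" "pr g : carrier B" using 2 by (auto simp: B_carrier)
  have "pr (f - g) \<oplus>B pr g = pr f" using 2 by (simp add: B_add )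
  moreover have "pr (f - g) : carrier B" using 2 by (auto simp: B_carrier )
  ultimately have d: "pr (f - g) = pr f \<oplus>B \<ominus>\<^bsub>B\<^esub> pr g"
   using c Br.r_neg by (metis Br.add.inv_closed Br.add.m_assoc Br.r_zero)
  then have "\<ominus>\<^bsub>B\<^esub> pr (f - g) = \<ominus>\<^bsub>B\<^esub> pr f \<oplus>B pr g"
   using c by (simp add: Br.minus_add)
  then show ?case using d add[of "pr f" "\<ominus>\<^bsub>B\<^esub> pr g"] add[of "\<ominus>\<^bsub>B\<^esub> pr f" "pr g"] 2 c by simp
 next
  case (of r a)
  then show ?case using pure[of r a] pure[of "\<ominus>\<^bsub>R\<^esub> r" a] by (simp add: pt_pr[symmetric] pt_minus_left)
 qed
 then show ?thesis using assms(1) by (auto simp: B_carrier)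
qed

lemma smult_pt [simp]:
 "s : carrier R ==> r : carrier R ==> a : carrier A ==> s \<odot>B pt r a = pt (s \<otimes>R r) a" by (simp add: B_smult)

lemma central:
 assumes "s : carrier R" "x : carrier B" shows "pt s \<one>A \<otimes>B x = x \<otimes>B pt s \<one>A" using assms(2)
 by (induction rule: B_induct) (use assms(1) in \<open>auto simp: R.m_comm Br.l_distr Br.r_distr\<close>)

lemma B_unital_algebra: "unital_algebra R B"
proof (intro unital_algebra.intro unital_algebra_axioms.intro B_ring)
 show "module R B"
 proof (rule moduleI[OF R_cring Br.abelian_group_axioms])
  fix a b x assume "a : carrier R" "b : carrier R" "x : carrier B"
  then show "(a \<otimes>R b) \<odot>B x = a \<odot>B (b \<odot>B x)" by (simp add: B_smult Br.m_assoc[symmetric])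
 qed (auto simp: B_smult pt_add_left Br.l_distr Br.r_distr B_one[symmetric])
next
 fix r x y assume r: "r : carrier R" "x : carrier B" "y : carrier B"
 then show "(r \<odot>B x) \<otimes>B y = r \<odot>B (x \<otimes>B y)" by (simp add: B_smult Br.m_assoc)
 show "x \<otimes>B (r \<odot>B y) = r \<odot>B (x \<otimes>B y)"
  using r central[of r x] by (simp add: B_smult Br.m_assoc[symmetric])
qed

text \<open>The source of coordinates over \<open>R\<close>. The map exists on the free abelian
  group by its universal property, and it kills the relations because an integer multiple of a
  scalar is additive in the integer and in the scalar.\<close>

lemma additive_functional:
 fixes k :: "'b => int"
 assumes k: "!!a b. a : carrier A ==> b : carrier A ==> k (a \<oplus>A b) = k a + k b"
 obtains f where "f : carrier B \<rightarrow> carrier R"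
  "!!x y. x : carrier B ==> y : carrier B ==> f (x \<oplus>B y) = f x \<oplus>R f y"
  "!!r a. r : carrier R ==> a : carrier A ==> f (pt r a) = add_pow R (k a) r"
proof -
 have cg: "comm_group (add_monoid R)" by (rule R.a_comm_group)
 obtain h where h: "h : hom (free_Abelian_group S) (add_monoid R)"
  and hf: "!!p. p : S ==> h (frag_of p) = (%(r, a). add_pow R (k a) r) p"
  by (rule comm_group.free_Abelian_group_universal[OF cg, where S = S and f = "%(r, a). add_pow R (k a) r"]) auto
 have hc: "h x : carrier R" if "x : C" for x using hom_in_carrier[OF h, of x] that by (simp add: C_def)
 have ha: "h (x + y) = h x \<oplus>R h y" if "x : C" "y : C" for x y using hom_mult[OF h, of x y] that by (simp add: C_def)
 have h0: "h 0 = \<zero>R" using ha[of 0 0] hc[of 0] R.add.l_cancel_one[of "h 0" "h 0"] by simp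
 have hd: "h (x - y) \<oplus>R h y = h x" if "x : C" "y : C" for x y using ha[of "x - y" y] that by simp
 have hd0: "h (x - y) = \<zero>R" if "x : C" "y : C" "h x = h y" for x y
  using hd[of x y] that hc[of y] hc[of "x - y"] R.add.r_cancel_one[of "h y" "h (x - y)"] by simp
 have hT: "h x = \<zero>R" if "x : T" for x using that
 proof (induction rule: T_induct)
  case (gen x)
  have eq: "h (f - g - g') = \<zero>R"
   if "f : C" "g : C" "g' : C" "h f = h g \<oplus>R h g'" for f g g'
   using hd0[of f "g + g'"] that ha[of g g'] by (simp add:  diff_diff_eq)
  from gen show ?case unfolding gens_def
  proof (elim UnE CollectE exE conjE)
   fix r s a assume g: "x = frag_of (r \<oplus>R s, a) - frag_of (r, a) - frag_of (s, a)"
    "r : carrier R" "s : carrier R" "a : carrier A"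
   have "add_pow R (k a) (r \<oplus>R s) = add_pow R (k a) r \<oplus>R add_pow R (k a) s"
    using R.add.int_pow_distrib[of r s "k a"] g by simp
   then show ?thesis unfolding g(1) using g by (intro eq) (auto simp: hf)
  next
   fix r a b assume g: "x = frag_of (r, a \<oplus>A b) - frag_of (r, a) - frag_of (r, b)"
    "r : carrier R" "a : carrier A" "b : carrier A"
   have "add_pow R (k (a \<oplus>A b)) r = add_pow R (k a) r \<oplus>R add_pow R (k b) r"
    using R.add.int_pow_mult[of r "k a" "k b"] g k by simp
   then show ?thesis unfolding g(1) using g by (intro eq) (auto simp: hf)
  qed
 next
  case (diff x y)
  then show ?case using hd0 T_keys by simp
 qed (rule h0)
 \<comment> \<open>The functional on cosets evaluates \<open>h\<close> at any representative;
   \<open>fpr\<close> shows that the choice does not matter.\<close>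
 define f where "f Y = h (SOME x. x : C & pr x = Y)" for Y
 have fpr: "f (pr x) = h x" if "x : C" for x
 proof -
  let ?y = "SOME y. y : C & pr y = pr x"
  have y: "?y : C & pr ?y = pr x" by (rule someI[where P = "%y. y : C & pr y = pr x"]) (use that in simp)
  then have "?y - x : T" using pr_eq_iff that by blast
  then have "h ?y = h x" using hd[of ?y x] hT hc y that by fastforce
  then show ?thesis by (simp add: f_def)
 qed
 show thesis
 proof
  show "f : carrier B \<rightarrow> carrier R" using fpr hc by (auto simp: B_carrier)
  show "f (x \<oplus>B y) = f x \<oplus>R f y" if "x : carrier B" "y : carrier B" for x y
   using that fpr ha by (auto simp: B_carrier B_add )
  show "f (pt r a) = add_pow R (k a) r" if "r : carrier R" "a : carrier A" for r a
   using that fpr[of "frag_of (r, a)"] hf[of "(r, a)"] by (simp add: pt_pr)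
 qed
qed


sublocale Bu: unital_algebra R B by (rule B_unital_algebra)

lemma pt_minus_right: assumes "r : carrier R" "a : carrier A" shows "pt r (\<ominus>\<^bsub>A\<^esub> a) = pt (\<ominus>\<^bsub>R\<^esub> r) a"
proof -
 have "pt r (\<ominus>\<^bsub>A\<^esub> a) \<oplus>B pt r a = \<zero>B"
  using pt_add_right[of r "\<ominus>\<^bsub>A\<^esub> a" a] assms by (simp add: A.l_neg)
 then show ?thesis using assms Br.minus_equality[of "pt r (\<ominus>\<^bsub>A\<^esub> a)" "pt r a"] by (simp add: pt_minus_left)
qed

end

text \<open>A cell structure over the integers in terms of dual coordinates:
  \<open>coord_inj\<close> and \<open>coord_c\<close> stand for the basis, and the cell axioms only
  speak of coordinates at indices that are not strictly above \<open>xi\<close>. All these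
  conditions are additive in the algebra element, so they can be carried through pure tensors. The
  function \<open>rho\<close> is chosen before \<open>t\<close> (respectively \<open>s\<close>), as
  the cell axioms require.\<close>

locale integral_cell_datum = base_change_setting R A
 for R :: "('a, 'm) ring_scheme" and A :: "('b, 'q) ring_scheme" +
 fixes Lam0 :: "'p set" and leq :: "'p rel"
  and L :: "'p => 's set" and Rt :: "'p => 't set"
  and c :: "'p => 's => 't => 'b" and coord :: "'b => 'p \<times> 's \<times> 't => int"
 assumes R_domain: "domain R"
  and fin_poset: "finite Lam0" and po: "partial_order_on Lam0 leq"
  and finL: "!!xi. xi : Lam0 ==> finite (L xi)" and finRt: "!!xi. xi : Lam0 ==> finite (Rt xi)"
  and c_closed: "!!xi s t. xi : Lam0 ==> s : L xi ==> t : Rt xi ==> c xi s t : carrier A"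
  and coord_add: "!!a b i. a : carrier A ==> b : carrier A ==> coord (a \<oplus>A b) i = coord a i + coord b i"
  and coord_inj: "!!a. a : carrier A ==> (!!i. i : (SIGMA xi:Lam0. L xi \<times> Rt xi) ==> coord a i = 0) ==> a = \<zero>A"
  and coord_c: "!!xi s t i. xi : Lam0 ==> s : L xi ==> t : Rt xi ==> i : (SIGMA xi:Lam0. L xi \<times> Rt xi) ==>
   coord (c xi s t) i = (if i = (xi, s, t) then 1 else 0)"
  and left: "!!a xi s. a : carrier A ==> xi : Lam0 ==> s : L xi ==>
   \<exists>rho. \<forall>t\<in>Rt xi. \<forall>xi'\<in>Lam0. \<forall>s'\<in>L xi'. \<forall>t'\<in>Rt xi'. ~ ((xi, xi') : leq & xi ~= xi') -->
    coord (a \<otimes>A c xi s t) (xi', s', t') = (if xi' = xi & t' = t then rho s' else 0)"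
  and right: "!!a xi t. a : carrier A ==> xi : Lam0 ==> t : Rt xi ==>
   \<exists>rho. \<forall>s\<in>L xi. \<forall>xi'\<in>Lam0. \<forall>s'\<in>L xi'. \<forall>t'\<in>Rt xi'. ~ ((xi, xi') : leq & xi ~= xi') -->
    coord (c xi s t \<otimes>A a) (xi', s', t') = (if xi' = xi & s' = s then rho t' else 0)"
begin

interpretation Rd: domain R by (rule R_domain)

lemma add_pow_0 [simp]: "add_pow R (0::int) r = \<zero>R" by (simp add: add_pow_def)

definition Idx :: "('p \<times> 's \<times> 't) set" where "Idx = (SIGMA xi:Lam0. L xi \<times> Rt xi)"
definition bas :: "'p \<times> 's \<times> 't => 'b" where "bas = (%(xi, s, t). c xi s t)"
definition E :: "'p \<times> 's \<times> 't => (('a \<times> 'b) \<Rightarrow>\<^sub>0 int) set" where "E i = pt \<one>R (bas i)"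

lemma finite_Idx: "finite Idx" unfolding Idx_def using fin_poset finL finRt by auto

lemma bas_closed [simp]: "i : Idx ==> bas i : carrier A" by (auto simp: Idx_def bas_def c_closed)

lemma coord_bas: "i : Idx ==> j : Idx ==> coord (bas i) j = (if j = i then 1 else 0)"
 by (cases i) (auto simp: Idx_def bas_def coord_c)

lemma coord_minus: assumes "a : carrier A" "b : carrier A" shows "coord (a \<ominus>\<^bsub>A\<^esub> b) i = coord a i - coord b i"
proof -
 have "(a \<ominus>\<^bsub>A\<^esub> b) \<oplus>A b = a" using assms by (simp add: A.minus_eq A.a_assoc A.l_neg)
 then have "coord a i = coord (a \<ominus>\<^bsub>A\<^esub> b) i + coord b i"
  using coord_add[of "a \<ominus>\<^bsub>A\<^esub> b" b i] assms A.minus_closed by simp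
 then show ?thesis by simp
qed

text \<open>Induction on the sum of the absolute values of the coordinates: a nonzero coordinate
  moves towards zero when its basis element is added or subtracted. This is where the basis elements
  are seen to generate \<open>A\<close> as a group.\<close>

lemma coord_induct [consumes 1, case_names zero plus minus]:
 assumes "a : carrier A" and "Q \<zero>A"
  and "!!a i. a : carrier A ==> i : Idx ==> Q a ==> Q (a \<oplus>A bas i)"
  and "!!a i. a : carrier A ==> i : Idx ==> Q a ==> Q (a \<ominus>\<^bsub>A\<^esub> bas i)"
 shows "Q a" using assms(1)
proof (induction "\<Sum>i\<in>Idx. nat \<bar>coord a i\<bar>" arbitrary: a rule: less_induct)
 case less
 show ?case
 proof (cases "\<forall>i\<in>Idx. coord a i = 0")
  case True
  then have "a = \<zero>A" using coord_inj[OF less.prems] unfolding Idx_def by blast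
  then show ?thesis using assms(2) by simp
 next
  case False
  then obtain i where i: "i : Idx" "coord a i ~= 0" by blast
  note bi = bas_closed[OF i(1)]
  show ?thesis
  proof (cases "coord a i > 0")
   case True
   have "(\<Sum>j\<in>Idx. nat \<bar>coord (a \<ominus>\<^bsub>A\<^esub> bas i) j\<bar>) < (\<Sum>j\<in>Idx. nat \<bar>coord a j\<bar>)"
    by (rule sum_strict_mono_ex1[OF finite_Idx])
     (use i True in \<open>auto simp: coord_minus[OF less.prems bi] coord_bas intro!: bexI[of _ i]\<close>)
   then have "Q (a \<ominus>\<^bsub>A\<^esub> bas i)" using less bi by (simp add: A.minus_closed)
   then have "Q ((a \<ominus>\<^bsub>A\<^esub> bas i) \<oplus>A bas i)" using assms(3) i less.prems bi by (simp add: A.minus_closed)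
   moreover have "(a \<ominus>\<^bsub>A\<^esub> bas i) \<oplus>A bas i = a" using less.prems bi by (simp add: A.minus_eq A.a_assoc A.l_neg)
   ultimately show ?thesis by simp
  next
   case neg: False
   have "(\<Sum>j\<in>Idx. nat \<bar>coord (a \<oplus>A bas i) j\<bar>) < (\<Sum>j\<in>Idx. nat \<bar>coord a j\<bar>)"
    by (rule sum_strict_mono_ex1[OF finite_Idx])
     (use i neg in \<open>auto simp: coord_add[OF less.prems bi] coord_bas intro!: bexI[of _ i]\<close>)
   then have "Q (a \<oplus>A bas i)" using less bi by simp
   then have "Q ((a \<oplus>A bas i) \<ominus>\<^bsub>A\<^esub> bas i)" using assms(4) i less.prems bi by simp
   moreover have "(a \<oplus>A bas i) \<ominus>\<^bsub>A\<^esub> bas i = a" using less.prems bi by (simp add: A.minus_eq A.a_assoc A.r_neg)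
   ultimately show ?thesis by simp
  qed
 qed
qed

text \<open>The coordinates over \<open>R\<close>; \<open>additive_functional\<close> asserts only
  existence, hence the choice.\<close>

definition cc :: "'p \<times> 's \<times> 't => (('a \<times> 'b) \<Rightarrow>\<^sub>0 int) set => 'a" where
 "cc i = (SOME f. f : carrier B \<rightarrow> carrier R &
  (\<forall>x\<in>carrier B. \<forall>y\<in>carrier B. f (x \<oplus>B y) = f x \<oplus>R f y) &
  (\<forall>r\<in>carrier R. \<forall>a\<in>carrier A. f (pt r a) = add_pow R (coord a i) r))"

lemma cc:
 shows cc_closed [simp]: "x : carrier B ==> cc i x : carrier R"
  and cc_add: "x : carrier B ==> y : carrier B ==> cc i (x \<oplus>B y) = cc i x \<oplus>R cc i y"
  and cc_pt: "r : carrier R ==> a : carrier A ==> cc i (pt r a) = add_pow R (coord a i) r"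
proof -
 obtain f where f: "f : carrier B \<rightarrow> carrier R"
  "!!x y. x : carrier B ==> y : carrier B ==> f (x \<oplus>B y) = f x \<oplus>R f y"
  "!!r a. r : carrier R ==> a : carrier A ==> f (pt r a) = add_pow R (coord a i) r"
  by (rule additive_functional[of "%a. coord a i"]) (use coord_add in auto)
 have *: "cc i : carrier B \<rightarrow> carrier R &
  (\<forall>x\<in>carrier B. \<forall>y\<in>carrier B. cc i (x \<oplus>B y) = cc i x \<oplus>R cc i y) &
  (\<forall>r\<in>carrier R. \<forall>a\<in>carrier A. cc i (pt r a) = add_pow R (coord a i) r)"
  unfolding cc_def by (rule someI[of _ f]) (use f in blast)
 show "x : carrier B ==> cc i x : carrier R" using * by blast
 show "x : carrier B ==> y : carrier B ==> cc i (x \<oplus>B y) = cc i x \<oplus>R cc i y" using * by blast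
 show "r : carrier R ==> a : carrier A ==> cc i (pt r a) = add_pow R (coord a i) r" using * by blast
qed

lemma cc_zero [simp]: "cc i \<zero>B = \<zero>R"
 using cc_add[of "\<zero>B" "\<zero>B" i] R.add.l_cancel_one[of "cc i \<zero>B" "cc i \<zero>B"] by simp

lemma cc_minus: assumes "x : carrier B" "y : carrier B" shows "cc i (x \<ominus>\<^bsub>B\<^esub> y) = cc i x \<ominus>\<^bsub>R\<^esub> cc i y"
proof -
 have "(x \<ominus>\<^bsub>B\<^esub> y) \<oplus>B y = x" using assms by (simp add: Br.minus_eq Br.a_assoc Br.l_neg)
 then have "cc i x = cc i (x \<ominus>\<^bsub>B\<^esub> y) \<oplus>R cc i y"
  using cc_add[of "x \<ominus>\<^bsub>B\<^esub> y" y i] assms Br.minus_closed by simp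
 then show ?thesis using assms Br.minus_closed by (simp add: R.minus_eq R.a_assoc R.r_neg)
qed

lemma cc_smult: assumes "r : carrier R" "x : carrier B" shows "cc i (r \<odot>B x) = r \<otimes>R cc i x" using assms(2)
proof (induction rule: B_induct)
 case (pure s a)
 then show ?case using assms(1) by (simp add: cc_pt R.add_pow_rdistr_int)
next
 case (add x y)
 then show ?case using assms(1) by (simp add: Bu.smult_r_distr cc_add R.r_distr)
qed

lemma E_closed [simp]: "i : Idx ==> E i : carrier B" by (simp add: E_def)

lemma cc_E: "i : Idx ==> j : Idx ==> cc j (E i) = (if j = i then \<one>R else \<zero>R)" by (simp add: E_def cc_pt coord_bas)

lemma comb_funcset:
 "J <= Idx ==> (!!j. j : J ==> f j : carrier R) ==> (%j. f j \<odot>B E j) : J \<rightarrow> carrier B"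
 by (intro Pi_I Bu.smult_closed E_closed) auto

lemma cc_comb:
 assumes "finite J" "J <= Idx" "f : J \<rightarrow> carrier R" "i : Idx"
 shows "cc i (\<Oplus>\<^bsub>B\<^esub>j\<in>J. f j \<odot>B E j) = (if i : J then f i else \<zero>R)" using assms(1-3)
proof (induction J rule: finite_induct)
 case (insert j J)
 have c: "f j : carrier R" "j : Idx" "J <= Idx" "f : J \<rightarrow> carrier R"
  "(%j. f j \<odot>B E j) : J \<rightarrow> carrier B" using insert.prems comb_funcset[of J f] by auto
 then have "(\<Oplus>\<^bsub>B\<^esub>j\<in>insert j J. f j \<odot>B E j) = f j \<odot>B E j \<oplus>B (\<Oplus>\<^bsub>B\<^esub>j\<in>J. f j \<odot>B E j)"
  using insert.hyps by (intro Br.finsum_insert) auto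
 then show ?case using c insert.hyps insert.IH[OF c(3,4)] assms(4) Br.finsum_closed[OF c(5)]
   funcset_mem[OF c(4), of i] by (auto simp: cc_add cc_smult cc_E)
qed simp

definition ex :: "(('a \<times> 'b) \<Rightarrow>\<^sub>0 int) set => (('a \<times> 'b) \<Rightarrow>\<^sub>0 int) set" where
 "ex x = (\<Oplus>\<^bsub>B\<^esub>i\<in>Idx. cc i x \<odot>B E i)"

lemma ex_add: assumes "x : carrier B" "y : carrier B" shows "ex (x \<oplus>B y) = ex x \<oplus>B ex y"
proof -
 have "ex (x \<oplus>B y) = (\<Oplus>\<^bsub>B\<^esub>i\<in>Idx. cc i x \<odot>B E i \<oplus>B cc i y \<odot>B E i)"
  unfolding ex_def by (rule Br.finsum_cong') (use assms in \<open>auto simp: cc_add Bu.smult_l_distr\<close>)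
 also have "... = ex x \<oplus>B ex y" unfolding ex_def by (rule Br.finsum_addf) (use assms in auto)
 finally show ?thesis .
qed

lemma ex_bas: assumes "r : carrier R" "i : Idx" shows "ex (pt r (bas i)) = pt r (bas i)"
proof -
 have "ex (pt r (bas i)) = (\<Oplus>\<^bsub>B\<^esub>j\<in>Idx. if i = j then pt r (bas j) else \<zero>B)" unfolding ex_def
 proof (rule Br.finsum_cong')
  fix j assume j: "j : Idx"
  have "cc j (pt r (bas i)) = (if i = j then r else \<zero>R)"
   using cc_smult[OF assms(1) E_closed[OF assms(2)], of j] assms j by (simp add: E_def[symmetric] cc_E)
    (simp add: E_def cc_pt coord_bas)
  then show "cc j (pt r (bas i)) \<odot>B E j = (if i = j then pt r (bas j) else \<zero>B)"
   using assms j by (auto simp: E_def)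
 qed (use assms in auto)
 also have "... = pt r (bas i)" by (rule Br.finsum_singleton) (use assms finite_Idx in auto)
 finally show ?thesis .
qed

text \<open>Both sides are additive, so \<open>B_induct\<close> reduces the claim to pure tensors
  and \<open>coord_induct\<close> further to \<open>pt r (bas i)\<close>, where a single coordinate
  survives.\<close>

lemma expand: assumes "x : carrier B" shows "ex x = x" using assms
proof (induction rule: B_induct)
 case (pure r a)
 have "\<forall>r\<in>carrier R. ex (pt r a) = pt r a" using pure(2)
 proof (induction rule: coord_induct)
  case zero
  have "ex \<zero>B = \<zero>B" unfolding ex_def
   using Br.finsum_cong'[of Idx Idx "%i. \<zero>B" "%i. cc i \<zero>B \<odot>B E i"] by (simp add: Br.finsum_zero)
  then show ?case by simp
 next
  case (plus a i)
  then show ?case by (simp add: pt_add_right ex_add ex_bas)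
 next
  case (minus a i)
  then show ?case by (simp add: A.minus_eq pt_add_right ex_add pt_minus_right ex_bas)
 qed
 then show ?case using pure(1) by blast
next
 case (add x y)
 then show ?case by (simp add: ex_add)
qed

text \<open>Coordinates separate the indices because 1 and 0 differ in a domain.\<close>

lemma E_inj: "inj_on E Idx"
proof (rule inj_onI)
 fix i j assume ij: "i : Idx" "j : Idx" "E i = E j"
 then have "cc i (E i) = cc i (E j)" by simp
 then show "i = j" using ij(1,2) Rd.one_not_zero by (simp add: cc_E split: if_splits)
qed

lemma finsum_E: "f : E ` J \<rightarrow> carrier R ==> J <= Idx ==>
  (\<Oplus>\<^bsub>B\<^esub>b\<in>E ` J. f b \<odot>B b) = (\<Oplus>\<^bsub>B\<^esub>j\<in>J. f (E j) \<odot>B E j)"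
 by (rule Br.finsum_reindex) (auto intro!: Bu.smult_closed E_closed intro: inj_on_subset[OF E_inj])

lemma E_basis: "finite_free_basis R B (E ` Idx)" unfolding finite_free_basis_def
proof (intro conjI ballI)
 fix x assume x: "x : carrier B"
 define f where "f = (\<lambda>b\<in>E ` Idx. cc (inv_into Idx E b) x)"
 have fE: "f (E i) = cc i x" if "i : Idx" for i using that E_inj by (simp add: f_def)
 have f: "f : E ` Idx \<rightarrow>\<^sub>E carrier R" using fE x by (auto simp: f_def)
 show "\<exists>!f. f : E ` Idx \<rightarrow>\<^sub>E carrier R & x = (\<Oplus>\<^bsub>B\<^esub>b\<in>E ` Idx. f b \<odot>B b)"
 proof (rule ex1I[of _ f])
  have "(\<Oplus>\<^bsub>B\<^esub>b\<in>E ` Idx. f b \<odot>B b) = (\<Oplus>\<^bsub>B\<^esub>i\<in>Idx. f (E i) \<odot>B E i)"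
   by (rule finsum_E) (use f in auto)
  also have "... = ex x" unfolding ex_def by (rule Br.finsum_cong') (use fE x in auto)
  finally show "f : E ` Idx \<rightarrow>\<^sub>E carrier R & x = (\<Oplus>\<^bsub>B\<^esub>b\<in>E ` Idx. f b \<odot>B b)"
   using f expand[OF x] by simp
 next
  fix g assume g: "g : E ` Idx \<rightarrow>\<^sub>E carrier R & x = (\<Oplus>\<^bsub>B\<^esub>b\<in>E ` Idx. g b \<odot>B b)"
  have gx: "x = (\<Oplus>\<^bsub>B\<^esub>i\<in>Idx. g (E i) \<odot>B E i)" using g finsum_E[of g Idx] by auto
  have "g (E i) = f (E i)" if "i : Idx" for i
  proof -
   have "(%i. g (E i)) : Idx \<rightarrow> carrier R" using g by auto
   from cc_comb[OF finite_Idx subset_refl this that] show ?thesis using that fE[OF that] gx by simp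
  qed
  then show "g = f" using g f by (intro PiE_ext[of g _ _ f]) auto
 qed
qed (use finite_Idx in auto)

definition Up :: "'p => ('p \<times> 's \<times> 't) set" where
 "Up xi = {(mu, s, t) : Idx. (xi, mu) : leq & xi ~= mu}"

text \<open>By \<open>expand\<close>, only coordinates outside \<open>Up xi\<close> can keep an
  element out of the span. Both cell axioms over \<open>R\<close> are verified through this
  test.\<close>

lemma upper_spanI:
 assumes x: "x : carrier B" and z: "!!i. i : Idx - Up xi ==> cc i x = \<zero>R"
 shows "x : upper_span R B leq Lam0 L Rt (%xi s t. pt \<one>R (c xi s t)) xi"
proof -
 have U: "Up xi <= Idx" by (auto simp: Up_def)
 have set: "{pt \<one>R (c mu s t) | mu s t. mu : Lam0 & (xi, mu) : leq & xi ~= mu & s : L mu & t : Rt mu} = E ` Up xi"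
  unfolding Up_def Idx_def E_def bas_def by (force simp: image_iff)
 define f where "f = (\<lambda>b\<in>E ` Up xi. cc (inv_into Idx E b) x)"
 have fE: "f (E i) = cc i x" if "i : Up xi" for i using that E_inj U by (auto simp: f_def)
 have f: "f : E ` Up xi \<rightarrow> carrier R" using fE x by auto
 have "x = ex x" using expand[OF x] by simp
 also have "... = (\<Oplus>\<^bsub>B\<^esub>i\<in>Up xi. cc i x \<odot>B E i)" unfolding ex_def
  by (rule Br.add.finprod_mono_neutral_cong_right[OF finite_Idx U]) (use z x U in \<open>auto simp: Bu.smult_l_null\<close>)
 also have "... = (\<Oplus>\<^bsub>B\<^esub>i\<in>Up xi. f (E i) \<odot>B E i)"
  by (rule Br.finsum_cong') (use fE x U in auto)
 also have "... = (\<Oplus>\<^bsub>B\<^esub>b\<in>E ` Up xi. f b \<odot>B b)" by (rule finsum_E[OF f U, symmetric])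
 finally show ?thesis unfolding upper_span_def lin_span_def set using f by blast
qed

text \<open>The coefficients of a sum are the sums of the coefficients. On a pure tensor
  \<open>pt r a\<close> they are the multiples of \<open>r\<close> by the integral coefficients of
  \<open>a\<close>, so they remain the same for all \<open>t\<close>.\<close>

lemma left_B:
 assumes x: "x : carrier B" and xi: "xi : Lam0" "s : L xi"
 shows "\<exists>rho\<in>L xi \<rightarrow> carrier R. \<forall>t\<in>Rt xi. \<forall>i\<in>Idx - Up xi.
  cc i (x \<otimes>B E (xi, s, t)) = (if fst i = xi & snd (snd i) = t then rho (fst (snd i)) else \<zero>R)" using x
proof (induction rule: B_induct)
 case (pure r a)
 obtain rho where rho: "!!t xi' s' t'. t : Rt xi ==> xi' : Lam0 ==> s' : L xi' ==> t' : Rt xi' ==> ~ ((xi, xi') : leq & xi ~= xi') ==>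
   coord (a \<otimes>A c xi s t) (xi', s', t') = (if xi' = xi & t' = t then rho s' else 0)"
  using left[OF pure(2) xi] by blast
 show ?case
 proof (rule bexI[of _ "%s'. add_pow R (rho s' :: int) r"], intro ballI)
  fix t i assume t: "t : Rt xi" and i: "i : Idx - Up xi"
  obtain xi' s' t' where i': "i = (xi', s', t')" by (cases i)
  have b: "(xi, s, t) : Idx" using t xi by (simp add: Idx_def)
  have "cc i (pt r a \<otimes>B E (xi, s, t)) = add_pow R (coord (a \<otimes>A c xi s t) i) r"
   using pure bas_closed[OF b] by (simp add: E_def cc_pt bas_def)
  also have "coord (a \<otimes>A c xi s t) i = (if xi' = xi & t' = t then rho s' else 0)"
   unfolding i' by (rule rho[OF t]) (use i i' in \<open>auto simp: Idx_def Up_def\<close>)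
  finally show "cc i (pt r a \<otimes>B E (xi, s, t)) =
    (if fst i = xi & snd (snd i) = t then add_pow R (rho (fst (snd i))) r else \<zero>R)" by (simp add: i')
 qed (use pure in auto)
next
 case (add x y)
 then obtain rho1 rho2 where rho: "rho1 : L xi \<rightarrow> carrier R" "rho2 : L xi \<rightarrow> carrier R"
  "!!t i. t : Rt xi ==> i : Idx - Up xi ==>
   cc i (x \<otimes>B E (xi, s, t)) = (if fst i = xi & snd (snd i) = t then rho1 (fst (snd i)) else \<zero>R)"
  "!!t i. t : Rt xi ==> i : Idx - Up xi ==>
   cc i (y \<otimes>B E (xi, s, t)) = (if fst i = xi & snd (snd i) = t then rho2 (fst (snd i)) else \<zero>R)" by blast
 show ?case
 proof (rule bexI[of _ "%s'. rho1 s' \<oplus>R rho2 s'"], intro ballI)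
  fix t i assume t: "t : Rt xi" and i: "i : Idx - Up xi"
  have b: "E (xi, s, t) : carrier B" using t xi by (simp add: Idx_def)
  show "cc i ((x \<oplus>B y) \<otimes>B E (xi, s, t)) =
    (if fst i = xi & snd (snd i) = t then rho1 (fst (snd i)) \<oplus>R rho2 (fst (snd i)) else \<zero>R)"
   using add(1,2) b rho(3,4)[OF t i] by (simp add: Br.l_distr cc_add)
 qed (use rho in auto)
qed

lemma right_B:
 assumes x: "x : carrier B" and xi: "xi : Lam0" "t : Rt xi"
 shows "\<exists>rho\<in>Rt xi \<rightarrow> carrier R. \<forall>s\<in>L xi. \<forall>i\<in>Idx - Up xi.
  cc i (E (xi, s, t) \<otimes>B x) = (if fst i = xi & fst (snd i) = s then rho (snd (snd i)) else \<zero>R)" using x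
proof (induction rule: B_induct)
 case (pure r a)
 obtain rho where rho: "!!s xi' s' t'. s : L xi ==> xi' : Lam0 ==> s' : L xi' ==> t' : Rt xi' ==> ~ ((xi, xi') : leq & xi ~= xi') ==>
   coord (c xi s t \<otimes>A a) (xi', s', t') = (if xi' = xi & s' = s then rho t' else 0)"
  using right[OF pure(2) xi] by blast
 show ?case
 proof (rule bexI[of _ "%t'. add_pow R (rho t' :: int) r"], intro ballI)
  fix s i assume s: "s : L xi" and i: "i : Idx - Up xi"
  obtain xi' s' t' where i': "i = (xi', s', t')" by (cases i)
  have b: "(xi, s, t) : Idx" using s xi by (simp add: Idx_def)
  have "cc i (E (xi, s, t) \<otimes>B pt r a) = add_pow R (coord (c xi s t \<otimes>A a) i) r"
   using pure bas_closed[OF b] by (simp add: E_def cc_pt bas_def)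
  also have "coord (c xi s t \<otimes>A a) i = (if xi' = xi & s' = s then rho t' else 0)"
   unfolding i' by (rule rho[OF s]) (use i i' in \<open>auto simp: Idx_def Up_def\<close>)
  finally show "cc i (E (xi, s, t) \<otimes>B pt r a) =
    (if fst i = xi & fst (snd i) = s then add_pow R (rho (snd (snd i))) r else \<zero>R)" by (simp add: i')
 qed (use pure in auto)
next
 case (add x y)
 then obtain rho1 rho2 where rho: "rho1 : Rt xi \<rightarrow> carrier R" "rho2 : Rt xi \<rightarrow> carrier R"
  "!!s i. s : L xi ==> i : Idx - Up xi ==>
   cc i (E (xi, s, t) \<otimes>B x) = (if fst i = xi & fst (snd i) = s then rho1 (snd (snd i)) else \<zero>R)"
  "!!s i. s : L xi ==> i : Idx - Up xi ==>
   cc i (E (xi, s, t) \<otimes>B y) = (if fst i = xi & fst (snd i) = s then rho2 (snd (snd i)) else \<zero>R)" by blast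
 show ?case
 proof (rule bexI[of _ "%s'. rho1 s' \<oplus>R rho2 s'"], intro ballI)
  fix s i assume s: "s : L xi" and i: "i : Idx - Up xi"
  have b: "E (xi, s, t) : carrier B" using s xi by (simp add: Idx_def)
  show "cc i (E (xi, s, t) \<otimes>B (x \<oplus>B y)) =
    (if fst i = xi & fst (snd i) = s then rho1 (snd (snd i)) \<oplus>R rho2 (snd (snd i)) else \<zero>R)"
   using add(1,2) b rho(3,4)[OF s i] by (simp add: Br.r_distr cc_add)
 qed (use rho in auto)
qed

theorem base_change_cell_algebra:
 "cell_algebra R B Lam0 leq L Rt (%xi s t. pt \<one>R (c xi s t))"
proof (intro cell_algebra.intro cell_algebra_axioms.intro B_unital_algebra R_domain fin_poset po finL finRt)
 have eq: "(%(xi, s, t). pt \<one>R (c xi s t)) = E" by (auto simp: E_def bas_def fun_eq_iff)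
 show "inj_on (%(xi, s, t). pt \<one>R (c xi s t)) (SIGMA xi:Lam0. L xi \<times> Rt xi)"
  unfolding eq Idx_def[symmetric] by (rule E_inj)
 show "finite_free_basis R B ((%(xi, s, t). pt \<one>R (c xi s t)) ` (SIGMA xi:Lam0. L xi \<times> Rt xi))"
  unfolding eq Idx_def[symmetric] by (rule E_basis)
 fix a xi s assume a: "a : carrier B" and xi: "xi : Lam0" and s: "s : L xi"
 obtain rho where rho: "rho : L xi \<rightarrow> carrier R" "!!t i. t : Rt xi ==> i : Idx - Up xi ==>
   cc i (a \<otimes>B E (xi, s, t)) = (if fst i = xi & snd (snd i) = t then rho (fst (snd i)) else \<zero>R)"
  using left_B[OF a xi s] by blast
 show "\<exists>rho\<in>L xi \<rightarrow> carrier R. \<forall>t\<in>Rt xi.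
   (a \<otimes>B pt \<one>R (c xi s t)) \<ominus>\<^bsub>B\<^esub> (\<Oplus>\<^bsub>B\<^esub>s'\<in>L xi. rho s' \<odot>B pt \<one>R (c xi s' t))
    : upper_span R B leq Lam0 L Rt (%xi s t. pt \<one>R (c xi s t)) xi"
 proof (rule bexI[OF ballI rho(1)])
  fix t assume t: "t : Rt xi"
  let ?J = "(%s'. (xi, s', t)) ` L xi"
  have J: "?J <= Idx" using t xi by (auto simp: Idx_def)
  have inj: "inj_on (%s'. (xi, s', t)) (L xi)" by (auto simp: inj_on_def)
  have sumJ: "(\<Oplus>\<^bsub>B\<^esub>s'\<in>L xi. rho s' \<odot>B pt \<one>R (c xi s' t)) = (\<Oplus>\<^bsub>B\<^esub>j\<in>?J. rho (fst (snd j)) \<odot>B E j)"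
  proof -
   have "(%j. rho (fst (snd j)) \<odot>B E j) : ?J \<rightarrow> carrier B"
    by (rule comb_funcset[OF J]) (use rho(1) in auto)
   from Br.finsum_reindex[OF this inj] show ?thesis by (simp add: E_def bas_def)
  qed
  have cl: "(\<Oplus>\<^bsub>B\<^esub>j\<in>?J. rho (fst (snd j)) \<odot>B E j) : carrier B"
   by (rule Br.finsum_closed, rule comb_funcset[OF J]) (use rho(1) in auto)
  have b: "(xi, s, t) : Idx" using t xi s by (simp add: Idx_def)
  have e: "pt \<one>R (c xi s t) = E (xi, s, t)" by (simp add: E_def bas_def)
  show "(a \<otimes>B pt \<one>R (c xi s t)) \<ominus>\<^bsub>B\<^esub> (\<Oplus>\<^bsub>B\<^esub>s'\<in>L xi. rho s' \<odot>B pt \<one>R (c xi s' t))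
    : upper_span R B leq Lam0 L Rt (%xi s t. pt \<one>R (c xi s t)) xi" unfolding sumJ e
  proof (rule upper_spanI)
   fix i assume i: "i : Idx - Up xi"
   have "cc i (\<Oplus>\<^bsub>B\<^esub>j\<in>?J. rho (fst (snd j)) \<odot>B E j) = (if i : ?J then rho (fst (snd i)) else \<zero>R)"
    by (rule cc_comb) (use finL[OF xi] J rho(1) i in auto)
   moreover have "i : ?J \<longleftrightarrow> fst i = xi & snd (snd i) = t" using i by (cases i) (auto simp: Idx_def)
   moreover have "rho (fst (snd i)) : carrier R" if "i : ?J" using that rho(1) by auto
   ultimately show "cc i (a \<otimes>B E (xi, s, t) \<ominus>\<^bsub>B\<^esub> (\<Oplus>\<^bsub>B\<^esub>j\<in>?J. rho (fst (snd j)) \<odot>B E j)) = \<zero>R"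
    using a b cl rho(2)[OF t i] by (simp add: cc_minus R.minus_eq R.r_neg)
  qed (use a b cl in \<open>simp add: Br.minus_closed\<close>)
 qed
next
 fix a xi t assume a: "a : carrier B" and xi: "xi : Lam0" and t: "t : Rt xi"
 obtain rho where rho: "rho : Rt xi \<rightarrow> carrier R" "!!s i. s : L xi ==> i : Idx - Up xi ==>
   cc i (E (xi, s, t) \<otimes>B a) = (if fst i = xi & fst (snd i) = s then rho (snd (snd i)) else \<zero>R)"
  using right_B[OF a xi t] by blast
 show "\<exists>rho\<in>Rt xi \<rightarrow> carrier R. \<forall>s\<in>L xi.
   (pt \<one>R (c xi s t) \<otimes>B a) \<ominus>\<^bsub>B\<^esub> (\<Oplus>\<^bsub>B\<^esub>t'\<in>Rt xi. rho t' \<odot>B pt \<one>R (c xi s t'))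
    : upper_span R B leq Lam0 L Rt (%xi s t. pt \<one>R (c xi s t)) xi"
 proof (rule bexI[OF ballI rho(1)])
  fix s assume s: "s : L xi"
  let ?J = "(%t'. (xi, s, t')) ` Rt xi"
  have J: "?J <= Idx" using s xi by (auto simp: Idx_def)
  have inj: "inj_on (%t'. (xi, s, t')) (Rt xi)" by (auto simp: inj_on_def)
  have sumJ: "(\<Oplus>\<^bsub>B\<^esub>t'\<in>Rt xi. rho t' \<odot>B pt \<one>R (c xi s t')) = (\<Oplus>\<^bsub>B\<^esub>j\<in>?J. rho (snd (snd j)) \<odot>B E j)"
  proof -
   have "(%j. rho (snd (snd j)) \<odot>B E j) : ?J \<rightarrow> carrier B"
    by (rule comb_funcset[OF J]) (use rho(1) in auto)
   from Br.finsum_reindex[OF this inj] show ?thesis by (simp add: E_def bas_def)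
  qed
  have cl: "(\<Oplus>\<^bsub>B\<^esub>j\<in>?J. rho (snd (snd j)) \<odot>B E j) : carrier B"
   by (rule Br.finsum_closed, rule comb_funcset[OF J]) (use rho(1) in auto)
  have b: "(xi, s, t) : Idx" using t xi s by (simp add: Idx_def)
  have e: "pt \<one>R (c xi s t) = E (xi, s, t)" by (simp add: E_def bas_def)
  show "(pt \<one>R (c xi s t) \<otimes>B a) \<ominus>\<^bsub>B\<^esub> (\<Oplus>\<^bsub>B\<^esub>t'\<in>Rt xi. rho t' \<odot>B pt \<one>R (c xi s t'))
    : upper_span R B leq Lam0 L Rt (%xi s t. pt \<one>R (c xi s t)) xi" unfolding sumJ e
  proof (rule upper_spanI)
   fix i assume i: "i : Idx - Up xi"
   have "cc i (\<Oplus>\<^bsub>B\<^esub>j\<in>?J. rho (snd (snd j)) \<odot>B E j) = (if i : ?J then rho (snd (snd i)) else \<zero>R)"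
    by (rule cc_comb) (use finRt[OF xi] J rho(1) i in auto)
   moreover have "i : ?J \<longleftrightarrow> fst i = xi & fst (snd i) = s" using i by (cases i) (auto simp: Idx_def)
   moreover have "rho (snd (snd i)) : carrier R" if "i : ?J" using that rho(1) by auto
   ultimately show "cc i (E (xi, s, t) \<otimes>B a \<ominus>\<^bsub>B\<^esub> (\<Oplus>\<^bsub>B\<^esub>j\<in>?J. rho (snd (snd j)) \<odot>B E j)) = \<zero>R"
    using a b cl rho(2)[OF s i] by (simp add: cc_minus R.minus_eq R.r_neg)
  qed (use a b cl in \<open>simp add: Br.minus_closed\<close>)
 qed
qed

end

section \<open>Unitriangular integral systems\<close>

text \<open>Bijections between fibres of equal size are glued. All matching arguments below, for
  colour matrices, Young subgroups and orbits, become counting arguments through this lemma.\<close>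

lemma ex_bij_betw_fibers:
 assumes "finite Z" "finite Y"
  and "!!c. card {x\<in>Z. f x = c} = card {y\<in>Y. g y = c}"
 shows "\<exists>b. bij_betw b Z Y & (\<forall>x\<in>Z. g (b x) = f x)"
proof -
 have "\<exists>b. bij_betw b {x\<in>Z. f x = c} {y\<in>Y. g y = c}" for c using assms by (intro finite_same_card_bij) auto
 then obtain b where b: "!!c. bij_betw (b c) {x\<in>Z. f x = c} {y\<in>Y. g y = c}" by metis
 have bZ: "b (f x) x : Y & g (b (f x) x) = f x" if "x : Z" for x using b[of "f x"] that by (auto simp: bij_betw_def)
 have "bij_betw (%x. b (f x) x) Z Y"
 proof (rule bij_betwI')
  fix x y assume xy: "x : Z" "y : Z"
  show "(b (f x) x = b (f y) y) = (x = y)"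
  proof
   assume e: "b (f x) x = b (f y) y"
   then have "f x = f y" using bZ xy by metis
   then show "x = y" using e b[of "f x"] xy by (auto simp: bij_betw_def inj_on_def)
  qed simp
 next
  fix y assume "y : Y"
  then have "y : b (g y) ` {x\<in>Z. f x = g y}" using b[of "g y"] by (auto simp: bij_betw_def)
  then obtain x where "x : Z" "f x = g y" "y = b (g y) x" by blast
  then show "\<exists>x\<in>Z. y = b (f x) x" by metis
 qed (use bZ in auto)
 then show ?thesis using bZ by blast
qed

text \<open>Induction on \<open>W j\<close>: an off-diagonal term in the equation at
  \<open>j\<close> belongs to some \<open>i\<close> of smaller weight which again lies outside
  \<open>Up\<close>, so the equation reduces to \<open>z j = 0\<close>. The predicate
  \<open>Up\<close> serves the case where equations are known only outside an upward closed set of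
  indices.\<close>

lemma unitriangular_kernel:
 fixes G :: "'i => 'i => 'a::comm_ring_1" and W :: "'i => nat"
 assumes "finite I" and diag: "!!i. i : I ==> G i i = 1"
  and tri: "!!i j. i : I ==> j : I ==> G i j ~= 0 ==> i = j \<or> W i < W j"
  and up: "!!i j. i : I ==> j : I ==> G i j ~= 0 ==> Up i ==> Up j"
  and zero: "!!j. j : I ==> ~ Up j ==> (\<Sum>i\<in>I. z i * G i j) = 0"
  and "j : I" "~ Up j"
 shows "z j = 0" using \<open>j : I\<close> \<open>~ Up j\<close>
proof (induction "W j" arbitrary: j rule: less_induct)
 case less
 have *: "z i * G i j = 0" if "i : I - {j}" for i
 proof (cases "G i j = 0")
  case False
  have i: "i : I" "i ~= j" using that by auto
  have "W i < W j" using tri[OF i(1) less.prems(1) False] i(2) by blast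
  moreover have "~ Up i" using up[OF i(1) less.prems(1) False] less.prems(2) by blast
  ultimately have "z i = 0" using less.hyps i(1) by blast
  then show ?thesis by simp
 qed simp
 have "0 = (\<Sum>i\<in>I. z i * G i j)" using zero[OF less.prems] by simp
 also have "... = z j * G j j + (\<Sum>i\<in>I - {j}. z i * G i j)" by (rule sum.remove[OF assms(1) less.prems(1)])
 also have "... = z j" using sum.neutral[of "I - {j}"] * diag[OF less.prems(1)] by simp
 finally show ?case by simp
qed

text \<open>Back substitution, starting from the largest weight. The diagonal entries are 1, so no
  division occurs and integral matrices have integral inverses.\<close>

lemma unitriangular_inverse:
 fixes G :: "'i => 'i => 'a::comm_ring_1" and W :: "'i => nat"
 assumes fin: "finite I" and diag: "!!i. i : I ==> G i i = 1"
  and tri: "!!i j. i : I ==> j : I ==> G i j ~= 0 ==> i = j \<or> W i < W j"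
 shows "\<exists>H. \<forall>i\<in>I. \<forall>k\<in>I. (\<Sum>j\<in>I. H i j * G j k) = (if i = k then 1 else 0)"
proof -
 define m where "m = Max (insert 0 (W ` I))"
 have m: "W i <= m" if "i : I" for i unfolding m_def using fin that by (intro Max_ge) auto
 have "\<exists>h. \<forall>k\<in>I. (\<Sum>j\<in>I. h j * G j k) = (if i = k then 1 else 0)" if "i : I" for i using that
 proof (induction "m - W i" arbitrary: i rule: less_induct)
  case less
  have "\<forall>i'\<in>{i'\<in>I. W i < W i'}. \<exists>h. \<forall>k\<in>I. (\<Sum>j\<in>I. h j * G j k) = (if i' = k then 1 else 0)"
  proof
   fix i' assume i': "i' : {i'\<in>I. W i < W i'}"
   then have "m - W i' < m - W i" using m[of i'] by auto
   then show "\<exists>h. \<forall>k\<in>I. (\<Sum>j\<in>I. h j * G j k) = (if i' = k then 1 else 0)"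
    using less.hyps i' by blast
  qed
  from bchoice[OF this] obtain h where h: "!!i' k. i' : I ==> W i < W i' ==> k : I ==>
    (\<Sum>j\<in>I. h i' j * G j k) = (if i' = k then 1 else 0)" by blast
  define h0 where "h0 j = (if j = i then 1 else 0) - (\<Sum>i'\<in>{i'\<in>I. W i < W i'}. G i i' * h i' j)" for j
  have "(\<Sum>j\<in>I. h0 j * G j k) = (if i = k then 1 else 0)" if "k : I" for k
  proof -
   have "(\<Sum>j\<in>I. h0 j * G j k) = (\<Sum>j\<in>I. (if j = i then G j k else 0)) -
     (\<Sum>j\<in>I. \<Sum>i'\<in>{i'\<in>I. W i < W i'}. G i i' * (h i' j * G j k))" unfolding h0_def
    by (subst sum_subtractf[symmetric], intro sum.cong)
     (auto simp: left_diff_distrib sum_distrib_right mult.assoc)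
   also have "(\<Sum>j\<in>I. (if j = i then G j k else 0)) = G i k" using fin less.prems by (simp add: sum.delta)
   also have "(\<Sum>j\<in>I. \<Sum>i'\<in>{i'\<in>I. W i < W i'}. G i i' * (h i' j * G j k)) =
     (\<Sum>i'\<in>{i'\<in>I. W i < W i'}. G i i' * (\<Sum>j\<in>I. h i' j * G j k))"
    by (subst sum.swap) (simp add: sum_distrib_left)
   also have "... = (\<Sum>i'\<in>{i'\<in>I. W i < W i'}. if i' = k then G i i' else 0)"
    using h that by (intro sum.cong) auto
   also have "... = (if W i < W k then G i k else 0)" using fin that by (simp add: sum.delta')
   finally show ?thesis using tri[OF less.prems that] diag less.prems by auto
  qed
  then show ?case by blast
 qed
 then show ?thesis by (intro bchoice) blast
qed

text \<open>A one-sided inverse of a square matrix over a field is two-sided, and the identity of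
  integers can be read in the rationals.\<close>

lemma square_inverse:
 fixes A :: "'i => 'j => int" and B :: "'j => 'i => int"
 assumes fin: "finite I" "finite J" and card: "card I = card J"
  and AB: "!!i k. i : I ==> k : I ==> (\<Sum>j\<in>J. A i j * B j k) = (if i = k then 1 else 0)"
  and jk: "j : J" "k : J"
 shows "(\<Sum>i\<in>I. B j i * A i k) = (if j = k then 1 else 0)"
proof -
 define n where "n = card I"
 obtain e where e: "bij_betw e {0..<n} I" using ex_bij_betw_nat_finite[OF fin(1)] n_def by auto
 obtain d where d: "bij_betw d {0..<n} J" using ex_bij_betw_nat_finite[OF fin(2)] n_def card by auto
 have eI: "e a : I" if "a < n" for a using bij_betwE[OF e] that by auto
 have inj: "e a = e b \<longleftrightarrow> a = b" "d a = d b \<longleftrightarrow> a = b" if "a < n" "b < n" for a b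
  using inj_on_eq_iff[OF bij_betw_imp_inj_on[OF e]] inj_on_eq_iff[OF bij_betw_imp_inj_on[OF d]] that by auto
 define MA where "MA = mat n n (%(a, b). of_int (A (e a) (d b)) :: rat)"
 define MB where "MB = mat n n (%(a, b). of_int (B (d a) (e b)) :: rat)"
 have c: "MA : carrier_mat n n" "MB : carrier_mat n n" by (auto simp: MA_def MB_def)
 have "MA * MB = 1\<^sub>m n"
 proof (rule eq_matI)
  fix a b assume ab: "a < dim_row (1\<^sub>m n :: rat mat)" "b < dim_col (1\<^sub>m n :: rat mat)"
  have "(MA * MB) $$ (a, b) = of_int (\<Sum>x = 0..<n. A (e a) (d x) * B (d x) (e b))"
   using ab by (simp add: MA_def MB_def scalar_prod_def)
  also have "(\<Sum>x = 0..<n. A (e a) (d x) * B (d x) (e b)) = (\<Sum>j\<in>J. A (e a) j * B j (e b))"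
   by (rule sum.reindex_bij_betw[OF d])
  also have "(\<Sum>j\<in>J. A (e a) j * B j (e b)) = (if a = b then 1 else 0)" using AB[OF eI eI] inj(1) ab by simp
  finally show "(MA * MB) $$ (a, b) = (1\<^sub>m n) $$ (a, b)" using ab by simp
 qed (auto simp: MA_def MB_def)
 then have BA: "MB * MA = 1\<^sub>m n" using mat_mult_left_right_inverse[OF c] by simp
 obtain a b where ab: "a < n" "b < n" "j = d a" "k = d b"
  using bij_betw_imp_surj_on[OF d] jk by (metis atLeastLessThan_iff imageE)
 have "of_int (\<Sum>i\<in>I. B j i * A i k) = (of_int (\<Sum>x = 0..<n. B j (e x) * A (e x) k) :: rat)"
  by (rule arg_cong[OF sum.reindex_bij_betw[OF e, symmetric]])
 also have "... = (MB * MA) $$ (a, b)" using ab by (simp add: MA_def MB_def scalar_prod_def)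
 also have "... = of_int (if j = k then 1 else 0)" using BA ab inj by simp
 finally show ?thesis by (subst (asm) of_int_eq_iff)
qed

section \<open>The Robinson-Schensted-Knuth count\<close>

text \<open>Partitions as weakly decreasing functions that vanish eventually: adding and removing
  boxes then needs no bookkeeping of list lengths.\<close>

definition Par :: "(nat => nat) set" where
 "Par = {l. antimono l & (\<exists>m. \<forall>k\<ge>m. l k = 0)}"

definition psize :: "(nat => nat) => nat" where
 "psize l = (\<Sum>k\<in>{k. l k ~= 0}. l k)"

text \<open>The interlacing condition, which says that the boxes of \<open>rho\<close> outside
  \<open>l\<close> form a horizontal strip.\<close>

definition hstrip :: "(nat => nat) => (nat => nat) => bool" where
 "hstrip l rho \<longleftrightarrow> (\<forall>k. l k <= rho k & rho (Suc k) <= l k)"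

definition fdiag :: "(nat => nat) => (nat \<times> nat) set" where
 "fdiag l = {(i, j). j < l i}"

definition SST :: "(nat => nat) => nat => (nat => nat) => (nat \<times> nat => nat) set" where
 "SST l n kap = {S : fdiag l \<rightarrow>\<^sub>E {..<n}.
  (\<forall>c<n. card {p : fdiag l. S p = c} = kap c) &
  (\<forall>i j j'. j < j' & j' < l i --> S (i, j) <= S (i, j')) &
  (\<forall>i i' j. i < i' & j < l i & j < l i' --> S (i, j) < S (i', j))}"

lemma psize_eq: "(!!k. k \<ge> m ==> l k = 0) ==> psize l = (\<Sum>k<m. l k)" unfolding psize_def
 by (rule sum.mono_neutral_left) (auto, metis not_le not_less0)

lemma Par_bound:
 assumes "l : Par" obtains m where "!!k. k \<ge> m ==> l k = 0" using assms by (auto simp: Par_def)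

lemma Par_le: "l : Par ==> i <= j ==> l j <= l i" by (auto simp: Par_def antimono_def)

lemma finite_fdiag: assumes "l : Par" shows "finite (fdiag l)"
proof -
 obtain m where m: "!!k. k \<ge> m ==> l k = 0" using Par_bound assms by metis
 have "fdiag l <= {..<m} \<times> {..<l 0}"
 proof clarify
  fix i j assume "(i, j) : fdiag l"
  then have j: "j < l i" by (simp add: fdiag_def)
  then have "i < m" using m[of i] by (metis not_le not_less0)
  moreover have "j < l 0" using j Par_le[OF assms, of 0 i] by simp
  ultimately show "i : {..<m} & j : {..<l 0}" by simp
 qed
 then show ?thesis using finite_subset by blast
qed

lemma card_fdiag: assumes "l : Par" shows "card (fdiag l) = psize l"
proof -
 obtain m where m: "!!k. k \<ge> m ==> l k = 0" using Par_bound assms by metis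
 have "fdiag l = (SIGMA i:{..<m}. {..<l i})" unfolding fdiag_def using m by auto (metis not_le not_less0)
 then have "card (fdiag l) = (\<Sum>i<m. l i)" by (simp add: card_SigmaI)
 then show ?thesis using psize_eq[of m l] m by simp
qed

lemma Par_small:
 assumes "l : Par" shows "l k <= psize l" "k \<ge> psize l ==> l k = 0"
proof -
 have f: "finite (fdiag l)" by (rule finite_fdiag[OF assms])
 have "card ((%j. (k, j)) ` {..<l k}) <= card (fdiag l)" by (rule card_mono[OF f]) (auto simp: fdiag_def)
 then show "l k <= psize l" using card_fdiag[OF assms] by (simp add: card_image inj_on_def)
 show "l k = 0" if "k \<ge> psize l"
 proof (rule ccontr)
  assume "l k ~= 0"
  then have "(i, 0) : fdiag l" if "i <= k" for i using Par_le[OF assms that] by (auto simp: fdiag_def)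
  then have "card ((%i. (i, 0::nat)) ` {..k}) <= card (fdiag l)" by (intro card_mono[OF f]) auto
  then show False using that card_fdiag[OF assms] by (simp add: card_image inj_on_def)
 qed
qed

lemma finite_Par: "finite {l : Par. psize l <= K}"
proof (rule finite_subset)
 show "{l : Par. psize l <= K} <= {l. \<forall>k. (k : {..<K} --> l k : {..K}) & (k ~: {..<K} --> l k = 0)}"
 proof clarify
  fix l k assume l: "l : Par" "psize l <= K"
  then show "(k : {..<K} --> l k : {..K}) & (k ~: {..<K} --> l k = 0)" using Par_small[OF l(1), of k] by auto
 qed
 show "finite {l. \<forall>k. (k : {..<K} --> l k : {..K}) & (k ~: {..<K} --> l k = 0)}"
  by (rule finite_set_of_finite_funs) auto
qed

lemma SST_cong: "(!!c. c < n ==> kap c = kap' c) ==> SST l n kap = SST l n kap'" unfolding SST_def by auto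

lemma finite_SST: "l : Par ==> finite (SST l n kap)"
 by (rule finite_subset[of _ "fdiag l \<rightarrow>\<^sub>E {..<n}"]) (auto simp: SST_def finite_fdiag finite_PiE)

lemma SST_size:
 assumes "l : Par" "S : SST l n kap" shows "psize l = (\<Sum>c<n. kap c)"
proof -
 have "card (fdiag l) = (\<Sum>c<n. card {p : fdiag l. S p = c})" using assms finite_fdiag[of l]
  by (subst card_UN_disjoint[symmetric]) (auto simp: SST_def intro!: arg_cong[where f=card])
 then show ?thesis using assms card_fdiag[of l] by (auto simp: SST_def)
qed

lemma fdiag_empty_iff: "fdiag l = {} \<longleftrightarrow> l = (%_. 0)" by (auto simp: fdiag_def fun_eq_iff)

lemma SST_0: "card (SST l 0 kap) = (if l = (%_. 0) then 1 else 0)"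
proof (cases "l = (%_. 0)")
 case True
 then have "fdiag l = {}" by (simp add: fdiag_def)
 then have "SST l 0 kap = {%_. undefined}" unfolding SST_def using True by auto
 then show ?thesis using True by simp
next
 case False
 then have "fdiag l ~= {}" by (simp add: fdiag_empty_iff)
 then have "SST l 0 kap = {}" unfolding SST_def by auto
 then show ?thesis using False by simp
qed

lemma zero_Par [simp]: "(%_. 0) : Par" by (auto simp: Par_def antimono_def)
lemma psize_zero [simp]: "psize (%_. 0) = 0" by (simp add: psize_def)
lemma psize_0_iff: "l : Par ==> psize l = 0 \<longleftrightarrow> l = (%_. 0)"
 using Par_small(1)[of l] by (auto simp: fun_eq_iff psize_def)

lemma hstrip_size: assumes "l : Par" "rho : Par" "hstrip l rho" shows "psize l <= psize rho"
proof -
 have "fdiag l <= fdiag rho" using assms(3) by (force simp: hstrip_def fdiag_def intro: less_le_trans)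
 then show ?thesis using card_mono[OF finite_fdiag[OF assms(2)]] card_fdiag assms by metis
qed

text \<open>The local growth rule behind RSK in piecewise linear form. For given \<open>lm\<close>
  and \<open>l\<close>, the row \<open>Suc k\<close> of \<open>rho\<close> and the row
  \<open>k\<close> of \<open>sig\<close> range over the same interval from \<open>M (Suc k)\<close>
  to \<open>m k\<close>, and reflection of these intervals exchanges them. The first row of
  \<open>rho\<close> has no upper bound from interlacing; its excess \<open>j\<close> over
  \<open>M 0\<close> is recorded separately and corresponds to a matrix entry in RSK.\<close>

lemma hstrip_local_count:
 assumes lam: "lm : Par" and l: "l : Par"
 shows "card {rho : Par. hstrip lm rho & hstrip l rho & psize rho = psize lm + b & psize rho = psize l + a} =
  (\<Sum>j\<le>min a b. card {sig : Par. hstrip sig lm & hstrip sig l &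
    psize lm = psize sig + (a - j) & psize l = psize sig + (b - j)})"
  (is "card ?A = (\<Sum>j\<le>min a b. card (?B j))")
proof -
 define M where "M k = max (lm k) (l k)" for k
 define m where "m k = min (lm k) (l k)" for k
 have finB: "finite (?B j)" for j by (rule finite_subset[OF _ finite_Par[of "psize l"]]) auto
 \<comment> \<open>The reflection identity summed over all rows; the first row of \<open>rho\<close>
   and \<open>M 0\<close> are the terms without a partner.\<close>
 have size: "psize sig + psize rho + M 0 = rho 0 + psize lm + psize l"
  if "sig : Par" "rho : Par" "!!k. sig k + rho (Suc k) = M (Suc k) + m k" for sig rho
 proof -
  define N where "N = psize sig + psize rho + psize lm + psize l"
  have z: "sig k = 0" "rho k = 0" "lm k = 0" "l k = 0" if "k \<ge> N" for k
   using Par_small(2) that \<open>sig : Par\<close> \<open>rho : Par\<close> lam l by (auto simp: N_def)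
  have s: "psize sig = (\<Sum>k<N. sig k)" "psize lm = (\<Sum>k<Suc N. lm k)" "psize l = (\<Sum>k<Suc N. l k)"
   "psize rho = (\<Sum>k<Suc N. rho k)" by (rule psize_eq, use z in auto)+
  have "(\<Sum>k<N. sig k) + (\<Sum>k<N. rho (Suc k)) = (\<Sum>k<N. M (Suc k)) + (\<Sum>k<N. m k)"
   using that(3) by (simp flip: sum.distrib)
  moreover have "(\<Sum>k<Suc N. rho k) = rho 0 + (\<Sum>k<N. rho (Suc k))" "(\<Sum>k<Suc N. M k) = M 0 + (\<Sum>k<N. M (Suc k))"
   by (rule sum.lessThan_Suc_shift)+
  moreover have "(\<Sum>k<Suc N. M k) + (\<Sum>k<Suc N. m k) = (\<Sum>k<Suc N. lm k) + (\<Sum>k<Suc N. l k)"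
   unfolding sum.distrib[symmetric] by (intro sum.cong) (auto simp: M_def m_def)
  moreover have "(\<Sum>k<Suc N. m k) = (\<Sum>k<N. m k)" using z[of N] by (simp add: m_def)
  ultimately show ?thesis unfolding s by linarith
 qed
 define f where "f rho = (rho 0 - M 0, %k. M (Suc k) + m k - rho (Suc k))" for rho :: "nat => nat"
 define g where "g = (%(j, sig) k. case k of 0 => M 0 + j | Suc k => M (Suc k) + m k - sig k)"
 have A: "f rho : (SIGMA j:{..min a b}. ?B j) & g (f rho) = rho" if "rho : ?A" for rho
 proof -
  have r: "rho : Par" "hstrip lm rho" "hstrip l rho" "psize rho = psize lm + b" "psize rho = psize l + a"
   using that by auto
  define sig where "sig = (%k. M (Suc k) + m k - rho (Suc k))"
  have bd: "M k <= rho k" "rho (Suc k) <= m k" for k using r by (auto simp: M_def m_def hstrip_def)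
  have e: "sig k + rho (Suc k) = M (Suc k) + m k" for k using bd[of k] by (simp add: sig_def)
  have mM: "m k <= M k" for k by (auto simp: m_def M_def)
  have sb: "M (Suc k) <= sig k" "sig k <= m k" for k using bd[of k] bd[of "Suc k"] e[of k] by auto
  have "sig (Suc k) <= sig k" for k using sb[of k] sb[of "Suc k"] mM[of "Suc k"] by linarith
  then have "antimono sig" by (simp add: decseq_Suc_iff)
  moreover have "\<exists>q. \<forall>k\<ge>q. sig k = 0"
   using Par_bound[OF lam] sb(2) unfolding m_def by (metis le_zero_eq min.boundedE)
  ultimately have sP: "sig : Par" by (simp add: Par_def)
  have h: "hstrip sig lm" "hstrip sig l" using sb unfolding hstrip_def M_def m_def by auto
  have "psize sig <= psize lm" "psize sig <= psize l" using hstrip_size sP lam l h by auto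
  moreover have "psize sig + psize rho + M 0 = rho 0 + psize lm + psize l" by (rule size[OF sP r(1)]) (rule e)
  ultimately have "f rho : (SIGMA j:{..min a b}. ?B j)"
   using h sP r(4,5) bd(1)[of 0] unfolding f_def sig_def[symmetric] by auto
  moreover have "g (f rho) = rho"
  proof
   fix k show "g (f rho) k = rho k" using bd(1)[of 0] bd[of "k - 1"] mM unfolding g_def f_def by (cases k) auto
  qed
  ultimately show ?thesis by simp
 qed
 have B: "g p : ?A & f (g p) = p" if p: "p : (SIGMA j:{..min a b}. ?B j)" for p
 proof -
  obtain j sig where js: "p = (j, sig)" "j <= a" "j <= b" "sig : Par" "hstrip sig lm" "hstrip sig l"
    "psize lm = psize sig + (a - j)" "psize l = psize sig + (b - j)" using p by auto
  define rho where "rho = g p"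
  have rho0: "rho 0 = M 0 + j" and rhoS: "!!k. rho (Suc k) = M (Suc k) + m k - sig k" by (auto simp: rho_def g_def js)
  have bd: "M (Suc k) <= sig k" "sig k <= m k" for k using js by (auto simp: M_def m_def hstrip_def)
  have mM: "m k <= M k" for k by (auto simp: m_def M_def)
  have e: "sig k + rho (Suc k) = M (Suc k) + m k" for k using bd[of k] rhoS by simp
  have sb: "M k <= rho k" "rho (Suc k) <= m k" for k
  proof -
   show "M k <= rho k" using rho0 e[of "k-1"] bd(2)[of "k-1"] by (cases k) auto
   show "rho (Suc k) <= m k" using e[of k] bd(1)[of k] by linarith
  qed
  have "rho (Suc k) <= rho k" for k using sb[of k] mM[of k] by linarith
  then have "antimono rho" by (simp add: decseq_Suc_iff)
  moreover have "\<exists>q. \<forall>k\<ge>q. rho k = 0"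
  proof -
   obtain q where "!!k. k \<ge> q ==> lm k = 0" using Par_bound lam by metis
   then have "rho k = 0" if "k \<ge> Suc q" for k using sb(2)[of "k-1"] that by (cases k) (auto simp: m_def)
   then show ?thesis by blast
  qed
  ultimately have rP: "rho : Par" by (simp add: Par_def)
  have h: "hstrip lm rho" "hstrip l rho" using sb unfolding hstrip_def M_def m_def by auto
  have "psize sig + psize rho + M 0 = rho 0 + psize lm + psize l" by (rule size[OF js(4) rP]) (rule e)
  then have "rho : ?A" using h rP js rho0 by auto
  moreover have "f rho = p" unfolding f_def js(1) using rho0 rhoS bd by (auto simp: fun_eq_iff)
   (metis add_diff_cancel_right' e)
  ultimately show ?thesis by (simp add: rho_def)
 qed
 have "bij_betw f ?A (SIGMA j:{..min a b}. ?B j)" by (rule bij_betw_byWitness[where f' = g]) (use A B in blast)+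
 then have "card ?A = card (SIGMA j:{..min a b}. ?B j)" by (rule bij_betw_same_card)
 also have "... = (\<Sum>j\<le>min a b. card (?B j))" by (rule card_SigmaI) (simp, use finB in blast)
 finally show ?thesis .
qed


text \<open>Deleting the largest letter \<open>n\<close> leaves a tableau of the smaller shape
  \<open>ll S\<close>. Strictness of the columns says precisely that the deleted boxes form a
  horizontal strip.\<close>

lemma SST_Suc:
 assumes "rho : Par"
 shows "card (SST rho (Suc n) kap) =
  (\<Sum>l\<in>{l : Par. hstrip l rho & psize rho = psize l + kap n}. card (SST l n kap))"
proof -
 let ?Q = "{l : Par. hstrip l rho & psize rho = psize l + kap n}"
 define ll where "ll S k = card {j. j < rho k & S (k, j) < n}" for S :: "nat \<times> nat => nat" and k
 define f where "f S = (ll S, restrict S (fdiag (ll S)))" for S :: "nat \<times> nat => nat"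
 define g where "g = (%(l, S') p. if p : fdiag rho then (if p : fdiag l then S' p else n) else undefined)"
 have finr: "finite (fdiag rho)" by (rule finite_fdiag[OF assms])
 have Q: "fdiag l <= fdiag rho" if "hstrip l rho" for l
  using that by (force simp: hstrip_def fdiag_def intro: less_le_trans)
 have A: "f S : (SIGMA l:?Q. SST l n kap) & g (f S) = S" if "S : SST rho (Suc n) kap" for S
 proof -
  have Sr: "S : fdiag rho \<rightarrow>\<^sub>E {..<Suc n}"
   and cnt: "!!c. c < Suc n ==> card {p : fdiag rho. S p = c} = kap c"
   and row: "!!i j j'. j < j' ==> j' < rho i ==> S (i, j) <= S (i, j')"
   and col: "!!i i' j. i < i' ==> j < rho i ==> j < rho i' ==> S (i, j) < S (i', j)" using that by (auto simp: SST_def)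
  have le: "S (i, j) <= n" if "j < rho i" for i j using Sr that by (auto simp: fdiag_def PiE_iff less_Suc_eq_le)
  \<comment> \<open>Rows increase weakly, so the entries below \<open>n\<close> occupy an initial
    segment of each row.\<close>
  have ini: "j < rho k & S (k, j) < n \<longleftrightarrow> j < ll S k" for k j
  proof -
   let ?A = "{j. j < rho k & S (k, j) < n}"
   have fin: "finite ?A" by (rule finite_subset[of _ "{..<rho k}"]) auto
   have down: "x : ?A" if "x < y" "y : ?A" for x y using that row[of x y k] by auto
   show ?thesis
   proof
    assume j: "j < rho k & S (k, j) < n"
    then have "{..j} <= ?A" using down[of _ j] by (auto simp: le_less)
    then have "card {..j} <= card ?A" by (rule card_mono[OF fin])
    then show "j < ll S k" by (simp add: ll_def)
   next
    assume j: "j < ll S k"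
    show "j < rho k & S (k, j) < n"
    proof (rule ccontr)
     assume n: "~ ?thesis"
     have "?A <= {..<j}"
     proof
      fix y assume y: "y : ?A"
      show "y : {..<j}" using n y down[of j y] by (cases "j < y"; cases "j = y") auto
     qed
     then have "card ?A <= card {..<j}" by (rule card_mono[rotated]) auto
     then show False using j by (simp add: ll_def)
    qed
   qed
  qed
  have dl: "fdiag (ll S) = {p : fdiag rho. S p < n}" using ini by (auto simp: fdiag_def)
  have hs: "hstrip (ll S) rho"
  proof -
   have "ll S k <= rho k" for k using ini[of "rho k" k] by auto
   moreover have "rho (Suc k) <= ll S k" for k
   proof (rule ccontr)
    assume "~ ?thesis"
    then have j: "ll S k < rho (Suc k)" by simp
    then have "ll S k < rho k" using Par_le[OF assms, of k "Suc k"] by simp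
    then have "S (k, ll S k) < S (Suc k, ll S k)" using col j by simp
    then have "ll S k < rho k & S (k, ll S k) < n" using le[OF j] \<open>ll S k < rho k\<close> by simp
    then show False using ini by blast
   qed
   ultimately show ?thesis by (simp add: hstrip_def)
  qed
  have lP: "ll S : Par"
  proof -
   have "ll S (Suc k) <= ll S k" for k using hs unfolding hstrip_def by (meson le_trans)
   then have "antimono (ll S)" by (simp add: decseq_Suc_iff)
   moreover have "\<exists>m. \<forall>k\<ge>m. ll S k = 0"
    using Par_bound[OF assms] hs unfolding hstrip_def by (metis le_zero_eq)
   ultimately show ?thesis by (simp add: Par_def)
  qed
  have "fdiag rho = fdiag (ll S) \<union> {p : fdiag rho. S p = n}"
   unfolding dl using Sr by (force simp: PiE_iff less_Suc_eq)
  then have "card (fdiag rho) = card (fdiag (ll S)) + card {p : fdiag rho. S p = n}"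
   using finr dl by (subst card_Un_disjoint[symmetric]) auto
  then have sz: "psize rho = psize (ll S) + kap n" using card_fdiag assms lP cnt[of n] by simp
  have cnt': "card {p : fdiag (ll S). restrict S (fdiag (ll S)) p = c} = kap c" if "c < n" for c
  proof -
   have "{p : fdiag (ll S). restrict S (fdiag (ll S)) p = c} = {p : fdiag rho. S p = c}" using that by (auto simp: dl)
   then show ?thesis using cnt that by simp
  qed
  have r: "restrict S (fdiag (ll S)) (i, j) = S (i, j)" "j < rho i" if "j < ll S i" for i j
   using that ini[of j i] by (auto simp: fdiag_def)
  have "restrict S (fdiag (ll S)) (i, j) <= restrict S (fdiag (ll S)) (i, j')"
   if "j < j'" "j' < ll S i" for i j j' using that r[of j i] r[of j' i] row[of j j' i] by simp
  moreover have "restrict S (fdiag (ll S)) (i, j) < restrict S (fdiag (ll S)) (i', j)"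
   if "i < i'" "j < ll S i" "j < ll S i'" for i i' j using that r[of j i] r[of j i'] col[of i i' j] by simp
  moreover have "restrict S (fdiag (ll S)) : fdiag (ll S) \<rightarrow>\<^sub>E {..<n}" by (auto simp: dl)
  ultimately have "restrict S (fdiag (ll S)) : SST (ll S) n kap" unfolding SST_def using cnt' by blast
  moreover have "g (f S) = S"
  proof
   fix p
   have "g (f S) p = (if p : fdiag rho then (if p : fdiag (ll S) then S p else n) else undefined)"
    by (simp add: g_def f_def)
   moreover have "S p < n \<or> S p = n" if "p : fdiag rho" using Sr that by (auto simp: less_Suc_eq)
   moreover have "S p = undefined" if "p ~: fdiag rho" by (rule PiE_arb[OF Sr that])
   ultimately show "g (f S) p = S p" unfolding dl by auto
  qed
  ultimately show ?thesis using hs lP sz by (simp add: f_def)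
 qed
 have B: "g x : SST rho (Suc n) kap & f (g x) = x" if x: "x : (SIGMA l:?Q. SST l n kap)" for x
 proof -
  obtain l S' where xl: "x = (l, S')" and l: "l : Par" "hstrip l rho" "psize rho = psize l + kap n"
   and S': "S' : SST l n kap" using x by auto
  have sub: "fdiag l <= fdiag rho" by (rule Q[OF l(2)])
  have Sr: "S' : fdiag l \<rightarrow>\<^sub>E {..<n}"
   and cnt: "!!c. c < n ==> card {p : fdiag l. S' p = c} = kap c"
   and row: "!!i j j'. j < j' ==> j' < l i ==> S' (i, j) <= S' (i, j')"
   and col: "!!i i' j. i < i' ==> j < l i ==> j < l i' ==> S' (i, j) < S' (i', j)" using S' by (auto simp: SST_def)
  define S where "S = g x"
  have S: "S p = (if p : fdiag rho then (if p : fdiag l then S' p else n) else undefined)" for p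
   by (simp add: S_def g_def xl)
  have lt: "S' p < n" if "p : fdiag l" for p using Sr that by auto
  have lr: "l i <= rho i" "rho (Suc i) <= l i" for i using l(2) by (auto simp: hstrip_def)
  have c1: "card {p : fdiag rho. S p = c} = kap c" if c: "c < Suc n" for c
  proof (cases "c = n")
   case True
   have "{p : fdiag rho. S p = c} = fdiag rho - fdiag l" using True lt by (auto simp: S)
   then have "card {p : fdiag rho. S p = c} = card (fdiag rho) - card (fdiag l)"
    using card_Diff_subset[OF finite_subset[OF sub finr] sub] by simp
   then show ?thesis using l card_fdiag assms True by simp
  next
   case False
   then have "{p : fdiag rho. S p = c} = {p : fdiag l. S' p = c}" using sub by (auto simp: S)
   then show ?thesis using cnt[of c] c False by simp
  qed
  have "S : fdiag rho \<rightarrow>\<^sub>E {..<Suc n}" using lt by (auto simp: S less_Suc_eq)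
  moreover have "S (i, j) <= S (i, j')" if "j < j'" "j' < rho i" for i j j'
   using that lt[of "(i, j)"] row[of j j' i] by (auto simp: S fdiag_def)
  moreover have "S (i, j) < S (i', j)" if "i < i'" "j < rho i" "j < rho i'" for i i' j
  proof -
   have "j < rho (Suc i)" using that Par_le[OF assms, of "Suc i" i'] by simp
   then have "j < l i" using lr(2)[of i] by simp
   then show ?thesis using that lt[of "(i, j)"] col[of i i' j] by (auto simp: S fdiag_def)
  qed
  ultimately have "S : SST rho (Suc n) kap" using c1 by (auto simp: SST_def)
  moreover have ll: "ll S = l"
  proof
   fix k
   have "{j. j < rho k & S (k, j) < n} = {..<l k}"
    using lr(1)[of k] lt[of "(k, _)"] by (auto simp: S fdiag_def split: if_splits)
   then show "ll S k = l k" by (simp add: ll_def)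
  qed
  moreover have "restrict S (fdiag l) = S'" using Sr sub by (auto simp: S fun_eq_iff PiE_iff extensional_def restrict_def)
  moreover have "f S = x" using calculation by (simp add: f_def xl)
  ultimately show ?thesis by (simp add: S_def)
 qed
 have "bij_betw f (SST rho (Suc n) kap) (SIGMA l:?Q. SST l n kap)"
  by (rule bij_betw_byWitness[where f' = g]) (use A B in blast)+
 then have "card (SST rho (Suc n) kap) = card (SIGMA l:?Q. SST l n kap)" by (rule bij_betw_same_card)
 also have "... = (\<Sum>l\<in>?Q. card (SST l n kap))"
 proof (rule card_SigmaI)
  show "finite ?Q" by (rule finite_subset[OF _ finite_Par[of "psize rho"]]) auto
 qed (auto simp: finite_SST)
 finally show ?thesis .
qed

definition subvectors :: "nat => nat => (nat => nat) => (nat => nat) set" where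
 "subvectors n b kap = {v. (\<forall>c\<ge>n. v c = 0) & (\<forall>c<n. v c <= kap c) & (\<Sum>c<n. v c) = b}"

lemma finite_subvectors: "finite (subvectors n b kap)"
proof (rule finite_subset)
 show "subvectors n b kap <= {v. \<forall>c. (c : {..<n} --> v c : {..b}) & (c ~: {..<n} --> v c = 0)}"
  by (auto simp: subvectors_def member_le_sum)
 show "finite {v. \<forall>c. (c : {..<n} --> v c : {..b}) & (c ~: {..<n} --> v c = (0::nat))}"
  by (rule finite_set_of_finite_funs) auto
qed

lemma sum_subvectors_Suc:
 "(\<Sum>v\<in>subvectors (Suc n) b kap. F v) =
  (\<Sum>j\<le>min (kap n) b. \<Sum>v\<in>subvectors n (b - j) kap. F (v(n := j)))"
proof -
 have "(\<Sum>j\<le>min (kap n) b. \<Sum>v\<in>subvectors n (b - j) kap. F (v(n := j))) =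
   (\<Sum>(j, v)\<in>(SIGMA j:{..min (kap n) b}. subvectors n (b - j) kap). F (v(n := j)))"
  by (rule sum.Sigma) (auto simp: finite_subvectors)
 also have "... = (\<Sum>v\<in>subvectors (Suc n) b kap. F v)"
 proof (rule sum.reindex_bij_witness[where i = "%v. (v n, v(n := 0))" and j = "%(j, v). v(n := j)"])
  fix a assume "a : (SIGMA j:{..min (kap n) b}. subvectors n (b - j) kap)"
  then show "(case a of (j, v) => v(n := j)) : subvectors (Suc n) b kap" by (auto simp: subvectors_def less_Suc_eq)
  show "((case a of (j, v) => v(n := j)) n, (case a of (j, v) => v(n := j))(n := 0)) = a"
   using \<open>a : _\<close> by (auto simp: subvectors_def fun_eq_iff)
 next
  fix v assume v: "v : subvectors (Suc n) b kap"
  then have "(\<Sum>c<n. v c) = b - v n" "v n <= b" by (auto simp: subvectors_def)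
  moreover have "(\<Sum>c<n. (v(n := 0)) c) = (\<Sum>c<n. v c)" by (rule sum.cong) auto
  ultimately show "(v n, v(n := 0)) : (SIGMA j:{..min (kap n) b}. subvectors n (b - j) kap)"
   using v by (auto simp: subvectors_def)
 qed auto
 finally show ?thesis by simp
qed

text \<open>The adjoint Pieri rule in terms of Kostka numbers: both sides are the scalar product of
  the symmetric functions h_b s_lm and h_kap. Splitting off the largest letter on the left means one
  strip up from \<open>lm\<close> and one strip down; \<open>hstrip_local_count\<close> exchanges
  this for first down, then up, and the induction hypothesis applies to the upward step.\<close>

lemma SST_removal:
 assumes "lm : Par"
 shows "(\<Sum>rho\<in>{rho : Par. hstrip lm rho & psize rho = psize lm + b}. card (SST rho n kap)) =
  (\<Sum>v\<in>subvectors n b kap. card (SST lm n (%c. kap c - v c)))" using assms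
proof (induction n arbitrary: lm b)
 case 0
 have fin: "finite {rho : Par. hstrip lm rho & psize rho = psize lm + b}"
  by (rule finite_subset[OF _ finite_Par[of "psize lm + b"]]) auto
 have "(\<Sum>rho\<in>{rho : Par. hstrip lm rho & psize rho = psize lm + b}. card (SST rho 0 kap)) =
   (if (%_. 0) : {rho : Par. hstrip lm rho & psize rho = psize lm + b} then 1 else 0)"
  using fin by (simp add: SST_0 sum.delta)
 moreover have "subvectors 0 b kap = (if b = 0 then {%_. 0} else {})" by (auto simp: subvectors_def fun_eq_iff)
 moreover have "hstrip lm (%_. 0) \<longleftrightarrow> lm = (%_. 0)" by (auto simp: hstrip_def fun_eq_iff)
 ultimately show ?case by (auto simp: SST_0)
next
 case (Suc n)
 define P where "P = {l : Par. psize l <= psize lm + b}"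
 have finP: "finite P" unfolding P_def by (rule finite_Par)
 define A where "A = {rho : Par. hstrip lm rho & psize rho = psize lm + b}"
 have finA: "finite A" by (rule finite_subset[OF _ finP]) (auto simp: A_def P_def)
 let ?a = "kap n"
 have "(\<Sum>rho\<in>A. card (SST rho (Suc n) kap)) =
   (\<Sum>rho\<in>A. \<Sum>l\<in>{l : P. hstrip l rho & psize rho = psize l + ?a}. card (SST l n kap))"
 proof (rule sum_eq)
  fix rho assume "rho : A"
  then have "rho : Par" "psize rho = psize lm + b" by (auto simp: A_def)
  then show "card (SST rho (Suc n) kap) = (\<Sum>l\<in>{l : P. hstrip l rho & psize rho = psize l + ?a}. card (SST l n kap))"
   by (subst SST_Suc, simp, intro sum.cong) (auto simp: P_def)
 qed
 also have "... = (\<Sum>l\<in>P. \<Sum>rho\<in>{rho : A. hstrip l rho & psize rho = psize l + ?a}. card (SST l n kap))"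
  by (rule sum.swap_restrict[OF finA finP])
 also have "... = (\<Sum>l\<in>P. \<Sum>j\<le>min ?a b. \<Sum>sig\<in>{sig : P. hstrip sig lm & hstrip sig l &
    psize lm = psize sig + (?a - j) & psize l = psize sig + (b - j)}. card (SST l n kap))"
 proof (rule sum_eq)
  fix l assume "l : P"
  then have l: "l : Par" by (simp add: P_def)
  have e1: "{rho : A. hstrip l rho & psize rho = psize l + ?a} =
    {rho : Par. hstrip lm rho & hstrip l rho & psize rho = psize lm + b & psize rho = psize l + ?a}"
   by (auto simp: A_def)
  have e2: "{sig : P. hstrip sig lm & hstrip sig l &
    psize lm = psize sig + (?a - j) & psize l = psize sig + (b - j)} = {sig : Par. hstrip sig lm & hstrip sig l &
    psize lm = psize sig + (?a - j) & psize l = psize sig + (b - j)}" for j by (auto simp: P_def)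
  show "(\<Sum>rho\<in>{rho : A. hstrip l rho & psize rho = psize l + ?a}. card (SST l n kap)) =
   (\<Sum>j\<le>min ?a b. \<Sum>sig\<in>{sig : P. hstrip sig lm & hstrip sig l &
    psize lm = psize sig + (?a - j) & psize l = psize sig + (b - j)}. card (SST l n kap))" unfolding e1 e2
   by (simp only: sum_constant of_nat_id hstrip_local_count[OF Suc.prems l, of b ?a] sum_distrib_right)
 qed
 also have "... = (\<Sum>j\<le>min ?a b. \<Sum>l\<in>P. \<Sum>sig\<in>{sig : P. (hstrip sig lm & psize lm = psize sig + (?a - j)) &
    hstrip sig l & psize l = psize sig + (b - j)}. card (SST l n kap))" by (subst sum.swap) (intro sum.cong refl, auto)
 also have "... = (\<Sum>j\<le>min ?a b. \<Sum>sig\<in>P. \<Sum>l\<in>{l : P. (hstrip sig lm & psize lm = psize sig + (?a - j)) &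
    hstrip sig l & psize l = psize sig + (b - j)}. card (SST l n kap))" by (intro sum.cong refl sum.swap_restrict finP)
 also have "... = (\<Sum>j\<le>min ?a b. \<Sum>sig\<in>{sig : P. hstrip sig lm & psize lm = psize sig + (?a - j)}.
   \<Sum>l\<in>{l : P. hstrip sig l & psize l = psize sig + (b - j)}. card (SST l n kap))"
  by (intro sum.cong refl sum.mono_neutral_cong_right finP) (auto intro!: sum.neutral)
 also have "... = (\<Sum>j\<le>min ?a b. \<Sum>sig\<in>{sig : P. hstrip sig lm & psize lm = psize sig + (?a - j)}.
   \<Sum>v\<in>subvectors n (b - j) kap. card (SST sig n (%c. kap c - v c)))"
 proof (rule sum_eq, rule sum_eq)
  fix j sig assume j: "j : {..min ?a b}" and s: "sig : {sig : P. hstrip sig lm & psize lm = psize sig + (?a - j)}"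
  have "{l : P. hstrip sig l & psize l = psize sig + (b - j)} = {l : Par. hstrip sig l & psize l = psize sig + (b - j)}"
   using s by (auto simp: P_def)
  then show "(\<Sum>l\<in>{l : P. hstrip sig l & psize l = psize sig + (b - j)}. card (SST l n kap)) =
    (\<Sum>v\<in>subvectors n (b - j) kap. card (SST sig n (%c. kap c - v c)))"
   using Suc.IH[of sig "b - j"] s by (simp add: P_def)
 qed
 also have "... = (\<Sum>j\<le>min ?a b. \<Sum>v\<in>subvectors n (b - j) kap. card (SST lm (Suc n) (%c. kap c - (v(n := j)) c)))"
 proof (rule sum_eq)
  fix j assume j: "j : {..min ?a b}"
  have "card (SST lm (Suc n) (%c. kap c - (v(n := j)) c)) =
    (\<Sum>sig\<in>{sig : P. hstrip sig lm & psize lm = psize sig + (?a - j)}. card (SST sig n (%c. kap c - v c)))" for v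
  proof -
   have "{sig : P. hstrip sig lm & psize lm = psize sig + (?a - j)} =
     {sig : Par. hstrip sig lm & psize lm = psize sig + (?a - j)}" by (auto simp: P_def)
   moreover have "SST sig n (%c. kap c - (v(n := j)) c) = SST sig n (%c. kap c - v c)" for sig by (rule SST_cong) auto
   ultimately show ?thesis by (simp add: SST_Suc[OF Suc.prems] del: fun_upd_apply) simp
  qed
  then show "(\<Sum>sig\<in>{sig : P. hstrip sig lm & psize lm = psize sig + (?a - j)}.
   \<Sum>v\<in>subvectors n (b - j) kap. card (SST sig n (%c. kap c - v c))) =
   (\<Sum>v\<in>subvectors n (b - j) kap. card (SST lm (Suc n) (%c. kap c - (v(n := j)) c)))" by (subst sum.swap) simp
 qed
 also have "... = (\<Sum>v\<in>subvectors (Suc n) b kap. card (SST lm (Suc n) (%c. kap c - v c)))"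
  by (rule sum_subvectors_Suc[symmetric])
 finally show ?case by (simp add: A_def)
qed

definition margin_matrices :: "nat => nat => (nat => nat) => (nat => nat) => (nat => nat => nat) set" where
 "margin_matrices n n' kap kap' = {N. (\<forall>c c'. ~ (c < n & c' < n') --> N c c' = 0) &
  (\<forall>c<n. (\<Sum>c'<n'. N c c') = kap c) & (\<forall>c'<n'. (\<Sum>c<n. N c c') = kap' c')}"

lemma finite_margin_matrices: "finite (margin_matrices n n' kap kap')"
proof (rule finite_subset)
 let ?F = "{v. \<forall>c'. (c' : {..<n'} --> v c' : {..\<Sum>c<n. kap c}) & (c' ~: {..<n'} --> v c' = 0)}"
 show "margin_matrices n n' kap kap' <= {N. \<forall>c. (c : {..<n} --> N c : ?F) & (c ~: {..<n} --> N c = (%_. 0))}"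
 proof clarify
  fix N c assume N: "N : margin_matrices n n' kap kap'"
  have "N c c' <= (\<Sum>c<n. kap c)" if "c < n" "c' < n'" for c'
  proof -
   have "N c c' <= (\<Sum>c'<n'. N c c')" using that by (intro member_le_sum) auto
   also have "... = kap c" using N that by (simp add: margin_matrices_def)
   also have "... <= (\<Sum>c<n. kap c)" using that by (intro member_le_sum) auto
   finally show ?thesis .
  qed
  then show "(c : {..<n} --> N c : ?F) & (c ~: {..<n} --> N c = (%_. 0))" using N by (auto simp: margin_matrices_def)
 qed
 show "finite {N. \<forall>c. (c : {..<n} --> N c : ?F) & (c ~: {..<n} --> N c = (%_. 0))}"
  by (intro finite_set_of_finite_funs) auto
qed

lemma card_margin_matrices_Suc:
 "card (margin_matrices n (Suc n') kap kap') =
  (\<Sum>v\<in>subvectors n (kap' n') kap. card (margin_matrices n n' (%c. kap c - v c) kap'))"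
proof -
 let ?S = "SIGMA v:subvectors n (kap' n') kap. margin_matrices n n' (%c. kap c - v c) kap'"
 let ?f = "%N. (%c. N c n', %c c'. if c' = n' then 0 else N c c')"
 let ?g = "%(v, N) c c'. if c' = n' then v c else N c c'"
 have A: "?f N : ?S & ?g (?f N) = N" if N: "N : margin_matrices n (Suc n') kap kap'" for N
 proof -
  have r: "(\<Sum>c'<n'. N c c') + N c n' = kap c" if "c < n" for c using N that by (simp add: margin_matrices_def)
  then have "N c n' <= kap c" "(\<Sum>c'<n'. N c c') = kap c - N c n'" if "c < n" for c
   using that by (metis le_add2) (metis diff_add_inverse2 r that)
  note r1 = this
  have s: "(\<Sum>c'<n'. if c' = n' then 0 else N c c') = (\<Sum>c'<n'. N c c')" for c by (rule sum.cong) auto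
  have z: "N c c' = 0" if "~ (c < n & c' < Suc n')" for c c' using N that by (simp add: margin_matrices_def)
  have cs: "(\<Sum>c<n. N c c') = kap' c'" if "c' < Suc n'" for c' using N that by (simp add: margin_matrices_def)
  have "(%c. N c n') : subvectors n (kap' n') kap" using z r1(1) cs by (simp add: subvectors_def)
  moreover have "(%c c'. if c' = n' then 0 else N c c') : margin_matrices n n' (%c. kap c - N c n') kap'"
  proof -
   have "N c c' = 0" if "~ (c < n & c' < n')" "c' ~= n'" for c c' using z[of c c'] that by auto
   then show ?thesis unfolding margin_matrices_def mem_Collect_eq s using r1(2) cs by simp
  qed
  moreover have "?g (?f N) = N" by (auto simp: fun_eq_iff)
  ultimately show ?thesis by blast
 qed
 have B: "?g p : margin_matrices n (Suc n') kap kap' & ?f (?g p) = p" if p: "p : ?S" for p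
 proof -
  obtain v N where vN: "p = (v, N)" "v : subvectors n (kap' n') kap"
   "N : margin_matrices n n' (%c. kap c - v c) kap'" using p by auto
  have s: "(\<Sum>c'<n'. if c' = n' then v c else N c c') = (\<Sum>c'<n'. N c c')" for c by (rule sum.cong) auto
  have v: "v c = 0" if "c \<ge> n" for c using vN(2) that by (simp add: subvectors_def)
  have v': "v c <= kap c" if "c < n" for c using vN(2) that by (simp add: subvectors_def)
  have vs: "(\<Sum>c<n. v c) = kap' n'" using vN(2) by (simp add: subvectors_def)
  have z: "N c c' = 0" if "~ (c < n & c' < n')" for c c' using vN(3) that unfolding margin_matrices_def by blast
  have rs: "(\<Sum>c'<n'. N c c') = kap c - v c" if "c < n" for c using vN(3) that by (simp add: margin_matrices_def)
  have cs: "(\<Sum>c<n. N c c') = kap' c'" if "c' < n'" for c' using vN(3) that by (simp add: margin_matrices_def)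
  define G where "G c c' = (if c' = n' then v c else N c c')" for c c'
  have G: "?g p = G" by (simp add: vN(1) G_def fun_eq_iff)
  have "G c c' = 0" if "~ (c < n & c' < Suc n')" for c c' using that v[of c] z[of c c'] by (auto simp: G_def)
  moreover have "(\<Sum>c'<Suc n'. G c c') = kap c" if "c < n" for c using rs[OF that] v'[OF that] s by (simp add: G_def)
  moreover have "(\<Sum>c<n. G c c') = kap' c'" if "c' < Suc n'" for c' using that cs vs by (auto simp: G_def less_Suc_eq)
  ultimately have "G : margin_matrices n (Suc n') kap kap'" unfolding margin_matrices_def by blast
  moreover have "?f G = p" using z by (auto simp: vN(1) G_def fun_eq_iff)
  ultimately show ?thesis unfolding G by simp
 qed
 have "bij_betw ?f (margin_matrices n (Suc n') kap kap') ?S" by (rule bij_betw_byWitness[where f' = ?g]) (use A B in blast)+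
 then have "card (margin_matrices n (Suc n') kap kap') = card ?S" by (rule bij_betw_same_card)
 also have "... = (\<Sum>v\<in>subvectors n (kap' n') kap. card (margin_matrices n n' (%c. kap c - v c) kap'))"
  by (rule card_SigmaI) (auto simp: finite_subvectors finite_margin_matrices)
 finally show ?thesis .
qed

text \<open>Induction on the number of columns: \<open>SST_Suc\<close> strips the last letter from
  the right tableau, \<open>SST_removal\<close> passes the strip on to the content of the left
  tableau, and the content \<open>v\<close> removed there is the last column of the matrix.\<close>

lemma RSK_count:
 "(\<Sum>l\<in>{l : Par. psize l = (\<Sum>c'<n'. kap' c')}. card (SST l n kap) * card (SST l n' kap')) =
  card (margin_matrices n n' kap kap')"
proof (induction n' arbitrary: kap)
 case 0
 have e: "{l : Par. psize l = 0} = {%_. 0}" using psize_0_iff by auto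
 have z: "fdiag (%_. 0) = {}" by (simp add: fdiag_def)
 have "card (SST (%_. 0) n kap) = (if \<forall>c<n. kap c = 0 then 1 else 0)"
 proof (cases "\<forall>c<n. kap c = 0")
  case True
  then have "SST (%_. 0) n kap = {%_. undefined}" unfolding SST_def z by auto
  then show ?thesis using True by simp
 next
  case False
  then have "SST (%_. 0) n kap = {}" unfolding SST_def z by auto
  then show ?thesis using False by simp
 qed
 moreover have "margin_matrices n 0 kap kap' = (if \<forall>c<n. kap c = 0 then {%_ _. 0} else {})"
  by (auto simp: margin_matrices_def fun_eq_iff)
 ultimately show ?case by (simp add: e SST_0)
next
 case (Suc n')
 let ?b = "kap' n'"
 define i where "i = (\<Sum>c'<n'. kap' c')"
 define P where "P = {l : Par. psize l = i}"
 define P' where "P' = {l : Par. psize l = i + ?b}"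
 have fin: "finite P" "finite P'" by (rule finite_subset[OF _ finite_Par[of "i + ?b"]], force simp: P_def P'_def)+
 have "(\<Sum>rho\<in>P'. card (SST rho n kap) * card (SST rho (Suc n') kap')) =
   (\<Sum>rho\<in>P'. \<Sum>l\<in>{l : P. hstrip l rho}. card (SST rho n kap) * card (SST l n' kap'))"
 proof (rule sum_eq)
  fix rho assume r: "rho : P'"
  then have "{l : Par. hstrip l rho & psize rho = psize l + ?b} = {l : P. hstrip l rho}" by (auto simp: P_def P'_def)
  then show "card (SST rho n kap) * card (SST rho (Suc n') kap') =
    (\<Sum>l\<in>{l : P. hstrip l rho}. card (SST rho n kap) * card (SST l n' kap'))"
   using SST_Suc[of rho n' kap'] r by (simp add: P'_def sum_distrib_left)
 qed
 also have "... = (\<Sum>l\<in>P. \<Sum>rho\<in>{rho : P'. hstrip l rho}. card (SST rho n kap) * card (SST l n' kap'))"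
  by (rule sum.swap_restrict[OF fin(2,1)])
 also have "... = (\<Sum>l\<in>P. \<Sum>v\<in>subvectors n ?b kap. card (SST l n (%c. kap c - v c)) * card (SST l n' kap'))"
 proof (rule sum_eq)
  fix l assume l: "l : P"
  then have "{rho : P'. hstrip l rho} = {rho : Par. hstrip l rho & psize rho = psize l + ?b}" by (auto simp: P_def P'_def)
  then show "(\<Sum>rho\<in>{rho : P'. hstrip l rho}. card (SST rho n kap) * card (SST l n' kap')) =
    (\<Sum>v\<in>subvectors n ?b kap. card (SST l n (%c. kap c - v c)) * card (SST l n' kap'))"
   using SST_removal[where lm = l and b = ?b and n = n and kap = kap] l by (simp add: P_def flip: sum_distrib_right)
 qed
 also have "... = (\<Sum>v\<in>subvectors n ?b kap. \<Sum>l\<in>P. card (SST l n (%c. kap c - v c)) * card (SST l n' kap'))"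
  by (rule sum.swap)
 also have "... = card (margin_matrices n (Suc n') kap kap')" unfolding card_margin_matrices_Suc P_def i_def Suc.IH ..
 finally show ?case by (simp add: P'_def i_def)
qed

section \<open>Row contents and column alternation\<close>

text \<open>With \<open>h\<close> as row and \<open>u\<close> as entry, this records the content of each row of a tableau.\<close>

definition stat :: "'x set => ('x => nat) => ('x => nat) => nat => nat => nat" where
 "stat Z h u = (%k c. card {x\<in>Z. h x = k & u x = c})"

abbreviation rt :: "(nat => nat) => (nat \<times> nat => nat) => nat => nat => nat" where
 "rt l S == stat (fdiag l) fst S"

text \<open>A map \<open>h\<close> distributes the points of \<open>Z\<close> over rows, and
  \<open>u\<close> and \<open>v\<close> are two colourings of these points. The maps are taken
  extensional so that they can be counted.\<close>

definition cnt :: "'x set => ('x => nat) => ('x => nat) => (nat => nat => nat) => (nat => nat => nat) => nat" where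
 "cnt Z u v A B = card {h : extensional Z. stat Z h u = A & stat Z h v = B}"

lemma stat_cong: "(!!x. x : Z ==> h x = h' x) ==> (!!x. x : Z ==> u x = u' x) ==> stat Z h u = stat Z h' u'"
 unfolding stat_def by (intro ext arg_cong[where f = card]) auto

lemma stat_bij:
 assumes "bij_betw b Z' Z" "!!x. x : Z' ==> h' x = h (b x)" "!!x. x : Z' ==> u' x = u (b x)"
 shows "stat Z' h' u' = stat Z h u"
proof -
 have "bij_betw b {x\<in>Z'. h' x = k & u' x = c} {x\<in>Z. h x = k & u x = c}" for k c
  using assms by (auto simp: bij_betw_def inj_on_def)
 then show ?thesis unfolding stat_def by (intro ext) (rule bij_betw_same_card)
qed

lemma stat_pos_iff: "finite Z ==> stat Z h u k c ~= 0 \<longleftrightarrow> (\<exists>x\<in>Z. h x = k & u x = c)"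
 unfolding stat_def by auto

lemma card_fibers: "finite Z ==> finite T ==> g ` Z <= T ==> card Z = (\<Sum>t\<in>T. card {x\<in>Z. g x = t})"
 using sum.group[of Z T g "%_. 1::nat"] by simp

lemma stat_row: assumes "finite Z" shows "card {x\<in>Z. h x = k} = (\<Sum>c | stat Z h u k c ~= 0. stat Z h u k c)"
proof -
 have "{c. stat Z h u k c ~= 0} = u ` {x\<in>Z. h x = k}" unfolding stat_pos_iff[OF assms] by auto
 then have "card {x\<in>Z. h x = k} = (\<Sum>c | stat Z h u k c ~= 0. card {x\<in>{x\<in>Z. h x = k}. u x = c})"
  using assms by (intro card_fibers) auto
 then show ?thesis unfolding stat_def by (simp add: conj_assoc)
qed

lemma stat_row_eq:
 assumes "finite Z" "finite Z'" "stat Z h u = stat Z' h' u'"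
 shows "card {x\<in>Z. h x = k} = card {x\<in>Z'. h' x = k}"
 using assms stat_row[of Z h k u] stat_row[of Z' h' k u'] by simp

lemma stat_sum:
 assumes "finite Z"
 shows "card {x\<in>Z. h x < m & u x <= c} = (\<Sum>k<m. \<Sum>d\<le>c. stat Z h u k d)"
proof -
 have "card {x\<in>Z. h x < m & u x <= c} =
   (\<Sum>t\<in>{..<m} \<times> {..c}. card {x\<in>{x\<in>Z. h x < m & u x <= c}. (h x, u x) = t})"
  using assms by (intro card_fibers) auto
 also have "... = (\<Sum>(k, d)\<in>{..<m} \<times> {..c}. stat Z h u k d)"
  unfolding stat_def by (intro sum.cong refl) (auto intro!: arg_cong[where f = card])
 also have "... = (\<Sum>k<m. \<Sum>d\<le>c. stat Z h u k d)" by (rule sum.cartesian_product[symmetric])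
 finally show ?thesis .
qed

text \<open>The values of \<open>h\<close> are not bounded in advance, but only rows in which
  \<open>A\<close> has a nonzero entry can be used, and these are finitely many.\<close>

lemma finite_stat_set: assumes "finite Z" shows "finite {h : extensional Z. stat Z h u = A}"
proof -
 have sub: "{h : extensional Z. stat Z h u = A} <= Z \<rightarrow>\<^sub>E {k. \<exists>c. A k c ~= 0}"
 proof clarify
  fix h assume h: "h : extensional Z" "A = stat Z h u"
  have "\<exists>c. stat Z h u (h x) c ~= 0" if "x : Z" for x
   using that stat_pos_iff[OF assms, of h u "h x" "u x"] by blast
  then show "h : Z \<rightarrow>\<^sub>E {k. \<exists>c. stat Z h u k c ~= 0}" using h by (auto simp: PiE_iff simp del: neq0_conv)
 qed
 show ?thesis
 proof (cases "{h : extensional Z. stat Z h u = A} = {}")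
  case False
  then obtain h where A: "stat Z h u = A" by blast
  have "{k. \<exists>c. A k c ~= 0} <= h ` Z" unfolding A[symmetric] stat_pos_iff[OF assms] by blast
  then have "finite {k. \<exists>c. A k c ~= 0}" using assms finite_surj by blast
  then show ?thesis using sub finite_PiE[OF assms] by (meson finite_subset)
 next
  case True then show ?thesis by (metis finite.emptyI)
 qed
qed

lemma cnt_bij:
 assumes b: "bij_betw b Z' Z" and u: "!!x. x : Z' ==> u' x = u (b x)" and v: "!!x. x : Z' ==> v' x = v (b x)"
 shows "cnt Z' u' v' A B = cnt Z u v A B"
proof -
 let ?i = "inv_into Z' b"
 have i: "bij_betw ?i Z Z'" by (rule bij_betw_inv_into[OF b])
 have bi: "b (?i x) = x" if "x : Z" for x using bij_betw_inv_into_right[OF b that] .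
 have ib: "?i (b x) = x" if "x : Z'" for x using bij_betw_inv_into_left[OF b that] .
 have bZ: "b x : Z" if "x : Z'" for x using bij_betwE[OF b] that by blast
 have iZ: "?i x : Z'" if "x : Z" for x using bij_betwE[OF i] that by blast
 let ?f = "%h. restrict (h o b) Z'" and ?g = "%h. restrict (h o ?i) Z"
 have s1: "stat Z' (?f h) u' = stat Z h u" "stat Z' (?f h) v' = stat Z h v" for h by (rule stat_bij[OF b], use u v in auto)+
 have s2: "stat Z (?g h) u = stat Z' h u'" "stat Z (?g h) v = stat Z' h v'" for h
  by (rule stat_bij[OF i], use u v bi iZ in auto)+
 have "bij_betw ?f {h : extensional Z. stat Z h u = A & stat Z h v = B}
   {h : extensional Z'. stat Z' h u' = A & stat Z' h v' = B}"
 proof (rule bij_betw_byWitness[where f' = ?g])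
  show "\<forall>a\<in>{h : extensional Z. stat Z h u = A & stat Z h v = B}. ?g (?f a) = a"
   using bi iZ by (auto simp: fun_eq_iff restrict_def extensional_def)
  show "\<forall>a\<in>{h : extensional Z'. stat Z' h u' = A & stat Z' h v' = B}. ?f (?g a) = a"
   using ib bZ by (auto simp: fun_eq_iff restrict_def extensional_def)
 qed (use s1 s2 in auto)
 then show ?thesis unfolding cnt_def by (rule bij_betw_same_card[symmetric])
qed

definition cmat :: "'x set => ('x => nat) => ('x => nat) => nat => nat => nat" where
 "cmat Z u v = (%c c'. card {x\<in>Z. u x = c & v x = c'})"

text \<open>The count on a model set with \<open>N c c'\<close> points coloured \<open>c\<close> and
  \<open>c'\<close>. By \<open>cnt_eq_cntm\<close> it makes \<open>cnt\<close> a function of the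
  colour matrix alone.\<close>

definition cntm :: "(nat => nat => nat) => (nat => nat => nat) => (nat => nat => nat) => nat" where
 "cntm A B N = cnt {(c, c', e). e < N c c'} fst (fst o snd) A B"

lemma cmat_match:
 assumes "finite Z" "finite Z'" "cmat Z u v = cmat Z' u' v'"
 shows "\<exists>b. bij_betw b Z Z' & (\<forall>x\<in>Z. u' (b x) = u x & v' (b x) = v x)"
proof -
 have "card {x\<in>Z. (u x, v x) = c} = card {y\<in>Z'. (u' y, v' y) = c}" for c
  using fun_cong[OF fun_cong[OF assms(3), of "fst c"], of "snd c"] unfolding cmat_def by (cases c) simp
 from ex_bij_betw_fibers[OF assms(1,2) this] show ?thesis by auto
qed

lemma cnt_eq_cntm: assumes "finite Z" shows "cnt Z u v A B = cntm A B (cmat Z u v)"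
proof -
 let ?Y = "{(c, c', e). e < cmat Z u v c c'}"
 have "?Y <= u ` Z \<times> v ` Z \<times> {..<card Z}"
 proof
  fix y assume "y : ?Y"
  then obtain c c' e where y: "y = (c, c', e)" and e: "e < cmat Z u v c c'" by auto
  then have "{x\<in>Z. u x = c & v x = c'} ~= {}" unfolding cmat_def by (metis card.empty not_less0)
  moreover have "cmat Z u v c c' <= card Z" unfolding cmat_def by (rule card_mono[OF assms]) auto
  ultimately show "y : u ` Z \<times> v ` Z \<times> {..<card Z}" using e by (auto simp: y)
 qed
 then have fin: "finite ?Y" by (rule finite_subset) (use assms in auto)
 have "cmat ?Y fst (fst o snd) = cmat Z u v"
 proof (intro ext)
  fix c c'
  have "{y\<in>?Y. fst y = c & (fst o snd) y = c'} = (%e. (c, c', e)) ` {..<cmat Z u v c c'}" by auto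
  then show "cmat ?Y fst (fst o snd) c c' = cmat Z u v c c'" by (simp add: cmat_def[of ?Y] card_image inj_on_def)
 qed
 from cmat_match[OF assms fin this[symmetric]] obtain b where
  "bij_betw b Z ?Y" "\<forall>x\<in>Z. fst (b x) = u x & (fst o snd) (b x) = v x" by blast
 then show ?thesis unfolding cntm_def by (intro cnt_bij) auto
qed

lemma cntm_transpose: "cntm A B N = cntm B A (%c c'. N c' c)"
proof -
 have "cntm A B N = cnt {(c, c', e). e < N c c'} (fst o snd) fst B A"
  unfolding cntm_def cnt_def by (rule arg_cong[where f = card]) auto
 also have "... = cntm B A (%c c'. N c' c)" unfolding cntm_def by (rule cnt_bij[where b = "%(c, c', e). (c', c, e)"])
   (auto simp: bij_betw_def inj_on_def image_def)
 finally show ?thesis .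
qed

section \<open>Column permutations and signed sums\<close>

definition col_perms :: "(nat => nat) => (nat \<times> nat => nat \<times> nat) set" where
 "col_perms l = {q. q permutes fdiag l & (\<forall>p. snd (q p) = snd p)}"

lemma finite_col_perms: "l : Par ==> finite (col_perms l)"
 unfolding col_perms_def by (rule finite_subset[OF _ finite_permutations[OF finite_fdiag]]) auto

lemma col_perms_permutes: "q : col_perms l ==> q permutes fdiag l" by (simp add: col_perms_def)

lemma col_perms_snd: "q : col_perms l ==> snd (q p) = snd p" unfolding col_perms_def by blast

lemma col_permsI: "q permutes fdiag l ==> (!!p. snd (q p) = snd p) ==> q : col_perms l" unfolding col_perms_def by blast

lemma col_perms_comp: "q : col_perms l ==> w : col_perms l ==> q o w : col_perms l"
 by (rule col_permsI) (blast intro: permutes_compose col_perms_permutes, simp add: col_perms_snd)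

lemma col_perms_inv: assumes "q : col_perms l" shows "pinv q : col_perms l"
proof -
 have q: "q permutes fdiag l" "!!p. snd (q p) = snd p" using assms unfolding col_perms_def by blast+
 have "snd (pinv q p) = snd p" for p using q(2)[of "pinv q p"] permutes_inverses(1)[OF q(1)] by simp
 then show ?thesis using permutes_inv[OF q(1)] by (intro col_permsI)
qed



lemma col_perms_permutation: "l : Par ==> q : col_perms l ==> permutation q"
 using permutation_permutes finite_fdiag col_perms_permutes by blast

lemma id_col_perms: "id : col_perms l" by (simp add: col_perms_def permutes_id)

lemma col_perms_reindex:
 assumes "w : col_perms l" shows "(\<Sum>q\<in>col_perms l. f (q o w)) = (\<Sum>q\<in>col_perms l. f q)"
proof (rule sum.reindex_bij_witness[where i = "%q. q o pinv w" and j = "%q. q o w"])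
 have p: "w permutes fdiag l" using assms by (rule col_perms_permutes)
 fix q assume q: "q : col_perms l"
 show "(q o w) o pinv w = q" "(q o pinv w) o w = q" using permutes_inv_o[OF p] by (simp_all add: comp_assoc)
 show "q o w : col_perms l" "q o pinv w : col_perms l" using q assms col_perms_comp col_perms_inv by auto
qed simp

lemma col_perms_reindex_inv: "(\<Sum>q\<in>col_perms l. f (pinv q)) = (\<Sum>q\<in>col_perms l. f q)"
 by (rule sum.reindex_bij_witness[where i = "pinv" and j = "pinv"])
  (auto simp: col_perms_inv permutes_inv_inv[OF col_perms_permutes])

text \<open>The coefficient of the row content \<open>A\<close> in the polytabloid of
  \<open>U\<close>, that is, in its signed sum over the column group.\<close>

definition polar :: "(nat => nat) => (nat \<times> nat => nat) => (nat => nat => nat) => int" where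
 "polar l U A = (\<Sum>q\<in>col_perms l. sign q * of_bool (rt l (U o q) = A))"

definition altsum :: "(nat => nat) => (nat \<times> nat => nat) => (nat \<times> nat => nat) =>
  ((nat => nat => nat) => 'a::comm_ring_1) => 'a" where
 "altsum l U V g = (\<Sum>q\<in>col_perms l. of_int (sign q) * g (cmat (fdiag l) (U o q) V))"

definition psum :: "(nat => nat) => nat => nat" where "psum l m = (\<Sum>k<m. l k)"

definition dom :: "(nat => nat) => (nat => nat) => bool" where
 "dom l' l \<longleftrightarrow> (\<forall>m. psum l m <= psum l' m)"

context
 fixes l :: "nat => nat" and h :: "nat \<times> nat => nat" and U :: "nat \<times> nat => nat"
  and A :: "nat => nat => nat"
 assumes l: "l : Par"
begin

text \<open>Swapping \<open>x\<close> and \<open>y\<close> inside their column changes the sign of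
  \<open>q\<close> but not the content of the rows given by \<open>h\<close>, so the sum equals its
  negative.\<close>

lemma signed_sum_zero:
 assumes "x : fdiag l" "y : fdiag l" "x ~= y" "snd x = snd y" "h x = h y"
 shows "(\<Sum>q\<in>col_perms l. sign q * of_bool (stat (fdiag l) h (U o q) = A)) = 0" (is "?s = 0")
proof -
 define t where "t = Transposition.transpose x y"
 have tp: "t permutes fdiag l" unfolding t_def by (rule permutes_swap_id[OF assms(1,2)])
 have t: "t : col_perms l" by (rule col_permsI[OF tp]) (use assms(4) in \<open>auto simp: t_def transpose_def\<close>)
 have "?s = (\<Sum>q\<in>col_perms l. sign (q o t) * of_bool (stat (fdiag l) h (U o (q o t)) = A))"
  by (rule col_perms_reindex[OF t, symmetric])
 also have "... = (\<Sum>q\<in>col_perms l. - (sign q * of_bool (stat (fdiag l) h (U o q) = A)))"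
 proof (rule sum_eq)
  fix q assume q: "q : col_perms l"
  have "sign (q o t) = - sign q" unfolding t_def
   using sign_compose[OF col_perms_permutation[OF l q] col_perms_permutation[OF l t]] assms(3)
   unfolding t_def by (simp add: sign_swap_id)
  moreover have "stat (fdiag l) h (U o (q o t)) = stat (fdiag l) h (U o q)"
   by (rule stat_bij[OF permutes_imp_bij[OF tp]]) (auto simp: t_def transpose_def assms(5))
  ultimately show "sign (q o t) * of_bool (stat (fdiag l) h (U o (q o t)) = A) =
    - (sign q * of_bool (stat (fdiag l) h (U o q) = A))" by simp
 qed
 also have "... = - ?s" by (rule sum_negf)
 finally show ?thesis by simp
qed

text \<open>Replacing \<open>q\<close> by \<open>q o w\<close> undoes the relabelling of the rows,
  at the cost of the sign of \<open>w\<close>.\<close>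

lemma signed_sum_perm:
 assumes w: "w : col_perms l" and h: "!!x. x : fdiag l ==> h x = fst (w x)"
 shows "(\<Sum>q\<in>col_perms l. sign q * of_bool (stat (fdiag l) h (U o q) = A)) = sign w * polar l U A"
proof -
 have wp: "w permutes fdiag l" using w by (rule col_perms_permutes)
 have "(\<Sum>q\<in>col_perms l. sign q * of_bool (stat (fdiag l) h (U o q) = A)) =
   (\<Sum>q\<in>col_perms l. sign (q o w) * of_bool (stat (fdiag l) h (U o (q o w)) = A))"
  by (rule col_perms_reindex[OF w, symmetric])
 also have "... = (\<Sum>q\<in>col_perms l. sign w * (sign q * of_bool (rt l (U o q) = A)))"
 proof (rule sum_eq)
  fix q assume q: "q : col_perms l"
  have "stat (fdiag l) h (U o (q o w)) = rt l (U o q)" by (rule stat_bij[OF permutes_imp_bij[OF wp]]) (auto simp: h)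
  then show "sign (q o w) * of_bool (stat (fdiag l) h (U o (q o w)) = A) =
   sign w * (sign q * of_bool (rt l (U o q) = A))"
   using sign_compose[OF col_perms_permutation[OF l q] col_perms_permutation[OF l w]] by simp
 qed
 finally show ?thesis by (simp add: polar_def sum_distrib_left)
qed

end

text \<open>Passing to the inverse moves the permutation from the rows to the entries.\<close>

lemma polar_inv: "(\<Sum>w\<in>col_perms l. sign w * of_bool (stat (fdiag l) (fst o w) V = B)) = polar l V B"
 if l: "l : Par"
proof -
 have "(\<Sum>w\<in>col_perms l. sign w * of_bool (stat (fdiag l) (fst o w) V = B)) =
  (\<Sum>w\<in>col_perms l. sign (pinv w) * of_bool (stat (fdiag l) (fst o pinv w) V = B))"
  by (rule col_perms_reindex_inv[symmetric])
 also have "... = polar l V B" unfolding polar_def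
 proof (rule sum_eq)
  fix q assume q: "q : col_perms l"
  have qp: "q permutes fdiag l" using q by (rule col_perms_permutes)
  have "rt l (V o q) = stat (fdiag l) (fst o pinv q) V"
   by (rule stat_bij[OF permutes_imp_bij[OF qp]]) (auto simp: permutes_inverses[OF qp])
  then show "sign (pinv q) * of_bool (stat (fdiag l) (fst o pinv q) V = B) = sign q * of_bool (rt l (V o q) = B)"
   using sign_inverse[OF col_perms_permutation[OF l q]] by simp
 qed
 finally show ?thesis .
qed

lemma initial_segment:
 fixes D :: "nat set"
 assumes "finite D" "!!x y. x < y ==> y : D ==> x : D"
 shows "D = {..<card D}"
proof -
 have "x < card D" if "x : D" for x
 proof -
  have "{..x} <= D" using assms(2)[of _ x] that by (auto simp: le_less)
  from card_mono[OF assms(1) this] show ?thesis by simp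
 qed
 then have "D <= {..<card D}" by auto
 then show ?thesis using card_subset_eq[of "{..<card D}" D] by simp
qed

lemma column_eq: assumes "l : Par"
 shows "{x\<in>fdiag l. snd x = j} = (%i. (i, j)) ` {..<card {i. j < l i}}" "finite {i. j < l i}"
proof -
 obtain m where m: "!!k. k \<ge> m ==> l k = 0" using Par_bound assms by metis
 show f: "finite {i. j < l i}" by (rule finite_subset[of _ "{..<m}"]) (use m in \<open>auto, metis not_le not_less0\<close>)
 have "{i. j < l i} = {..<card {i. j < l i}}"
  by (rule initial_segment[OF f]) (use Par_le[OF assms] in \<open>auto, meson le_less_trans less_imp_le not_le\<close>)
 moreover have "{x\<in>fdiag l. snd x = j} = (%i. (i, j)) ` {i. j < l i}" by (auto simp: fdiag_def)
 ultimately show "{x\<in>fdiag l. snd x = j} = (%i. (i, j)) ` {..<card {i. j < l i}}" by simp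
qed

lemma card_columns:
 assumes "l : Par"
 shows "card {x\<in>fdiag l. Q x} = (\<Sum>j<l 0. card {x\<in>fdiag l. snd x = j & Q x})"
proof -
 have "snd ` {x\<in>fdiag l. Q x} <= {..<l 0}" using Par_le[OF assms, of 0] by (auto simp: fdiag_def intro: less_le_trans)
 then have "card {x\<in>fdiag l. Q x} = (\<Sum>j<l 0. card {x\<in>{x\<in>fdiag l. Q x}. snd x = j})"
  using finite_fdiag[OF assms] by (intro card_fibers) auto
 then show ?thesis by (simp add: conj_commute conj_left_commute)
qed

lemma card_rows_fdiag: assumes "l : Par" shows "card {x\<in>fdiag l. fst x = k} = l k"
proof -
 have "{x\<in>fdiag l. fst x = k} = (%j. (k, j)) ` {..<l k}" by (auto simp: fdiag_def)
 then show ?thesis by (simp add: card_image inj_on_def)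
qed

lemma card_lt_psum:
 assumes "finite Z" "!!k. card {x\<in>Z. h x = k} = l k" shows "card {x\<in>Z. h x < m} = psum l m"
proof -
 have "card {x\<in>Z. h x < m} = (\<Sum>k<m. card {x\<in>{x\<in>Z. h x < m}. h x = k})"
  using assms by (intro card_fibers) auto
 also have "... = (\<Sum>k<m. l k)" unfolding assms(2)[symmetric] by (intro sum.cong arg_cong[where f = card]) auto
 finally show ?thesis by (simp add: psum_def)
qed

text \<open>If \<open>h\<close> is injective on a column of height H, at most \<open>min\<close> of
  H and \<open>m\<close> of its boxes have \<open>h\<close> below \<open>m\<close>, a bound attained
  by the first \<open>m\<close> rows. Summing over the columns gives dominance. For equal shapes the
  totals agree, so the bound is attained in every column and \<open>h\<close> merely permutes each
  column.\<close>

lemma column_injective: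
 assumes l: "l : Par" and l': "l' : Par"
  and inj: "!!x y. x : fdiag l' ==> y : fdiag l' ==> snd x = snd y ==> h x = h y ==> x = y"
  and sz: "!!k. card {x\<in>fdiag l'. h x = k} = l k"
 shows "dom l' l" and "l' = l ==> \<exists>w\<in>col_perms l. \<forall>x\<in>fdiag l. h x = fst (w x)"
proof -
 have fin: "finite (fdiag l')" by (rule finite_fdiag[OF l'])
 have le: "card {x\<in>fdiag l'. snd x = j & h x < m} <= card {x\<in>fdiag l'. snd x = j & fst x < m}" for j m
 proof -
  let ?H = "card {i. j < l' i}"
  have "{x\<in>fdiag l'. snd x = j & fst x < m} = (%i. (i, j)) ` ({..<?H} \<inter> {..<m})"
   using column_eq(1)[OF l', of j] by (force simp: set_eq_iff image_iff)
  then have r: "card {x\<in>fdiag l'. snd x = j & fst x < m} = min ?H m"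
   proof -
   have "{..<?H} \<inter> {..<m} = {..<min ?H m}" by auto
   then show ?thesis using \<open>_ = (%i. (i, j)) ` ({..<?H} \<inter> {..<m})\<close> by (simp add: card_image inj_on_def)
  qed
  have "card {x\<in>fdiag l'. snd x = j & h x < m} <= card {..<m}"
   by (rule card_inj_on_le[of h]) (use inj in \<open>auto simp: inj_on_def\<close>)
  moreover have "card {x\<in>fdiag l'. snd x = j & h x < m} <= card {x\<in>fdiag l'. snd x = j}"
   by (rule card_mono) (use fin in auto)
  moreover have "card {x\<in>fdiag l'. snd x = j} = ?H" unfolding column_eq(1)[OF l'] by (simp add: card_image inj_on_def)
  ultimately show ?thesis using r by simp
 qed
 have tot: "card {x\<in>fdiag l'. h x < m} = psum l m" "card {x\<in>fdiag l'. fst x < m} = psum l' m" for m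
  using card_lt_psum[OF fin, of h l] card_lt_psum[OF fin, of fst l'] sz card_rows_fdiag[OF l'] by auto
 have "psum l m <= psum l' m" for m unfolding tot(1)[of m, symmetric] tot(2)[of m, symmetric]
   card_columns[OF l', of "%x. h x < m"] card_columns[OF l', of "%x. fst x < m"] by (rule sum_mono) (rule le)
 then show "dom l' l" by (simp add: dom_def)
 assume eq: "l' = l"
 have ceq: "card {x\<in>fdiag l. snd x = j & h x < m} = card {x\<in>fdiag l. snd x = j & fst x < m}"
  if "j < l 0" for j m
 proof (rule sum_mono_inv[where I = "{..<l 0}" and i = j and
    f = "%j. card {x\<in>fdiag l. snd x = j & h x < m}" and
    g = "%j. card {x\<in>fdiag l. snd x = j & fst x < m}"])
  show "(\<Sum>j<l 0. card {x\<in>fdiag l. snd x = j & h x < m}) =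
    (\<Sum>j<l 0. card {x\<in>fdiag l. snd x = j & fst x < m})"
   using tot[of m] card_columns[OF l, of "%x. h x < m"] card_columns[OF l, of "%x. fst x < m"] unfolding eq by simp
 qed (use le that eq in auto)
 define w where "w x = (if x : fdiag l then (h x, snd x) else x)" for x
 have "w x : fdiag l" if x: "x : fdiag l" for x
 proof -
  define j where "j = snd x"
  have j0: "j < l 0" using x Par_le[OF l, of 0 "fst x"] by (auto simp: fdiag_def j_def)
  let ?H = "card {i. j < l i}"
  have "fst y < ?H" if "y : fdiag l" "snd y = j" for y
  proof -
   have "y : (%i. (i, j)) ` {..<?H}" using that column_eq(1)[OF l, of j] by blast
   then show ?thesis by auto
  qed
  then have "{x\<in>fdiag l. snd x = j & fst x < ?H} = {x\<in>fdiag l. snd x = j}" by auto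
  then have "card {x\<in>fdiag l. snd x = j & h x < ?H} = card {x\<in>fdiag l. snd x = j}" using ceq[OF j0, of ?H] by simp
  then have "{x\<in>fdiag l. snd x = j & h x < ?H} = {x\<in>fdiag l. snd x = j}"
   using fin eq by (intro card_subset_eq) auto
  then have "h x < ?H" using x j_def by blast
  then have "(h x, j) : {x\<in>fdiag l. snd x = j}" unfolding column_eq(1)[OF l] by simp
  then show ?thesis using x by (simp add: w_def j_def)
 qed
 moreover have "inj_on w (fdiag l)" using inj unfolding eq inj_on_def w_def by (metis prod.inject)
 ultimately have "bij_betw w (fdiag l) (fdiag l)" using endo_inj_surj[of "fdiag l" w] fin eq unfolding bij_betw_def by blast
 then have "w permutes fdiag l" by (rule bij_imp_permutes) (simp add: w_def)
 then have "w : col_perms l" by (rule col_permsI) (simp add: w_def)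
 then show "\<exists>w\<in>col_perms l. \<forall>x\<in>fdiag l. h x = fst (w x)" by (rule bexI[rotated]) (simp add: w_def)
qed

text \<open>After exchanging the sums, a row assignment \<open>h\<close> with content
  \<open>rt l T\<close> under \<open>V\<close> is fixed and the signs are summed over
  \<open>q\<close>. By \<open>signed_sum_zero\<close> only assignments that are injective on columns
  survive. By \<open>column_injective\<close> there are none unless \<open>l'\<close> dominates
  \<open>l\<close>, and for \<open>l' = l\<close> they are the column permutations, whose signs add
  up to the second factor.\<close>

lemma altsum_cntm:
 assumes l: "l : Par" and l': "l' : Par"
 shows "~ dom l' l ==> altsum l' U V (%N. of_nat (cntm A (rt l T) N)) = (0::int)"
  and "l' = l ==> altsum l' U V (%N. of_nat (cntm A (rt l T) N)) = polar l U A * polar l V (rt l T)"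
proof -
 let ?B = "rt l T"
 let ?D = "fdiag l'"
 have fin: "finite ?D" by (rule finite_fdiag[OF l'])
 define HB where "HB = {h : extensional ?D. stat ?D h V = ?B}"
 have finHB: "finite HB" unfolding HB_def by (rule finite_stat_set[OF fin])
 have sz: "card {x\<in>?D. h x = k} = l k" if "h : HB" for h k
  using stat_row_eq[OF fin finite_fdiag[OF l], of h V fst T k] that card_rows_fdiag[OF l] by (simp add: HB_def)
 define E where "E h = (\<Sum>q\<in>col_perms l'. sign q * of_bool (stat ?D h (U o q) = A))" for h
 have "int (cntm A ?B (cmat ?D (U o q) V)) = (\<Sum>h\<in>HB. of_bool (stat ?D h (U o q) = A))" for q
 proof -
  have "cntm A ?B (cmat ?D (U o q) V) = cnt ?D (U o q) V A ?B" by (rule cnt_eq_cntm[OF fin, symmetric])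
  also have "... = card {h\<in>HB. stat ?D h (U o q) = A}" unfolding cnt_def HB_def by (rule arg_cong[where f = card]) auto
  finally show ?thesis using finHB by (simp add: sum.If_cases of_bool_def Int_def)
 qed
 then have main: "altsum l' U V (%N. of_nat (cntm A ?B N)) = (\<Sum>h\<in>HB. E h)"
  unfolding altsum_def E_def by (simp add: sum_distrib_left) (rule sum.swap)
 have E0: "\<exists>x y. x : ?D & y : ?D & x ~= y & snd x = snd y & h x = h y ==> E h = 0" for h
  using signed_sum_zero[OF l'] unfolding E_def by blast
 {
  assume nd: "~ dom l' l"
  have "E h = 0" if "h : HB" for h using column_injective(1)[OF l l', of h] sz[OF that] nd E0 by blast
  then show "altsum l' U V (%N. of_nat (cntm A ?B N)) = (0::int)" using main by simp
 }
 assume eq: "l' = l"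
 let ?W = "{w\<in>col_perms l. stat ?D (fst o w) V = ?B}"
 let ?r = "%w. restrict (fst o w) ?D"
 have rst: "stat ?D (?r w) V = stat ?D (fst o w) V" for w :: "nat \<times> nat => nat \<times> nat" by (rule stat_cong) auto
 have injr: "inj_on ?r (col_perms l)"
 proof (rule inj_onI)
  fix w w' assume w: "w : col_perms l" "w' : col_perms l" and e: "?r w = ?r w'"
  show "w = w'"
  proof
   fix x show "w x = w' x"
   proof (cases "x : ?D")
    case True
    then have "fst (w x) = fst (w' x)" using fun_cong[OF e, of x] by simp
    then show ?thesis using w by (simp add: col_perms_snd prod_eq_iff)
   next
    case False
    then show ?thesis using permutes_not_in[OF col_perms_permutes] w eq by metis
   qed
  qed
 qed
 have "(\<Sum>h\<in>HB. E h) = (\<Sum>h\<in>?r ` ?W. E h)"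
 proof (rule sum.mono_neutral_right[OF finHB])
  show "?r ` ?W <= HB" using rst by (auto simp: HB_def)
  show "\<forall>h\<in>HB - ?r ` ?W. E h = 0"
  proof
   fix h assume h: "h : HB - ?r ` ?W"
   show "E h = 0"
   proof (rule ccontr)
    assume "E h ~= 0"
    then have "\<exists>w\<in>col_perms l. \<forall>x\<in>fdiag l. h x = fst (w x)"
     using column_injective(2)[OF l l', of h] sz[of h] h eq E0[of h] by blast
    then obtain w where w: "w : col_perms l" "\<forall>x\<in>fdiag l. h x = fst (w x)" by blast
    have "h : extensional ?D" using h by (simp add: HB_def)
    then have "h = ?r w" using w(2) unfolding eq by (intro extensionalityI[of _ "fdiag l"]) auto
    moreover have "w : ?W" using h w calculation rst by (auto simp: HB_def)
    ultimately show False using h by blast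
   qed
  qed
 qed
 also have "... = (\<Sum>w\<in>?W. E (?r w))" by (rule sum.reindex_cong[OF inj_on_subset[OF injr]]) auto
 also have "... = (\<Sum>w\<in>?W. sign w * polar l U A)"
 proof (rule sum_eq)
  fix w assume "w : ?W"
  then show "E (?r w) = sign w * polar l U A" unfolding E_def eq by (intro signed_sum_perm[OF l]) auto
 qed
 also have "... = (\<Sum>w\<in>col_perms l. sign w * of_bool (stat ?D (fst o w) V = ?B)) * polar l U A"
  unfolding sum_distrib_right by (rule sum.mono_neutral_cong_left) (auto simp: finite_col_perms[OF l])
 also have "... = polar l V ?B * polar l U A" unfolding eq polar_inv[OF l] ..
 finally show "altsum l' U V (%N. of_nat (cntm A ?B N)) = polar l U A * polar l V ?B" using main by (simp add: mult.commute)
qed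


section \<open>Semistandard tableaux dominate their column permutations\<close>

definition nn :: "(nat => nat) => (nat \<times> nat => nat) => nat => nat => nat" where
 "nn l S m c = card {p\<in>fdiag l. fst p < m & S p <= c}"

lemma SST_D:
 assumes "S : SST l n kap"
 shows "S : fdiag l \<rightarrow>\<^sub>E {..<n}" "c < n ==> card {p\<in>fdiag l. S p = c} = kap c"
  "j < j' ==> j' < l i ==> S (i, j) <= S (i, j')"
  "i < i' ==> j < l i ==> j < l i' ==> S (i, j) < S (i', j)" using assms by (auto simp: SST_def)

lemma column_entries:
 assumes l: "l : Par" and U: "U : SST l n kap"
 shows "\<exists>t. {p\<in>fdiag l. snd p = j & U p <= c} = (%i. (i, j)) ` {..<t}"
proof -
 let ?D = "{i. j < l i & U (i, j) <= c}"
 have "finite ?D" using column_eq(2)[OF l, of j] by simp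
 then have "?D = {..<card ?D}"
 proof (rule initial_segment)
  fix x y assume xy: "x < y" "y : ?D"
  then have "j < l x" using Par_le[OF l, of x y] by simp
  then show "x : ?D" using SST_D(4)[OF U, of x y j] xy by simp
 qed
 moreover have "{p\<in>fdiag l. snd p = j & U p <= c} = (%i. (i, j)) ` ?D" by (auto simp: fdiag_def)
 ultimately have "{p\<in>fdiag l. snd p = j & U p <= c} = (%i. (i, j)) ` {..<card ?D}" by (simp only:)
 then show ?thesis by blast
qed

lemma column_perm_bound:
 assumes l: "l : Par" and U: "U : SST l n kap" and q: "q : col_perms l"
 shows "card {p\<in>fdiag l. snd p = j & (fst p < m & U (q p) <= c)} <=
  card {p\<in>fdiag l. snd p = j & (fst p < m & U p <= c)}"
proof -
 have fin: "finite (fdiag l)" by (rule finite_fdiag[OF l])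
 obtain t where t: "{p\<in>fdiag l. snd p = j & U p <= c} = (%i. (i, j)) ` {..<t}" using column_entries[OF l U] by blast
 have "{p\<in>fdiag l. snd p = j & (fst p < m & U p <= c)} = {p\<in>(%i. (i, j)) ` {..<t}. fst p < m}"
  unfolding t[symmetric] by auto
 also have "... = (%i. (i, j)) ` {..<min t m}" by auto
 finally have r: "card {p\<in>fdiag l. snd p = j & (fst p < m & U p <= c)} = min t m" by (simp add: card_image inj_on_def)
 have "card {p\<in>fdiag l. snd p = j & (fst p < m & U (q p) <= c)} <= card ((%i. (i, j)) ` {..<m})"
  by (rule card_mono) auto
 then have a: "card {p\<in>fdiag l. snd p = j & (fst p < m & U (q p) <= c)} <= m" by (simp add: card_image inj_on_def)
 have "card {p\<in>fdiag l. snd p = j & (fst p < m & U (q p) <= c)} <= card {p\<in>fdiag l. snd p = j & U (q p) <= c}"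
  by (rule card_mono) (use fin in auto)
 also have "... = card {p\<in>fdiag l. snd p = j & U p <= c}"
 proof (rule bij_betw_same_card[of q])
  have qp: "q permutes fdiag l" using q by (rule col_perms_permutes)
  show "bij_betw q {p\<in>fdiag l. snd p = j & U (q p) <= c} {p\<in>fdiag l. snd p = j & U p <= c}"
  proof (rule bij_betw_byWitness[where f' = "pinv q"])
   show "q ` {p : fdiag l. snd p = j & U (q p) <= c} <= {p : fdiag l. snd p = j & U p <= c}"
    using col_perms_snd[OF q] permutes_in_image[OF qp] by auto
   show "pinv q ` {p : fdiag l. snd p = j & U p <= c} <= {p : fdiag l. snd p = j & U (q p) <= c}"
    using col_perms_snd[OF col_perms_inv[OF q]] permutes_in_image[OF permutes_inv[OF qp]]
     permutes_inverses[OF qp] by auto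
  qed (use permutes_inverses[OF qp] in auto)
 qed
 also have "... = t" unfolding t by (simp add: card_image inj_on_def)
 finally show ?thesis using a r by simp
qed

text \<open>The numbers \<open>nn\<close> compare tableaux of one shape in the dominance order. The
  entries up to \<open>c\<close> in a column of \<open>U\<close> sit at its top, so a column
  permutation can only move them out of the first \<open>m\<close> rows. If no count drops, no box
  is sent to a lower row, and then nothing moves at all.\<close>

lemma nn_perm:
 assumes l: "l : Par" and U: "U : SST l n kap" and q: "q : col_perms l" and rt: "rt l (U o q) = rt l S"
 shows "nn l S m c <= nn l U m c" and "(!!m c. nn l S m c = nn l U m c) ==> q = id"
proof -
 have fin: "finite (fdiag l)" by (rule finite_fdiag[OF l])
 have qp: "q permutes fdiag l" using q by (rule col_perms_permutes)
 have nS: "nn l S m c = card {p\<in>fdiag l. fst p < m & U (q p) <= c}" for m c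
  using stat_sum[OF fin, of fst m S c] stat_sum[OF fin, of fst m "U o q" c] rt by (simp add: nn_def)
 have cS: "nn l S m c = (\<Sum>j<l 0. card {p\<in>fdiag l. snd p = j & (fst p < m & U (q p) <= c)})" for m c
  unfolding nS by (rule card_columns[OF l])
 have cU: "nn l U m c = (\<Sum>j<l 0. card {p\<in>fdiag l. snd p = j & (fst p < m & U p <= c)})" for m c
  unfolding nn_def by (rule card_columns[OF l])
 show "nn l S m c <= nn l U m c" for m c unfolding cS cU by (rule sum_mono) (rule column_perm_bound[OF l U q])
 assume eq: "!!m c. nn l S m c = nn l U m c"
 have ceq: "card {p\<in>fdiag l. snd p = j & (fst p < m & U (q p) <= c)} =
   card {p\<in>fdiag l. snd p = j & (fst p < m & U p <= c)}" if "j < l 0" for j m c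
  by (rule sum_mono_inv[where I = "{..<l 0}" and i = j and
     f = "%j. card {p\<in>fdiag l. snd p = j & (fst p < m & U (q p) <= c)}" and
     g = "%j. card {p\<in>fdiag l. snd p = j & (fst p < m & U p <= c)}"])
   (use that eq[of m c] cS[of m c] cU[of m c] column_perm_bound[OF l U q] in auto)
 \<comment> \<open>Equality of the counts for the row and the entry of \<open>p\<close> gives
   \<open>U (q p) <= U p\<close>, and strict columns turn this into an inequality of rows.\<close>
 have le: "fst (q p) <= fst p" if p: "p : fdiag l" for p
 proof -
  obtain i j where ij: "p = (i, j)" by (cases p)
  have jl: "j < l i" using p ij by (simp add: fdiag_def)
  have j0: "j < l 0" using jl Par_le[OF l, of 0 i] by simp
  have in_col: "j < l i'" if "i' <= i" for i' using Par_le[OF l that] jl by simp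
  let ?C = "{p\<in>fdiag l. snd p = j & fst p < Suc i}"
  have "{p'\<in>fdiag l. snd p' = j & (fst p' < Suc i & U p' <= U p)} = ?C"
  proof -
   have "U (i', j) <= U (i, j)" if "i' <= i" for i'
    using SST_D(4)[OF U, of i' i j] in_col[OF that] jl that by (cases "i' = i") auto
   then show ?thesis using ij by auto
  qed
  then have "card {p'\<in>fdiag l. snd p' = j & (fst p' < Suc i & U (q p') <= U p)} = card ?C"
   using ceq[OF j0, of "Suc i" "U p"] by simp
  then have "{p'\<in>fdiag l. snd p' = j & (fst p' < Suc i & U (q p') <= U p)} = ?C"
   using fin by (intro card_subset_eq) auto
  moreover have "p : ?C" using p ij by simp
  ultimately have "U (q p) <= U p" by blast
  show "fst (q p) <= fst p"
  proof (rule ccontr)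
   assume n: "~ ?thesis"
   have "q p : fdiag l" using p permutes_in_image[OF qp] by simp
   moreover have "q p = (fst (q p), j)" using col_perms_snd[OF q, of p] ij by (metis prod.collapse snd_conv)
   ultimately have "j < l (fst (q p))" by (metis (mono_tags, lifting) fdiag_def case_prod_conv mem_Collect_eq)
   then have "U (i, j) < U (fst (q p), j)" using SST_D(4)[OF U, of i "fst (q p)" j] n ij jl by simp
   then show False using \<open>U (q p) <= U p\<close> \<open>q p = _\<close> ij by simp
  qed
 qed
 \<comment> \<open>The sum of all row numbers is invariant under \<open>q\<close>, so a permutation
   that never increases the row must preserve it.\<close>
 have "(\<Sum>p\<in>fdiag l. fst (q p)) = (\<Sum>p\<in>fdiag l. fst p)"
  by (rule sum.reindex_bij_betw[OF permutes_imp_bij[OF qp]])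
 then have "fst (q p) = fst p" if "p : fdiag l" for p
  by (rule sum_mono_inv[where f = "%p. fst (q p)" and g = fst]) (use le that fin in auto)
 then have "q p = p" for p
  using col_perms_snd[OF q] permutes_not_in[OF qp] by (cases "p : fdiag l") (auto simp: prod_eq_iff)
 then show "q = id" by auto
qed

text \<open>The entries up to \<open>c\<close> in row \<open>k\<close> form an initial segment whose
  length is a difference of two numbers \<open>nn\<close>, so these numbers determine a semistandard
  tableau.\<close>

lemma SST_eqI:
 assumes l: "l : Par" and S: "S : SST l n kap" and U: "U : SST l n kap'"
  and eq: "!!m c. m <= psize l ==> c < n ==> nn l S m c = nn l U m c"
 shows "S = U"
proof -
 have fin: "finite (fdiag l)" by (rule finite_fdiag[OF l])
 have row: "R (k, j) <= c \<longleftrightarrow> j < nn l R (Suc k) c - nn l R k c"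
  if R: "R : SST l n kap''" and j: "j < l k" for R kap'' k j c
 proof -
  let ?D = "{j. j < l k & R (k, j) <= c}"
  have f: "finite ?D" by simp
  have D: "?D = {..<card ?D}"
  proof (rule initial_segment[OF f])
   fix x y assume "x < y" "y : ?D"
   then show "x : ?D" using SST_D(3)[OF R, of x y k] by simp
  qed
  have "{p\<in>fdiag l. fst p < Suc k & R p <= c} = {p\<in>fdiag l. fst p < k & R p <= c} \<union> Pair k ` ?D"
   by (auto simp: fdiag_def less_Suc_eq)
  then have "nn l R (Suc k) c = nn l R k c + card (Pair k ` ?D)"
   unfolding nn_def using fin by (subst card_Un_disjoint[symmetric]) auto
  then have "nn l R (Suc k) c - nn l R k c = card ?D" by (simp add: card_image inj_on_def)
  then show ?thesis using D j by auto
 qed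
 show ?thesis
 proof
  fix p show "S p = U p"
  proof (cases "p : fdiag l")
   case False
   then show ?thesis using PiE_arb[OF SST_D(1)[OF S]] PiE_arb[OF SST_D(1)[OF U]] by simp
  next
   case True
   obtain k j where p: "p = (k, j)" by (cases p)
   then have j: "j < l k" using True by (simp add: fdiag_def)
   then have k: "Suc k <= psize l" using Par_small(2)[OF l, of k] by (metis not_less0 not_less_eq_eq)
   have "S p <= c \<longleftrightarrow> U p <= c" if "c < n" for c
    using row[OF S j, of c] row[OF U j, of c] eq[OF k that] eq[of k c] k that by (simp add: p)
   moreover have "S p < n" "U p < n" using SST_D(1)[OF S] SST_D(1)[OF U] True by auto
   ultimately show ?thesis by (metis order.antisym order_refl)
  qed
 qed
qed

text \<open>A linear extension of the dominance order on tableaux of shape \<open>l\<close>. Rows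
  from \<open>psize l\<close> on are empty, so this range of \<open>m\<close> suffices to separate
  tableaux.\<close>

definition wt :: "(nat => nat) => nat => (nat \<times> nat => nat) => nat" where
 "wt l n S = (\<Sum>m\<le>psize l. \<Sum>c<n. nn l S m c)"

text \<open>A nonzero coefficient requires a column permutation of \<open>U\<close> with the row
  content of \<open>S\<close>, which by \<open>nn_perm\<close> puts \<open>S\<close> below
  \<open>U\<close> in dominance.\<close>

lemma polar_triangular:
 assumes l: "l : Par" and U: "U : SST l n kap" and S: "S : SST l n kap'" and nz: "polar l U (rt l S) ~= 0"
 shows "S = U \<or> wt l n S < wt l n U" "wt l n S <= wt l n U"
proof -
 obtain q where q: "q : col_perms l" "rt l (U o q) = rt l S"
 proof (rule ccontr)
  assume "~ thesis"
  then have "polar l U (rt l S) = 0" unfolding polar_def using that by (intro sum.neutral) auto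
  then show False using nz by simp
 qed
 note le = nn_perm(1)[OF l U q]
 show w: "wt l n S <= wt l n U" unfolding wt_def by (intro sum_mono le)
 have "S = U" if "wt l n S = wt l n U"
 proof (rule SST_eqI[OF l S U])
  fix m c assume mc: "m <= psize l" "c < n"
  have "(\<Sum>c<n. nn l S m c) = (\<Sum>c<n. nn l U m c)"
   by (rule sum_mono_inv[OF that[unfolded wt_def]]) (use mc in \<open>auto intro!: sum_mono le\<close>)
  then show "nn l S m c = nn l U m c" by (rule sum_mono_inv) (use mc in \<open>auto intro!: le\<close>)
 qed
 then show "S = U \<or> wt l n S < wt l n U" using w by linarith
qed

lemma polar_diag:
 assumes l: "l : Par" and U: "U : SST l n kap" shows "polar l U (rt l U) = 1"
proof -
 have "polar l U (rt l U) = (\<Sum>q\<in>col_perms l. if q = id then 1 else 0)" unfolding polar_def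
 proof (rule sum_eq)
  fix q assume q: "q : col_perms l"
  have "q = id" if "rt l (U o q) = rt l U" by (rule nn_perm(2)[OF l U q that]) simp
  then show "sign q * of_bool (rt l (U o q) = rt l U) = (if q = id then 1 else 0)" by (auto simp: sign_id)
 qed
 then show ?thesis using finite_col_perms[OF l] id_col_perms by (simp add: sum.delta)
qed

lemma wt_bound:
 assumes "l : Par" shows "wt l n S <= Suc (psize l) * (n * psize l)"
proof -
 have "nn l S m c <= psize l" for m c
  unfolding nn_def card_fdiag[OF assms, symmetric] by (rule card_mono[OF finite_fdiag[OF assms]]) auto
 then have "(\<Sum>c<n. nn l S m c) <= n * psize l" for m using sum_bounded_above[of "{..<n}" "nn l S m" "psize l"] by simp
 then show ?thesis
  unfolding wt_def using sum_bounded_above[of "{..psize l}" "%m. \<Sum>c<n. nn l S m c" "n * psize l"] by simp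
qed

lemma dom_trans: "dom a b ==> dom b c ==> dom a c" unfolding dom_def using order_trans by blast
lemma dom_antisym: assumes "dom a b" "dom b a" shows "a = b"
proof
 fix k
 have "psum a m = psum b m" for m using assms by (auto simp: dom_def intro: antisym)
 from this[of k] this[of "Suc k"] show "a k = b k" by (simp add: psum_def)
qed

lemma dom_strict:
 assumes l: "l : Par" "l' : Par" "psize l = s" "psize l' = s" and d: "dom l' l" "l' ~= l"
 shows "(\<Sum>m\<le>s. psum l m) < (\<Sum>m\<le>s. psum l' m)"
proof -
 have le: "psum l m <= psum l' m" for m using d by (simp add: dom_def)
 have "(\<Sum>m\<le>s. psum l m) ~= (\<Sum>m\<le>s. psum l' m)"
 proof
  assume e: "(\<Sum>m\<le>s. psum l m) = (\<Sum>m\<le>s. psum l' m)"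
  have eq: "psum l m = psum l' m" if "m <= s" for m by (rule sum_mono_inv[OF e]) (use le that in auto)
  have "l k = l' k" for k
  proof (cases "k < s")
   case True
   then show ?thesis using eq[of k] eq[of "Suc k"] by (simp add: psum_def)
  next
   case False
   then show ?thesis using Par_small(2)[OF l(1), of k] Par_small(2)[OF l(2), of k] l by simp
  qed
  then show False using d(2) by auto
 qed
 then show ?thesis using sum_mono[of "{..s}" "psum l" "psum l'"] le by (simp add: less_le)
qed

section \<open>Bitableau functions on matrices with given margins\<close>

type_synonym bitableau = "(nat => nat) \<times> (nat \<times> nat => nat) \<times> (nat \<times> nat => nat)"

definition bitableaux :: "nat => nat => (nat => nat) => (nat => nat) => bitableau set" where
 "bitableaux n n' kap kap' = {(l, S, T). l : Par & S : SST l n kap & T : SST l n' kap'}"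

definition bival :: "bitableau => (nat => nat => nat) => nat" where
 "bival = (%(l, S, T). cntm (rt l S) (rt l T))"

lemma bitableaux_Sigma:
 "bitableaux n n' kap kap' = (SIGMA l:{l : Par. psize l = (\<Sum>c'<n'. kap' c')}. SST l n kap \<times> SST l n' kap')"
 unfolding bitableaux_def using SST_size by auto

lemma finite_Par_eq: "finite {l : Par. psize l = s}" by (rule finite_subset[OF _ finite_Par[of s]]) auto

lemma finite_bitableaux: "finite (bitableaux n n' kap kap')"
 unfolding bitableaux_Sigma by (intro finite_SigmaI finite_cartesian_product finite_Par_eq) (auto simp: finite_SST)

lemma card_bitableaux: "card (bitableaux n n' kap kap') = card (margin_matrices n n' kap kap')"
proof -
 have "card (bitableaux n n' kap kap') =
   (\<Sum>l\<in>{l : Par. psize l = (\<Sum>c'<n'. kap' c')}. card (SST l n kap \<times> SST l n' kap'))"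
  unfolding bitableaux_Sigma by (rule card_SigmaI) (auto simp: finite_SST finite_Par_eq)
 then show ?thesis using RSK_count[where n = n and n' = n' and kap = kap and kap' = kap']
  by (simp add: card_cartesian_product)
qed

text \<open>A column permutation does not change the content of \<open>U\<close>, so
  \<open>altsum\<close> evaluates functions only at matrices with the prescribed margins.\<close>

lemma cmat_margins:
 assumes l: "l : Par" and U: "U : SST l n kap" and V: "V : SST l n' kap'" and q: "q permutes fdiag l"
 shows "cmat (fdiag l) (U o q) V : margin_matrices n n' kap kap'"
proof -
 have fin: "finite (fdiag l)" by (rule finite_fdiag[OF l])
 have Uq: "U (q p) < n" "V p < n'" if "p : fdiag l" for p
  using that PiE_mem[OF SST_D(1)[OF U]] PiE_mem[OF SST_D(1)[OF V]] permutes_in_image[OF q] by (metis lessThan_iff)+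
 have "cmat (fdiag l) (U o q) V c c' = 0" if "~ (c < n & c' < n')" for c c'
  unfolding cmat_def using Uq that fin by (intro card_eq_0_iff[THEN iffD2] disjI1) auto
 moreover have "(\<Sum>c'<n'. cmat (fdiag l) (U o q) V c c') = kap c" if "c < n" for c
 proof -
  have "(\<Sum>c'<n'. cmat (fdiag l) (U o q) V c c') = card {p\<in>fdiag l. (U o q) p = c}"
   using card_fibers[of "{p\<in>fdiag l. (U o q) p = c}" "{..<n'}" V] fin Uq
   unfolding cmat_def by (simp add: image_subset_iff conj_assoc)
  also have "... = card {p\<in>fdiag l. U p = c}"
  proof (rule bij_betw_same_card[of q])
   show "bij_betw q {p\<in>fdiag l. (U o q) p = c} {p\<in>fdiag l. U p = c}"
    by (rule bij_betw_byWitness[where f' = "pinv q"])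
     (use permutes_inverses[OF q] permutes_in_image[OF q] permutes_in_image[OF permutes_inv[OF q]] in auto)
  qed
  finally show ?thesis using SST_D(2)[OF U that] by simp
 qed
 moreover have "(\<Sum>c<n. cmat (fdiag l) (U o q) V c c') = kap' c'" if "c' < n'" for c'
 proof -
  have "(\<Sum>c<n. cmat (fdiag l) (U o q) V c c') = card {p\<in>fdiag l. V p = c'}"
   using card_fibers[of "{p\<in>fdiag l. V p = c'}" "{..<n}" "U o q"] fin Uq
   unfolding cmat_def by (simp add: image_subset_iff conj_ac)
  then show ?thesis using SST_D(2)[OF V that] by simp
 qed
 ultimately show ?thesis unfolding margin_matrices_def by blast
qed

lemma altsum_cong:
 assumes "l : Par" "U : SST l n kap" "V : SST l n' kap'"
  and "!!N. N : margin_matrices n n' kap kap' ==> g N = g' N"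
 shows "altsum l U V g = altsum l U V g'" unfolding altsum_def
proof (rule sum_eq)
 fix q assume "q : col_perms l"
 from col_perms_permutes[OF this] show "of_int (sign q) * g (cmat (fdiag l) (U o q) V) =
   of_int (sign q) * g' (cmat (fdiag l) (U o q) V)" using assms(4)[OF cmat_margins[OF assms(1-3)]] by simp
qed

lemma altsum_sum: "altsum l U V (%N. \<Sum>i\<in>I. z i * F i N) = (\<Sum>i\<in>I. z i * altsum l U V (F i))"
 unfolding altsum_def sum_distrib_left by (subst sum.swap) (simp add: ac_simps)

lemma altsum_of_nat:
 "altsum l U V (%N. of_nat (F N)) = (of_int (altsum l U V (%N. of_nat (F N))) :: 'a::comm_ring_1)"
 unfolding altsum_def by simp

definition gram :: "bitableau => bitableau => int" where
 "gram i = (%(l, U, V). altsum l U V (%N. of_nat (bival i N)))"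

lemma gram_dom:
 assumes "l : Par" "l' : Par"
 shows "gram (l, S, T) (l', U, V) ~= 0 ==> dom l' l"
  and "gram (l, S, T) (l, U, V) = polar l U (rt l S) * polar l V (rt l T)"
 using altsum_cntm(1)[OF assms] altsum_cntm(2)[OF assms(1,1) refl] by (auto simp: gram_def bival_def)

text \<open>A lexicographic order packed into one number: first the shape, by its partial sums, then
  the two tableaux. By \<open>wt_bound\<close> the leading factor exceeds every possible value of
  the last two summands together.\<close>

definition bweight :: "nat => nat => nat => bitableau => nat" where
 "bweight n n' s = (%(l, S, T). Suc (Suc s * (n * s) + Suc s * (n' * s)) * (\<Sum>m\<le>s. psum l m) + wt l n S + wt l n' T)"

lemma gram_triangular:
 assumes i: "i : bitableaux n n' kap kap'" and j: "j : bitableaux n n' kap kap'"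
 shows "gram i i = 1"
  and "gram i j ~= 0 ==> i = j \<or> bweight n n' (\<Sum>c'<n'. kap' c') i < bweight n n' (\<Sum>c'<n'. kap' c') j"
proof -
 define s where "s = (\<Sum>c'<n'. kap' c')"
 obtain l S T where i': "i = (l, S, T)" "l : Par" "S : SST l n kap" "T : SST l n' kap'" "psize l = s"
  using i unfolding bitableaux_Sigma s_def by auto
 obtain l' U V where j': "j = (l', U, V)" "l' : Par" "U : SST l' n kap" "V : SST l' n' kap'" "psize l' = s"
  using j unfolding bitableaux_Sigma s_def by auto
 show "gram i i = 1" using i' by (simp add: gram_dom polar_diag)
 assume nz: "gram i j ~= 0"
 have d: "dom l' l" using nz gram_dom(1)[OF i'(2) j'(2)] i'(1) j'(1) by simp
 show "i = j \<or> bweight n n' (\<Sum>c'<n'. kap' c') i < bweight n n' (\<Sum>c'<n'. kap' c') j"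
 proof (cases "l' = l")
  case True
  then have "polar l U (rt l S) ~= 0" "polar l V (rt l T) ~= 0" using nz gram_dom(2)[OF i'(2) i'(2)] i'(1) j'(1) by auto
  then show ?thesis
   using polar_triangular[OF i'(2), of U n kap S kap] polar_triangular[OF i'(2), of V n' kap' T kap'] i' j' True
   unfolding bweight_def by auto
 next
  case False
  let ?b = "Suc s * (n * s) + Suc s * (n' * s)"
  have "Suc (\<Sum>m\<le>s. psum l m) <= (\<Sum>m\<le>s. psum l' m)"
   using dom_strict[OF i'(2) j'(2) i'(5) j'(5) d False] by simp
  then have "Suc ?b * Suc (\<Sum>m\<le>s. psum l m) <= Suc ?b * (\<Sum>m\<le>s. psum l' m)" by (rule mult_le_mono2)
  moreover have "wt l n S + wt l n' T <= ?b" using wt_bound[OF i'(2), of n S] wt_bound[OF i'(2), of n' T] i'(5) by simp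
  moreover have "Suc ?b * Suc (\<Sum>m\<le>s. psum l m) = Suc ?b * (\<Sum>m\<le>s. psum l m) + Suc ?b" by simp
  ultimately have "Suc ?b * (\<Sum>m\<le>s. psum l m) + (wt l n S + wt l n' T) < Suc ?b * (\<Sum>m\<le>s. psum l' m) + (wt l' n U + wt l' n' V)"
   by linarith
  then show ?thesis unfolding bweight_def i'(1) j'(1) s_def[symmetric] prod.case add.assoc by blast
 qed
qed

text \<open>The Gram matrix is the matrix of values of the functions times the signed incidence
  matrix \<open>B\<close> of the alternating sums. Multiplying the values by an integral left
  inverse \<open>H\<close> of the Gram matrix gives \<open>A\<close> with A B = 1. Both index sets
  have the same size by \<open>card_bitableaux\<close>, hence also B A = 1, and this identity
  expands every \<open>g\<close> integrally.\<close>

theorem bival_span: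
 fixes g :: "(nat => nat => nat) => int"
 shows "\<exists>z. \<forall>N\<in>margin_matrices n n' kap kap'. g N = (\<Sum>i\<in>bitableaux n n' kap kap'. z i * int (bival i N))"
proof -
 let ?I = "bitableaux n n' kap kap'" and ?J = "margin_matrices n n' kap kap'"
 have finI: "finite ?I" and finJ: "finite ?J" by (rule finite_bitableaux finite_margin_matrices)+
 have "\<exists>H. \<forall>i\<in>?I. \<forall>k\<in>?I. (\<Sum>j\<in>?I. H i j * gram j k) = (if i = k then 1 else 0)"
  by (rule unitriangular_inverse[OF finI, where W = "bweight n n' (\<Sum>c'<n'. kap' c')"])
   (use gram_triangular in blast)+
 then obtain H where H: "!!i k. i : ?I ==> k : ?I ==> (\<Sum>j\<in>?I. H i j * gram j k) = (if i = k then 1 else 0)"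
  by blast
 define A where "A i N = (\<Sum>j\<in>?I. H i j * int (bival j N))" for i N
 define B where "B N = (%(l, U, V). \<Sum>q\<in>col_perms l. sign q * of_bool (cmat (fdiag l) (U o q) V = N))" for N
 have BG: "(\<Sum>N\<in>?J. int (bival j N) * B N k) = gram j k" if k_in: "k : ?I" for j k
 proof -
  obtain l U V where k: "k = (l, U, V)" "l : Par" "U : SST l n kap" "V : SST l n' kap'"
   using k_in by (auto simp: bitableaux_def)
  have "(\<Sum>N\<in>?J. int (bival j N) * B N k) =
    (\<Sum>q\<in>col_perms l. \<Sum>N\<in>?J. int (bival j N) * (sign q * of_bool (cmat (fdiag l) (U o q) V = N)))"
   unfolding B_def k prod.case sum_distrib_left by (rule sum.swap)
  also have "... = (\<Sum>q\<in>col_perms l. sign q * int (bival j (cmat (fdiag l) (U o q) V)))"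
  proof (rule sum_eq)
   fix q assume "q : col_perms l"
   from cmat_margins[OF k(2-4) col_perms_permutes[OF this]]
   have m: "cmat (fdiag l) (U o q) V : ?J" .
   have "(\<Sum>N\<in>?J. int (bival j N) * (sign q * of_bool (cmat (fdiag l) (U o q) V = N))) =
     (\<Sum>N\<in>?J. if cmat (fdiag l) (U o q) V = N then int (bival j N) * sign q else 0)" by (intro sum.cong) auto
   also have "... = int (bival j (cmat (fdiag l) (U o q) V)) * sign q" using finJ m by (simp add: sum.delta')
   finally show "(\<Sum>N\<in>?J. int (bival j N) * (sign q * of_bool (cmat (fdiag l) (U o q) V = N))) =
     sign q * int (bival j (cmat (fdiag l) (U o q) V))" by simp
  qed
  finally show ?thesis by (simp add: gram_def k altsum_def)
 qed
 have AB: "(\<Sum>N\<in>?J. A i N * B N k) = (if i = k then 1 else 0)" if "i : ?I" "k : ?I" for i k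
 proof -
  have "(\<Sum>N\<in>?J. A i N * B N k) = (\<Sum>j\<in>?I. H i j * (\<Sum>N\<in>?J. int (bival j N) * B N k))"
   unfolding A_def sum_distrib_left sum_distrib_right by (subst sum.swap) (simp add: mult.assoc)
  then show ?thesis using BG[OF that(2)] H[OF that] by simp
 qed
 have BA: "(\<Sum>i\<in>?I. B N i * A i N') = (if N = N' then 1 else 0)" if "N : ?J" "N' : ?J" for N N'
  by (rule square_inverse[OF finI finJ card_bitableaux AB that])
 define z where "z j = (\<Sum>N\<in>?J. \<Sum>i\<in>?I. g N * (B N i * H i j))" for j
 have "g N' = (\<Sum>j\<in>?I. z j * int (bival j N'))" if "N' : ?J" for N'
 proof -
  have "(\<Sum>j\<in>?I. z j * int (bival j N')) = (\<Sum>N\<in>?J. g N * (\<Sum>i\<in>?I. B N i * A i N'))"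
  proof -
   have "(\<Sum>j\<in>?I. z j * int (bival j N')) =
     (\<Sum>j\<in>?I. \<Sum>N\<in>?J. \<Sum>i\<in>?I. g N * (B N i * (H i j * int (bival j N'))))"
    unfolding z_def sum_distrib_right by (simp add: mult.assoc)
   also have "... = (\<Sum>N\<in>?J. \<Sum>i\<in>?I. \<Sum>j\<in>?I. g N * (B N i * (H i j * int (bival j N'))))"
    by (subst sum.swap, rule sum_eq, rule sum.swap)
   finally show ?thesis unfolding A_def sum_distrib_left .
  qed
  also have "... = (\<Sum>N\<in>?J. if N = N' then g N else 0)" using BA that by (intro sum.cong) auto
  also have "... = g N'" using finJ that by (simp add: sum.delta)
  finally show ?thesis by simp
 qed
 then show ?thesis by blast
qed

lemma altsum_bival: "altsum l U V (%N. of_nat (bival i N)) = (of_int (gram i (l, U, V)) :: 'a::comm_ring_1)"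
 unfolding gram_def prod.case by (rule altsum_of_nat)

lemma altsum_combination:
 fixes z :: "bitableau => rat"
 assumes k: "(l, U, V) : bitableaux n n' kap kap'"
  and g: "!!N. N : margin_matrices n n' kap kap' ==>
   (\<Sum>i\<in>bitableaux n n' kap kap'. z i * of_nat (bival i N)) = g N"
 shows "(\<Sum>i\<in>bitableaux n n' kap kap'. z i * of_int (gram i (l, U, V))) = altsum l U V g"
proof -
 have "altsum l U V g = altsum l U V (%N. \<Sum>i\<in>bitableaux n n' kap kap'. z i * of_nat (bival i N))"
  by (rule altsum_cong) (use k g in \<open>auto simp: bitableaux_def\<close>)
 also have "... = (\<Sum>i\<in>bitableaux n n' kap kap'. z i * of_int (gram i (l, U, V)))"
  unfolding altsum_sum altsum_bival ..
 finally show ?thesis by simp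
qed

lemma gram_kernel:
 fixes z :: "bitableau => rat"
 assumes zero: "!!l U V. (l, U, V) : bitableaux n n' kap kap' ==> ~ Up l ==>
   (\<Sum>i\<in>bitableaux n n' kap kap'. z i * of_int (gram i (l, U, V))) = 0"
  and up: "!!l l'. Up l ==> dom l' l ==> Up l'"
  and k: "(l, U, V) : bitableaux n n' kap kap'" "~ Up l"
 shows "z (l, U, V) = 0"
proof (rule unitriangular_kernel[where I = "bitableaux n n' kap kap'" and G = "%i j. of_int (gram i j)"
   and W = "bweight n n' (\<Sum>c'<n'. kap' c')" and Up = "%(l, U, V). Up l"])
 fix i j :: bitableau
 assume i: "i : bitableaux n n' kap kap'"
 show "rat_of_int (gram i i) = 1" using gram_triangular(1)[OF i i] by simp
 assume j: "j : bitableaux n n' kap kap'" and nz: "rat_of_int (gram i j) ~= 0"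
 show "i = j \<or> bweight n n' (\<Sum>c'<n'. kap' c') i < bweight n n' (\<Sum>c'<n'. kap' c') j"
  using gram_triangular(2)[OF i j] nz by simp
 assume "case i of (l, U, V) => Up l"
 then show "case j of (l, U, V) => Up l" using i j nz up gram_dom(1) by (auto simp: bitableaux_def)
next
 fix j :: bitableau
 assume "j : bitableaux n n' kap kap'" "~ (case j of (l, U, V) => Up l)"
 then show "(\<Sum>i\<in>bitableaux n n' kap kap'. z i * rat_of_int (gram i j)) = 0" using zero by (cases j) auto
qed (use k finite_bitableaux in auto)

text \<open>The alternating sums turn a linear relation into a kernel vector of the unitriangular
  Gram matrix.\<close>

theorem bival_independent:
 fixes z :: "bitableau => rat"
 assumes "!!N. N : margin_matrices n n' kap kap' ==>
   (\<Sum>i\<in>bitableaux n n' kap kap'. z i * of_nat (bival i N)) = 0"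
  and "i : bitableaux n n' kap kap'"
 shows "z i = 0"
proof -
 obtain l U V where i: "i = (l, U, V)" by (cases i)
 show ?thesis unfolding i
 proof (rule gram_kernel[where Up = "%_. False"])
  fix l U V assume "(l, U, V) : bitableaux n n' kap kap'"
  from altsum_combination[OF this assms(1)]
  show "(\<Sum>i\<in>bitableaux n n' kap kap'. z i * rat_of_int (gram i (l, U, V))) = 0" by (simp add: altsum_def)
 qed (use assms i in auto)
qed

lemma polar_kernel:
 fixes y :: "(nat \<times> nat => nat) => rat"
 assumes l: "l : Par"
  and zero: "!!U. U : SST l n kap ==> (\<Sum>S\<in>SST l n kap. y S * of_int (polar l U (rt l S))) = 0"
  and U: "U : SST l n kap"
 shows "y U = 0"
proof (rule unitriangular_kernel[where I = "SST l n kap" and G = "%S U. of_int (polar l U (rt l S))"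
   and W = "wt l n" and Up = "%_. False"])
 fix i j assume i: "i : SST l n kap"
 show "rat_of_int (polar l i (rt l i)) = 1" using polar_diag[OF l i] by simp
 assume j: "j : SST l n kap" and "rat_of_int (polar l j (rt l i)) ~= 0"
 then show "i = j \<or> wt l n i < wt l n j" using polar_triangular(1)[OF l j i] by simp
qed (use zero U finite_SST[OF l] in auto)

text \<open>The combination \<open>g\<close> below is the shape of a product of an algebra element with a basis
 element: the coefficients \<open>c A\<close> do not see the right tableau \<open>T\<close>.\<close>

theorem bival_expansion:
 fixes z :: "bitableau => rat" and c :: "'k => rat"
 assumes l: "l : Par" and T: "T : SST l n' kap'"
  and g: "!!N. N : margin_matrices n n' kap kap' ==>
   (\<Sum>i\<in>bitableaux n n' kap kap'. z i * of_nat (bival i N)) = (\<Sum>k\<in>K. c k * of_nat (cntm (A k) (rt l T) N))"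
 shows "(l', U, V) : bitableaux n n' kap kap' ==> ~ dom l' l ==> z (l', U, V) = 0"
  and "U : SST l n kap ==> V : SST l n' kap' ==> V ~= T ==> z (l, U, V) = 0"
  and "U : SST l n kap ==> (\<Sum>S\<in>SST l n kap. z (l, S, T) * of_int (polar l U (rt l S))) =
   (\<Sum>k\<in>K. c k * of_int (polar l U (A k)))"
proof -
 let ?I = "bitableaux n n' kap kap'"
 define ct where "ct U = (\<Sum>k\<in>K. c k * of_int (polar l U (A k)))" for U
 have alt: "(\<Sum>i\<in>?I. z i * of_int (gram i (l', U, V))) =
   (\<Sum>k\<in>K. c k * of_int (altsum l' U V (%N. of_nat (cntm (A k) (rt l T) N))))"
  if "(l', U, V) : ?I" for l' U V
 proof -
  have "(\<Sum>i\<in>?I. z i * of_int (gram i (l', U, V))) =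
    altsum l' U V (%N. \<Sum>k\<in>K. c k * of_nat (cntm (A k) (rt l T) N))" by (rule altsum_combination[OF that g])
  also have "... = (\<Sum>k\<in>K. c k * altsum l' U V (%N. of_nat (cntm (A k) (rt l T) N)))" by (rule altsum_sum)
  also have "... = (\<Sum>k\<in>K. c k * of_int (altsum l' U V (%N. of_nat (cntm (A k) (rt l T) N))))"
   by (rule sum_eq) (subst altsum_of_nat, rule refl)
  finally show ?thesis .
 qed
 \<comment> \<open>The pairings of \<open>g\<close> with shapes that do not dominate
   \<open>l\<close> vanish by \<open>altsum_cntm\<close>. Shapes dominating \<open>l\<close> are
   closed under dominance, so triangularity transfers the vanishing to the coefficients.\<close>
 have z0: "z (l', U, V) = 0" if k: "(l', U, V) : ?I" "~ dom l' l" for l' U V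
 proof (rule gram_kernel[where Up = "%l'. dom l' l", OF _ _ k])
  fix l' U V assume i: "(l', U, V) : ?I" and d: "~ dom l' l"
  have "l' : Par" using i by (simp add: bitableaux_def)
  then show "(\<Sum>i\<in>?I. z i * rat_of_int (gram i (l', U, V))) = 0"
   unfolding alt[OF i] using altsum_cntm(1)[OF l _ d] by simp
 qed (use dom_trans in blast)
 then show "(l', U, V) : ?I ==> ~ dom l' l ==> z (l', U, V) = 0" .
 \<comment> \<open>Only the shape \<open>l\<close> contributes to these equations: a shape with
   nonzero coefficient dominates \<open>l\<close>, and a nonzero Gram entry needs \<open>l\<close>
   to dominate that shape.\<close>
 have main: "(\<Sum>S\<in>SST l n kap. \<Sum>T'\<in>SST l n' kap'. z (l, S, T') * (of_int (polar l U (rt l S)) * of_int (polar l V (rt l T'))))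
   = ct U * of_int (polar l V (rt l T))"
  if U: "U : SST l n kap" and V: "V : SST l n' kap'" for U V
 proof -
  have i: "(l, U, V) : ?I" using l U V by (simp add: bitableaux_def)
  let ?P = "(%(S, T'). (l, S, T')) ` (SST l n kap \<times> SST l n' kap')"
  have "(\<Sum>i\<in>?I. z i * of_int (gram i (l, U, V))) = (\<Sum>i\<in>?P. z i * of_int (gram i (l, U, V)))"
  proof (rule sum.mono_neutral_right[OF finite_bitableaux])
   show "?P <= ?I" using l by (auto simp: bitableaux_def)
   show "\<forall>i\<in>?I - ?P. z i * rat_of_int (gram i (l, U, V)) = 0"
   proof
    fix i assume i: "i : ?I - ?P"
    obtain l1 S1 T1 where i1: "i = (l1, S1, T1)" by (cases i)
    have l1: "l1 : Par" "l1 ~= l" using i i1 by (auto simp: bitableaux_def)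
    have "z i = 0 \<or> gram i (l, U, V) = 0"
    proof (rule ccontr)
     assume n: "~ ?thesis"
     then have "dom l1 l" using z0[of l1 S1 T1] i i1 by auto
     moreover have "dom l l1" using n gram_dom(1)[OF l1(1) l] i1 by auto
     ultimately show False using l1(2) dom_antisym by blast
    qed
    then show "z i * rat_of_int (gram i (l, U, V)) = 0" by auto
   qed
  qed
  also have "... = (\<Sum>p\<in>SST l n kap \<times> SST l n' kap'. z (l, p) * of_int (gram (l, p) (l, U, V)))"
   by (rule sum.reindex_cong) (auto simp: inj_on_def)
  also have "... = (\<Sum>S\<in>SST l n kap. \<Sum>T'\<in>SST l n' kap'. z (l, S, T') * of_int (gram (l, S, T') (l, U, V)))"
   by (simp add: sum.cartesian_product split_def)
  also have "... = (\<Sum>S\<in>SST l n kap. \<Sum>T'\<in>SST l n' kap'. z (l, S, T') * (of_int (polar l U (rt l S)) * of_int (polar l V (rt l T'))))"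
   unfolding gram_dom(2)[OF l l] by simp
  finally show ?thesis unfolding alt[OF i] altsum_cntm(2)[OF l l refl] ct_def by (simp add: sum_distrib_right mult.assoc)
 qed
 define y where "y U V = (\<Sum>S\<in>SST l n kap. z (l, S, V) * of_int (polar l U (rt l S)))" for U V
 \<comment> \<open>For fixed \<open>U\<close>, both \<open>y U\<close> and the function equal to
   \<open>ct U\<close> at \<open>T\<close> and zero elsewhere solve \<open>main\<close>; by
   \<open>polar_kernel\<close> the solution is unique.\<close>
 have y: "y U V = (if V = T then ct U else 0)" if U: "U : SST l n kap" and V: "V : SST l n' kap'" for U V
 proof -
  have "y U V - (if V = T then ct U else 0) = 0"
  proof (rule polar_kernel[OF l, where n = n' and kap = kap' and y = "%V. y U V - (if V = T then ct U else 0)", OF _ V])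
   fix V assume V: "V : SST l n' kap'"
   have "(\<Sum>T'\<in>SST l n' kap'. (y U T' - (if T' = T then ct U else 0)) * of_int (polar l V (rt l T'))) =
    (\<Sum>T'\<in>SST l n' kap'. y U T' * of_int (polar l V (rt l T'))) -
    (\<Sum>T'\<in>SST l n' kap'. if T' = T then ct U * of_int (polar l V (rt l T')) else 0)"
    unfolding sum_subtractf[symmetric] by (intro sum.cong) (auto simp: left_diff_distrib)
   also have "(\<Sum>T'\<in>SST l n' kap'. if T' = T then ct U * of_int (polar l V (rt l T')) else 0) =
     ct U * rat_of_int (polar l V (rt l T))" using finite_SST[OF l] T by (simp add: sum.delta)
   also have "(\<Sum>T'\<in>SST l n' kap'. y U T' * of_int (polar l V (rt l T'))) =
     (\<Sum>S\<in>SST l n kap. \<Sum>T'\<in>SST l n' kap'. z (l, S, T') * (of_int (polar l U (rt l S)) * of_int (polar l V (rt l T'))))"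
    unfolding y_def sum_distrib_right by (subst sum.swap) (simp add: mult.assoc)
   finally show "(\<Sum>T'\<in>SST l n' kap'. (y U T' - (if T' = T then ct U else 0)) * rat_of_int (polar l V (rt l T'))) = 0"
    using main[OF U V] by simp
  qed
  then show ?thesis by simp
 qed
 show "z (l, U, V) = 0" if "U : SST l n kap" "V : SST l n' kap'" "V ~= T"
  by (rule polar_kernel[OF l, where n = n and kap = kap and y = "%U. z (l, U, V)", OF _ that(1)])
   (use y that in \<open>simp add: y_def\<close>)
 show "(\<Sum>S\<in>SST l n kap. z (l, S, T) * of_int (polar l U (rt l S))) = (\<Sum>k\<in>K. c k * of_int (polar l U (A k)))"
  if "U : SST l n kap" using y[OF that T] by (simp add: y_def ct_def)
qed

text \<open>Both families of coefficients solve the same triangular system with matrix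
  \<open>polar\<close>, and its right-hand side mentions neither \<open>T1\<close> nor
  \<open>T2\<close>. The contents of \<open>T1\<close> and \<open>T2\<close> may differ, since one
  coefficient has to serve the right indices from all orbits and all compositions.\<close>

lemma bival_expansion_coeff_unique:
 fixes z1 z2 :: "bitableau => rat" and c :: "'k => rat"
 assumes l: "l : Par" and T1: "T1 : SST l n1 kap1" and T2: "T2 : SST l n2 kap2"
  and g1: "!!N. N : margin_matrices n n1 kap kap1 ==>
   (\<Sum>i\<in>bitableaux n n1 kap kap1. z1 i * of_nat (bival i N)) = (\<Sum>k\<in>K. c k * of_nat (cntm (A k) (rt l T1) N))"
  and g2: "!!N. N : margin_matrices n n2 kap kap2 ==>
   (\<Sum>i\<in>bitableaux n n2 kap kap2. z2 i * of_nat (bival i N)) = (\<Sum>k\<in>K. c k * of_nat (cntm (A k) (rt l T2) N))"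
  and U: "U : SST l n kap"
 shows "z1 (l, U, T1) = z2 (l, U, T2)"
proof -
 have "z1 (l, U, T1) - z2 (l, U, T2) = 0"
 proof (rule polar_kernel[OF l, where n = n and kap = kap and y = "%U. z1 (l, U, T1) - z2 (l, U, T2)", OF _ U])
  fix U assume "U : SST l n kap"
  from bival_expansion(3)[OF l T1 g1 this] bival_expansion(3)[OF l T2 g2 this]
  show "(\<Sum>S\<in>SST l n kap. (z1 (l, S, T1) - z2 (l, S, T2)) * rat_of_int (polar l U (rt l S))) = 0"
   by (simp add: left_diff_distrib sum_subtractf)
 qed
 then show ?thesis by simp
qed

definition swap_bitableau :: "bitableau => bitableau" where
 "swap_bitableau = (%(l, S, T). (l, T, S))"

text \<open>Transposing the matrices exchanges the two tableaux of a bitableau and converts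
  statements for left multiplication into those for right multiplication.\<close>

lemma swap_expansion:
 fixes z :: "bitableau => rat"
 assumes g: "!!N. N : margin_matrices n n' kap kap' ==>
   (\<Sum>i\<in>bitableaux n n' kap kap'. z i * of_nat (bival i N)) = (\<Sum>k\<in>K. c k * of_nat (cntm (rt l S) (A k) N))"
  and N: "N : margin_matrices n' n kap' kap"
 shows "(\<Sum>i\<in>bitableaux n' n kap' kap. z (swap_bitableau i) * of_nat (bival i N)) =
   (\<Sum>k\<in>K. c k * of_nat (cntm (A k) (rt l S) N))"
proof -
 have Nt: "(%c c'. N c' c) : margin_matrices n n' kap kap'" using N by (auto simp: margin_matrices_def)
 have "(\<Sum>i\<in>bitableaux n' n kap' kap. z (swap_bitableau i) * of_nat (bival i N)) =
   (\<Sum>i\<in>bitableaux n n' kap kap'. z i * of_nat (bival i (%c c'. N c' c)))"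
  by (rule sum.reindex_bij_witness[where i = swap_bitableau and j = swap_bitableau])
   (auto simp: bitableaux_def swap_bitableau_def bival_def cntm_transpose[of _ _ N])
 also have "... = (\<Sum>k\<in>K. c k * of_nat (cntm (A k) (rt l S) N))"
  unfolding g[OF Nt] by (simp add: cntm_transpose[of _ _ N])
 finally show ?thesis .
qed

theorem bival_expansion_right:
 fixes z :: "bitableau => rat" and c :: "'k => rat"
 assumes l: "l : Par" and S: "S : SST l n kap"
  and g: "!!N. N : margin_matrices n n' kap kap' ==>
   (\<Sum>i\<in>bitableaux n n' kap kap'. z i * of_nat (bival i N)) = (\<Sum>k\<in>K. c k * of_nat (cntm (rt l S) (A k) N))"
 shows "(l', U, V) : bitableaux n n' kap kap' ==> ~ dom l' l ==> z (l', U, V) = 0"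
  and "U : SST l n kap ==> V : SST l n' kap' ==> U ~= S ==> z (l, U, V) = 0"
proof -
 note e = bival_expansion(1,2)[OF l S swap_expansion[OF g], unfolded swap_bitableau_def, simplified]
 show "(l', U, V) : bitableaux n n' kap kap' ==> ~ dom l' l ==> z (l', U, V) = 0"
  using e(1)[of l' V U] by (auto simp: bitableaux_def)
 show "U : SST l n kap ==> V : SST l n' kap' ==> U ~= S ==> z (l, U, V) = 0" using e(2)[of V U] by auto
qed

lemma bival_expansion_coeff_unique_right:
 fixes z1 z2 :: "bitableau => rat" and c :: "'k => rat"
 assumes l: "l : Par" and S1: "S1 : SST l n1 kap1" and S2: "S2 : SST l n2 kap2"
  and g1: "!!N. N : margin_matrices n1 n' kap1 kap' ==>
   (\<Sum>i\<in>bitableaux n1 n' kap1 kap'. z1 i * of_nat (bival i N)) = (\<Sum>k\<in>K. c k * of_nat (cntm (rt l S1) (A k) N))"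
  and g2: "!!N. N : margin_matrices n2 n' kap2 kap' ==>
   (\<Sum>i\<in>bitableaux n2 n' kap2 kap'. z2 i * of_nat (bival i N)) = (\<Sum>k\<in>K. c k * of_nat (cntm (rt l S2) (A k) N))"
  and V: "V : SST l n' kap'"
 shows "z1 (l, S1, V) = z2 (l, S2, V)"
 using bival_expansion_coeff_unique[OF l S1 S2 swap_expansion[OF g1] swap_expansion[OF g2] V]
 by (simp add: swap_bitableau_def)

section \<open>Colour matrices of double cosets\<close>

definition blk :: "nat list => nat => nat" where
 "blk mu y = (THE j. j < length mu & y : block mu j)"

lemma partial_sum_mono: "j <= k ==> sum_list (take j mu) <= sum_list (take k (mu :: nat list))"
proof -
 assume "j <= k"
 then have "take k mu = take j mu @ drop j (take k mu)" by (metis append_take_drop_id min.absorb1 take_take)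
 then show ?thesis by (metis le_add1 sum_list_append)
qed

lemma block_unique: "y : block mu j ==> y : block mu k ==> j = k"
proof (induction j k rule: linorder_wlog)
 case (le j k)
 show ?case
 proof (rule ccontr)
  assume "j ~= k"
  then have "sum_list (take (Suc j) mu) <= sum_list (take k mu)" using le by (intro partial_sum_mono) auto
  then show False using le by (auto simp: block_def)
 qed
qed auto

lemma block_exists: assumes "y : {1..sum_list mu}" shows "\<exists>j<length mu. y : block mu j"
proof -
 define j where "j = (LEAST j. y <= sum_list (take (Suc j) mu))"
 have ex: "y <= sum_list (take (Suc (length mu)) mu)" using assms by simp
 then have j: "y <= sum_list (take (Suc j) mu)"     using LeastI[of "%j. y <= sum_list (take (Suc j) mu)" "length mu"] ex by (simp only: j_def)
 have "sum_list (take j mu) < y"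
 proof (cases j)
  case 0
  then show ?thesis using assms by simp
 next
  case (Suc k)
  then have "k < (LEAST j. y <= sum_list (take (Suc j) mu))" by (simp add: j_def)
  from not_less_Least[OF this] have "~ y <= sum_list (take (Suc k) mu)" .
  then show ?thesis using Suc by simp
 qed
 moreover have "j < length mu"
 proof (rule ccontr)
  assume "~ ?thesis"
  then have "sum_list (take j mu) = sum_list mu" by simp
  then show False using calculation assms by simp
 qed
 ultimately show ?thesis using j by (auto simp: block_def)
qed

lemma blk_iff:
 assumes "y : {1..sum_list mu}" shows "blk mu y < length mu" "j < length mu ==> y : block mu j \<longleftrightarrow> blk mu y = j"
proof -
 have "\<exists>!j. j < length mu & y : block mu j" using block_exists[OF assms] block_unique by blast
 from theI'[OF this] have b: "blk mu y < length mu & y : block mu (blk mu y)" unfolding blk_def .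
 then show "blk mu y < length mu" by simp
 show "j < length mu ==> y : block mu j \<longleftrightarrow> blk mu y = j" using b block_unique by blast
qed

lemma block_subset: "block mu j <= {1..sum_list mu}"
proof -
 have "sum_list (take (Suc j) mu) <= sum_list mu" by (metis append_take_drop_id le_add1 sum_list_append)
 then show ?thesis by (auto simp: block_def)
qed

text \<open>A permutation preserves the blocks as sets exactly when it preserves the block number of
  each point; from here on blocks are treated as colours.\<close>

lemma young_iff: "p : young mu \<longleftrightarrow> p permutes {1..sum_list mu} & (\<forall>y\<in>{1..sum_list mu}. blk mu (p y) = blk mu y)"
proof (intro iffI conjI ballI)
 assume p: "p : young mu"
 show pp: "p permutes {1..sum_list mu}" using p by (simp add: young_def)
 fix y assume y: "y : {1..sum_list mu}"
 have "y : block mu (blk mu y)" "blk mu y < length mu" using blk_iff[OF y] by auto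
 then have "p y : block mu (blk mu y)" using p by (auto simp: young_def)
 then show "blk mu (p y) = blk mu y" using blk_iff[of "p y" mu] blk_iff(1)[OF y] permutes_in_image[OF pp, of y] y by auto
next
 assume p: "p permutes {1..sum_list mu} & (\<forall>y\<in>{1..sum_list mu}. blk mu (p y) = blk mu y)"
 have "p ` block mu j = block mu j" if j: "j < length mu" for j
 proof (rule card_subset_eq)
  show f: "finite (block mu j)" by (simp add: block_def)
  show "p ` block mu j <= block mu j"
  proof
   fix z assume "z : p ` block mu j"
   then obtain y where y: "z = p y" "y : block mu j" by blast
   then have yr: "y : {1..sum_list mu}" using block_subset by blast
   then have "p y : {1..sum_list mu}" using p permutes_in_image by metis
   then show "z : block mu j" using blk_iff(2)[OF _ j] yr p y by metis
  qed
  show "card (p ` block mu j) = card (block mu j)"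
   using p by (intro card_image) (meson inj_on_subset permutes_inj subset_UNIV)
 qed
 then show "p : young mu" using p by (simp add: young_def)
qed

lemma young_permutes: "p : young mu ==> p permutes {1..sum_list mu}" by (simp add: young_def)

lemma young_blk: "p : young mu ==> y : {1..sum_list mu} ==> blk mu (p y) = blk mu y" by (simp add: young_iff)

lemma id_young: "id : young mu" by (simp add: young_iff permutes_id)

lemma young_comp: "p : young mu ==> q : young mu ==> p o q : young mu"
proof -
 assume p: "p : young mu" and q: "q : young mu"
 have "p o q permutes {1..sum_list mu}" by (rule permutes_compose[OF young_permutes[OF q] young_permutes[OF p]])
 moreover have "blk mu ((p o q) y) = blk mu y" if "y : {1..sum_list mu}" for y
  using young_blk[OF q that] young_blk[OF p, of "q y"] permutes_in_image[OF young_permutes[OF q], of y] that by simp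
 ultimately show "p o q : young mu" by (simp add: young_iff)
qed

lemma young_inv: assumes "p : young mu" shows "pinv p : young mu"
proof -
 have p: "p permutes {1..sum_list mu}" using assms by (rule young_permutes)
 have "blk mu (pinv p y) = blk mu y" if "y : {1..sum_list mu}" for y
  using young_blk[OF assms, of "pinv p y"] permutes_inverses(1)[OF p, of y]
   permutes_in_image[OF permutes_inv[OF p], of y] that by simp
 then show ?thesis using permutes_inv[OF p] by (simp add: young_iff)
qed

lemma finite_young: "finite (young mu)"
 by (rule finite_subset[of _ "{p. p permutes {1..sum_list mu}}"]) (auto simp: young_def finite_permutations)

text \<open>The complements of \<open>C\<close> and \<open>C'\<close> also have equally many points
  in each block, so the partial matching can be completed within the blocks.\<close>

lemma extend_young:
 assumes b: "bij_betw b C C'" and C: "C <= {1..sum_list mu}" "C' <= {1..sum_list mu}"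
  and col: "!!y. y : C ==> blk mu (b y) = blk mu y"
 shows "\<exists>rho\<in>young mu. \<forall>y\<in>C. rho y = b y"
proof -
 let ?U = "{1..sum_list mu}"
 have fin: "finite C" "finite C'" using C finite_subset by blast+
 have "card {y\<in>?U - C. blk mu y = j} = card {y\<in>?U - C'. blk mu y = j}" for j
 proof -
  have c: "card {y\<in>?U - D. blk mu y = j} = card {y\<in>?U. blk mu y = j} - card {y\<in>D. blk mu y = j}"
   if "D <= ?U" for D
  proof -
   have "{y\<in>?U - D. blk mu y = j} = {y\<in>?U. blk mu y = j} - {y\<in>D. blk mu y = j}" by auto
   then show ?thesis using that finite_subset[OF that] by (auto intro!: card_Diff_subset)
  qed
  have "bij_betw b {y\<in>C. blk mu y = j} {y\<in>C'. blk mu y = j}" using b col by (auto simp: bij_betw_def inj_on_def)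
  then have "card {y\<in>C. blk mu y = j} = card {y\<in>C'. blk mu y = j}" by (rule bij_betw_same_card)
  then show ?thesis using c[OF C(1)] c[OF C(2)] by simp
 qed
 from ex_bij_betw_fibers[OF _ _ this] obtain b' where
  b': "bij_betw b' (?U - C) (?U - C')" "!!y. y : ?U - C ==> blk mu (b' y) = blk mu y" by auto
 define rho where "rho y = (if y : C then b y else if y : ?U then b' y else y)" for y
 have "bij_betw rho (C \<union> (?U - C)) (C' \<union> (?U - C'))"
 proof (rule bij_betw_combine)
  show "bij_betw rho C C'" using b bij_betw_cong[of C rho b C'] by (simp add: rho_def)
  show "bij_betw rho (?U - C) (?U - C')"       using b'(1) bij_betw_cong[of "?U - C" rho b' "?U - C'"] by (simp add: rho_def)
 qed auto
 moreover have "C \<union> (?U - C) = ?U" "C' \<union> (?U - C') = ?U" using C by auto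
 ultimately have "bij_betw rho ?U ?U" by simp
 then have "rho permutes ?U" by (rule bij_imp_permutes) (use C in \<open>auto simp: rho_def\<close>)
 moreover have "\<forall>y\<in>?U. blk mu (rho y) = blk mu y" using col b'(2) by (auto simp: rho_def)
 ultimately have "rho : young mu" by (simp add: young_iff)
 then show ?thesis by (intro bexI[of _ rho]) (simp_all add: rho_def)
qed

text \<open>The case of a single block: the Young subgroup of \<open>[r]\<close> is the full
  symmetric group.\<close>

lemma extend_permutation:
 assumes b: "bij_betw b C C'" and C: "C <= {1..r}" "C' <= {1..r}"
 shows "\<exists>rho. rho permutes {1..r::nat} & (\<forall>y\<in>C. rho y = b y)"
proof -
 have "blk [r] y = 0" if "y : {1..r}" for y using blk_iff(1)[of y "[r]"] that by simp
 note blk0 = this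
 have bC: "b y : C'" if "y : C" for y using b that by (auto simp: bij_betw_def)
 have "blk [r] (b y) = blk [r] y" if "y : C" for y using blk0[of y] blk0[of "b y"] bC[OF that] that C by (metis subsetD)
 then have "\<exists>rho\<in>young [r]. \<forall>y\<in>C. rho y = b y" using C by (intro extend_young[OF b]) simp_all
 then show ?thesis using young_permutes[of _ "[r]"] by auto
qed

section \<open>Images, fibres and orbit colours of the maps in \<open>M\<close>\<close>

locale gs_data =
 fixes r n :: nat and M :: "(nat => nat) set"
  and orbs :: "nat list => nat set set list" and ord :: "nat list => nat set rel"
 assumes M: "intermediate_monoid r M" and ords: "compatible_orders r n orbs ord"
begin

abbreviation "RO nu i == right_orbits (ord nu) M nu i r"
abbreviation "LO mu i == left_orbits mu i r"
abbreviation "Inv == invariants r M"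
abbreviation "Comp == compositions r n"
abbreviation "Ls == L_set r n"
abbreviation "Rs == R_set r n M orbs ord"
abbreviation "Cell == cell_elt orbs ord"

definition im :: "(nat => nat) => nat set" where "im m = m ` {1..r} - {0}"

definition oi :: "nat list => nat set => nat" where
 "oi nu d = (THE j. j < length (orbs nu) & d : orbs nu ! j)"

definition cm :: "nat list => nat list => (nat => nat) => nat => nat => nat" where
 "cm mu nu m = cmat (im m) (blk mu) (%y. oi nu (m -` {y}))"

text \<open>The family D in the factorisation of \<open>m\<close> through \<open>phi\<close> and
  \<open>psi\<close>, obtained from the fibres without reference to any order; see
  \<open>phi_psi\<close> and \<open>decomposition\<close>.\<close>

definition fam :: "(nat => nat) => nat set set" where "fam m = (%y. m -` {y}) ` im m"

lemma tau_D:
 assumes "m : tau r" shows "m 0 = 0" "x > r ==> m x = 0" "m x <= r"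
proof -
 show 0: "m 0 = 0" and z: "x > r ==> m x = 0" using assms by (auto simp: tau_def)
 show "m x <= r"
 proof (cases "x <= r")
  case True
  then show ?thesis using assms by (auto simp: tau_def image_subset_iff)
 qed (use z in simp)
qed

lemma M_tau: "m : M ==> m : tau r" using M by (auto simp: intermediate_monoid_def)
lemma M_comp: "m : M ==> m' : M ==> m o m' : M" using M by (auto simp: intermediate_monoid_def)
lemma M_perm: "p permutes {1..r} ==> perm_map r p : M" using M by (auto simp: intermediate_monoid_def)

lemma perm_0: "p permutes {1..r::nat} ==> p 0 = 0" by (simp add: permutes_not_in)

lemma perm_map_comp:
 assumes "p permutes {1..r}" "m : tau r" shows "perm_map r p o m = p o m" "m o perm_map r p = m o p"
proof -
 show "perm_map r p o m = p o m" using tau_D(3)[OF assms(2)] by (auto simp: perm_map_def)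
 have "m (p x) = m 0" if "~ x <= r" for x using tau_D(1,2)[OF assms(2)] that permutes_not_in[OF assms(1), of x] by simp
 then show "m o perm_map r p = m o p" by (auto simp: perm_map_def)
qed

lemma M_left: "p permutes {1..r} ==> m : M ==> p o m : M" using perm_map_comp(1)[of p m] M_perm[of p] M_comp M_tau by metis

lemma M_right: "p permutes {1..r} ==> m : M ==> m o p : M" using perm_map_comp(2)[of p m] M_perm[of p] M_comp M_tau by metis

lemma finite_tau: "finite (tau r)"
proof (rule finite_subset)
 show "tau r <= {m. \<forall>x. (x : {..r} --> m x : {..r}) & (x ~: {..r} --> m x = 0)}" using tau_D by auto
 show "finite {m. \<forall>x. (x : {..r} --> m x : {..r}) & (x ~: {..r} --> m x = (0::nat))}"
  by (rule finite_set_of_finite_funs) auto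
qed

lemma finite_M: "finite M" using finite_subset[OF _ finite_tau] M_tau by blast

lemma im_subset: "m : tau r ==> im m <= {1..r}" using tau_D(3) by (force simp: im_def)

lemma finite_im: "finite (im m)" by (simp add: im_def)

lemma index_im: "m : tau r ==> map_index r m = card (im m)"
proof -
 assume "m : tau r"
 then have "m 0 = 0" by (rule tau_D)
 moreover have "{0..r} = insert 0 {1..r}" by auto
 ultimately have "m ` {0..r} - {0} = im m" by (simp add: im_def)
 then show ?thesis by (simp add: map_index_def)
qed

lemma fiber_subset: "m : tau r ==> y ~= 0 ==> m -` {y} <= {1..r}"
proof
 fix x assume m: "m : tau r" "y ~= 0" "x : m -` {y}"
 then have "m x ~= 0" by simp
 then have "x ~= 0" "~ x > r" using tau_D(1,2)[OF m(1)] by metis+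
 then show "x : {1..r}" by simp
qed

lemma im_iff: "m : tau r ==> y : im m \<longleftrightarrow> y ~= 0 & (\<exists>x. m x = y)"
proof -
 assume m: "m : tau r"
 have "\<exists>x\<in>{1..r}. m x = y" if "y ~= 0" "m x = y" for x using fiber_subset[OF m that(1)] that by blast
 note ex = this
 show ?thesis
 proof
  show "y : im m" if "y ~= 0 & (\<exists>x. m x = y)"
  proof -
   obtain x where "m x = y" using \<open>y ~= 0 & (\<exists>x. m x = y)\<close> by blast
   from ex[OF _ this] obtain x' where "x' : {1..r}" "m x' = y" using \<open>y ~= 0 & (\<exists>x. m x = y)\<close> by blast
   then show ?thesis using \<open>y ~= 0 & (\<exists>x. m x = y)\<close> by (auto simp: im_def)
  qed
 qed (auto simp: im_def)
qed

lemma ords_D: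
 assumes "nu : Comp"
 shows "distinct (orbs nu)" "set (orbs nu) = power_orbits r nu" "linear_order_on (Pow {1..r}) (ord nu)"
  "j < k ==> k < length (orbs nu) ==> S : orbs nu ! j ==> T : orbs nu ! k ==> (S, T) : ord nu"
 using ords assms unfolding compatible_orders_def by blast+

lemma comps_D: "mu : Comp ==> sum_list mu = r" "mu : Comp ==> length mu = n" by (auto simp: compositions_def)

lemma vimage_young_subset: "p permutes {1..r::nat} ==> d <= {1..r} ==> p -` d <= {1..r}" using permutes_in_image by fastforce

text \<open>The sets \<open>Ob d\<close> are the classes of an equivalence relation, and
  \<open>orbs nu\<close> lists them without repetition, so every subset lies in exactly one listed
  orbit.\<close>

lemma oi_props:
 assumes nu: "nu : Comp" and d: "d <= {1..r}"
 shows "oi nu d < length (orbs nu)" "j < length (orbs nu) ==> d : orbs nu ! j \<longleftrightarrow> oi nu d = j"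
  "d' <= {1..r} ==> oi nu d = oi nu d' \<longleftrightarrow> (\<exists>ta\<in>young nu. d' = ta -` d)"
proof -
 define Ob where "Ob d = {ta -` d | ta. ta : young nu}" for d :: "nat set"
 have sr: "sum_list nu = r" using nu by (rule comps_D)
 have self: "d : Ob d" for d unfolding Ob_def using id_young by (auto intro!: exI[of _ id])
 have trans: "Ob d' = Ob d" if dd: "d' : Ob d" for d d'
 proof -
  obtain ta where p: "ta : young nu" "d' = ta -` d" using dd by (auto simp: Ob_def)
  have pp: "ta permutes {1..r}" using young_permutes[OF p(1)] sr by simp
  show ?thesis
  proof (intro equalityI subsetI)
   fix e assume "e : Ob d'"
   then obtain q where "q : young nu" "e = q -` (ta -` d)" by (auto simp: Ob_def p)
   then have "e = (ta o q) -` d" "ta o q : young nu" using young_comp p(1) by auto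
   then show "e : Ob d" unfolding Ob_def by blast
  next
   fix e assume "e : Ob d"
   then obtain q where q: "q : young nu" "e = q -` d" by (auto simp: Ob_def)
   have "e = (pinv ta o q) -` d'" using q p(2) permutes_inverses[OF pp] by auto
   then show "e : Ob d'" unfolding Ob_def using young_comp[OF young_inv[OF p(1)] q(1)] by blast
  qed
 qed
 have orbsO: "set (orbs nu) = Ob ` Pow {1..r}" using ords_D(2)[OF nu] by (simp add: power_orbits_def Ob_def)
 have ex: "\<exists>!j. j < length (orbs nu) & d : orbs nu ! j" if "d <= {1..r}" for d
 proof -
  have "Ob d : set (orbs nu)" using orbsO that by blast
  then obtain j where j: "j < length (orbs nu)" "orbs nu ! j = Ob d" by (auto simp: in_set_conv_nth)
  show ?thesis
  proof (rule ex1I[of _ j])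
   show "j < length (orbs nu) & d : orbs nu ! j" using j self by simp
   fix k assume k: "k < length (orbs nu) & d : orbs nu ! k"
   then have "orbs nu ! k : Ob ` Pow {1..r}" using orbsO nth_mem by metis
   then obtain e where "orbs nu ! k = Ob e" by blast
   then have "orbs nu ! k = Ob d" using trans k by metis
   then show "k = j" using j k ords_D(1)[OF nu] nth_eq_iff_index_eq by metis
  qed
 qed
 have oiO: "oi nu d < length (orbs nu) & d : orbs nu ! oi nu d" if "d <= {1..r}" for d
  unfolding oi_def by (rule theI'[OF ex[OF that]])
 have oiO2: "orbs nu ! oi nu d = Ob d" if "d <= {1..r}" for d
 proof -
  have "orbs nu ! oi nu d : Ob ` Pow {1..r}" using oiO[OF that] orbsO nth_mem by metis
  then obtain e where "orbs nu ! oi nu d = Ob e" by blast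
  then show ?thesis using trans oiO[OF that] by metis
 qed
 show "oi nu d < length (orbs nu)" using oiO[OF d] by simp
 show "j < length (orbs nu) ==> d : orbs nu ! j \<longleftrightarrow> oi nu d = j" using oiO[OF d] ex[OF d] by blast
 show "oi nu d = oi nu d' \<longleftrightarrow> (\<exists>ta\<in>young nu. d' = ta -` d)" if d': "d' <= {1..r}"
 proof
  assume "oi nu d = oi nu d'"
  then have "Ob d = Ob d'" using oiO2 d d' by metis
  then have "d' : Ob d" using self by blast
  then show "\<exists>ta\<in>young nu. d' = ta -` d" by (auto simp: Ob_def)
 next
  assume "\<exists>ta\<in>young nu. d' = ta -` d"
  then have "d' : Ob d" by (auto simp: Ob_def)
  then have "d' : orbs nu ! oi nu d" using oiO2[OF d] by simp
  then show "oi nu d = oi nu d'" using ex[OF d'] oiO[OF d'] oiO[OF d] by blast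
 qed
qed

lemma oi_vimage:
 assumes "nu : Comp" "d <= {1..r}" "ta : young nu" shows "oi nu (ta -` d) = oi nu d"
proof -
 have "ta permutes {1..r}" using young_permutes[OF assms(3)] comps_D(1)[OF assms(1)] by simp
 then show ?thesis using oi_props(3)[OF assms(1,2), of "ta -` d"] vimage_young_subset assms by metis
qed

lemma oi_block_card:
 assumes nu: "nu : Comp" and d: "d <= {1..r}" "d' <= {1..r}" and eq: "oi nu d = oi nu d'"
 shows "card {x\<in>d. blk nu x = j} = card {x\<in>d'. blk nu x = j}"
proof -
 obtain ta where p: "ta : young nu" "d' = ta -` d" using oi_props(3)[OF nu d] eq by blast
 have pp: "ta permutes {1..r}" using young_permutes[OF p(1)] comps_D(1)[OF nu] by simp
 have "bij_betw ta {x\<in>d'. blk nu x = j} {x\<in>d. blk nu x = j}"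
 proof (rule bij_betw_byWitness[where f' = "pinv ta"])
  have b: "blk nu (ta x) = blk nu x" if "x : {1..r}" for x using young_blk[OF p(1)] that comps_D(1)[OF nu] by simp
  show "ta ` {x : d'. blk nu x = j} <= {x : d. blk nu x = j}" using p(2) b d(2) by auto
  show "pinv ta ` {x : d. blk nu x = j} <= {x : d'. blk nu x = j}"
  proof
   fix z assume "z : pinv ta ` {x : d. blk nu x = j}"
   then obtain x where x: "z = pinv ta x" "x : d" "blk nu x = j" by blast
   then have pz: "ta z = x" using permutes_inverses(1)[OF pp] by simp
   then have "z : d'" using p(2) x by simp
   then show "z : {x : d'. blk nu x = j}" using b[of z] d(2) pz x(3) by auto
  qed
 qed (use permutes_inverses[OF pp] in auto)
 from bij_betw_same_card[OF this] show ?thesis by simp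
qed

text \<open>The fibres over \<open>y\<close> and over \<open>b y\<close> have equally many points in
  each block, and so have the zero fibres, being complements. Colouring the points by value and
  block therefore gives equal counts for \<open>m\<close> followed by \<open>b\<close> and for
  \<open>m'\<close>, and a matching of these colourings is the required \<open>ta\<close>.\<close>

lemma match_right:
 assumes nu: "nu : Comp" and m: "m : tau r" "m' : tau r"
  and b: "bij_betw b (im m) (im m')"
  and col: "!!y. y : im m ==> oi nu (m' -` {b y}) = oi nu (m -` {y})"
 shows "\<exists>ta\<in>young nu. \<forall>x. m' (ta x) = (if m x = 0 then 0 else b (m x))"
proof -
 let ?U = "{1..r}"
 define mb where "mb x = (if m x = 0 then 0 else b (m x))" for x
 have mim: "m x : im m" if "m x ~= 0" for x using im_iff[OF m(1)] that by blast
 have bim: "b y : im m'" if "y : im m" for y using bij_betwE[OF b] that by blast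
 have im0: "0 ~: im m'" by (simp add: im_def)
 have nz: "card {x\<in>?U. mb x = z & blk nu x = j} = card {x\<in>?U. m' x = z & blk nu x = j}" if z: "z : im m'" for z j
 proof -
  obtain y where y: "y : im m" "b y = z" using bij_betw_imp_surj_on[OF b] z by (metis imageE)
  have y0: "y ~= 0" "z ~= 0" using y z by (auto simp: im_def)
  have "mb x = z \<longleftrightarrow> m x = y" for x
   using y y0 mim[of x] inj_on_eq_iff[OF bij_betw_imp_inj_on[OF b], of "m x" y] by (auto simp: mb_def)
  then have "{x\<in>?U. mb x = z & blk nu x = j} = {x\<in>m -` {y}. blk nu x = j}"
   using fiber_subset[OF m(1) y0(1)] by auto
  moreover have "{x\<in>?U. m' x = z & blk nu x = j} = {x\<in>m' -` {z}. blk nu x = j}"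
   using fiber_subset[OF m(2) y0(2)] by auto
  moreover have "card {x\<in>m -` {y}. blk nu x = j} = card {x\<in>m' -` {z}. blk nu x = j}"
   by (rule oi_block_card[OF nu fiber_subset[OF m(1) y0(1)] fiber_subset[OF m(2) y0(2)]]) (use col[OF y(1)] y in simp)
  ultimately show ?thesis by simp
 qed
 have tot: "card {x\<in>?U. f x = 0 & blk nu x = j} =
   card {x\<in>?U. blk nu x = j} - (\<Sum>z\<in>im m'. card {x\<in>?U. f x = z & blk nu x = j})"
  if f: "!!x. x : ?U ==> f x : insert 0 (im m')" for f j
 proof -
  have "card {x\<in>?U. blk nu x = j} = (\<Sum>z\<in>insert 0 (im m'). card {x\<in>{x\<in>?U. blk nu x = j}. f x = z})"
   by (rule card_fibers) (use f finite_im in auto)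
  also have "... = (\<Sum>z\<in>insert 0 (im m'). card {x\<in>?U. f x = z & blk nu x = j})"
   by (intro sum.cong refl arg_cong[where f = card]) auto
  finally show ?thesis using im0 finite_im by simp
 qed
 have "card {x\<in>?U. (mb x, blk nu x) = c} = card {x\<in>?U. (m' x, blk nu x) = c}" for c
 proof -
  obtain z j where c: "c = (z, j)" by (cases c)
  have "card {x\<in>?U. mb x = z & blk nu x = j} = card {x\<in>?U. m' x = z & blk nu x = j}"
  proof (cases "z : im m'")
   case True then show ?thesis by (rule nz)
  next
   case False
   have mbi: "mb x : insert 0 (im m')" for x using mim bim by (auto simp: mb_def)
   have m'i: "m' x : insert 0 (im m')" for x using im_iff[OF m(2)] by blast
   show ?thesis
   proof (cases "z = 0")
    case True
    show ?thesis unfolding True tot[OF mbi] tot[OF m'i] using nz by simp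
   next
    case z0: False
    then have "mb x ~= z" "m' x ~= z" for x using mbi[of x] m'i[of x] False by auto
    then show ?thesis by simp
   qed
  qed
  then show ?thesis by (simp add: c)
 qed
 from ex_bij_betw_fibers[OF _ _ this] obtain p where
  p: "bij_betw p ?U ?U" "!!x. x : ?U ==> m' (p x) = mb x & blk nu (p x) = blk nu x" by auto
 define ta where "ta x = (if x : ?U then p x else x)" for x
 have "bij_betw ta ?U ?U" using p(1) by (rule bij_betw_cong[THEN iffD1, rotated]) (simp add: ta_def)
 then have pp: "ta permutes ?U" by (rule bij_imp_permutes) (simp only: ta_def if_False)
 have "ta : young nu" using pp p(2) comps_D(1)[OF nu] by (simp add: young_iff ta_def)
 moreover have "m' (ta x) = (if m x = 0 then 0 else b (m x))" for x
 proof (cases "x : ?U")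
  case True then show ?thesis using p(2)[OF True] by (simp add: ta_def mb_def)
 next
  case False
  then have z: "m x = 0" "m' x = 0" using tau_D m by (cases "x = 0"; simp)+
  have "ta x = x" unfolding ta_def using False by (simp only: if_False)
  then show ?thesis using z by simp
 qed
 ultimately show ?thesis by blast
qed

lemma im_comp:
 assumes "rho permutes {1..r}" "ta permutes {1..r}" "m : tau r"
 shows "im (rho o m o ta) = rho ` im m" "y ~= 0 ==> (rho o m o ta) -` {rho y} = ta -` (m -` {y})"
proof -
 have inj: "rho a = rho b \<longleftrightarrow> a = b" for a b using permutes_inj[OF assms(1)] by (auto simp: inj_def)
 have "(rho o m o ta) ` {1..r} = rho ` m ` {1..r}" using permutes_image[OF assms(2)] by (metis image_comp)
 moreover have "rho ` m ` {1..r} - {0} = rho ` (m ` {1..r} - {0})"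
  using image_set_diff[OF permutes_inj[OF assms(1)], of "m ` {1..r}" "{0}"] perm_0[OF assms(1)] by simp
 ultimately show "im (rho o m o ta) = rho ` im m" by (simp add: im_def)
 show "(rho o m o ta) -` {rho y} = ta -` (m -` {y})" by (simp add: set_eq_iff vimage_def inj)
qed

lemma cm_comp:
 assumes mu: "mu : Comp" and nu: "nu : Comp" and "rho : young mu" "ta : young nu" "m : tau r"
 shows "cm mu nu (rho o m o ta) = cm mu nu m"
proof -
 have p: "rho permutes {1..r}" "ta permutes {1..r}"
  using young_permutes[OF assms(3)] young_permutes[OF assms(4)] comps_D(1)[OF mu] comps_D(1)[OF nu] by auto
 have "card {y : im (rho o m o ta). blk mu y = c & oi nu ((rho o m o ta) -` {y}) = c'} =
   card {y : im m. blk mu y = c & oi nu (m -` {y}) = c'}" for c c'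
 proof (rule bij_betw_same_card[symmetric, of rho])
  have e: "blk mu (rho y) = blk mu y" "oi nu ((rho o m o ta) -` {rho y}) = oi nu (m -` {y})" if "y : im m" for y
  proof -
   have y: "y : {1..r}" "y ~= 0" using that im_subset[OF assms(5)] by auto
   show "blk mu (rho y) = blk mu y" using young_blk[OF assms(3)] y comps_D(1)[OF mu] by simp
   show "oi nu ((rho o m o ta) -` {rho y}) = oi nu (m -` {y})"
    unfolding im_comp(2)[OF p assms(5) y(2)] by (rule oi_vimage[OF nu fiber_subset[OF assms(5) y(2)] assms(4)])
  qed
  show "bij_betw rho {y : im m. blk mu y = c & oi nu (m -` {y}) = c'}
   {y : im (rho o m o ta). blk mu y = c & oi nu ((rho o m o ta) -` {y}) = c'}"
   unfolding bij_betw_def im_comp(1)[OF p assms(5)]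
   using e inj_on_subset[OF permutes_inj[OF p(1)]] by (auto simp del: comp_apply vimage_comp)
 qed
 then show ?thesis unfolding cm_def cmat_def by blast
qed

text \<open>Equal colour matrices give a bijection of the images that respects both colours. It
  extends on the left to an element of \<open>young mu\<close> by \<open>extend_young\<close> and
  lifts on the right to an element of \<open>young nu\<close> by \<open>match_right\<close>.\<close>

lemma dcoset_iff:
 assumes mu: "mu : Comp" and nu: "nu : Comp" and m: "m : tau r" "m' : tau r"
 shows "m' : dcoset mu nu m \<longleftrightarrow> cm mu nu m' = cm mu nu m"
proof
 assume "m' : dcoset mu nu m"
 then show "cm mu nu m' = cm mu nu m" using cm_comp[OF mu nu] m by (auto simp: dcoset_def)
next
 assume "cm mu nu m' = cm mu nu m"
 then have "cmat (im m) (blk mu) (%y. oi nu (m -` {y})) = cmat (im m') (blk mu) (%y. oi nu (m' -` {y}))"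
  by (simp add: cm_def)
 from cmat_match[OF finite_im finite_im this] obtain b where b: "bij_betw b (im m) (im m')"
  "!!y. y : im m ==> blk mu (b y) = blk mu y" "!!y. y : im m ==> oi nu (m' -` {b y}) = oi nu (m -` {y})" by blast
 obtain rho where rho: "rho : young mu" "\<forall>y\<in>im m. rho y = b y"
  using extend_young[OF b(1) _ _ b(2)] im_subset m comps_D(1)[OF mu] by blast
 obtain ta where ta: "ta : young nu" "!!x. m' (ta x) = (if m x = 0 then 0 else b (m x))"
  using match_right[OF nu m b(1) b(3)] by blast
 have p: "rho permutes {1..r}" "ta permutes {1..r}"
  using young_permutes[OF rho(1)] young_permutes[OF ta(1)] comps_D(1)[OF mu] comps_D(1)[OF nu] by auto
 have "m' (ta x) = rho (m x)" for x using ta(2)[of x] rho(2) perm_0[OF p(1)] im_iff[OF m(1), of "m x"] by auto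
 then have "m' x = rho (m (pinv ta x))" for x using permutes_inverses(1)[OF p(2), of x] by metis
 then have "m' = rho o m o pinv ta" by auto
 then show "m' : dcoset mu nu m" unfolding dcoset_def using rho(1) young_inv[OF ta(1)] by blast
qed

end

section \<open>Murphy elements as counting functions\<close>

definition lf :: "nat list => nat => nat" where
 "lf xi k = (if k < length xi then xi ! k else 0)"

abbreviation nf :: "nat list => nat => nat" where "nf kap == (%c. kap ! c)"

lemma diagram_fdiag: "diagram xi = fdiag (lf xi)" by (auto simp: diagram_def fdiag_def lf_def split: if_splits)

lemma lf_Par: assumes "xi : partitions i" shows "lf xi : Par" "psize (lf xi) = i"
proof -
 have s: "sorted_wrt (\<ge>) xi" "sum_list xi = i" using assms by (auto simp: partitions_def)
 have "lf xi b <= lf xi a" if "a <= b" for a b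
  using sorted_wrt_nth_less[OF s(1), of a b] that by (cases "a = b") (auto simp: lf_def)
 then show "lf xi : Par" by (auto simp: Par_def antimono_def lf_def intro!: exI[of _ "length xi"])
 have "psize (lf xi) = (\<Sum>k<length xi. lf xi k)" by (rule psize_eq) (simp add: lf_def)
 also have "... = sum_list xi" by (simp add: lf_def sum_list_sum_nth atLeast0LessThan)
 finally show "psize (lf xi) = i" using s by simp
qed

lemma lf_inj: assumes "xi : partitions i" "xi' : partitions i'" "lf xi = lf xi'" shows "xi = xi'"
proof -
 have nz: "xi ! k ~= 0" if "k < length xi" "xi : partitions i" for xi k i
 proof -
  have "0 ~: set xi" using that(2) by (simp add: partitions_def)
  then show ?thesis using nth_mem[OF that(1)] by metis
 qed
 have "length xi <= length xi'" if "xi : partitions i" "xi' : partitions i'" "lf xi = lf xi'" for xi xi' i i'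
 proof (rule ccontr)
  assume "~ ?thesis"
  then have "length xi' < length xi" by simp
  then have "lf xi (length xi') ~= 0" "lf xi' (length xi') = 0" using nz[OF _ that(1)] by (auto simp: lf_def)
  then show False using that(3) by simp
 qed
 then have len: "length xi = length xi'" using assms by (metis antisym)
 show ?thesis
 proof (rule nth_equalityI[OF len])
  fix k assume "k < length xi"
  then show "xi ! k = xi' ! k" using fun_cong[OF assms(3), of k] len by (simp add: lf_def)
 qed
qed

lemma semistandard_SST: "semistandard xi kap S \<longleftrightarrow> S : SST (lf xi) (length kap) (nf kap)"
 unfolding semistandard_def SST_def diagram_fdiag by (auto simp: fdiag_def)

lemma dominates_dom: "dominates xi mu \<longleftrightarrow> dom (lf xi) (lf mu)"
proof -
 have "sum_list (take k xi) = psum (lf xi) k" for xi k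
 proof (induction k)
  case (Suc k)
  then show ?case by (cases "k < length xi") (auto simp: psum_def lf_def take_Suc_conv_app_nth)
 qed (simp add: psum_def)
 then show ?thesis by (simp add: dominates_def dom_def)
qed

lemma blk_mono:
 assumes "x : {1..sum_list mu}" "y : {1..sum_list mu}" "x <= y" shows "blk mu x <= blk mu y"
proof (rule ccontr)
 assume "~ ?thesis"
 then have "sum_list (take (Suc (blk mu y)) mu) <= sum_list (take (blk mu x) mu)" by (intro partial_sum_mono) auto
 moreover have "x : block mu (blk mu x)" "y : block mu (blk mu y)" using blk_iff assms by auto
 ultimately show False using assms(3) by (auto simp: block_def)
qed

lemma partial_sum_eq_sum: "c <= length kap ==> sum_list (take c kap) = (\<Sum>d<c. kap ! d)"
proof (induction c)
 case (Suc c)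
 then show ?case by (simp add: take_Suc_conv_app_nth)
qed simp

text \<open>The fibres of a monotone map are consecutive intervals, as are the blocks of
  \<open>kap\<close>, so equal sizes make them coincide. It identifies the blocks of an orbit
  composition with colours as soon as the points are listed in the order of their colours.\<close>

lemma blk_of_monotone:
 assumes mono: "!!x y. x : {1..i} ==> y : {1..i} ==> x <= y ==> f x <= f y"
  and bd: "!!x. x : {1..i} ==> f x < length kap"
  and cnt: "!!c. c < length kap ==> kap ! c = card {x\<in>{1..i}. f x = c}"
  and x: "x : {1..i}"
 shows "blk kap x = f x" "sum_list kap = i"
proof -
 have ps: "sum_list (take c kap) = card {x\<in>{1..i}. f x < c}" if "c <= length kap" for c
 proof -
  have "card {x\<in>{1..i}. f x < c} = (\<Sum>d<c. card {y\<in>{x\<in>{1..i}. f x < c}. f y = d})"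
   by (rule card_fibers) auto
  also have "... = (\<Sum>d<c. kap ! d)"
   using that by (intro sum.cong refl) (auto simp: cnt intro!: arg_cong[where f = card])
  finally show ?thesis using partial_sum_eq_sum[OF that] by simp
 qed
 have "{x\<in>{1..i}. f x < length kap} = {1..i}" using bd by auto
 then show s: "sum_list kap = i" using ps[of "length kap"] by simp
 have "x : block kap (f x)"
 proof -
  have "{y\<in>{1..i}. f y < f x} <= {1..x - 1}"
  proof
   fix y assume y: "y : {y\<in>{1..i}. f y < f x}"
   then have "~ x <= y" using mono[OF x, of y] by auto
   then show "y : {1..x - 1}" using y by auto
  qed
  then have "card {y\<in>{1..i}. f y < f x} <= card {1..x - 1}" by (intro card_mono) auto
  moreover have "{1..x} <= {y\<in>{1..i}. f y < Suc (f x)}" using mono[of _ x] x by (auto simp: less_Suc_eq_le)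
  then have "card {1..x} <= card {y\<in>{1..i}. f y < Suc (f x)}" by (intro card_mono) auto
  ultimately show ?thesis using ps[of "f x"] ps[of "Suc (f x)"] bd[OF x] x by (auto simp: block_def)
 qed
 then show "blk kap x = f x" using blk_iff(2)[of x kap "f x"] bd[OF x] x s by simp
qed

lemma row_reading_blk:
 assumes "(k, j) : diagram xi"
 shows "row_reading xi (k, j) : {1..sum_list xi}" "blk xi (row_reading xi (k, j)) = k"
proof -
 have k: "k < length xi" "j < xi ! k" using assms by (auto simp: diagram_def)
 have "sum_list (take (Suc k) xi) = sum_list (take k xi) + xi ! k" using k by (simp add: take_Suc_conv_app_nth)
 then have b: "row_reading xi (k, j) : block xi k" using assms k by (simp add: row_reading_def block_def)
 then show r: "row_reading xi (k, j) : {1..sum_list xi}" using block_subset by blast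
 show "blk xi (row_reading xi (k, j)) = k" using blk_iff(2)[OF r k(1)] b by simp
qed

lemma card_diagram: "finite (diagram xi)" "card (diagram xi) = sum_list xi"
proof -
 have "diagram xi = (SIGMA k:{..<length xi}. {..<xi ! k})" by (auto simp: diagram_def)
 then show "finite (diagram xi)" "card (diagram xi) = sum_list xi"
  by (simp_all add: card_SigmaI sum_list_sum_nth atLeast0LessThan)
qed

lemma row_reading_bij: "bij_betw (row_reading xi) (diagram xi) {1..sum_list xi}"
proof -
 have "inj_on (row_reading xi) (diagram xi)"
 proof (rule inj_onI)
  fix p q assume p: "p : diagram xi" "q : diagram xi" "row_reading xi p = row_reading xi q"
  obtain k j k' j' where kj: "p = (k, j)" "q = (k', j')" by (cases p; cases q)
  have "k = k'" using row_reading_blk(2) p kj by metis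
  then show "p = q" using p kj by (simp add: row_reading_def)
 qed
 moreover have "row_reading xi ` diagram xi <= {1..sum_list xi}" using row_reading_blk(1) by auto
 ultimately show ?thesis using card_diagram[of xi] by (simp add: bij_betw_def card_image card_subset_eq)
qed

lemma tab_perm_props:
 assumes "bij_betw s (diagram xi) {1..sum_list xi}"
 shows "tab_perm xi s permutes {1..sum_list xi}" "c : diagram xi ==> tab_perm xi s (row_reading xi c) = s c"
proof -
 let ?U = "{1..sum_list xi}"
 define d where "d x = (if x : ?U then s (inv_into (diagram xi) (row_reading xi) x) else x)" for x
 have "bij_betw (s o inv_into (diagram xi) (row_reading xi)) ?U ?U"
  using bij_betw_trans[OF bij_betw_inv_into[OF row_reading_bij] assms] .
 then have "bij_betw d ?U ?U" using bij_betw_cong[of ?U d "s o inv_into (diagram xi) (row_reading xi)" ?U]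
  by (simp add: d_def)
 then have dp: "d permutes ?U" by (rule bij_imp_permutes) (simp only: d_def if_False)
 have dc: "d (row_reading xi c) = s c" if "c : diagram xi" for c
  using bij_betwE[OF row_reading_bij] that bij_betw_inv_into_left[OF row_reading_bij that] by (simp add: d_def)
 have uniq: "e = d" if "e permutes ?U" "\<forall>c\<in>diagram xi. e (row_reading xi c) = s c" for e
 proof
  fix x show "e x = d x"
  proof (cases "x : ?U")
   case True
   then obtain c where "c : diagram xi" "x = row_reading xi c"
    using bij_betw_imp_surj_on[OF row_reading_bij] by (metis imageE)
   then show ?thesis using that(2) dc by simp
  next
   case False
   show ?thesis using permutes_not_in[OF that(1) False] permutes_not_in[OF dp False] by simp
  qed
 qed
 have "tab_perm xi s = d" unfolding tab_perm_def
 proof (rule the_equality)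
  show "d permutes ?U & (\<forall>p\<in>diagram xi. d (row_reading xi p) = s p)" using dp dc by blast
 qed (use uniq in blast)
 then show "tab_perm xi s permutes ?U" "c : diagram xi ==> tab_perm xi s (row_reading xi c) = s c" using dp dc by auto
qed

definition rowof :: "nat list => (nat \<times> nat => nat) => nat => nat" where
 "rowof xi s = (\<lambda>x\<in>{1..sum_list xi}. fst (inv_into (diagram xi) s x))"

lemma rowof_cell:
 assumes "bij_betw s (diagram xi) {1..sum_list xi}" "c : diagram xi"
 shows "rowof xi s (s c) = fst c"
 using bij_betwE[OF assms(1)] assms(2) bij_betw_inv_into_left[OF assms] by (simp add: rowof_def)

text \<open>The equation p = d(s) sig d(t)^-1 has the single solution \<open>sig0\<close>, so the
  coefficient is 0 or 1. Membership of \<open>sig0\<close> in \<open>young xi\<close> says that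
  \<open>p\<close> carries each row of \<open>t\<close> to the same row of \<open>s\<close>.\<close>

lemma murphy_rows:
 assumes s: "bij_betw s (diagram xi) {1..sum_list xi}" and t: "bij_betw t (diagram xi) {1..sum_list xi}"
  and p: "p permutes {1..sum_list xi}"
 shows "murphy xi s t p = of_bool (\<forall>x\<in>{1..sum_list xi}. rowof xi s (p x) = rowof xi t x)"
proof -
 let ?U = "{1..sum_list xi}"
 let ?ds = "tab_perm xi s" and ?dt = "tab_perm xi t"
 note ds = tab_perm_props[OF s] and dt = tab_perm_props[OF t]
 define sig0 where "sig0 = pinv ?ds o p o ?dt"
 have s0p: "sig0 permutes ?U" unfolding sig0_def by (intro permutes_compose permutes_inv ds(1) dt(1) p)
 have eq: "p = ?ds o sig o pinv ?dt \<longleftrightarrow> sig = sig0" for sig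
 proof
  assume "p = ?ds o sig o pinv ?dt"
  then show "sig = sig0" unfolding sig0_def using permutes_inverses[OF ds(1)] permutes_inverses[OF dt(1)] by (auto simp: fun_eq_iff)
 next
  assume "sig = sig0"
  then show "p = ?ds o sig o pinv ?dt" unfolding sig0_def
   using permutes_inverses[OF ds(1)] permutes_inverses[OF dt(1)] by (auto simp: fun_eq_iff)
 qed
 have "murphy xi s t p = (\<Sum>sig\<in>young xi. if sig = sig0 then 1 else 0)"
  unfolding murphy_def single_def by (intro sum.cong refl) (simp only: eq)
 also have "... = of_bool (sig0 : young xi)" using finite_young by (simp add: sum.delta)
 also have "sig0 : young xi \<longleftrightarrow> (\<forall>x\<in>?U. rowof xi s (p x) = rowof xi t x)"
 proof -
  have key: "blk xi (sig0 (row_reading xi c)) = rowof xi s (p (t c)) & blk xi (row_reading xi c) = rowof xi t (t c)"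
   if c: "c : diagram xi" for c
  proof -
   have "t c : ?U" using bij_betwE[OF t] c by blast
   then have "p (t c) : ?U" using permutes_in_image[OF p] by simp
   then obtain e where e: "e : diagram xi" "p (t c) = s e" using bij_betw_imp_surj_on[OF s] by (metis imageE)
   have "sig0 (row_reading xi c) = pinv ?ds (s e)" using e dt(2)[OF c] by (simp add: sig0_def)
   also have "... = row_reading xi e" using ds(2)[OF e(1)] permutes_inverses(2)[OF ds(1)] by metis
   finally have "blk xi (sig0 (row_reading xi c)) = fst e" using row_reading_blk(2)[of "fst e" "snd e" xi] e(1) by simp
   then show ?thesis using rowof_cell[OF s e(1)] rowof_cell[OF t c] e(2) row_reading_blk(2)[of "fst c" "snd c" xi] c by simp
  qed
  have "sig0 : young xi \<longleftrightarrow> (\<forall>c\<in>diagram xi. blk xi (sig0 (row_reading xi c)) = blk xi (row_reading xi c))"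
  proof -
   have "(\<forall>y\<in>row_reading xi ` diagram xi. blk xi (sig0 y) = blk xi y) \<longleftrightarrow>
     (\<forall>c\<in>diagram xi. blk xi (sig0 (row_reading xi c)) = blk xi (row_reading xi c))" by simp
   then show ?thesis using s0p unfolding young_iff bij_betw_imp_surj_on[OF row_reading_bij] by blast
  qed
  also have "... \<longleftrightarrow> (\<forall>c\<in>diagram xi. rowof xi s (p (t c)) = rowof xi t (t c))" using key by simp
  also have "... \<longleftrightarrow> (\<forall>x\<in>t ` diagram xi. rowof xi s (p x) = rowof xi t x)" by simp
  finally show ?thesis unfolding bij_betw_imp_surj_on[OF t] .
 qed
 finally show ?thesis .
qed

lemma strict_enumeration_unique:
 fixes f g :: "nat => nat"
 assumes "!!j k. j < k ==> k < n ==> f j < f k" "!!j k. j < k ==> k < n ==> g j < g k"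
  and "f ` {..<n} = g ` {..<n}" "j < n"
 shows "f j = g j"
proof -
 have s: "sorted_wrt (<) (map f [0..<n])" "sorted_wrt (<) (map g [0..<n])"
  using assms(1,2) by (auto simp: sorted_wrt_iff_nth_less)
 moreover have "set (map f [0..<n]) = set (map g [0..<n])" using assms(3) by (simp add: atLeast0LessThan)
 ultimately have "map f [0..<n] = map g [0..<n]" using strict_sorted_equal by metis
 then show ?thesis using assms(4) by (metis add_0 length_upt minus_nat.diff_0 nth_map nth_upt)
qed

lemma weak_enumeration_unique:
 fixes f g :: "nat => nat"
 assumes "!!j k. j < k ==> k < n ==> f j <= f k" "!!j k. j < k ==> k < n ==> g j <= g k"
  and "!!c. card {j. j < n & f j = c} = card {j. j < n & g j = c}" "j < n"
 shows "f j = g j"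
proof -
 have le: "card {j. j < n & f j <= c} = card {j. j < n & g j <= c}" for c
 proof -
  have "card {j. j < n & h j <= c} = (\<Sum>d\<le>c. card {j. j < n & h j = d})" for h :: "nat => nat"
  proof -
   have "card {j. j < n & h j <= c} = (\<Sum>d\<in>{..c}. card {j\<in>{j. j < n & h j <= c}. h j = d})"
    by (rule card_fibers) auto
   also have "... = (\<Sum>d\<le>c. card {j. j < n & h j = d})" by (intro sum.cong refl arg_cong[where f = card]) auto
   finally show ?thesis .
  qed
  then show ?thesis using assms(3) by simp
 qed
 have ini: "{j. j < n & h j <= c} = {..<card {j. j < n & h j <= c}}"
  if "!!j k. j < k ==> k < n ==> h j <= h k" for h :: "nat => nat" and c
 proof (rule initial_segment)
  fix x y assume xy: "x < y" "y : {j. j < n & h j <= c}"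
  then show "x : {j. j < n & h j <= c}" using that[OF xy(1)] by simp
 qed simp
 have "{j. j < n & f j <= c} = {j. j < n & g j <= c}" for c
  using trans[OF ini[of f c, OF assms(1), unfolded le] ini[of g c, OF assms(2), symmetric]] .
 then have "f j <= c \<longleftrightarrow> g j <= c" for c using assms(4) by blast
 then show ?thesis by (metis antisym order_refl)
qed

lemma standard_D:
 assumes "standard xi s"
 shows "s : extensional (diagram xi)" "bij_betw s (diagram xi) {1..sum_list xi}"
  "(i, j') : diagram xi ==> j < j' ==> s (i, j) < s (i, j')"
proof -
 show "s : extensional (diagram xi)" "bij_betw s (diagram xi) {1..sum_list xi}" using assms by (simp_all add: standard_def)
 assume "(i, j') : diagram xi" "j < j'"
 moreover have "(i, j) : diagram xi" using calculation by (auto simp: diagram_def)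
 ultimately show "s (i, j) < s (i, j')" using assms unfolding standard_def by blast
qed

lemma tab_type_eq:
 assumes "bij_betw s (diagram xi) {1..sum_list xi}" "sum_list kap = sum_list xi" "c : diagram xi"
 shows "tab_type kap xi s c = blk kap (s c)" using assms by (simp add: tab_type_def blk_def)

text \<open>A standard tableau is determined by the rows of its entries, because each row is sorted.
  Conversely, sorting the rows of an assignment with the row content of \<open>T\<close> produces a
  tableau of type \<open>T\<close>; its columns increase because those of \<open>T\<close> increase
  strictly and larger block numbers mean larger entries.\<close>

lemma rowof_bij:
 assumes i: "sum_list kap = sum_list xi" and T: "semistandard xi kap T"
 shows "bij_betw (rowof xi) {t. standard xi t & tab_type kap xi t = T}
  {h : extensional {1..sum_list xi}. stat {1..sum_list xi} h (blk kap) = rt (lf xi) T}"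
  (is "bij_betw _ ?S ?H")
proof -
 let ?U = "{1..sum_list xi}"
 note SD = SST_D[OF T[unfolded semistandard_SST], folded diagram_fdiag]
 have image: "rowof xi t : ?H" if t: "t : ?S" for t
 proof -
  have tb: "bij_betw t (diagram xi) ?U" using t standard_D by blast
  have "T c = blk kap (t c)" if "c : diagram xi" for c using tab_type_eq[OF tb i that] t by auto
  then have "stat (diagram xi) fst T = stat ?U (rowof xi t) (blk kap)"
   by (intro stat_bij[OF tb]) (auto simp: rowof_cell[OF tb])
  then show ?thesis by (simp add: diagram_fdiag rowof_def)
 qed
 have rowset: "{x\<in>?U. rowof xi t x = k} = (%j. t (k, j)) ` {..<lf xi k}" if t: "standard xi t" for t k
 proof -
  note tb = standard_D(2)[OF t]
  have "{x\<in>?U. rowof xi t x = k} = {x\<in>t ` diagram xi. rowof xi t x = k}" using bij_betw_imp_surj_on[OF tb] by simp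
  also have "... = t ` {c\<in>diagram xi. fst c = k}" using rowof_cell[OF tb] by auto
  also have "{c\<in>diagram xi. fst c = k} = Pair k ` {..<lf xi k}" by (auto simp: diagram_fdiag fdiag_def)
  finally show ?thesis by (simp add: image_image)
 qed
 have inj: "inj_on (rowof xi) ?S"
 proof (rule inj_onI)
  fix t t' assume t: "t : ?S" "t' : ?S" and e: "rowof xi t = rowof xi t'"
  have st: "standard xi t" "standard xi t'" using t by auto
  show "t = t'"
  proof (rule extensionalityI[OF standard_D(1)[OF st(1)] standard_D(1)[OF st(2)]])
   fix c assume c: "c : diagram xi"
   obtain k j where kj: "c = (k, j)" by (cases c)
   show "t c = t' c" unfolding kj
   proof (rule strict_enumeration_unique[where n = "lf xi k" and f = "%j. t (k, j)" and g = "%j. t' (k, j)"])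
    show "(%j. t (k, j)) ` {..<lf xi k} = (%j. t' (k, j)) ` {..<lf xi k}"
     using rowset[OF st(1), of k] rowset[OF st(2), of k] e by simp
   qed (use standard_D(3) st c kj in \<open>auto simp: diagram_fdiag fdiag_def\<close>)
  qed
 qed
 have surj: "h : rowof xi ` ?S" if h: "h : ?H" for h
 proof -
  define Ak where "Ak k = {x\<in>?U. h x = k}" for k
  have finA: "finite (Ak k)" for k by (simp add: Ak_def)
  have hs: "stat ?U h (blk kap) = stat (diagram xi) fst T" using h by (simp add: diagram_fdiag)
  have cardA: "card (Ak k) = lf xi k" for k
  proof -
   have "card (Ak k) = card {c\<in>diagram xi. fst c = k}"
    unfolding Ak_def by (rule stat_row_eq[OF _ card_diagram(1) hs]) simp
   also have "{c\<in>diagram xi. fst c = k} = Pair k ` {..<lf xi k}" by (auto simp: diagram_fdiag fdiag_def)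
   finally show ?thesis by (simp add: card_image inj_on_def)
  qed
  define t where "t = (\<lambda>(k, j)\<in>diagram xi. sorted_list_of_set (Ak k) ! j)"
  have t: "t (k, j) = sorted_list_of_set (Ak k) ! j" if "j < lf xi k" for k j
   using that by (simp add: t_def diagram_fdiag fdiag_def)
  have tA: "bij_betw (%j. t (k, j)) {..<lf xi k} (Ak k)" for k
  proof -
   have "bij_betw (%j. sorted_list_of_set (Ak k) ! j) {..<length (sorted_list_of_set (Ak k))} (set (sorted_list_of_set (Ak k)))"
    by (rule bij_betw_nth) (auto simp: finA)
   then have "bij_betw (%j. sorted_list_of_set (Ak k) ! j) {..<lf xi k} (Ak k)" using finA cardA by simp
   then show ?thesis using bij_betw_cong[of "{..<lf xi k}" "%j. t (k, j)" "%j. sorted_list_of_set (Ak k) ! j" "Ak k"] t by simp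
  qed
  have tmem: "t (k, j) : Ak k" if "j < lf xi k" for k j using bij_betwE[OF tA] that by blast
  have row: "t (k, j) < t (k, j')" if "j < j'" "j' < lf xi k" for k j j'
   using that sorted_wrt_nth_less[OF strict_sorted_list_of_set[of "Ak k"], of j j'] cardA[of k] finA by (simp add: t)
  have tb: "bij_betw t (diagram xi) ?U"
  proof -
   have "inj_on t (diagram xi)"
   proof (rule inj_onI)
    fix c c' assume c: "c : diagram xi" "c' : diagram xi" "t c = t c'"
    obtain k j k' j' where kj: "c = (k, j)" "c' = (k', j')" by (cases c; cases c')
    have jl: "j < lf xi k" "j' < lf xi k'" using c kj by (auto simp: diagram_fdiag fdiag_def)
    have "k = k'" using tmem[OF jl(1)] tmem[OF jl(2)] c kj by (simp add: Ak_def)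
    then show "c = c'" using jl c kj inj_onD[OF bij_betw_imp_inj_on[OF tA[of k]], of j j'] by simp
   qed
   moreover have "t ` diagram xi <= ?U" using tmem by (auto simp: diagram_fdiag fdiag_def Ak_def)
   ultimately show ?thesis using card_diagram[of xi] by (simp add: bij_betw_def card_image card_subset_eq)
  qed
  \<comment> \<open>Along a row both sequences increase weakly and take every value equally
    often.\<close>
  have type: "blk kap (t (k, j)) = T (k, j)" if "j < lf xi k" for k j
  proof (rule weak_enumeration_unique[where n = "lf xi k" and f = "%j. blk kap (t (k, j))" and g = "%j. T (k, j)", OF _ _ _ that])
   fix a b assume ab: "a < b" "b < lf xi k"
   show "blk kap (t (k, a)) <= blk kap (t (k, b))"
    by (rule blk_mono) (use row[OF ab] tmem[of a k] tmem[of b k] ab i in \<open>auto simp: Ak_def\<close>)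
   show "T (k, a) <= T (k, b)" using SD(3)[OF ab] .
  next
   fix c
   have "card {j. j < lf xi k & blk kap (t (k, j)) = c} = card {x\<in>?U. h x = k & blk kap x = c}"
   proof (rule bij_betw_same_card[of "%j. t (k, j)"])
    show "bij_betw (%j. t (k, j)) {j. j < lf xi k & blk kap (t (k, j)) = c} {x\<in>?U. h x = k & blk kap x = c}"
    proof (rule bij_betw_imageI)
     show "inj_on (%j. t (k, j)) {j. j < lf xi k & blk kap (t (k, j)) = c}"
      by (rule inj_on_subset[OF bij_betw_imp_inj_on[OF tA[of k]]]) auto
     have "Ak k = (%j. t (k, j)) ` {..<lf xi k}" using bij_betw_imp_surj_on[OF tA[of k]] by simp
     then have "{x\<in>Ak k. blk kap x = c} = (%j. t (k, j)) ` {j. j < lf xi k & blk kap (t (k, j)) = c}" by auto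
     then show "(%j. t (k, j)) ` {j. j < lf xi k & blk kap (t (k, j)) = c} = {x\<in>?U. h x = k & blk kap x = c}"
      by (simp add: Ak_def conj_assoc)
    qed
   qed
   also have "... = card {p\<in>diagram xi. fst p = k & T p = c}"
    using fun_cong[OF fun_cong[OF hs, of k], of c] by (simp add: stat_def)
   also have "{p\<in>diagram xi. fst p = k & T p = c} = Pair k ` {j. j < lf xi k & T (k, j) = c}"
    by (auto simp: diagram_fdiag fdiag_def)
   finally show "card {j. j < lf xi k & blk kap (t (k, j)) = c} = card {j. j < lf xi k & T (k, j) = c}"
    by (simp add: card_image inj_on_def)
  qed
  have "standard xi t" unfolding standard_def
  proof (intro conjI allI impI)
   show "t : extensional (diagram xi)" by (auto simp: t_def extensional_def)
   show "bij_betw t (diagram xi) ?U" by (rule tb)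
  next
   fix k j j' assume "(k, j) : diagram xi & (k, j') : diagram xi & j < j'"
   then show "t (k, j) < t (k, j')" using row by (simp add: diagram_fdiag fdiag_def)
  next
   fix k k' j assume c: "(k, j) : diagram xi & (k', j) : diagram xi & k < k'"
   then have l: "j < lf xi k" "j < lf xi k'" by (auto simp: diagram_fdiag fdiag_def)
   have "blk kap (t (k, j)) < blk kap (t (k', j))" using SD(4)[of k k' j] l c by (simp add: type)
   then show "t (k, j) < t (k', j)" using blk_mono[of "t (k', j)" kap "t (k, j)"] tmem l i by (force simp: Ak_def)
  qed
  moreover have "tab_type kap xi t = T"
  proof (rule extensionalityI[of _ "diagram xi"])
   fix c assume "c : diagram xi"
   then show "tab_type kap xi t c = T c" using tab_type_eq[OF tb i] type by (cases c) (simp add: diagram_fdiag fdiag_def)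
  qed (use SD(1) in \<open>auto simp: tab_type_def PiE_def\<close>)
  moreover have "rowof xi t = h"
  proof (rule extensionalityI[of _ ?U])
   fix x assume "x : ?U"
   then obtain c where c: "c : diagram xi" "x = t c" using bij_betw_imp_surj_on[OF tb] by (metis imageE)
   then show "rowof xi t x = h x"
    using rowof_cell[OF tb c(1)] tmem[of "snd c" "fst c"] by (cases c) (simp add: diagram_fdiag fdiag_def Ak_def)
  qed (use h in \<open>auto simp: rowof_def\<close>)
  ultimately show ?thesis by blast
 qed
 show ?thesis unfolding bij_betw_def using inj image surj by blast
qed

text \<open>By \<open>murphy_rows\<close> and \<open>rowof_bij\<close> the coefficient counts pairs
  of row assignments with \<open>h o p\<close> equal to \<open>h'\<close> on the points. The second
  determines the first, and the content of \<open>h\<close> under \<open>blk kap\<close> is the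
  content of \<open>h'\<close> under the colouring moved by \<open>p\<close>.\<close>

lemma semi_murphy_cnt:
 assumes kap: "sum_list kap = sum_list xi" "sum_list kap' = sum_list xi"
  and S: "semistandard xi kap S" and T: "semistandard xi kap' T" and p: "p permutes {1..sum_list xi}"
 shows "semi_murphy xi kap kap' S T p =
  int (cnt {1..sum_list xi} (%x. blk kap (p x)) (blk kap') (rt (lf xi) S) (rt (lf xi) T))"
proof -
 let ?U = "{1..sum_list xi}"
 let ?SS = "{s. standard xi s & tab_type kap xi s = S}" and ?TT = "{t. standard xi t & tab_type kap' xi t = T}"
 define HS where "HS = {h : extensional ?U. stat ?U h (blk kap) = rt (lf xi) S}"
 define HT where "HT = {h : extensional ?U. stat ?U h (blk kap') = rt (lf xi) T}"
 have fin: "finite HS" "finite HT" unfolding HS_def HT_def by (rule finite_stat_set, simp)+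
 note bS = rowof_bij[OF kap(1) S, folded HS_def] and bT = rowof_bij[OF kap(2) T, folded HT_def]
 have pU: "p x : ?U \<longleftrightarrow> x : ?U" for x by (rule permutes_in_image[OF p])
 have "semi_murphy xi kap kap' S T p = (\<Sum>s\<in>?SS. \<Sum>t\<in>?TT. of_bool (\<forall>x\<in>?U. rowof xi s (p x) = rowof xi t x))"
  unfolding semi_murphy_def by (intro sum.cong refl murphy_rows[OF _ _ p]) (auto simp: standard_def)
 also have "... = (\<Sum>h\<in>HS. \<Sum>h'\<in>HT. of_bool (\<forall>x\<in>?U. h (p x) = h' x))"
  by (subst sum.reindex_bij_betw[OF bS, symmetric], subst sum.reindex_bij_betw[OF bT, symmetric]) (rule refl)
 also have "... = (\<Sum>h'\<in>HT. \<Sum>h\<in>HS. of_bool (\<forall>x\<in>?U. h (p x) = h' x))" by (rule sum.swap)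
 also have "... = (\<Sum>h'\<in>HT. of_bool (stat ?U h' (%x. blk kap (p x)) = rt (lf xi) S))"
 proof (rule sum_eq)
  fix h' assume h': "h' : HT"
  define h0 where "h0 = (\<lambda>x\<in>?U. h' (pinv p x))"
  have h0: "h0 (p x) = h' x" if "x : ?U" for x using that pU permutes_inverses(2)[OF p] by (simp add: h0_def)
  have st: "stat ?U h' (%x. blk kap (p x)) = stat ?U h0 (blk kap)"
   by (rule stat_bij[OF permutes_imp_bij[OF p]]) (auto simp: h0)
  have uniq: "(\<forall>x\<in>?U. h (p x) = h' x) \<longleftrightarrow> h = h0" if "h : HS" for h
  proof
   assume a: "\<forall>x\<in>?U. h (p x) = h' x"
   show "h = h0"
   proof (rule extensionalityI[of _ ?U])
    fix y assume y: "y : ?U"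
    then have "pinv p y : ?U" using permutes_in_image[OF permutes_inv[OF p]] by simp
    then show "h y = h0 y" using a y permutes_inverses(1)[OF p, of y] by (metis h0)
   qed (use that in \<open>auto simp: HS_def h0_def\<close>)
  qed (use h0 in simp)
  have "(\<Sum>h\<in>HS. of_bool (\<forall>x\<in>?U. h (p x) = h' x)) = (\<Sum>h\<in>HS. if h = h0 then 1 else (0::int))"
   using uniq by (intro sum.cong refl) auto
  also have "... = of_bool (h0 : HS)" using fin by (simp add: sum.delta)
  also have "h0 : HS \<longleftrightarrow> stat ?U h' (%x. blk kap (p x)) = rt (lf xi) S"
   unfolding st by (simp add: HS_def h0_def)
  finally show "(\<Sum>h\<in>HS. of_bool (\<forall>x\<in>?U. h (p x) = h' x)) =
    (of_bool (stat ?U h' (%x. blk kap (p x)) = rt (lf xi) S) :: int)" .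
 qed
 also have "... = int (card {h'\<in>HT. stat ?U h' (%x. blk kap (p x)) = rt (lf xi) S})"
  using fin by (simp add: of_bool_def sum.If_cases Int_def)
 also have "{h'\<in>HT. stat ?U h' (%x. blk kap (p x)) = rt (lf xi) S} =
   {h : extensional ?U. stat ?U h (%x. blk kap (p x)) = rt (lf xi) S & stat ?U h (blk kap') = rt (lf xi) T}"
  by (auto simp: HT_def)
 finally show ?thesis by (simp add: cnt_def)
qed

section \<open>Cell elements as counting functions\<close>

lemma phi_bij: assumes "finite C" shows "bij_betw (phi C) {1..card C} C"
proof -
 let ?xs = "sorted_list_of_set C"
 have "bij_betw (%j. ?xs ! j) {..<length ?xs} (set ?xs)" by (rule bij_betw_nth) auto
 then have a: "bij_betw (%j. ?xs ! j) {..<card C} C" using assms by simp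
 have b: "bij_betw (%j. j - 1) {1..card C} {..<card C}" by (rule bij_betw_byWitness[where f' = Suc]) auto
 have "bij_betw ((%j. ?xs ! j) o (%j. j - 1)) {1..card C} C" by (rule bij_betw_trans[OF b a])
 then show ?thesis using bij_betw_cong[of "{1..card C}" "phi C" "(%j. ?xs ! j) o (%j. j - 1)" C] by (simp add: phi_def)
qed

lemma phi_0: "j ~: {1..card C} ==> phi C j = 0" unfolding phi_def by (rule if_not_P)

lemma phi_mono: assumes "finite C" "j : {1..card C}" "k : {1..card C}" "j <= k" shows "phi C j <= phi C k"
proof (cases "j = k")
 case False
 then have "sorted_list_of_set C ! (j - 1) < sorted_list_of_set C ! (k - 1)"
  using assms by (intro sorted_wrt_nth_less[OF strict_sorted_list_of_set]) auto
 then show ?thesis using assms by (simp add: phi_def)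
qed simp

definition pos :: "nat set rel => nat set set => nat set => nat" where
 "pos leq D d = card {S' : D. (S', d) : leq}"

lemma disjoint_families_D:
 assumes "D : disjoint_families i r"
 shows "finite D" "card D = i" "d : D ==> d <= {1..r}" "d : D ==> d ~= {}"
  "d : D ==> d' : D ==> x : d ==> x : d' ==> d = d'"
proof -
 have D: "D <= Pow {1..r} - {{}}" "disjoint D" "card D = i" using assms by (auto simp: disjoint_families_def)
 have "finite (Pow {1..r})" by simp
 then show "finite D" using D(1) by (meson Diff_subset finite_subset)
 show "card D = i" by (rule D)
 show "d : D ==> d <= {1..r}" "d : D ==> d ~= {}" using D(1) by auto
 show "d : D ==> d' : D ==> x : d ==> x : d' ==> d = d'" using D(2) by (auto simp: disjoint_def)
qed

lemma psi_eq:
 assumes "D : disjoint_families i r" shows "d : D ==> x : d ==> psi leq D x = pos leq D d" "x ~: \<Union>D ==> psi leq D x = 0"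
proof -
 assume d: "d : D" "x : d"
 have "(THE S. S : D & x : S) = d" by (rule the_equality) (use d disjoint_families_D(5)[OF assms] in auto)
 then show "psi leq D x = pos leq D d" using d by (auto simp: psi_def pos_def)
qed (simp add: psi_def)

lemma pos_bij:
 assumes lin: "linear_order_on (Pow {1..r}) leq" and D: "D : disjoint_families i r"
 shows "bij_betw (pos leq D) D {1..i}"
  and "d : D ==> d' : D ==> (d, d') : leq ==> pos leq D d <= pos leq D d'"
proof -
 note DD = disjoint_families_D[OF D]
 have refl: "(d, d) : leq" if "d : D" for d
  using lin DD(3)[OF that] by (auto simp: linear_order_on_def partial_order_on_def preorder_on_def refl_on_def)
 have trans: "(a, c) : leq" if "(a, b) : leq" "(b, c) : leq" for a b c
  using lin that by (auto simp: linear_order_on_def partial_order_on_def preorder_on_def dest: transD)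
 have anti: "a = b" if "(a, b) : leq" "(b, a) : leq" for a b
  using lin that by (auto simp: linear_order_on_def partial_order_on_def dest: antisymD)
 have total: "(a, b) : leq \<or> (b, a) : leq" if "a : D" "b : D" "a ~= b" for a b
  using lin that DD(3) by (auto simp: linear_order_on_def total_on_def)
 show mono: "pos leq D d <= pos leq D d'" if "d : D" "d' : D" "(d, d') : leq" for d d'
  unfolding pos_def by (rule card_mono) (use DD(1) that trans in auto)
 have strict: "pos leq D d < pos leq D d'" if "d : D" "d' : D" "(d, d') : leq" "d ~= d'" for d d' unfolding pos_def
 proof (rule psubset_card_mono)
  show "{S' : D. (S', d) : leq} \<subset> {S' : D. (S', d') : leq}" using that trans refl anti by blast
 qed (use DD(1) in simp)
 have inj: "inj_on (pos leq D) D"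
 proof (rule inj_onI)
  fix d d' assume d: "d : D" "d' : D" "pos leq D d = pos leq D d'"
  show "d = d'"
  proof (rule ccontr)
   assume "d ~= d'"
   then show False using total[OF d(1,2)] strict[OF d(1,2)] strict[OF d(2,1)] d(3) by auto
  qed
 qed
 have "pos leq D ` D <= {1..i}"
 proof
  fix j assume "j : pos leq D ` D"
  then obtain d where d: "d : D" "j = pos leq D d" by blast
  have "card {d} <= pos leq D d" unfolding pos_def by (rule card_mono) (use DD(1) d refl in auto)
  moreover have "pos leq D d <= card D" unfolding pos_def by (rule card_mono) (use DD(1) in auto)
  ultimately show "j : {1..i}" using d DD(2) by simp
 qed
 then show "bij_betw (pos leq D) D {1..i}" using inj DD(2) by (simp add: bij_betw_def card_image card_subset_eq)
qed

context gs_data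
begin

lemma fam_disjoint: assumes m: "m : tau r" shows "fam m : disjoint_families (card (im m)) r"
  "bij_betw (%y. m -` {y}) (im m) (fam m)"
proof -
 have ne: "m -` {y} ~= {}" "m -` {y} <= {1..r}" if "y : im m" for y using that im_iff[OF m] fiber_subset[OF m] by auto
 have inj: "inj_on (%y. m -` {y}) (im m)"
 proof (rule inj_onI)
  fix y z assume yz: "y : im m" "z : im m" "m -` {y} = m -` {z}"
  obtain x where "x : m -` {y}" using ne(1)[OF yz(1)] by blast
  then show "y = z" using yz(3) by auto
 qed
 then show "bij_betw (%y. m -` {y}) (im m) (fam m)" by (simp add: fam_def bij_betw_def)
 have "card (fam m) = card (im m)" unfolding fam_def by (rule card_image[OF inj])
 moreover have "disjoint (fam m)" by (auto simp: disjoint_def fam_def)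
 ultimately show "fam m : disjoint_families (card (im m)) r" using ne by (auto simp: disjoint_families_def fam_def)
qed

context
 fixes leq :: "nat set rel" assumes lin: "linear_order_on (Pow {1..r}) leq"
begin

text \<open>Each \<open>d\<close> in \<open>D\<close> is the fibre over the point of
  \<open>C\<close> that \<open>p\<close> assigns to its position, so image and fibres recover
  \<open>C\<close> and \<open>D\<close> for every permutation \<open>p\<close>.\<close>

lemma phi_psi:
 assumes C: "C : subsets i r" and D: "D : disjoint_families i r" and p: "p permutes {1..i}"
 defines "m == phi C o p o psi leq D"
 shows "d : D ==> x : d ==> m x = phi C (p (pos leq D d))" "x ~: \<Union>D ==> m x = 0"
  "m : tau r" "im m = C" "fam m = D" "d : D ==> m -` {phi C (p (pos leq D d))} = d"
proof -
 have C': "C <= {1..r}" "card C = i" "finite C" using C finite_subset[of C "{1..r}"] by (auto simp: subsets_def)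
 note DD = disjoint_families_D[OF D]
 note pb = pos_bij(1)[OF lin D]
 have phb: "bij_betw (phi C) {1..i} C" using phi_bij[OF C'(3)] C'(2) by simp
 have p0: "p 0 = 0" using p by (simp add: permutes_not_in)
 show m1: "m x = phi C (p (pos leq D d))" if "d : D" "x : d" for d x using psi_eq(1)[OF D that] by (simp add: m_def)
 show m0: "m x = 0" if "x ~: \<Union>D" for x using psi_eq(2)[OF D that] p0 phi_0[of 0 C] by (simp add: m_def)
 define y where "y d = phi C (p (pos leq D d))" for d
 have yb: "bij_betw y D C"
  using bij_betw_trans[OF bij_betw_trans[OF pb permutes_imp_bij[OF p]] phb] by (simp add: y_def[abs_def] comp_def)
 have yC: "y d : {1..r}" if "d : D" for d using bij_betwE[OF yb] that C' by blast
 have mx: "m x = 0 \<or> (\<exists>d\<in>D. x : d & m x = y d)" for x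
  using m0[of x] m1 by (cases "x : \<Union>D") (auto simp: y_def)
 show mt: "m : tau r"
 proof -
  have "m x <= r" for x using mx[of x] yC by fastforce
  moreover have "m 0 = 0" using m0[of 0] DD(3) by fastforce
  moreover have "m x = 0" if "x > r" for x using m0[of x] DD(3) that by fastforce
  ultimately show ?thesis by (auto simp: tau_def)
 qed
 show imC: "im m = C"
 proof (intro equalityI subsetI)
  fix z assume "z : im m"
  then obtain x where "m x = z" "z ~= 0" using im_iff[OF mt] by blast
  then show "z : C" using mx[of x] bij_betwE[OF yb] by auto
 next
  fix z assume z: "z : C"
  then obtain d where d: "d : D" "y d = z" using bij_betw_imp_surj_on[OF yb] by (metis imageE)
  then obtain x where "x : d" using DD(4) by blast
  then have "m x = z" using m1[OF d(1)] d by (simp add: y_def)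
  moreover have "z ~= 0" using z C' by auto
  ultimately show "z : im m" using im_iff[OF mt] by blast
 qed
 have fib: "m -` {y d} = d" if d: "d : D" for d
 proof (intro equalityI subsetI)
  fix x assume x: "x : m -` {y d}"
  have "y d ~= 0" using yC[OF d] by auto
  then obtain d' where d': "d' : D" "x : d'" "m x = y d'" using mx[of x] x by auto
  then have "y d' = y d" using x by simp
  then have "d' = d" using inj_onD[OF bij_betw_imp_inj_on[OF yb]] d d' by blast
  then show "x : d" using d' by simp
 qed (use m1[OF d] in \<open>simp add: y_def\<close>)
 then show "d : D ==> m -` {phi C (p (pos leq D d))} = d" by (simp add: y_def)
 show "fam m = D" unfolding fam_def imC bij_betw_imp_surj_on[OF yb, symmetric] using fib by (simp add: image_image)
qed

lemma phi_psi_unique: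
 assumes C: "C : subsets i r" and D: "D : disjoint_families i r" and p: "p permutes {1..i}" "p' permutes {1..i}"
  and eq: "phi C o p o psi leq D = phi C o p' o psi leq D"
 shows "p = p'"
proof
 fix j
 have C': "card C = i" "finite C" using C finite_subset[of C "{1..r}"] by (auto simp: subsets_def)
 show "p j = p' j"
 proof (cases "j : {1..i}")
  case True
  then obtain d where d: "d : D" "pos leq D d = j" using bij_betw_imp_surj_on[OF pos_bij(1)[OF lin D]] by (metis imageE)
  obtain x where x: "x : d" using disjoint_families_D(4)[OF D d(1)] by blast
  have "phi C (p j) = phi C (p' j)" using phi_psi(1)[OF C D p(1) d(1) x] phi_psi(1)[OF C D p(2) d(1) x] eq d(2) by simp
  moreover have "p j : {1..card C}" "p' j : {1..card C}"
   unfolding C'(1) permutes_in_image[OF p(1)] permutes_in_image[OF p(2)] by (rule True)+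
  ultimately show ?thesis by (rule inj_onD[OF bij_betw_imp_inj_on[OF phi_bij[OF C'(2)]]])
 next
  case False
  show ?thesis using permutes_not_in[OF p(1) False] permutes_not_in[OF p(2) False] by simp
 qed
qed

text \<open>The permutation compares two enumerations: it sends the position of a fibre in
  \<open>fam m\<close> to the position of its value in \<open>im m\<close>.\<close>

lemma decomposition:
 assumes m: "m : tau r"
 shows "im m : subsets (card (im m)) r" "\<exists>p. p permutes {1..card (im m)} & m = phi (im m) o p o psi leq (fam m)"
proof -
 let ?i = "card (im m)"
 show C: "im m : subsets ?i r" using im_subset[OF m] by (simp add: subsets_def)
 note D = fam_disjoint(1)[OF m] and fb = fam_disjoint(2)[OF m]
 let ?q = "%y. pos leq (fam m) (m -` {y})"
 have qb: "bij_betw ?q (im m) {1..?i}" using bij_betw_trans[OF fb pos_bij(1)[OF lin D]] by (simp add: comp_def)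
 have phb: "bij_betw (phi (im m)) {1..?i} (im m)" by (rule phi_bij[OF finite_im])
 define p where "p j = (if j : {1..?i} then inv_into {1..?i} (phi (im m)) (inv_into (im m) ?q j) else j)" for j
 have "bij_betw (inv_into {1..?i} (phi (im m)) o inv_into (im m) ?q) {1..?i} {1..?i}"
  by (rule bij_betw_trans[OF bij_betw_inv_into[OF qb] bij_betw_inv_into[OF phb]])
 then have "bij_betw p {1..?i} {1..?i}"
  using bij_betw_cong[of "{1..?i}" p "inv_into {1..?i} (phi (im m)) o inv_into (im m) ?q" "{1..?i}"] by (simp add: p_def)
 then have pp: "p permutes {1..?i}" by (rule bij_imp_permutes) (simp only: p_def if_False)
 have key: "phi (im m) (p (?q y)) = y" if y: "y : im m" for y
 proof -
  have "?q y : {1..?i}" using bij_betwE[OF qb] y by blast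
  then have "p (?q y) = inv_into {1..?i} (phi (im m)) (inv_into (im m) ?q (?q y))" by (simp only: p_def if_True)
  also have "inv_into (im m) ?q (?q y) = y" by (rule bij_betw_inv_into_left[OF qb y])
  finally show ?thesis using bij_betw_inv_into_right[OF phb y] by simp
 qed
 have "m x = (phi (im m) o p o psi leq (fam m)) x" for x
 proof (cases "m x = 0")
  case True
  then have "x ~: \<Union> (fam m)" by (auto simp: fam_def im_def)
  then show ?thesis using phi_psi(2)[OF C D pp] True by simp
 next
  case False
  then have y: "m x : im m" using im_iff[OF m] by blast
  then have "m -` {m x} : fam m" by (auto simp: fam_def)
  from phi_psi(1)[OF C D pp this, of x] show ?thesis using key[OF y] by simp
 qed
 then show "\<exists>p. p permutes {1..?i} & m = phi (im m) o p o psi leq (fam m)" using pp by blast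
qed

text \<open>The right-hand side is free of the order that enters \<open>psi\<close>, so membership
  of a family can be decided by exhibiting a map in \<open>M\<close> with these fibres.\<close>

lemma monoid_families_eq: "monoid_families leq M i r = {fam m | m. m : M & card (im m) = i}"
proof (intro equalityI subsetI)
 fix D assume "D : monoid_families leq M i r"
 then obtain al C sig where D: "D : disjoint_families i r" and a: "al : M" "map_index r al = i"
  "C : subsets i r" "sig permutes {1..i}" "al = phi C o sig o psi leq D" by (auto simp: monoid_families_def)
 have "fam al = D" unfolding a(5) by (rule phi_psi(5)[OF a(3) D a(4)])
 moreover have "card (im al) = i" using index_im[OF M_tau[OF a(1)]] a(2) by simp
 ultimately show "D : {fam m | m. m : M & card (im m) = i}" using a(1) by blast
next
 fix D assume "D : {fam m | m. m : M & card (im m) = i}"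
 then obtain m where m: "m : M" "card (im m) = i" "D = fam m" by blast
 note mt = M_tau[OF m(1)]
 obtain p where p: "p permutes {1..i}" "m = phi (im m) o p o psi leq D" using decomposition(2)[OF mt] m by auto
 have "map_index r m = i" using index_im[OF mt] m(2) by simp
 have "\<exists>al\<in>M. map_index r al = i & (\<exists>C\<in>subsets i r. \<exists>sig. sig permutes {1..i} & al = phi C o sig o psi leq D)"
 proof -
  have "im m : subsets i r" using decomposition(1)[OF mt] m(2) by simp
  with p \<open>map_index r m = i\<close> m(1) show ?thesis by (intro bexI[of _ m] conjI bexI[of _ "im m"] exI[of _ p])
 qed
 then show "D : monoid_families leq M i r" using fam_disjoint(1)[OF mt] m by (simp add: monoid_families_def)
qed

text \<open>Because \<open>M\<close> contains all permutations, the image and the permutation in a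
  factorisation can be replaced at will: multiply from the left by a permutation extending the
  induced bijection from \<open>C0\<close> to \<open>C\<close>.\<close>

lemma phi_psi_M:
 assumes C: "C : subsets i r" and D: "D : monoid_families leq M i r" and p: "p permutes {1..i}"
 shows "phi C o p o psi leq D : M"
proof -
 obtain al C0 sig where D': "D : disjoint_families i r" and a: "al : M"
  "C0 : subsets i r" "sig permutes {1..i}" "al = phi C0 o sig o psi leq D" using D by (auto simp: monoid_families_def)
 have fC: "finite C" "card C = i" "C <= {1..r}" "finite C0" "card C0 = i" "C0 <= {1..r}"
  using C a(2) finite_subset[of _ "{1..r}"] by (auto simp: subsets_def)
 have b1: "bij_betw (phi C0 o sig) {1..i} C0"
  using bij_betw_trans[OF permutes_imp_bij[OF a(3)]] phi_bij[OF fC(4)] fC(5) by metis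
 have b2: "bij_betw (phi C o p) {1..i} C" using bij_betw_trans[OF permutes_imp_bij[OF p]] phi_bij[OF fC(1)] fC(2) by metis
 obtain rho where rho: "rho permutes {1..r}" "\<forall>y\<in>C0. rho y = (phi C o p o inv_into {1..i} (phi C0 o sig)) y"
  using extend_permutation[OF bij_betw_trans[OF bij_betw_inv_into[OF b1] b2] fC(6,3)] by blast
 have "phi C o p o psi leq D = rho o al"
 proof
  fix x
  show "(phi C o p o psi leq D) x = (rho o al) x"
  proof (cases "x : \<Union>D")
   case True
   then obtain d where d: "d : D" "x : d" by blast
   let ?j = "pos leq D d"
   have j: "?j : {1..i}" using bij_betwE[OF pos_bij(1)[OF lin D']] d(1) by blast
   have "al x = (phi C0 o sig) ?j" using phi_psi(1)[OF a(2) D' a(3) d] a(4) by simp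
   moreover have "(phi C0 o sig) ?j : C0" using bij_betwE[OF b1] j by blast
   ultimately have "rho (al x) = (phi C o p) ?j" using rho(2) bij_betw_inv_into_left[OF b1 j] by (metis comp_apply)
   then show ?thesis using phi_psi(1)[OF C D' p d] by simp
  next
   case False
   then show ?thesis using phi_psi(2)[OF C D' p False] phi_psi(2)[OF a(2) D' a(3) False] a(4) perm_0[OF rho(1)] by simp
  qed
 qed
 then show ?thesis using M_left[OF rho(1) a(1)] by simp
qed

end

definition lcount :: "nat list => nat set => nat => nat" where
 "lcount mu C c = card {y\<in>C. blk mu y = c}"

definition rcount :: "nat list => nat set set => nat => nat" where
 "rcount nu D c = card {d\<in>D. oi nu d = c}"

text \<open>Orbits of subsets are classified by the number of points in each block; for equal counts
  a matching of the points is extended by \<open>extend_young\<close>.\<close>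

lemma left_orbit_iff:
 assumes mu: "mu : Comp" and Q: "Q : left_orbits mu i r" and C: "C : Q"
 shows "C : subsets i r" "C' : Q \<longleftrightarrow> C' : subsets i r & lcount mu C' = lcount mu C"
  "Q = {rho ` C | rho. rho : young mu}"
proof -
 have sr: "sum_list mu = r" using comps_D(1)[OF mu] .
 obtain C0 where C0: "C0 : subsets i r" "Q = {rho ` C0 | rho. rho : young mu}" using Q by (auto simp: left_orbits_def)
 have yp: "rho permutes {1..r}" if "rho : young mu" for rho using young_permutes[OF that] sr by simp
 have sub: "rho ` C1 : subsets i r" "lcount mu (rho ` C1) = lcount mu C1" if rho: "rho : young mu" and C1: "C1 : subsets i r" for rho C1
 proof -
  have inj: "inj_on rho A" for A using permutes_inj[OF yp[OF rho]] inj_on_subset by blast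
  show "rho ` C1 : subsets i r" using C1 permutes_image[OF yp[OF rho]] by (auto simp: subsets_def card_image[OF inj])
  show "lcount mu (rho ` C1) = lcount mu C1"
  proof
   fix c
   have "blk mu (rho y) = blk mu y" if "y : C1" for y using young_blk[OF rho, of y] that C1 sr by (auto simp: subsets_def)
   then have "{y\<in>rho ` C1. blk mu y = c} = rho ` {y\<in>C1. blk mu y = c}" by auto
   then show "lcount mu (rho ` C1) c = lcount mu C1 c" by (simp add: lcount_def card_image[OF inj])
  qed
 qed
 obtain rho0 where rho0: "rho0 : young mu" "C = rho0 ` C0" using C C0 by auto
 show Cs: "C : subsets i r" using sub(1)[OF rho0(1) C0(1)] rho0(2) by simp
 show Q2: "Q = {rho ` C | rho. rho : young mu}"
 proof (intro equalityI subsetI)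
  fix E assume "E : Q"
  then obtain rho where r: "rho : young mu" "E = rho ` C0" using C0 by auto
  have "C0 = pinv rho0 ` C" unfolding rho0(2) image_image using permutes_inverses(2)[OF yp[OF rho0(1)]] by simp
  then have "E = (rho o pinv rho0) ` C" unfolding r(2) by (simp add: image_comp)
  then show "E : {rho ` C | rho. rho : young mu}" using young_comp[OF r(1) young_inv[OF rho0(1)]] by blast
 next
  fix E assume "E : {rho ` C | rho. rho : young mu}"
  then obtain rho where r: "rho : young mu" "E = rho ` C" by auto
  then have "E = (rho o rho0) ` C0" using rho0(2) by (simp add: image_comp)
  then show "E : Q" using young_comp[OF r(1) rho0(1)] C0(2) by blast
 qed
 show "C' : Q \<longleftrightarrow> C' : subsets i r & lcount mu C' = lcount mu C"
 proof
  assume "C' : Q"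
  then show "C' : subsets i r & lcount mu C' = lcount mu C" using Q2 sub Cs by auto
 next
  assume a: "C' : subsets i r & lcount mu C' = lcount mu C"
  have f: "finite C" "finite C'" "C <= {1..r}" "C' <= {1..r}"
   using a Cs finite_subset[of _ "{1..r}"] by (auto simp: subsets_def)
  have "card {y\<in>C. blk mu y = c} = card {y\<in>C'. blk mu y = c}" for c
   using fun_cong[OF conjunct2[OF a], of c] by (simp add: lcount_def)
  from ex_bij_betw_fibers[OF f(1,2) this] obtain b where b: "bij_betw b C C'" "\<forall>y\<in>C. blk mu (b y) = blk mu y" by blast
  obtain rho where rho: "rho : young mu" "\<forall>y\<in>C. rho y = b y"
   using extend_young[OF b(1), of mu] b(2) f sr by blast
  have "rho ` C = C'" using rho(2) bij_betw_imp_surj_on[OF b(1)] by (metis image_cong)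
  then show "C' : Q" unfolding Q2 using rho(1) by blast
 qed
qed

lemma left_orbit_comp_nth:
 assumes mu: "mu : Comp" and Q: "Q : left_orbits mu i r" and C: "C : Q" and c: "c < n"
 shows "left_orbit_comp mu Q ! c = lcount mu C c"
proof -
 have "(SOME C. C : Q) : Q" using C by (rule someI)
 note S = left_orbit_iff(2)[OF mu Q C, of "SOME C. C : Q", THEN iffD1, OF this]
 have "left_orbit_comp mu Q ! c = card (block mu c \<inter> (SOME C. C : Q))"
  using c comps_D(2)[OF mu] by (simp add: left_orbit_comp_def left_comp_def)
 also have "block mu c \<inter> (SOME C. C : Q) = {y\<in>(SOME C. C : Q). blk mu y = c}"
  using S blk_iff(2)[of _ mu c] c comps_D[OF mu] by (auto simp: subsets_def)
 finally show ?thesis using S by (simp add: lcount_def[symmetric])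
qed

lemma left_orbit_comp_length: "mu : Comp ==> length (left_orbit_comp mu Q) = n"
 by (simp add: left_orbit_comp_def left_comp_def comps_D)

lemma left_orbit_exists:
 assumes "mu : Comp" "C : subsets i r"
 shows "\<exists>Q\<in>left_orbits mu i r. C : Q"
 using assms id_young[of mu] unfolding left_orbits_def by (force intro!: exI[of _ id])

lemma fam_comp_right:
 assumes "ta permutes {1..r}" "m : tau r" shows "fam (m o ta) = (%d. ta -` d) ` fam m" "im (m o ta) = im m"
proof -
 show i: "im (m o ta) = im m" using im_comp(1)[OF permutes_id assms] by simp
 show "fam (m o ta) = (%d. ta -` d) ` fam m" unfolding fam_def i image_image by (simp add: vimage_comp)
qed

text \<open>Orbits of families are classified by the number of members in each orbit on the power
  set. For equal counts, take maps in \<open>M\<close> with these families of fibres; the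
  permutation supplied by \<open>match_right\<close> carries one family to the other.\<close>

lemma right_orbit_iff:
 assumes nu: "nu : Comp" and Q: "Q : RO nu i" and D: "D : Q"
 shows "D : monoid_families (ord nu) M i r"
  "D' : Q \<longleftrightarrow> D' : monoid_families (ord nu) M i r & rcount nu D' = rcount nu D"
proof -
 have sr: "sum_list nu = r" using comps_D(1)[OF nu] .
 note lin = ords_D(3)[OF nu]
 note mf = monoid_families_eq[OF lin, of i]
 obtain D0 where D0: "D0 : monoid_families (ord nu) M i r" "Q = {(%d. ta -` d) ` D0 | ta. ta : young nu}"
  using Q by (auto simp: right_orbits_def)
 have yp: "rho permutes {1..r}" if "rho : young nu" for rho using young_permutes[OF that] sr by simp
 have sub: "(%d. ta -` d) ` D1 : monoid_families (ord nu) M i r" "rcount nu ((%d. ta -` d) ` D1) = rcount nu D1"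
  if ta: "ta : young nu" and D1: "D1 : monoid_families (ord nu) M i r" for ta D1
 proof -
  obtain m where m: "m : M" "card (im m) = i" "D1 = fam m" using D1 unfolding mf by blast
  note mt = M_tau[OF m(1)]
  show "(%d. ta -` d) ` D1 : monoid_families (ord nu) M i r"
   unfolding mf using M_right[OF yp[OF ta] m(1)] fam_comp_right[OF yp[OF ta] mt] m by (metis (mono_tags, lifting) mem_Collect_eq)
  have D1s: "d <= {1..r}" if "d : D1" for d using that disjoint_families_D(3)[OF fam_disjoint(1)[OF mt]] m(3) by blast
  have inj: "inj_on (%d. ta -` d) A" for A using permutes_surj[OF yp[OF ta]] by (metis inj_onI surj_image_vimage_eq)
  show "rcount nu ((%d. ta -` d) ` D1) = rcount nu D1"
  proof
   fix c
   have "{d\<in>(%d. ta -` d) ` D1. oi nu d = c} = (%d. ta -` d) ` {d\<in>D1. oi nu d = c}"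
    using oi_vimage[OF nu D1s ta] by auto
   then show "rcount nu ((%d. ta -` d) ` D1) c = rcount nu D1 c" by (simp add: rcount_def card_image[OF inj])
  qed
 qed
 obtain ta0 where ta0: "ta0 : young nu" "D = (%d. ta0 -` d) ` D0" using D D0 by auto
 show Ds: "D : monoid_families (ord nu) M i r" using sub(1)[OF ta0(1) D0(1)] ta0(2) by simp
 have rD: "rcount nu D = rcount nu D0" using sub(2)[OF ta0(1) D0(1)] ta0(2) by simp
 show "D' : Q \<longleftrightarrow> D' : monoid_families (ord nu) M i r & rcount nu D' = rcount nu D"
 proof
  assume "D' : Q"
  then show "D' : monoid_families (ord nu) M i r & rcount nu D' = rcount nu D" using D0 sub rD by auto
 next
  assume a: "D' : monoid_families (ord nu) M i r & rcount nu D' = rcount nu D"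
  obtain m where m: "m : M" "card (im m) = i" "D0 = fam m" using D0(1) unfolding mf by blast
  obtain m' where m': "m' : M" "card (im m') = i" "D' = fam m'" using a unfolding mf by blast
  note mt = M_tau[OF m(1)] and mt' = M_tau[OF m'(1)]
  have tr: "card {y\<in>im m. oi nu (m -` {y}) = c} = rcount nu (fam m) c" if "m : tau r" for m c
  proof -
   have "bij_betw (%y. m -` {y}) {y\<in>im m. oi nu (m -` {y}) = c} {d\<in>fam m. oi nu d = c}"
   proof (rule bij_betw_imageI)
    show "inj_on (%y. m -` {y}) {y\<in>im m. oi nu (m -` {y}) = c}"
     by (rule inj_on_subset[OF bij_betw_imp_inj_on[OF fam_disjoint(2)[OF that]]]) auto
   qed (auto simp: fam_def)
   then show ?thesis unfolding rcount_def by (rule bij_betw_same_card)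
  qed
  have "card {y\<in>im m'. oi nu (m' -` {y}) = c} = card {y\<in>im m. oi nu (m -` {y}) = c}" for c
   using tr[OF mt] tr[OF mt'] a rD m(3) m'(3) by simp
  from ex_bij_betw_fibers[OF finite_im finite_im this] obtain b where
   b: "bij_betw b (im m') (im m)" "!!y. y : im m' ==> oi nu (m -` {b y}) = oi nu (m' -` {y})" by blast
  obtain ta where ta: "ta : young nu" "!!x. m (ta x) = (if m' x = 0 then 0 else b (m' x))"
   using match_right[OF nu mt' mt b] by blast
  have b0: "b y ~= 0" if "y : im m'" for y using bij_betwE[OF b(1)] that by (auto simp: im_def)
  have "ta -` (m -` {b y}) = m' -` {y}" if y: "y : im m'" for y
  proof (intro equalityI subsetI)
   fix x assume "x : ta -` (m -` {b y})"
   then have "(if m' x = 0 then 0 else b (m' x)) = b y" using ta(2)[of x] by simp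
   then have "m' x ~= 0" "b (m' x) = b y" using b0[OF y] by (auto split: if_splits)
   moreover have "m' x : im m'" using calculation im_iff[OF mt'] by blast
   ultimately show "x : m' -` {y}" using inj_onD[OF bij_betw_imp_inj_on[OF b(1)]] y by blast
  next
   fix x assume "x : m' -` {y}"
   moreover have "y ~= 0" using y by (simp add: im_def)
   ultimately show "x : ta -` (m -` {b y})" using ta(2)[of x] by simp
  qed
  then have "fam m' = (%d. ta -` d) ` (%y. m -` {b y}) ` im m'" unfolding fam_def image_image by simp
  also have "(%y. m -` {b y}) ` im m' = fam m" unfolding fam_def bij_betw_imp_surj_on[OF b(1), symmetric] image_image ..
  finally show "D' : Q" unfolding D0(2) m'(3) m(3) using ta(1) by blast
 qed
qed

lemma right_orbit_comp_nth:
 assumes nu: "nu : Comp" and Q: "Q : RO nu i" and D: "D : Q"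
  and c: "c < length (orbs nu)"
 shows "right_orbit_comp (orbs nu) Q ! c = rcount nu D c"
proof -
 let ?D = "SOME D. D : Q"
 have "?D : Q" using D by (rule someI)
 note S = right_orbit_iff(2)[OF nu Q D, of ?D, THEN iffD1, OF this]
 have "?D : disjoint_families i r" using S by (simp add: monoid_families_def)
 from disjoint_families_D(3)[OF this] have "d <= {1..r}" if "d : ?D" for d using that .
 then have "?D \<inter> orbs nu ! c = {d\<in>?D. oi nu d = c}" using oi_props(2)[OF nu _ c] by blast
 then have "right_orbit_comp (orbs nu) Q ! c = rcount nu ?D c"
  using c by (simp add: right_orbit_comp_def right_comp_def rcount_def)
 then show ?thesis using S by simp
qed

lemma right_orbit_comp_length: "length (right_orbit_comp os Q) = length os"
 by (simp add: right_orbit_comp_def right_comp_def)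

lemma right_orbit_exists:
 assumes "D : monoid_families (ord nu) M i r"
 shows "\<exists>Q\<in>RO nu i. D : Q"
 using assms id_young[of nu] unfolding right_orbits_def by (force intro!: exI[of _ id])

end

lemma bij_betw_filter: assumes "bij_betw f A B" shows "bij_betw f {x\<in>A. P (f x)} {y\<in>B. P y}"
proof (rule bij_betw_imageI)
 show "f ` {x\<in>A. P (f x)} = {y\<in>B. P y}" unfolding bij_betw_imp_surj_on[OF assms, symmetric] by blast
 show "inj_on f {x\<in>A. P (f x)}" by (rule inj_on_subset[OF bij_betw_imp_inj_on[OF assms]]) auto
qed

text \<open>A single row assignment with both contents suffices: adding up its content over the rows
  gives the number of points of each colour, and the same sums are the contents of \<open>S\<close>
  and \<open>T\<close>.\<close>

lemma cnt_margins:
 assumes "finite Z" "l : Par" and nz: "cnt Z u v (rt l S) (rt l T) ~= 0"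
 shows "card {x\<in>Z. u x = c} = card {p\<in>fdiag l. S p = c}" "card {x\<in>Z. v x = c} = card {p\<in>fdiag l. T p = c}"
  "card Z = psize l"
proof -
 obtain h where h: "stat Z h u = rt l S" "stat Z h v = rt l T"
 proof (rule ccontr)
  assume "~ thesis"
  then have "{h : extensional Z. stat Z h u = rt l S & stat Z h v = rt l T} = {}" (is "?Z = {}") using that by fastforce
  then have "card ?Z = 0" by (simp only: card.empty)
  then show False using nz unfolding cnt_def by simp
 qed
 have fin: "finite (fdiag l)" by (rule finite_fdiag[OF assms(2)])
 have row: "card {x\<in>Z. h x = k} = card {p\<in>fdiag l. fst p = k}" for k by (rule stat_row_eq[OF assms(1) fin h(1)])
 have col': "card {x\<in>Z'. w x = c} = (\<Sum>k | stat Z' h' w k c ~= 0. stat Z' h' w k c)" if "finite Z'"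
  for Z' :: "(nat \<times> nat) set" and h' w c
 proof -
  have "{k. stat Z' h' w k c ~= 0} = h' ` {x\<in>Z'. w x = c}" unfolding stat_pos_iff[OF that] by auto
  then have "card {x\<in>Z'. w x = c} = (\<Sum>k | stat Z' h' w k c ~= 0. card {x\<in>{x\<in>Z'. w x = c}. h' x = k})"
   using that by (intro card_fibers) auto
  then show ?thesis unfolding stat_def by (simp add: conj_ac)
 qed
 have colZ: "card {x\<in>Z. w x = c} = (\<Sum>k | stat Z h w k c ~= 0. stat Z h w k c)" for w c
 proof -
  have "{k. stat Z h w k c ~= 0} = h ` {x\<in>Z. w x = c}" unfolding stat_pos_iff[OF assms(1)] by auto
  then have "card {x\<in>Z. w x = c} = (\<Sum>k | stat Z h w k c ~= 0. card {x\<in>{x\<in>Z. w x = c}. h x = k})"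
   using assms(1) by (intro card_fibers) auto
  then show ?thesis unfolding stat_def by (simp add: conj_ac)
 qed
 show "card {x\<in>Z. u x = c} = card {p\<in>fdiag l. S p = c}" unfolding colZ col'[OF fin, of S c fst] h(1) ..
 show "card {x\<in>Z. v x = c} = card {p\<in>fdiag l. T p = c}" unfolding colZ col'[OF fin, of T c fst] h(2) ..
 have "card Z = (\<Sum>k\<in>h ` Z \<union> fst ` fdiag l. card {x\<in>Z. h x = k})"
  by (rule card_fibers) (use assms fin in auto)
 also have "... = (\<Sum>k\<in>h ` Z \<union> fst ` fdiag l. card {p\<in>fdiag l. fst p = k})" using row by simp
 also have "... = card (fdiag l)" by (rule card_fibers[symmetric]) (use assms fin in auto)
 finally show "card Z = psize l" using card_fdiag[OF assms(2)] by simp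
qed

lemma Par_lf: assumes "l : Par" shows "\<exists>xi\<in>partitions (psize l). lf xi = l"
proof -
 define k where "k = card {i. 0 < l i}"
 have fin: "finite {i. 0 < l i}" using column_eq(2)[OF assms, of 0] by simp
 have "{i. 0 < l i} = {..<k}" unfolding k_def
 proof (rule initial_segment[OF fin])
  fix x y assume "x < y" "y : {i. 0 < l i}"
  then show "x : {i. 0 < l i}" using Par_le[OF assms, of x y] by simp
 qed
 then have k: "0 < l i \<longleftrightarrow> i < k" for i by auto
 let ?xi = "map l [0..<k]"
 have lf: "lf ?xi = l" using k by (auto simp: lf_def fun_eq_iff)
 have "sorted_wrt (\<ge>) ?xi" by (auto simp: sorted_wrt_iff_nth_less intro: Par_le[OF assms])
 moreover have "0 ~: set ?xi"
 proof
  assume "0 : set ?xi"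
  then obtain j where "j < k" "l j = 0" by auto
  then show False using k[of j] by simp
 qed
 moreover have "sum_list ?xi = psize l"
 proof -
  have "l j = 0" if "k <= j" for j using k[of j] that by simp
  from psize_eq[OF this] show ?thesis by (simp add: interv_sum_list_conv_sum_set_nat atLeast0LessThan)
 qed
 ultimately have "?xi : partitions (psize l)" by (simp add: partitions_def)
 then show ?thesis using lf by blast
qed

section \<open>Values of the cell elements and realisable colour matrices\<close>

context gs_data
begin

definition vf :: "nat list => (nat => nat) => nat => nat" where "vf nu m y = oi nu (m -` {y})"

lemma cm_vf: "cm mu nu m = cmat (im m) (blk mu) (vf nu m)" by (simp add: cm_def vf_def[abs_def])

lemma rcount_fam: assumes "m : tau r" shows "rcount nu (fam m) c = card {y\<in>im m. vf nu m y = c}"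
proof -
 have "bij_betw (%y. m -` {y}) {y\<in>im m. vf nu m y = c} {d\<in>fam m. oi nu d = c}"
 proof (rule bij_betw_imageI)
  show "inj_on (%y. m -` {y}) {y\<in>im m. vf nu m y = c}"
   by (rule inj_on_subset[OF bij_betw_imp_inj_on[OF fam_disjoint(2)[OF assms]]]) auto
 qed (auto simp: fam_def vf_def)
 then show ?thesis unfolding rcount_def by (rule bij_betw_same_card[symmetric])
qed

lemma blk_lt: "mu : Comp ==> m : tau r ==> y : im m ==> blk mu y < n" using blk_iff(1)[of y mu] im_subset comps_D by blast

lemma vf_lt: "nu : Comp ==> m : tau r ==> y : im m ==> vf nu m y < length (orbs nu)"
 unfolding vf_def by (rule oi_props(1), assumption, rule fiber_subset) (auto simp: im_iff)

lemma L_set_D: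
 assumes "(mu, Q, S) : Ls xi"
 shows "mu : Comp" "Q : LO mu (sum_list xi)"
  "S : SST (lf xi) n (nf (left_orbit_comp mu Q))" "semistandard xi (left_orbit_comp mu Q) S"
 using assms left_orbit_comp_length[of mu Q] by (auto simp: L_set_def semistandard_SST)

lemma R_set_D:
 assumes "(nu, Q, T) : Rs xi"
 shows "nu : Comp" "Q : RO nu (sum_list xi)"
  "T : SST (lf xi) (length (orbs nu)) (nf (right_orbit_comp (orbs nu) Q))"
  "semistandard xi (right_orbit_comp (orbs nu) Q) T"
 using assms right_orbit_comp_length[of "orbs nu" Q] by (auto simp: R_set_def semistandard_SST)

lemma left_orbit_nonempty: "Q : LO mu i ==> \<exists>C. C : Q" using id_young[of mu] by (auto simp: left_orbits_def)

lemma right_orbit_nonempty: "Q : right_orbits leq M nu i r ==> \<exists>D. D : Q"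
 using id_young[of nu] by (auto simp: right_orbits_def)

lemma left_orbit_finite: "mu : Comp ==> Q : LO mu i ==> finite Q"
 by (rule finite_subset[of _ "Pow {1..r}"]) (use left_orbit_iff(1) in \<open>force simp: subsets_def\<close>)+

lemma right_orbit_finite:
 assumes "nu : Comp" "Q : RO nu i" shows "finite Q"
proof (rule finite_subset[of _ "Pow (Pow {1..r})"])
 show "Q <= Pow (Pow {1..r})" using right_orbit_iff(1)[OF assms] by (auto simp: monoid_families_def disjoint_families_def)
qed simp

text \<open>The factorisation of \<open>m\<close> is unique, so only \<open>C = im m\<close>,
  \<open>D = fam m\<close> and one permutation \<open>p0\<close> contribute. The remaining
  coefficient is a count over \<open>{1..i}\<close>, which \<open>phi (im m) o p0\<close> carries to
  the image of \<open>m\<close>.\<close>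

lemma cell_elt_orbit:
 assumes L: "(mu, Q, S) : Ls xi" and R: "(nu, Q', T) : Rs xi"
  and xi: "xi : partitions i"
 shows "Cell xi (mu, Q, S) (nu, Q', T) mu nu m =
  (if m : M & im m : Q & fam m : Q' then int (cnt (im m) (blk mu) (vf nu m) (rt (lf xi) S) (rt (lf xi) T)) else 0)"
proof -
 have i: "sum_list xi = i" using xi by (simp add: partitions_def)
 note mu = L_set_D(1)[OF L] and Q = L_set_D(2)[OF L, unfolded i]
 note nu = R_set_D(1)[OF R] and Q' = R_set_D(2)[OF R, unfolded i]
 note lin = ords_D(3)[OF nu]
 let ?kap = "left_orbit_comp mu Q" and ?kap' = "right_orbit_comp (orbs nu) Q'"
 let ?P = "{p. p permutes {1..i}}"
 define w where "w p = semi_murphy xi ?kap ?kap' S T p" for p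
 have finP: "finite ?P" by (simp add: finite_permutations)
 have e: "Cell xi (mu, Q, S) (nu, Q', T) mu nu m =
   (\<Sum>C\<in>Q. \<Sum>D\<in>Q'. \<Sum>p\<in>?P. w p * single (phi C o p o psi (ord nu) D) m)"
  by (simp add: cell_elt_def w_def i)
 have CD: "C : subsets i r" "D : disjoint_families i r" "D : monoid_families (ord nu) M i r"
  if "C : Q" "D : Q'" for C D
  using left_orbit_iff(1)[OF mu Q that(1)] right_orbit_iff(1)[OF nu Q' that(2)] by (auto simp: monoid_families_def)
 show ?thesis
 proof (cases "m : M & im m : Q & fam m : Q'")
  case False
  have "single (phi C o p o psi (ord nu) D) m = 0" if "C : Q" "D : Q'" "p permutes {1..i}" for C D p
  proof (rule ccontr)
   assume "~ ?thesis"
   then have "m = phi C o p o psi (ord nu) D" by (simp add: single_def split: if_splits)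
   then show False using False that phi_psi_M[OF lin CD(1)[OF that(1,2)] CD(3)[OF that(1,2)] that(3)]
     phi_psi(4,5)[OF lin CD(1)[OF that(1,2)] CD(2)[OF that(1,2)] that(3)] by simp
  qed
  then have "(\<Sum>C\<in>Q. \<Sum>D\<in>Q'. \<Sum>p\<in>?P. w p * single (phi C o p o psi (ord nu) D) m) = 0"
   by (intro sum.neutral ballI) simp
  then show ?thesis unfolding e if_not_P[OF False] .
 next
  case True
  then have m: "m : M" "im m : Q" "fam m : Q'" by auto
  note mt = M_tau[OF m(1)]
  note C = CD(1)[OF m(2,3)] and D = CD(2)[OF m(2,3)]
  have ci: "card (im m) = i" using C by (simp add: subsets_def)
  obtain p0 where p0: "p0 permutes {1..i}" "m = phi (im m) o p0 o psi (ord nu) (fam m)"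
   using decomposition(2)[OF lin mt] ci by auto
  have "(\<Sum>p\<in>?P. w p * single (phi C o p o psi (ord nu) D) m) =
    (if C = im m then if D = fam m then w p0 else 0 else 0)" if cd: "C : Q" "D : Q'" for C D
  proof -
   have "w p * single (phi C o p o psi (ord nu) D) m = (if p = p0 then if C = im m & D = fam m then w p0 else 0 else 0)"
    if p: "p : ?P" for p
   proof (cases "m = phi C o p o psi (ord nu) D")
    case True
    have pp: "p permutes {1..i}" using p by simp
    have eqs: "C = im m" "D = fam m"
     using phi_psi(4,5)[OF lin CD(1)[OF cd] CD(2)[OF cd] pp] unfolding True[symmetric] by auto
    moreover have "p = p0"
    proof (rule phi_psi_unique[OF lin _ _ pp p0(1)])
     show "im m : subsets i r" "fam m : disjoint_families i r" by fact+
     show "phi (im m) o p o psi (ord nu) (fam m) = phi (im m) o p0 o psi (ord nu) (fam m)"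
      unfolding p0(2)[symmetric] unfolding eqs[symmetric] by (rule True[symmetric])
    qed
    moreover have "single (phi C o p o psi (ord nu) D) m = 1"
     unfolding True[symmetric] by (simp only: single_def if_True refl)
    ultimately show ?thesis by (simp only: mult_1_right if_True simp_thms)
   next
    case False
    then show ?thesis using p0(2) by (auto simp: single_def)
   qed
   then have "(\<Sum>p\<in>?P. w p * single (phi C o p o psi (ord nu) D) m) =
     (\<Sum>p\<in>?P. if p = p0 then if C = im m & D = fam m then w p0 else 0 else 0)" by (rule sum_eq)
   then show ?thesis using finP p0(1) by (simp add: sum.delta)
  qed
  then have "Cell xi (mu, Q, S) (nu, Q', T) mu nu m =
    (\<Sum>C\<in>Q. \<Sum>D\<in>Q'. if C = im m then if D = fam m then w p0 else 0 else 0)"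
   unfolding e by (intro sum.cong refl) auto
  also have "... = (\<Sum>C\<in>Q. if C = im m then \<Sum>D\<in>Q'. if D = fam m then w p0 else 0 else 0)"
   by (intro sum.cong refl) auto
  also have "... = w p0" using left_orbit_finite[OF mu Q] right_orbit_finite[OF nu Q'] m by (simp add: sum.delta)
  finally have main: "Cell xi (mu, Q, S) (nu, Q', T) mu nu m = w p0" .
  have phb: "bij_betw (phi (im m)) {1..i} (im m)" using phi_bij[OF finite_im, of m] ci by simp
  have imr: "phi (im m) x : {1..sum_list mu}" if "x : {1..i}" for x
   using bij_betwE[OF phb] that im_subset[OF mt] comps_D(1)[OF mu] by blast
  have monoL: "blk mu (phi (im m) x) <= blk mu (phi (im m) y)" if "x : {1..i}" "y : {1..i}" "x <= y" for x y
   by (rule blk_mono[OF imr[OF that(1)] imr[OF that(2)]]) (use phi_mono[OF finite_im] that ci in simp)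
  have cntL: "?kap ! c = card {x\<in>{1..i}. blk mu (phi (im m) x) = c}" if "c < n" for c
  proof -
   have "bij_betw (phi (im m)) {x\<in>{1..i}. blk mu (phi (im m) x) = c} {y\<in>im m. blk mu y = c}"
    by (rule bij_betw_filter[OF phb])
   then show ?thesis unfolding left_orbit_comp_nth[OF mu Q m(2) that] lcount_def by (rule bij_betw_same_card[symmetric])
  qed
  have bdL: "blk mu (phi (im m) x) < n" if "x : {1..i}" for x using blk_iff(1)[OF imr[OF that]] comps_D(2)[OF mu] by simp
  note lenL = left_orbit_comp_length[OF mu, of Q]
  have bL: "blk ?kap x = blk mu (phi (im m) x)" "sum_list ?kap = i" if "x : {1..i}" for x
   by (rule blk_of_monotone[where f = "%x. blk mu (phi (im m) x)", OF monoL _ _ that];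
     simp only: lenL bdL cntL)+
  note pb = pos_bij(1)[OF lin D] and pm = pos_bij(2)[OF lin D]
  define dd where "dd = inv_into (fam m) (pos (ord nu) (fam m))"
  have ddb: "bij_betw dd {1..i} (fam m)" unfolding dd_def by (rule bij_betw_inv_into[OF pb])
  have pdd: "pos (ord nu) (fam m) (dd x) = x" if "x : {1..i}" for x
   unfolding dd_def by (rule bij_betw_inv_into_right[OF pb that])
  have ddf: "dd x : fam m" if "x : {1..i}" for x using bij_betwE[OF ddb] that by blast
  have dds: "dd x <= {1..r}" if "x : {1..i}" for x using disjoint_families_D(3)[OF D ddf[OF that]] .
  \<comment> \<open>The compatibility of the order on subsets with the order of the orbits enters
    here: along the increasing list of fibres the orbit index increases weakly, as
    \<open>blk_of_monotone\<close> requires.\<close>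
  have monoR: "oi nu (dd x) <= oi nu (dd y)" if xy: "x : {1..i}" "y : {1..i}" "x <= y" for x y
  proof (rule ccontr)
   assume lt: "~ ?thesis"
   have "(dd y, dd x) : ord nu" by (rule ords_D(4)[OF nu, of "oi nu (dd y)" "oi nu (dd x)"])
     (use lt oi_props(1,2)[OF nu dds[OF xy(1)]] oi_props(1,2)[OF nu dds[OF xy(2)]] in auto)
   then have "y <= x" using pm[OF ddf[OF xy(2)] ddf[OF xy(1)]] pdd xy by simp
   then have "x = y" using xy by simp
   then show False using lt by simp
  qed
  have bdR: "oi nu (dd x) < length (orbs nu)" if "x : {1..i}" for x using oi_props(1)[OF nu dds[OF that]] .
  have cntR: "?kap' ! c = card {x\<in>{1..i}. oi nu (dd x) = c}" if "c < length (orbs nu)" for c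
  proof -
   have "bij_betw dd {x\<in>{1..i}. oi nu (dd x) = c} {d\<in>fam m. oi nu d = c}" by (rule bij_betw_filter[OF ddb])
   then show ?thesis unfolding right_orbit_comp_nth[OF nu Q' m(3) that] rcount_def by (rule bij_betw_same_card[symmetric])
  qed
  note lenR = right_orbit_comp_length[of "orbs nu" Q']
  have bR: "blk ?kap' x = oi nu (dd x)" "sum_list ?kap' = i" if "x : {1..i}" for x
   by (rule blk_of_monotone[where f = "%x. oi nu (dd x)", OF monoR _ _ that];
     simp only: lenR bdR cntR)+
  have sums: "sum_list ?kap = i" "sum_list ?kap' = i"
  proof -
   have "sum_list ?kap = psize (lf xi)" "sum_list ?kap' = psize (lf xi)"
    using SST_size[OF lf_Par(1)[OF xi] L_set_D(3)[OF L]] SST_size[OF lf_Par(1)[OF xi] R_set_D(3)[OF R]] lenL lenR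
    by (simp_all add: sum_list_sum_nth atLeast0LessThan)
   then show "sum_list ?kap = i" "sum_list ?kap' = i" using lf_Par(2)[OF xi] by auto
  qed
  have "w p0 = int (cnt {1..i} (%x. blk ?kap (p0 x)) (blk ?kap') (rt (lf xi) S) (rt (lf xi) T))"
   unfolding w_def using semi_murphy_cnt[of ?kap xi ?kap' S T p0] sums i L_set_D(4)[OF L] R_set_D(4)[OF R] p0(1) by simp
  also have "cnt {1..i} (%x. blk ?kap (p0 x)) (blk ?kap') (rt (lf xi) S) (rt (lf xi) T) =
    cnt (im m) (blk mu) (vf nu m) (rt (lf xi) S) (rt (lf xi) T)"
  proof (rule cnt_bij)
   show "bij_betw (phi (im m) o p0) {1..i} (im m)" by (rule bij_betw_trans[OF permutes_imp_bij[OF p0(1)] phb])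
   fix x assume x: "x : {1..i}"
   show "blk ?kap (p0 x) = blk mu ((phi (im m) o p0) x)" using bL(1)[of "p0 x"] permutes_in_image[OF p0(1), of x] x by simp
   have "m -` {phi (im m) (p0 x)} = dd x" using phi_psi(6)[OF lin C D p0(1) ddf[OF x]] p0(2) pdd[OF x] by simp
   then show "blk ?kap' x = vf nu m ((phi (im m) o p0) x)" using bR(1)[OF x] by (simp add: vf_def)
  qed
  finally show ?thesis using main True by simp
 qed
qed

text \<open>A nonzero count forces the margins by \<open>cnt_margins\<close>, and the margins
  determine the two orbits. The case distinction of \<open>cell_elt_orbit\<close> therefore
  disappears.\<close>

lemma cell_elt_cnt:
 assumes L: "(mu, Q, S) : Ls xi" and R: "(nu, Q', T) : Rs xi"
  and xi: "xi : partitions i" and m: "m : M"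
 shows "Cell xi (mu, Q, S) (nu, Q', T) mu nu m =
   int (cnt (im m) (blk mu) (vf nu m) (rt (lf xi) S) (rt (lf xi) T))"
  and "cnt (im m) (blk mu) (vf nu m) (rt (lf xi) S) (rt (lf xi) T) ~= 0 ==> im m : Q & fam m : Q' & card (im m) = i"
proof -
 have i: "sum_list xi = i" using xi by (simp add: partitions_def)
 note mu = L_set_D(1)[OF L] and Q = L_set_D(2)[OF L, unfolded i]
 note nu = R_set_D(1)[OF R] and Q' = R_set_D(2)[OF R, unfolded i]
 note mt = M_tau[OF m] and lP = lf_Par[OF xi] and lin = ords_D(3)[OF nu]
 show nz: "im m : Q & fam m : Q' & card (im m) = i"
  if "cnt (im m) (blk mu) (vf nu m) (rt (lf xi) S) (rt (lf xi) T) ~= 0"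
 proof -
  note cm = cnt_margins[OF finite_im lP(1) that]
  have ci: "card (im m) = i" using cm(3) lP(2) by simp
  obtain C where C: "C : Q" using left_orbit_nonempty[OF Q] by blast
  obtain D where D: "D : Q'" using right_orbit_nonempty[OF Q'] by blast
  have "lcount mu (im m) = lcount mu C"
  proof
   fix c
   show "lcount mu (im m) c = lcount mu C c"
   proof (cases "c < n")
    case True
    then have "lcount mu (im m) c = left_orbit_comp mu Q ! c"
     using cm(1)[of c] SST_D(2)[OF L_set_D(3)[OF L]] by (simp add: lcount_def)
    then show ?thesis using left_orbit_comp_nth[OF mu Q C True] by simp
   next
    case False
    have Cr: "C <= {1..r}" using left_orbit_iff(1)[OF mu Q C] by (simp add: subsets_def)
    have "{y\<in>E. blk mu y = c} = {}" if "E <= {1..r}" for E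
     using that blk_iff(1)[of _ mu] comps_D[OF mu] False by auto
    from this[OF Cr] this[OF im_subset[OF mt]] show ?thesis by (simp only: lcount_def)
   qed
  qed
  then have "im m : Q" using left_orbit_iff(2)[OF mu Q C] decomposition(1)[OF lin mt] ci by simp
  moreover have "rcount nu (fam m) = rcount nu D"
  proof
   fix c
   show "rcount nu (fam m) c = rcount nu D c"
   proof (cases "c < length (orbs nu)")
    case True
    then have "rcount nu (fam m) c = right_orbit_comp (orbs nu) Q' ! c"
     using cm(2)[of c] SST_D(2)[OF R_set_D(3)[OF R]] rcount_fam[OF mt] by simp
    then show ?thesis using right_orbit_comp_nth[OF nu Q' D True] by simp
   next
    case False
    have z: "{d\<in>E. oi nu d = c} = {}" if "E : disjoint_families i r" for E
     using oi_props(1)[OF nu disjoint_families_D(3)[OF that]] False by auto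
    have "D : disjoint_families i r" "fam m : disjoint_families i r"
     using right_orbit_iff(1)[OF nu Q' D] fam_disjoint(1)[OF mt] ci by (auto simp: monoid_families_def)
    from z[OF this(1)] z[OF this(2)] show ?thesis by (simp only: rcount_def)
   qed
  qed
  then have "fam m : Q'" using right_orbit_iff(2)[OF nu Q' D] monoid_families_eq[OF lin, of i] m ci by blast
  ultimately show ?thesis using ci by simp
 qed
 show "Cell xi (mu, Q, S) (nu, Q', T) mu nu m =
   int (cnt (im m) (blk mu) (vf nu m) (rt (lf xi) S) (rt (lf xi) T))"
  unfolding cell_elt_orbit[OF L R xi] using nz m by auto
qed

lemma cell_elt_off:
 "~ (mu' = mu & nu' = nu) ==> Cell xi (mu, Q, S) (nu, Q', T) mu' nu' m = 0" by (auto simp: cell_elt_def)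

abbreviation MM where
 "MM mu nu Q Q' == margin_matrices n (length (orbs nu)) (nf (left_orbit_comp mu Q)) (nf (right_orbit_comp (orbs nu) Q'))"

abbreviation BT where
 "BT mu nu Q Q' == bitableaux n (length (orbs nu)) (nf (left_orbit_comp mu Q)) (nf (right_orbit_comp (orbs nu) Q'))"

lemma cm_in_MM:
 assumes mu: "mu : Comp" and nu: "nu : Comp"
  and Q: "Q : LO mu i" and Q': "Q' : RO nu i"
  and m: "m : M" "im m : Q" "fam m : Q'"
 shows "cm mu nu m : MM mu nu Q Q'"
proof -
 note mt = M_tau[OF m(1)]
 have "cm mu nu m c c' = 0" if "~ (c < n & c' < length (orbs nu))" for c c'
 proof -
  have e: "{x\<in>im m. blk mu x = c & vf nu m x = c'} = {}" using blk_lt[OF mu mt] vf_lt[OF nu mt] that by auto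
  show ?thesis unfolding cm_vf cmat_def e by simp
 qed
 moreover have "(\<Sum>c'<length (orbs nu). cm mu nu m c c') = left_orbit_comp mu Q ! c" if "c < n" for c
  unfolding left_orbit_comp_nth[OF mu Q m(2) that] lcount_def cm_vf cmat_def
  using card_fibers[of "{x\<in>im m. blk mu x = c}" "{..<length (orbs nu)}" "vf nu m"] finite_im vf_lt[OF nu mt]
  by (simp add: image_subset_iff conj_assoc)
 moreover have "(\<Sum>c<n. cm mu nu m c c') = right_orbit_comp (orbs nu) Q' ! c'" if "c' < length (orbs nu)" for c'
  unfolding right_orbit_comp_nth[OF nu Q' m(3) that] rcount_fam[OF mt] cm_vf cmat_def
  using card_fibers[of "{x\<in>im m. vf nu m x = c'}" "{..<n}" "blk mu"] finite_im blk_lt[OF mu mt]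
  by (simp add: image_subset_iff conj_ac)
 ultimately show ?thesis unfolding margin_matrices_def by blast
qed

text \<open>Some map \<open>m0\<close> in \<open>M\<close> has its fibres in \<open>Q'\<close>,
  hence right colours with the prescribed column sums. Moving its image points into a set
  \<open>C\<close> of \<open>Q\<close> by a permutation allows every distribution of the left
  colours, while the fibres stay the same.\<close>

lemma realize:
 assumes mu: "mu : Comp" and nu: "nu : Comp"
  and Q: "Q : LO mu i" and Q': "Q' : RO nu i"
  and N: "N : MM mu nu Q Q'"
 shows "\<exists>m\<in>M. im m : Q & fam m : Q' & cm mu nu m = N"
proof -
 let ?n' = "length (orbs nu)"
 obtain C where C: "C : Q" using left_orbit_nonempty[OF Q] by blast
 obtain D where D: "D : Q'" using right_orbit_nonempty[OF Q'] by blast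
 obtain m0 where m0: "m0 : M" "card (im m0) = i" "D = fam m0"
  using right_orbit_iff(1)[OF nu Q' D] monoid_families_eq[OF ords_D(3)[OF nu], of i] by auto
 note mt = M_tau[OF m0(1)]
 have C': "C <= {1..r}" "finite C" using left_orbit_iff(1)[OF mu Q C] finite_subset[of C "{1..r}"] by (auto simp: subsets_def)
 have Cb: "blk mu y < n" if "y : C" for y using blk_iff(1)[of y mu] comps_D[OF mu] C'(1) that by auto
 \<comment> \<open>\<open>N c c'\<close> abstract points for each pair of colours, placed between
   the image of \<open>m0\<close> (matched by right colour) and \<open>C\<close> (matched by left
   colour).\<close>
 define Y where "Y = {(c, c', e). e < N c c'}"
 have Nz: "N c c' = 0" if "~ (c < n & c' < ?n')" for c c' using N that unfolding margin_matrices_def by blast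
 have Yn: "c < n & c' < ?n'" if "(c, c', e) : Y" for c c' e using Nz[of c c'] that unfolding Y_def by fastforce
 have Ye: "Y = (SIGMA c:{..<n}. SIGMA c':{..<?n'}. {..<N c c'})" using Yn by (auto simp: Y_def)
 have finY: "finite Y" unfolding Ye by auto
 have rowY: "card {y\<in>Y. fst y = c} = lcount mu C c" for c
 proof (cases "c < n")
  case True
  have "{y\<in>Y. fst y = c} = Pair c ` (SIGMA c':{..<?n'}. {..<N c c'})" unfolding Ye using True by auto
  then have "card {y\<in>Y. fst y = c} = (\<Sum>c'<?n'. N c c')" by (simp add: card_image inj_on_def card_SigmaI)
  also have "... = left_orbit_comp mu Q ! c" using N True by (simp add: margin_matrices_def)
  finally show ?thesis using left_orbit_comp_nth[OF mu Q C True] by simp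
 next
  case False
  have e: "{y\<in>Y. fst y = c} = {}" "{y\<in>C. blk mu y = c} = {}" using False Yn Cb by auto
  show ?thesis unfolding lcount_def e by simp
 qed
 have colY: "card {y\<in>Y. fst (snd y) = c'} = card {y\<in>im m0. vf nu m0 y = c'}" for c'
 proof (cases "c' < ?n'")
  case True
  have "bij_betw (%(c, e). (c, c', e)) (SIGMA c:{..<n}. {..<N c c'}) {y\<in>Y. fst (snd y) = c'}"
   unfolding Ye using True by (auto simp: bij_betw_def inj_on_def image_def)
  then have "card {y\<in>Y. fst (snd y) = c'} = (\<Sum>c<n. N c c')"
   by (simp add: bij_betw_same_card[symmetric] card_SigmaI)
  also have "... = right_orbit_comp (orbs nu) Q' ! c'" using N True by (simp add: margin_matrices_def)
  finally show ?thesis using right_orbit_comp_nth[OF nu Q' D True] rcount_fam[OF mt] m0(3) by simp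
 next
  case False
  have e: "{y\<in>Y. fst (snd y) = c'} = {}" "{y\<in>im m0. vf nu m0 y = c'} = {}" using False Yn vf_lt[OF nu mt] by auto
  show ?thesis unfolding e by simp
 qed
 obtain b1 where b1: "bij_betw b1 (im m0) Y" "\<forall>y\<in>im m0. fst (snd (b1 y)) = vf nu m0 y"
  using ex_bij_betw_fibers[OF finite_im finY, of m0 "vf nu m0" "%y. fst (snd y)"] colY by auto
 obtain b2 where b2: "bij_betw b2 Y C" "\<forall>y\<in>Y. blk mu (b2 y) = fst y"
  using ex_bij_betw_fibers[OF finY C'(2), of fst "blk mu"] rowY by (auto simp: lcount_def)
 have b: "bij_betw (b2 o b1) (im m0) C" by (rule bij_betw_trans[OF b1(1) b2(1)])
 obtain rho where rho: "rho permutes {1..r}" "\<forall>y\<in>im m0. rho y = (b2 o b1) y"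
  using extend_permutation[OF b im_subset[OF mt] C'(1)] by blast
 define m where "m = rho o m0"
 have mM: "m : M" unfolding m_def by (rule M_left[OF rho(1) m0(1)])
 have imm: "im m = rho ` im m0" using im_comp(1)[OF rho(1) permutes_id mt] by (simp add: m_def)
 have fib: "m -` {rho y} = m0 -` {y}" if "y : im m0" for y
  using im_comp(2)[OF rho(1) permutes_id mt, of y] that by (simp add: m_def im_def)
 have "rho ` im m0 = (b2 o b1) ` im m0" using rho(2) by (intro image_cong) auto
 then have imC: "im m = C" unfolding imm using bij_betw_imp_surj_on[OF b] by simp
 have "fam m = fam m0" unfolding fam_def imm image_image using fib by simp
 moreover have "cm mu nu m = N"
 proof (intro ext)
  fix c c'
  have "bij_betw b1 {y\<in>im m0. blk mu (rho y) = c & vf nu m0 y = c'} {y\<in>Y. fst y = c & fst (snd y) = c'}"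
  proof (rule bij_betw_imageI)
   have e: "blk mu (rho y) = fst (b1 y)" if "y : im m0" for y using rho(2) b2(2) bij_betwE[OF b1(1)] that by simp
   show "b1 ` {y\<in>im m0. blk mu (rho y) = c & vf nu m0 y = c'} = {y\<in>Y. fst y = c & fst (snd y) = c'}"
    unfolding bij_betw_imp_surj_on[OF b1(1), symmetric] using e b1(2) by auto
   show "inj_on b1 {y\<in>im m0. blk mu (rho y) = c & vf nu m0 y = c'}"
    by (rule inj_on_subset[OF bij_betw_imp_inj_on[OF b1(1)]]) auto
  qed
  then have "card {y\<in>im m0. blk mu (rho y) = c & vf nu m0 y = c'} = card {y\<in>Y. fst y = c & fst (snd y) = c'}"
   by (rule bij_betw_same_card)
  also have "{y\<in>Y. fst y = c & fst (snd y) = c'} = (%e. (c, c', e)) ` {..<N c c'}" by (auto simp: Y_def)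
  also have "card ... = N c c'" by (simp add: card_image inj_on_def)
  also have "card {y\<in>im m0. blk mu (rho y) = c & vf nu m0 y = c'} = cm mu nu m c c'" unfolding cm_vf cmat_def
  proof (rule bij_betw_same_card)
   show "bij_betw rho {y\<in>im m0. blk mu (rho y) = c & vf nu m0 y = c'} {y\<in>im m. blk mu y = c & vf nu m y = c'}"
   proof (rule bij_betw_imageI)
    show "inj_on rho {y\<in>im m0. blk mu (rho y) = c & vf nu m0 y = c'}"
     by (rule inj_on_subset[OF permutes_inj[OF rho(1)]]) simp
    show "rho ` {y\<in>im m0. blk mu (rho y) = c & vf nu m0 y = c'} = {y\<in>im m. blk mu y = c & vf nu m y = c'}"
     unfolding imm using fib by (auto simp: vf_def)
   qed
  qed
  finally show "cm mu nu m c c' = N c c'" .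
 qed
 ultimately show ?thesis using mM imC C D m0(3) by auto
qed

lemma orbits_exist:
 assumes mu: "mu : Comp" and nu: "nu : Comp" and m: "m : M"
 shows "\<exists>Q\<in>LO mu (card (im m)). im m : Q" "\<exists>Q'\<in>RO nu (card (im m)). fam m : Q'"
proof -
 note lin = ords_D(3)[OF nu] and mt = M_tau[OF m]
 show "\<exists>Q\<in>LO mu (card (im m)). im m : Q" by (rule left_orbit_exists[OF mu decomposition(1)[OF lin mt]])
 show "\<exists>Q'\<in>RO nu (card (im m)). fam m : Q'"
  by (rule right_orbit_exists) (use monoid_families_eq[OF lin] m in blast)
qed

lemma left_orbits_eq:
 assumes "mu : Comp" "Q : LO mu i" "Q1 : LO mu i1" "C : Q" "C : Q1"
 shows "Q = Q1" "i = i1" using left_orbit_iff(3)[OF assms(1,2,4)] left_orbit_iff(3)[OF assms(1,3,5)]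
  left_orbit_iff(1)[OF assms(1,2,4)] left_orbit_iff(1)[OF assms(1,3,5)] by (auto simp: subsets_def)

lemma right_orbits_eq:
 assumes "nu : Comp" "Q : RO nu i" "Q1 : RO nu i1"
  "D : Q" "D : Q1"
 shows "Q = Q1" "i = i1"
proof -
 have "card D = i" "card D = i1" using right_orbit_iff(1)[OF assms(1,2,4)] right_orbit_iff(1)[OF assms(1,3,5)]
  by (auto simp: monoid_families_def disjoint_families_def)
 then show i: "i = i1" by simp
 show "Q = Q1" using right_orbit_iff(2)[OF assms(1,2,4)] right_orbit_iff(2)[OF assms(1,3,5)] i by blast
qed

end

section \<open>The rings of double cosets\<close>

lemma dvd_sum_orbits:
 fixes f :: "'x => int"
 assumes fin: "finite Z" and orb: "!!z. z : Z ==> card {z'\<in>Z. orb z' = orb z} = c"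
  and const: "!!z z'. z : Z ==> z' : Z ==> orb z' = orb z ==> f z' = f z"
  and d: "!!z. z : Z ==> d dvd f z"
 shows "int c * d dvd sum f Z"
proof -
 have "sum f Z = (\<Sum>y\<in>orb ` Z. sum f {z\<in>Z. orb z = y})" by (rule sum.image_gen[OF fin])
 also have "int c * d dvd ..."
 proof (rule dvd_sum)
  fix y assume "y : orb ` Z"
  then obtain z where z: "z : Z" "y = orb z" by blast
  have "sum f {z'\<in>Z. orb z' = y} = sum (%_. f z) {z'\<in>Z. orb z' = y}"
  proof (rule sum_eq)
   fix z' assume "z' : {z'\<in>Z. orb z' = y}"
   then show "f z' = f z" using const[OF z(1), of z'] z(2) by simp
  qed
  also have "... = int c * f z" using orb[OF z(1)] z(2) by simp
  finally show "int c * d dvd sum f {z'\<in>Z. orb z' = y}" using d[OF z(1)] by simp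
 qed
 finally show ?thesis .
qed

text \<open>Divisibility by grouping pairs: the number of partners is constant on the class of
  \<open>b\<close>, and for fixed \<open>b\<close> the partners form whole classes of size
  \<open>c1\<close>.\<close>

lemma dvd_card_pairs:
 assumes fin: "finite Y" "finite Z"
  and c1: "!!a b. a : Y ==> b : Z ==> P a b ==> card {a'\<in>Y. P a' b & orb1 a' = orb1 a} = c1"
  and const: "!!b b'. b : Z ==> b' : Z ==> orb2 b' = orb2 b ==> card {a\<in>Y. P a b'} = card {a\<in>Y. P a b}"
  and c2: "!!b. b : Z ==> card {b'\<in>Z. orb2 b' = orb2 b} = c2"
 shows "int c2 * int c1 dvd (\<Sum>b\<in>Z. int (card {a\<in>Y. P a b}))"
proof (rule dvd_sum_orbits[OF fin(2)])
 show "int c1 dvd int (card {a\<in>Y. P a b})" if b: "b : Z" for b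
  using dvd_sum_orbits[of "{a\<in>Y. P a b}" orb1 c1 "%_. 1" 1] fin(1) c1[OF _ b] by (simp add: conj_assoc)
 show "card {b'\<in>Z. orb2 b' = orb2 b} = c2" if "b : Z" for b by (rule c2[OF that])
 show "int (card {a\<in>Y. P a b'}) = int (card {a\<in>Y. P a b})" if "b : Z" "b' : Z" "orb2 b' = orb2 b" for b b'
  using const[OF that] by simp
qed

text \<open>Maps with the same kernel take equally many values. It compares translates of a map with
  restrictions of permutations.\<close>

lemma card_image_cong_ker:
 assumes "!!x y. x : A ==> y : A ==> f x = f y \<longleftrightarrow> g x = g y"
 shows "card (f ` A) = card (g ` A)"
proof (rule bij_betw_same_card)
 have i: "inv_into A f (f x) : A" "g (inv_into A f (f x)) = g x" if "x : A" for x
 proof -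
  show "inv_into A f (f x) : A" using that by (intro inv_into_into) simp
  then show "g (inv_into A f (f x)) = g x" using assms[OF _ that] f_inv_into_f[of "f x" f A] that by blast
 qed
 show "bij_betw (%y. g (inv_into A f y)) (f ` A) (g ` A)"
 proof (rule bij_betw_imageI)
  show "inj_on (%y. g (inv_into A f y)) (f ` A)" using assms i by (auto simp: inj_on_def)
  show "(%y. g (inv_into A f y)) ` f ` A = g ` A" unfolding image_image using i(2) by (rule image_cong[OF refl])
 qed
qed

lemma young_translate:
 assumes "sig : young mu"
 shows "(%rho. rho o sig) ` young mu = young mu" "(%rho. sig o rho) ` young mu = young mu"
proof -
 note p = young_permutes[OF assms] and i = young_inv[OF assms]
 show "(%rho. rho o sig) ` young mu = young mu"
 proof (intro equalityI subsetI)
  fix rho assume "rho : young mu"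
  then show "rho : (%rho. rho o sig) ` young mu"
   using permutes_inv_o(2)[OF p] by (intro image_eqI[of _ _ "rho o pinv sig"] young_comp i) (simp_all add: comp_assoc)
 qed (use young_comp assms in auto)
 show "(%rho. sig o rho) ` young mu = young mu"
 proof (intro equalityI subsetI)
  fix rho assume "rho : young mu"
  then show "rho : (%rho. sig o rho) ` young mu"
   using permutes_inv_o(1)[OF p] by (intro image_eqI[of _ _ "pinv sig o rho"] young_comp i) (simp_all add: comp_assoc[symmetric])
 qed (use young_comp assms in auto)
qed

context gs_data
begin

lemma young_r: "mu : Comp ==> rho : young mu ==> rho permutes {1..r}" using young_permutes comps_D(1) by metis

lemma young_cancel:
 assumes "mu : Comp" "rho : young mu"
 shows "pinv rho o (rho o m) = m" "rho o (pinv rho o m) = m"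
  "(m o rho) o pinv rho = m" "(m o pinv rho) o rho = m"
 using permutes_inv_o[OF young_r[OF assms]] by (simp_all add: comp_assoc[symmetric] del: comp_apply)
  (simp_all add: comp_assoc)

lemma young_M: "mu : Comp ==> rho : young mu ==> m : M ==> rho o m : M"
  "mu : Comp ==> rho : young mu ==> m : M ==> m o rho : M" using M_left M_right young_r by blast+

lemma finite_factorizations: "finite {(a, b). a : M & b : M & a o b = m}"
 by (rule finite_subset[of _ "M \<times> M"]) (use finite_M in auto)

lemma conv_off: "m ~: M ==> conv M f g m = 0"
proof -
 assume "m ~: M"
 then have e: "{(a, b). a : M & b : M & a o b = m} = {}" using M_comp by auto
 show ?thesis unfolding conv_def e by simp
qed

lemma conv_single_left:
 assumes "mu : Comp" "rho : young mu" "m : M"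
 shows "conv M (single (perm_map r rho)) f m = f (pinv rho o m)"
proof -
 note p = young_r[OF assms(1,2)]
 have e: "single (perm_map r rho) a * f b = (if (a, b) = (perm_map r rho, pinv rho o m) then f (pinv rho o m) else 0)"
  if "a : M" "b : M" "a o b = m" for a b
 proof (cases "a = perm_map r rho")
  case True
  then have "rho o b = m" using that perm_map_comp(1)[OF p M_tau[OF that(2)]] by simp
  then have "b = pinv rho o m" using young_cancel(1)[OF assms(1,2), of b] by simp
  then show ?thesis using True by (simp add: single_def)
 qed (simp add: single_def)
 have "conv M (single (perm_map r rho)) f m = (\<Sum>x\<in>{(a, b). a : M & b : M & a o b = m}.
   if x = (perm_map r rho, pinv rho o m) then f (pinv rho o m) else 0)" unfolding conv_def
 proof (rule sum_eq)
  fix x assume "x : {(a, b). a : M & b : M & a o b = m}"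
  then obtain a b where x: "x = (a, b)" "a : M" "b : M" "a o b = m" by blast
  show "(case x of (a, b) => single (perm_map r rho) a * f b) =
    (if x = (perm_map r rho, pinv rho o m) then f (pinv rho o m) else 0)" unfolding x(1) prod.case by (rule e[OF x(2-4)])
 qed
 also have "... = f (pinv rho o m)"
 proof -
  have "pinv rho o m : M" by (rule young_M(1)[OF assms(1) young_inv[OF assms(2)] assms(3)])
  moreover from this have "perm_map r rho o (pinv rho o m) = m"
   using perm_map_comp(1)[OF p M_tau] young_cancel(2)[OF assms(1,2)] by simp
  ultimately show ?thesis using M_perm[OF p] by (simp add: sum.delta finite_factorizations)
 qed
 finally show ?thesis .
qed

lemma conv_single_right:
 assumes "nu : Comp" "rho : young nu" "m : M"
 shows "conv M f (single (perm_map r rho)) m = f (m o pinv rho)"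
proof -
 note p = young_r[OF assms(1,2)]
 have e: "f a * single (perm_map r rho) b = (if (a, b) = (m o pinv rho, perm_map r rho) then f (m o pinv rho) else 0)"
  if "a : M" "b : M" "a o b = m" for a b
 proof (cases "b = perm_map r rho")
  case True
  then have "a o rho = m" using that perm_map_comp(2)[OF p M_tau[OF that(1)]] by simp
  then have "a = m o pinv rho" using young_cancel(3)[OF assms(1,2), of a] by simp
  then show ?thesis using True by (simp add: single_def)
 qed (simp add: single_def)
 have "conv M f (single (perm_map r rho)) m = (\<Sum>x\<in>{(a, b). a : M & b : M & a o b = m}.
   if x = (m o pinv rho, perm_map r rho) then f (m o pinv rho) else 0)" unfolding conv_def
 proof (rule sum_eq)
  fix x assume "x : {(a, b). a : M & b : M & a o b = m}"
  then obtain a b where x: "x = (a, b)" "a : M" "b : M" "a o b = m" by blast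
  show "(case x of (a, b) => f a * single (perm_map r rho) b) =
    (if x = (m o pinv rho, perm_map r rho) then f (m o pinv rho) else 0)" unfolding x(1) prod.case by (rule e[OF x(2-4)])
 qed
 also have "... = f (m o pinv rho)"
 proof -
  have "m o pinv rho : M" by (rule young_M(2)[OF assms(1) young_inv[OF assms(2)] assms(3)])
  moreover from this have "m o pinv rho o perm_map r rho = m"
   using perm_map_comp(2)[OF p M_tau] young_cancel(4)[OF assms(1,2)] by simp
  ultimately show ?thesis using M_perm[OF p] by (simp add: sum.delta finite_factorizations)
 qed
 finally show ?thesis .
qed

text \<open>Convolution with a permutation is translation by its inverse, so invariance means
  constancy on double cosets, and these are the fibres of the colour matrix.\<close>

lemma invariants_iff:
 assumes mu: "mu : Comp" and nu: "nu : Comp"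
 shows "f : Inv mu nu \<longleftrightarrow> (\<forall>m. m ~: M --> f m = 0) &
  (\<forall>m\<in>M. \<forall>m'\<in>M. cm mu nu m' = cm mu nu m --> f m' = f m)"
proof (intro iffI conjI ballI impI)
 assume f: "f : Inv mu nu"
 have l: "f (rho o m) = f m" if "rho : young mu" "m : M" for rho m
  using conv_single_left[OF mu that(1) young_M(1)[OF mu that], of f] f that(1) young_cancel(1)[OF mu that(1)]
  by (simp add: invariants_def)
 have rr: "f (m o ta) = f m" if "ta : young nu" "m : M" for ta m
  using conv_single_right[OF nu that(1) young_M(2)[OF nu that], of f] f that(1) young_cancel(3)[OF nu that(1)]
  by (simp add: invariants_def)
 fix m m' assume m: "m : M" "m' : M" "cm mu nu m' = cm mu nu m"
 then obtain rho ta where "rho : young mu" "ta : young nu" "m' = rho o m o ta"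
  using dcoset_iff[OF mu nu M_tau[OF m(1)] M_tau[OF m(2)]] by (auto simp: dcoset_def)
 then show "f m' = f m" using l rr m(1) young_M(1)[OF mu] by simp
next
 assume "(\<forall>m. m ~: M --> f m = 0) & (\<forall>m\<in>M. \<forall>m'\<in>M. cm mu nu m' = cm mu nu m --> f m' = f m)"
 then have off: "!!m. m ~: M ==> f m = 0"
  and eq: "!!m m'. m : M ==> m' : M ==> cm mu nu m' = cm mu nu m ==> f m' = f m" by blast+
 have "conv M (single (perm_map r rho)) f m = f m" if r: "rho : young mu" for rho m
 proof (cases "m : M")
  case True
  have "cm mu nu (pinv rho o m) = cm mu nu m" using cm_comp[OF mu nu young_inv[OF r] id_young M_tau[OF True]] by simp
  then show ?thesis using conv_single_left[OF mu r True] eq[OF True young_M(1)[OF mu young_inv[OF r] True]] by simp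
 qed (simp add: conv_off off)
 moreover have "conv M f (single (perm_map r rho)) m = f m" if r: "rho : young nu" for rho m
 proof (cases "m : M")
  case True
  have "cm mu nu (m o pinv rho) = cm mu nu m" using cm_comp[OF mu nu id_young young_inv[OF r] M_tau[OF True]] by simp
  then show ?thesis using conv_single_right[OF nu r True] eq[OF True young_M(2)[OF nu young_inv[OF r] True]] by simp
 qed (simp add: conv_off off)
 ultimately show "f : Inv mu nu" using off by (simp add: invariants_def fun_eq_iff)
qed (auto simp: invariants_def)

lemma invariants_young:
 assumes "mu : Comp" "nu : Comp" "f : Inv mu nu"
  "rho : young mu" "ta : young nu" "m : M"
 shows "f (rho o m o ta) = f m"
 using assms invariants_iff[OF assms(1,2), of f] cm_comp[OF assms(1,2,4,5) M_tau[OF assms(6)]]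
  young_M(1)[OF assms(1,4,6)] young_M(2)[OF assms(2,5)] by blast

lemma dcoset_M:
 assumes mu: "mu : Comp" and nu: "nu : Comp" and m: "m : M"
 shows "dcoset mu nu m <= M" "finite (dcoset mu nu m)" "m : dcoset mu nu m"
  "m' : M ==> m' : dcoset mu nu m \<longleftrightarrow> cm mu nu m' = cm mu nu m"
  "m' : M ==> dcoset mu nu m' = dcoset mu nu m \<longleftrightarrow> cm mu nu m' = cm mu nu m"
proof -
 have s: "dcoset mu nu m <= M" if "m : M" for m using young_M(1)[OF mu _ that] young_M(2)[OF nu] by (auto simp: dcoset_def)
 then show "dcoset mu nu m <= M" using m .
 from s[OF m] show "finite (dcoset mu nu m)" using finite_M finite_subset by blast
 have i: "m' : dcoset mu nu m \<longleftrightarrow> cm mu nu m' = cm mu nu m" if "m' : M" "m : M" for m m'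
  by (rule dcoset_iff[OF mu nu M_tau[OF that(2)] M_tau[OF that(1)]])
 show "m : dcoset mu nu m" using i[OF m m] by simp
 show "m' : dcoset mu nu m \<longleftrightarrow> cm mu nu m' = cm mu nu m" if "m' : M" using i[OF that m] .
 have "dcoset mu nu m = {x\<in>M. cm mu nu x = cm mu nu m}" if "m : M" for m using i[OF _ that] s[OF that] by blast
 then show "dcoset mu nu m' = dcoset mu nu m \<longleftrightarrow> cm mu nu m' = cm mu nu m" if "m' : M"
  using i[OF m m] m that by auto
qed

lemma coset_sum_eq:
 assumes "mu : Comp" "nu : Comp" "m : M"
 shows "coset_sum (dcoset mu nu m) x = (if x : dcoset mu nu m then 1 else 0)"
 using dcoset_M(2)[OF assms] by (simp add: coset_sum_def single_def sum.delta')

lemma coset_sum_M: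
 assumes "mu : Comp" "nu : Comp" "m : M" "m' : M"
 shows "coset_sum (dcoset mu nu m) m' = (if cm mu nu m' = cm mu nu m then 1 else 0)"
 using coset_sum_eq[OF assms(1-3)] dcoset_M(4)[OF assms] by simp

lemma finite_dcosets: "finite (dcosets M mu nu)" using finite_M by (simp add: dcosets_def)

lemma sum_dcosets:
 assumes "mu : Comp" "nu : Comp" "m : M"
 shows "(\<Sum>D\<in>dcosets M mu nu. g D * of_int (coset_sum D m)) = (g (dcoset mu nu m) :: 'a::comm_ring_1)"
proof -
 have "g D * of_int (coset_sum D m) = (if D = dcoset mu nu m then g (dcoset mu nu m) else 0)" if D: "D : dcosets M mu nu" for D
 proof -
  obtain a where a: "a : M" "D = dcoset mu nu a" using D by (auto simp: dcosets_def)
  show ?thesis using coset_sum_M[OF assms(1,2) a(1) assms(3)] dcoset_M(5)[OF assms a(1)] a(2) by auto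
 qed
 then have "(\<Sum>D\<in>dcosets M mu nu. g D * of_int (coset_sum D m)) =
   (\<Sum>D\<in>dcosets M mu nu. if D = dcoset mu nu m then g (dcoset mu nu m) else 0)" by (rule sum_eq)
 also have "... = g (dcoset mu nu m)" using finite_dcosets assms(3) by (simp add: sum.delta dcosets_def)
 finally show ?thesis .
qed

text \<open>Double coset sums have disjoint supports, so the only possible coefficient is the value
  on the coset. The value 0 off \<open>dcosets\<close> makes the coefficient function unique, as
  \<open>THE\<close> demands.\<close>

lemma dcoord_eq:
 assumes mu: "mu : Comp" and nu: "nu : Comp" and f: "f : Inv mu nu" and m: "m : M"
 shows "dcoord M mu nu f (dcoset mu nu m) = f m"
proof -
 define a where "a D = (if D : dcosets M mu nu then f (SOME m. m : D) else 0)" for D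
 have am: "a (dcoset mu nu x) = f x" if "x : M" for x
 proof -
  have "(SOME y. y : dcoset mu nu x) : dcoset mu nu x" by (rule someI[of _ x]) (rule dcoset_M(3)[OF mu nu that])
  moreover from this have "(SOME y. y : dcoset mu nu x) : M" using dcoset_M(1)[OF mu nu that] by blast
  ultimately have "f (SOME y. y : dcoset mu nu x) = f x"
   using dcoset_M(4)[OF mu nu that] f that unfolding invariants_iff[OF mu nu] by blast
  then show ?thesis using that by (simp add: a_def dcosets_def)
 qed
 have sub: "coset_sum D x = 0" if "x ~: M" "D : dcosets M mu nu" for D x
 proof -
  obtain y where y: "y : M" "D = dcoset mu nu y" using \<open>D : dcosets M mu nu\<close> by (auto simp: dcosets_def)
  have "x ~: D" using y dcoset_M(1)[OF mu nu y(1)] \<open>x ~: M\<close> by blast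
  then show ?thesis using coset_sum_eq[OF mu nu y(1), of x] y(2) by simp
 qed
 have "dcoord M mu nu f = a" unfolding dcoord_def
 proof (rule the_equality)
  have "f x = (\<Sum>D\<in>dcosets M mu nu. a D * coset_sum D x)" for x
  proof (cases "x : M")
   case True
   then show ?thesis using sum_dcosets[OF mu nu True, of a] am by simp
  next
   case False
   then show ?thesis using sub f unfolding invariants_iff[OF mu nu] by simp
  qed
  then have "f = (%x. \<Sum>D\<in>dcosets M mu nu. a D * coset_sum D x)" by (rule ext)
  moreover have "\<forall>D. D ~: dcosets M mu nu --> a D = 0" by (simp add: a_def)
  ultimately show "(\<forall>D. D ~: dcosets M mu nu --> a D = 0) & f = (%x. \<Sum>D\<in>dcosets M mu nu. a D * coset_sum D x)"
   by blast
 next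
  fix b assume b: "(\<forall>D. D ~: dcosets M mu nu --> b D = 0) & f = (%x. \<Sum>D\<in>dcosets M mu nu. b D * coset_sum D x)"
  show "b = a"
  proof
   fix D
   show "b D = a D"
   proof (cases "D : dcosets M mu nu")
    case True
    then obtain x where x: "x : M" "D = dcoset mu nu x" by (auto simp: dcosets_def)
    have "f x = (\<Sum>D\<in>dcosets M mu nu. b D * coset_sum D x)" using b by meson
    also have "... = b D" using sum_dcosets[OF mu nu x(1), of b] x(2) by simp
    finally have "f x = b D" .
    then show ?thesis using am[OF x(1)] x(2) by simp
   qed (use b in \<open>simp add: a_def\<close>)
  qed
 qed
 then show ?thesis using am[OF m] by simp
qed

lemma conv_sum: "conv M f g m = (\<Sum>a\<in>M. \<Sum>b\<in>M. if a o b = m then f a * g b else 0)"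
proof -
 have "conv M f g m = (\<Sum>x\<in>{x\<in>M \<times> M. fst x o snd x = m}. f (fst x) * g (snd x))"
  unfolding conv_def by (rule sum.cong) auto
 also have "... = (\<Sum>x\<in>M \<times> M. if fst x o snd x = m then f (fst x) * g (snd x) else 0)"
  using finite_M by (intro sum.inter_filter) simp
 also have "... = (\<Sum>a\<in>M. \<Sum>b\<in>M. if a o b = m then f a * g b else 0)"
  by (simp add: sum.cartesian_product case_prod_beta)
 finally show ?thesis .
qed

lemma sum_M_translate:
 assumes "mu : Comp" "rho : young mu"
 shows "(\<Sum>a\<in>M. F (rho o a)) = (\<Sum>a\<in>M. F a)" "(\<Sum>a\<in>M. F (a o rho)) = (\<Sum>a\<in>M. F a)"
proof -
 note i = young_inv[OF assms(2)]
 have "bij_betw (%a. rho o a) M M" by (rule bij_betw_byWitness[where f' = "%a. pinv rho o a"])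
   (use young_cancel[OF assms] young_M[OF assms] young_M[OF assms(1) i] in auto)
 then show "(\<Sum>a\<in>M. F (rho o a)) = (\<Sum>a\<in>M. F a)" by (rule sum.reindex_bij_betw)
 have "bij_betw (%a. a o rho) M M" by (rule bij_betw_byWitness[where f' = "%a. a o pinv rho"])
   (use young_cancel[OF assms] young_M[OF assms] young_M[OF assms(1) i] in auto)
 then show "(\<Sum>a\<in>M. F (a o rho)) = (\<Sum>a\<in>M. F a)" by (rule sum.reindex_bij_betw)
qed

lemma comp_eq_young:
 assumes "mu : Comp" "nu : Comp" "rho : young mu" "ta : young nu"
 shows "rho o a o ta = rho o b o ta \<longleftrightarrow> a = b"
proof
 assume "rho o a o ta = rho o b o ta"
 then have "rho o a = rho o b" using young_cancel(3)[OF assms(2,4)] by metis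
 then show "a = b" using young_cancel(1)[OF assms(1,3)] by metis
qed simp

lemma conv_invariants:
 assumes mu: "mu : Comp" and nu: "nu : Comp" and ta: "ta : Comp"
  and f: "f : Inv mu nu" and g: "g : Inv nu ta"
 shows "conv M f g : Inv mu ta"
proof -
 have "conv M f g (rho o m o sig) = conv M f g m" if r: "rho : young mu" "sig : young ta" for rho sig m
 proof -
  have "conv M f g (rho o m o sig) = (\<Sum>a\<in>M. \<Sum>b\<in>M. if rho o a o (b o sig) = rho o m o sig then f (rho o a) * g (b o sig) else 0)"
  proof -
   have "conv M f g (rho o m o sig) = (\<Sum>a\<in>M. \<Sum>b\<in>M. if rho o a o b = rho o m o sig then f (rho o a) * g b else 0)"
    unfolding conv_sum by (rule sum_M_translate(1)[OF mu r(1), symmetric,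
       where F = "%a. \<Sum>b\<in>M. if a o b = rho o m o sig then f a * g b else 0"])
   also have "... = (\<Sum>a\<in>M. \<Sum>b\<in>M. if rho o a o (b o sig) = rho o m o sig then f (rho o a) * g (b o sig) else 0)"
   proof (rule sum_eq)
    fix a
    show "(\<Sum>b\<in>M. if rho o a o b = rho o m o sig then f (rho o a) * g b else 0) =
      (\<Sum>b\<in>M. if rho o a o (b o sig) = rho o m o sig then f (rho o a) * g (b o sig) else 0)"
     by (rule sum_M_translate(2)[OF ta r(2), symmetric,
       where F = "%b. if rho o a o b = rho o m o sig then f (rho o a) * g b else 0"])
   qed
   finally show ?thesis .
  qed
  also have "... = conv M f g m" unfolding conv_sum
  proof (intro sum.cong refl if_cong)
   fix a b assume ab: "a : M" "b : M"
   have "rho o a o (b o sig) = rho o (a o b) o sig" by (simp add: comp_assoc)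
   then show "rho o a o (b o sig) = rho o m o sig \<longleftrightarrow> a o b = m" using comp_eq_young[OF mu ta r] by simp
   show "f (rho o a) * g (b o sig) = f a * g b"
    using invariants_young[OF mu nu f r(1) id_young ab(1)] invariants_young[OF nu ta g id_young r(2) ab(2)] by simp
  qed
  finally show ?thesis .
 qed
 then have "conv M f g m' = conv M f g m" if "m : M" "m' : M" "cm mu ta m' = cm mu ta m" for m m'
  using dcoset_iff[OF mu ta M_tau[OF that(1)] M_tau[OF that(2)]] that(3) by (auto simp: dcoset_def)
 then show ?thesis unfolding invariants_iff[OF mu ta] using conv_off by blast
qed

lemma coset_sum_invariants:
 assumes "mu : Comp" "nu : Comp" "m : M"
 shows "coset_sum (dcoset mu nu m) : Inv mu nu" unfolding invariants_iff[OF assms(1,2)]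
 using coset_sum_M[OF assms] coset_sum_eq[OF assms] dcoset_M(1)[OF assms] by auto

end

lemma sum_pull: "(\<Sum>c\<in>A. \<Sum>b\<in>B. \<Sum>k\<in>K. h c b k) = (\<Sum>k\<in>K. \<Sum>c\<in>A. \<Sum>b\<in>B. h c b k)"
proof -
 have "(\<Sum>c\<in>A. \<Sum>b\<in>B. \<Sum>k\<in>K. h c b k) = (\<Sum>c\<in>A. \<Sum>k\<in>K. \<Sum>b\<in>B. h c b k)"
  by (rule sum_eq) (rule sum.swap)
 also have "... = (\<Sum>k\<in>K. \<Sum>c\<in>A. \<Sum>b\<in>B. h c b k)" by (rule sum.swap)
 finally show ?thesis .
qed

context gs_data
begin

lemma invariants_map2:
 assumes c: "mu : Comp" "nu : Comp"
  and f: "f : Inv mu nu" and g: "g : Inv mu nu" and h: "h 0 0 = 0"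
 shows "(%m. h (f m) (g m)) : Inv mu nu" unfolding invariants_iff[OF c]
proof (intro conjI allI ballI impI)
 fix m assume "m ~: M"
 then have "f m = 0" "g m = 0" using f g by (simp_all add: invariants_def)
 then show "h (f m) (g m) = 0" using h by simp
next
 fix m m' assume "m : M" "m' : M" "cm mu nu m' = cm mu nu m"
 then have "f m' = f m" "g m' = g m" using f g unfolding invariants_iff[OF c] by blast+
 then show "h (f m') (g m') = h (f m) (g m)" by simp
qed

lemma finite_compositions: "finite (Comp)"
proof (rule finite_subset)
 show "Comp <= {xs. set xs <= {..r} & length xs = n}" using member_le_sum_list by (auto simp: compositions_def)
qed (simp add: finite_lists_length_eq)

text \<open>Permutations are the identity beyond \<open>r\<close> whereas elements of
  \<open>M\<close> vanish there; composition with \<open>perm_map r id\<close> mediates between the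
  two conventions.\<close>

lemma one_coset: assumes mu: "mu : Comp" shows "dcoset mu mu (perm_map r id) = perm_map r ` young mu"
  "inj_on (perm_map r) (young mu)"
  "rho : young mu ==> rho o perm_map r id = perm_map r rho" "rho : young mu ==> perm_map r id o rho = perm_map r rho"
proof -
 have e: "rho o perm_map r id o ta = perm_map r (rho o ta)" if "rho : young mu" "ta : young mu" for rho ta
 proof
  fix x
  have p: "rho permutes {1..r}" "ta permutes {1..r}" using young_r[OF mu] that by auto
  show "(rho o perm_map r id o ta) x = perm_map r (rho o ta) x"
  proof (cases "x <= r")
   case True
   have "ta x <= r" using permutes_in_image[OF p(2), of x] perm_0[OF p(2)] True by (cases "x = 0") auto
   then show ?thesis using True by (simp add: perm_map_def)
  next
   case False
   then have "ta x = x" by (intro permutes_not_in[OF p(2)]) simp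
   then show ?thesis using False perm_0[OF p(1)] by (simp add: perm_map_def)
  qed
 qed
 show "rho : young mu ==> rho o perm_map r id = perm_map r rho" using e[OF _ id_young, of rho] by simp
 show "rho : young mu ==> perm_map r id o rho = perm_map r rho" using e[OF id_young, of rho] by simp
 show "dcoset mu mu (perm_map r id) = perm_map r ` young mu"
 proof (intro equalityI subsetI)
  fix y assume "y : perm_map r ` young mu"
  then obtain rho where r: "rho : young mu" "y = perm_map r rho" by blast
  then have "y = rho o perm_map r id o id" using e[OF r(1) id_young] by simp
  then show "y : dcoset mu mu (perm_map r id)" unfolding dcoset_def using r(1) id_young by blast
 next
  fix y assume "y : dcoset mu mu (perm_map r id)"
  then obtain rho ta where "rho : young mu" "ta : young mu" "y = rho o perm_map r id o ta" by (auto simp: dcoset_def)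
  then show "y : perm_map r ` young mu" using e young_comp by blast
 qed
 show "inj_on (perm_map r) (young mu)"
 proof (rule inj_onI, rule ext)
  fix rho ta x assume h: "rho : young mu" "ta : young mu" "perm_map r rho = perm_map r ta"
  show "rho x = ta x"
  proof (cases "x <= r")
   case True
   then show ?thesis using fun_cong[OF h(3), of x] by (simp add: perm_map_def)
  next
   case False
   then show ?thesis using permutes_not_in[OF young_r[OF mu h(1)], of x] permutes_not_in[OF young_r[OF mu h(2)], of x] by simp
  qed
 qed
qed

lemma perm_map_M: "mu : Comp ==> rho : young mu ==> perm_map r rho : M" using M_perm young_r by blast

end

text \<open>The common frame for \<open>n_left\<close> and \<open>n_right\<close>: \<open>u\<close>
  depends on the image and \<open>v\<close> on the family of fibres, and one of them is constantly 1
  in either instance. The condition \<open>weight_dvd\<close> makes the integer division in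
  \<open>struct_const\<close> exact.\<close>

locale weighted_gs = gs_data r n M orbs ord
 for r n :: nat and M :: "(nat => nat) set" and orbs ord +
 fixes w :: "nat list => nat list => (nat => nat) set => nat"
  and u :: "nat list => nat set => nat" and v :: "nat list => nat set set => nat"
 assumes weight_eq: "!!mu nu m. mu : Comp ==> nu : Comp ==> m : M ==>
   w mu nu (dcoset mu nu m) = u mu (im m) * v nu (fam m)"
  and u_pos: "!!mu C. 0 < u mu C" and v_pos: "!!nu D. 0 < v nu D"
  and u_young: "!!mu C rho. mu : Comp ==> rho : young mu ==> u mu (rho ` C) = u mu C"
  and v_young: "!!nu D ta. nu : Comp ==> ta : young nu ==> v nu ((%d. ta -` d) ` D) = v nu D"
  and weight_one: "!!mu. mu : Comp ==> w mu mu (dcoset mu mu (perm_map r id)) = card (young mu)"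
  and weight_dvd: "!!mu nu ta m1 m2 m. mu : Comp ==> nu : Comp ==> ta : Comp ==>
   m1 : M ==> m2 : M ==> m : M ==>
   int (w mu nu (dcoset mu nu m1)) * int (w nu ta (dcoset nu ta m2)) dvd
   int (w mu ta (dcoset mu ta m)) * conv M (coset_sum (dcoset mu nu m1)) (coset_sum (dcoset nu ta m2)) m"
begin

abbreviation "DR == double_coset_ring w r n M"
abbreviation multD (infixl "\<otimes>D" 70) where "x \<otimes>D y == x \<otimes>\<^bsub>DR\<^esub> y"
abbreviation addD (infixl "\<oplus>D" 65) where "x \<oplus>D y == x \<oplus>\<^bsub>DR\<^esub> y"
abbreviation oneD ("\<one>D") where "\<one>D == \<one>\<^bsub>DR\<^esub>"
abbreviation zeroD ("\<zero>D") where "\<zero>D == \<zero>\<^bsub>DR\<^esub>"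

definition W :: "nat list => nat list => (nat => nat) => rat" where
 "W mu nu m = of_nat (w mu nu (dcoset mu nu m))"

text \<open>Dividing by the weights turns the twisted product into convolution with rational coefficients.\<close>

definition nrm :: "(nat list => nat list => (nat => nat) => int) => nat list => nat list => (nat => nat) => rat" where
 "nrm x mu nu m = of_int (x mu nu m) / W mu nu m"

definition mconv :: "(nat list => nat list => (nat => nat) => rat) => (nat list => nat list => (nat => nat) => rat) =>
  nat list => nat list => (nat => nat) => rat" where
 "mconv F G mu ta m = (\<Sum>nu\<in>Comp. \<Sum>a\<in>M. \<Sum>b\<in>M. if a o b = m then F mu nu a * G nu ta b else 0)"

lemma W_pos: "mu : Comp ==> nu : Comp ==> m : M ==> 0 < W mu nu m" by (simp add: W_def weight_eq u_pos v_pos)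

lemma W_cm: "mu : Comp ==> nu : Comp ==> m : M ==> m' : M ==> cm mu nu m' = cm mu nu m ==> W mu nu m' = W mu nu m"
 using dcoset_M(5)[of mu nu m m'] by (simp add: W_def)

lemma carrier_iff: "x : carrier DR \<longleftrightarrow> (\<forall>mu nu. if mu : Comp & nu : Comp then x mu nu : Inv mu nu else x mu nu = (%m. 0))"
 by (simp add: double_coset_ring_def)

lemma carrierD:
 assumes "x : carrier DR"
 shows "mu : Comp ==> nu : Comp ==> x mu nu : Inv mu nu"
  "~ (mu : Comp & nu : Comp) ==> x mu nu m = 0" "m ~: M ==> x mu nu m = 0"
proof -
 have c: "if mu : Comp & nu : Comp then x mu nu : Inv mu nu else x mu nu = (%m. 0)"
  using assms unfolding carrier_iff by blast
 then show "mu : Comp ==> nu : Comp ==> x mu nu : Inv mu nu" by simp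
 show off: "~ (mu : Comp & nu : Comp) ==> x mu nu m = 0" using c by simp
 show "m ~: M ==> x mu nu m = 0" using c off by (cases "mu : Comp & nu : Comp") (auto simp: invariants_def)
qed

lemma carrierI:
 assumes "!!mu nu. mu : Comp ==> nu : Comp ==> x mu nu : Inv mu nu"
  "!!mu nu m. ~ (mu : Comp & nu : Comp) ==> x mu nu m = 0"
 shows "x : carrier DR"
proof -
 have "x mu nu = (%m. 0)" if "~ (mu : Comp & nu : Comp)" for mu nu using assms(2)[OF that] by (rule ext)
 then show ?thesis unfolding carrier_iff using assms(1) by simp
qed

lemma carrier_eqI:
 assumes "x : carrier DR" "y : carrier DR"
  and "!!mu nu m. mu : Comp ==> nu : Comp ==> m : M ==> nrm x mu nu m = nrm y mu nu m"
 shows "x = y"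
proof (intro ext)
 fix mu nu m
 show "x mu nu m = y mu nu m"
 proof (cases "(mu : Comp & nu : Comp) & m : M")
  case True
  then show ?thesis using assms(3)[of mu nu m] W_pos[of mu nu m] by (simp add: nrm_def)
 next
  case False
  then show ?thesis using carrierD(2,3)[OF assms(1)] carrierD(2,3)[OF assms(2)] by metis
 qed
qed

text \<open>A structure constant divided by \<open>W mu ta m\<close> is a convolution coefficient
  divided by the weights of the two factors, and these weights are absorbed by \<open>nrm x\<close>
  and \<open>nrm y\<close>. The sums over double cosets then recombine to functions on
  \<open>M\<close>.\<close>

lemma nrm_star:
 assumes x: "x : carrier DR" and y: "y : carrier DR" and mu: "mu : Comp" and ta: "ta : Comp" and m: "m : M"
 shows "nrm (star_mult w r n M x y) mu ta m = mconv (nrm x) (nrm y) mu ta m"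
proof -
 have sc: "of_int (struct_const w M mu nu ta (dcoset mu nu m1) (dcoset nu ta m2) (dcoset mu ta m)) =
   W mu ta m * of_int (conv M (coset_sum (dcoset mu nu m1)) (coset_sum (dcoset nu ta m2)) m) / (W mu nu m1 * W nu ta m2)"
  if nu: "nu : Comp" and m12: "m1 : M" "m2 : M" for nu m1 m2
 proof -
  have dc: "dcoord M mu ta (conv M (coset_sum (dcoset mu nu m1)) (coset_sum (dcoset nu ta m2))) (dcoset mu ta m) =
    conv M (coset_sum (dcoset mu nu m1)) (coset_sum (dcoset nu ta m2)) m"
   by (rule dcoord_eq[OF mu ta conv_invariants[OF mu nu ta coset_sum_invariants[OF mu nu m12(1)] coset_sum_invariants[OF nu ta m12(2)]] m])
  obtain q where q: "int (w mu ta (dcoset mu ta m)) * conv M (coset_sum (dcoset mu nu m1)) (coset_sum (dcoset nu ta m2)) m =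
    int (w mu nu (dcoset mu nu m1)) * int (w nu ta (dcoset nu ta m2)) * q"
   using weight_dvd[OF mu nu ta m12 m] by (elim dvdE)
  have p: "W mu nu m1 ~= 0" "W nu ta m2 ~= 0" using W_pos mu nu ta m12 by (metis less_irrefl)+
  have "struct_const w M mu nu ta (dcoset mu nu m1) (dcoset nu ta m2) (dcoset mu ta m) = q"
   unfolding struct_const_def dc q using p by (simp add: W_def)
  moreover have "rat_of_int (int (w mu ta (dcoset mu ta m)) * conv M (coset_sum (dcoset mu nu m1)) (coset_sum (dcoset nu ta m2)) m) =
    W mu nu m1 * W nu ta m2 * of_int q" unfolding q by (simp add: W_def)
  ultimately show ?thesis using p by (simp add: W_def field_simps)
 qed
 define dx where "dx nu D = rat_of_int (dcoord M mu nu (x mu nu) D)" for nu D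
 define dy where "dy nu D = rat_of_int (dcoord M nu ta (y nu ta) D)" for nu D
 have "nrm (star_mult w r n M x y) mu ta m = (\<Sum>nu\<in>Comp. \<Sum>D1\<in>dcosets M mu nu. \<Sum>D2\<in>dcosets M nu ta.
   dx nu D1 * dy nu D2 * of_int (struct_const w M mu nu ta D1 D2 (dcoset mu ta m)) / W mu ta m)"
  using mu ta sum_dcosets[OF mu ta m, where 'a = int] by (simp add: nrm_def star_mult_def sum_divide_distrib dx_def dy_def)
 also have "... = mconv (nrm x) (nrm y) mu ta m" unfolding mconv_def
 proof (rule sum_eq)
  fix nu assume nu: "nu : Comp"
  define cx where "cx D = dx nu D / of_nat (w mu nu D)" for D
  define cy where "cy D = dy nu D / of_nat (w nu ta D)" for D
  have t: "dx nu D1 * dy nu D2 * of_int (struct_const w M mu nu ta D1 D2 (dcoset mu ta m)) / W mu ta m =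
    (\<Sum>a\<in>M. \<Sum>b\<in>M. if a o b = m then (cx D1 * of_int (coset_sum D1 a)) * (cy D2 * of_int (coset_sum D2 b)) else 0)"
   if D: "D1 : dcosets M mu nu" "D2 : dcosets M nu ta" for D1 D2
  proof -
   obtain m1 m2 where m12: "m1 : M" "D1 = dcoset mu nu m1" "m2 : M" "D2 = dcoset nu ta m2"
    using D by (auto simp: dcosets_def)
   have "W mu ta m ~= 0" using W_pos[OF mu ta m] by simp
   then have "dx nu D1 * dy nu D2 * of_int (struct_const w M mu nu ta D1 D2 (dcoset mu ta m)) / W mu ta m =
     cx D1 * cy D2 * of_int (conv M (coset_sum D1) (coset_sum D2) m)"
    using sc[OF nu m12(1,3)] by (simp add: m12(2,4) cx_def cy_def W_def)
   also have "... = (\<Sum>a\<in>M. \<Sum>b\<in>M. cx D1 * cy D2 * (if a o b = m then of_int (coset_sum D1 a) * of_int (coset_sum D2 b) else 0))"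
    unfolding conv_sum by (simp add: sum_distrib_left of_int_sum if_distrib[of of_int] cong: if_cong)
   also have "... = (\<Sum>a\<in>M. \<Sum>b\<in>M. if a o b = m then (cx D1 * of_int (coset_sum D1 a)) * (cy D2 * of_int (coset_sum D2 b)) else 0)"
    by (intro sum.cong refl) simp
   finally show ?thesis .
  qed
  have "(\<Sum>D1\<in>dcosets M mu nu. \<Sum>D2\<in>dcosets M nu ta. dx nu D1 * dy nu D2 * of_int (struct_const w M mu nu ta D1 D2 (dcoset mu ta m)) / W mu ta m) =
    (\<Sum>D1\<in>dcosets M mu nu. \<Sum>D2\<in>dcosets M nu ta. \<Sum>a\<in>M. \<Sum>b\<in>M.
     if a o b = m then (cx D1 * of_int (coset_sum D1 a)) * (cy D2 * of_int (coset_sum D2 b)) else 0)"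
   by (intro sum.cong refl t)
  also have "... = (\<Sum>a\<in>M. \<Sum>b\<in>M. \<Sum>D1\<in>dcosets M mu nu. \<Sum>D2\<in>dcosets M nu ta.
     if a o b = m then (cx D1 * of_int (coset_sum D1 a)) * (cy D2 * of_int (coset_sum D2 b)) else 0)"
   by (rule trans[OF sum_pull], rule sum_eq, rule sum_pull)
  also have "... = (\<Sum>a\<in>M. \<Sum>b\<in>M. if a o b = m then nrm x mu nu a * nrm y nu ta b else 0)"
  proof (intro sum.cong refl)
   fix a b assume ab: "a : M" "b : M"
   have "nrm x mu nu a = (\<Sum>D\<in>dcosets M mu nu. cx D * of_int (coset_sum D a))"
    using sum_dcosets[OF mu nu ab(1), of cx] dcoord_eq[OF mu nu carrierD(1)[OF x mu nu] ab(1)]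
    by (simp add: cx_def dx_def nrm_def W_def)
   moreover have "nrm y nu ta b = (\<Sum>D\<in>dcosets M nu ta. cy D * of_int (coset_sum D b))"
    using sum_dcosets[OF nu ta ab(2), of cy] dcoord_eq[OF nu ta carrierD(1)[OF y nu ta] ab(2)]
    by (simp add: cy_def dy_def nrm_def W_def)
   ultimately show "(\<Sum>D1\<in>dcosets M mu nu. \<Sum>D2\<in>dcosets M nu ta.
     if a o b = m then (cx D1 * of_int (coset_sum D1 a)) * (cy D2 * of_int (coset_sum D2 b)) else 0) =
     (if a o b = m then nrm x mu nu a * nrm y nu ta b else 0)" by (simp only: sum_product) simp
  qed
  finally show "(\<Sum>D1\<in>dcosets M mu nu. \<Sum>D2\<in>dcosets M nu ta. dx nu D1 * dy nu D2 * of_int (struct_const w M mu nu ta D1 D2 (dcoset mu ta m)) / W mu ta m) =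
    (\<Sum>a\<in>M. \<Sum>b\<in>M. if a o b = m then nrm x mu nu a * nrm y nu ta b else 0)" .
 qed
 finally show ?thesis .
qed

lemma star_closed: "star_mult w r n M x y : carrier DR"
proof (rule carrierI)
 fix mu ta assume mu: "mu : Comp" and ta: "ta : Comp"
 have inv: "coset_sum D : Inv mu ta" if "D : dcosets M mu ta" for D
  using \<open>D : dcosets M mu ta\<close> coset_sum_invariants[OF mu ta] unfolding dcosets_def by blast
 have cs: "coset_sum D m = 0" if "D : dcosets M mu ta" "m ~: M" for D m
  using inv[OF that(1)] that(2) by (simp add: invariants_def)
 have cc: "coset_sum D m' = coset_sum D m" if "D : dcosets M mu ta" "m : M" "m' : M" "cm mu ta m' = cm mu ta m" for D m m'
  using inv[OF that(1), unfolded invariants_iff[OF mu ta]] that(2-4) by blast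
 show "star_mult w r n M x y mu ta : Inv mu ta" unfolding invariants_iff[OF mu ta]
 proof (intro conjI allI impI ballI)
  fix m assume "m ~: M"
  then show "star_mult w r n M x y mu ta m = 0" using mu ta cs by (simp add: star_mult_def)
 next
  fix m m' assume h: "m : M" "m' : M" "cm mu ta m' = cm mu ta m"
  have "(\<Sum>D\<in>dcosets M mu ta. g D * coset_sum D m') = (\<Sum>D\<in>dcosets M mu ta. g D * coset_sum D m)" for g
   by (intro sum.cong refl) (simp add: cc[OF _ h])
  then show "star_mult w r n M x y mu ta m' = star_mult w r n M x y mu ta m" by (simp add: star_mult_def)
 qed
qed (auto simp: star_mult_def)

lemma one_closed: "\<one>D : carrier DR"
proof (rule carrierI)
 fix mu nu assume h: "mu : Comp" "nu : Comp"
 show "\<one>D mu nu : Inv mu nu"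
 proof (cases "mu = nu")
  case True
  then show ?thesis using coset_sum_invariants[OF h(1) h(1) perm_map_M[OF h(1) id_young]] h
   by (simp add: double_coset_ring_def)
 next
  case False
  then show ?thesis unfolding invariants_iff[OF h] by (simp add: double_coset_ring_def)
 qed
qed (auto simp: double_coset_ring_def)

lemma nrm_cm:
 assumes "x : carrier DR" "mu : Comp" "nu : Comp" "m : M" "m' : M" "cm mu nu m' = cm mu nu m"
 shows "nrm x mu nu m' = nrm x mu nu m"
proof -
 have "x mu nu m' = x mu nu m" using carrierD(1)[OF assms(1-3), unfolded invariants_iff[OF assms(2,3)]] assms(4-6) by blast
 then show ?thesis using W_cm[OF assms(2-6)] by (simp add: nrm_def)
qed

lemma nrm_young:
 assumes "x : carrier DR" "mu : Comp" "nu : Comp" "m : M" "rho : young mu" "ta : young nu"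
 shows "nrm x mu nu (rho o m) = nrm x mu nu m" "nrm x mu nu (m o ta) = nrm x mu nu m"
 using nrm_cm[OF assms(1-4) young_M(1)[OF assms(2,5,4)]] nrm_cm[OF assms(1-4) young_M(2)[OF assms(3,6,4)]]
  cm_comp[OF assms(2,3,5) id_young M_tau[OF assms(4)]] cm_comp[OF assms(2,3) id_young assms(6) M_tau[OF assms(4)]] by simp_all

text \<open>After normalisation the identity is, in each diagonal component, the averaging
  idempotent of the Young subgroup.\<close>

lemma nrm_one:
 assumes mu: "mu : Comp" and "m : M"
 shows "nrm (\<one>D) mu nu m = (if mu = nu & m : perm_map r ` young mu then 1 / of_nat (card (young mu)) else 0)"
proof -
 note e = perm_map_M[OF mu id_young]
 have "W mu mu m = of_nat (card (young mu))" if "m : perm_map r ` young mu"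
  using that weight_one[OF mu] dcoset_M(4,5)[OF mu mu e, of m] assms(2) one_coset(1)[OF mu] by (simp add: W_def)
 moreover have "\<one>D mu nu m = (if mu = nu & m : perm_map r ` young mu then 1 else 0)"
 proof (cases "mu = nu")
  case True
  then show ?thesis using mu coset_sum_eq[OF mu mu e, of m] unfolding True[symmetric] one_coset(1)[OF mu]
   by (simp add: double_coset_ring_def one_coset(1))
 qed (simp add: double_coset_ring_def)
 ultimately show ?thesis by (auto simp: nrm_def)
qed

lemma mconv_one:
 assumes x: "x : carrier DR" and mu: "mu : Comp" and ta: "ta : Comp" and m: "m : M"
 shows "mconv (nrm \<one>D) (nrm x) mu ta m = nrm x mu ta m" "mconv (nrm x) (nrm \<one>D) mu ta m = nrm x mu ta m"
proof -
 have cpos: "card (young kap) ~= 0" for kap using finite_young id_young by (metis card_eq_0_iff empty_iff)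
 have av: "(\<Sum>a\<in>M. if a : perm_map r ` young kap then F a else 0) = (\<Sum>rho\<in>young kap. F (perm_map r rho))"
  if "kap : Comp" for kap and F :: "(nat => nat) => rat"
 proof -
  have "(\<Sum>a\<in>M. if a : perm_map r ` young kap then F a else 0) = (\<Sum>a\<in>M \<inter> perm_map r ` young kap. F a)"
   using finite_M by (simp add: sum.inter_restrict)
  also have "M \<inter> perm_map r ` young kap = perm_map r ` young kap" using perm_map_M[OF that] by blast
  also have "(\<Sum>a\<in>perm_map r ` young kap. F a) = (\<Sum>rho\<in>young kap. F (perm_map r rho))"
   using sum.reindex[OF one_coset(2)[OF that], of F] by simp
  finally show ?thesis .
 qed
 let ?c = "1 / rat_of_nat (card (young mu))" and ?d = "1 / rat_of_nat (card (young ta))"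
 have "mconv (nrm \<one>D) (nrm x) mu ta m =
   (\<Sum>nu\<in>Comp. if nu = mu then \<Sum>a\<in>M. if a : perm_map r ` young mu then \<Sum>b\<in>M. if a o b = m then ?c * nrm x mu ta b else 0 else 0 else 0)"
  unfolding mconv_def
 proof (rule sum_eq)
  fix nu assume "nu : Comp"
  have "(\<Sum>b\<in>M. if a o b = m then nrm \<one>D mu nu a * nrm x nu ta b else 0) =
    (if nu = mu then if a : perm_map r ` young mu then \<Sum>b\<in>M. if a o b = m then ?c * nrm x mu ta b else 0 else 0 else 0)"
   if "a : M" for a using nrm_one[OF mu that, of nu] by (auto intro!: sum.neutral sum.cong)
  then show "(\<Sum>a\<in>M. \<Sum>b\<in>M. if a o b = m then nrm \<one>D mu nu a * nrm x nu ta b else 0) =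
    (if nu = mu then \<Sum>a\<in>M. if a : perm_map r ` young mu then \<Sum>b\<in>M. if a o b = m then ?c * nrm x mu ta b else 0 else 0 else 0)"
   by (cases "nu = mu") simp_all
 qed
 also have "... = (\<Sum>rho\<in>young mu. \<Sum>b\<in>M. if perm_map r rho o b = m then ?c * nrm x mu ta b else 0)"
  using finite_compositions mu av[OF mu] by (simp add: sum.delta)
 also have "... = (\<Sum>rho\<in>young mu. ?c * nrm x mu ta m)"
 proof (rule sum_eq)
  fix rho assume r: "rho : young mu"
  note i = young_inv[OF r]
  have "(if perm_map r rho o b = m then ?c * nrm x mu ta b else 0) = (if b = pinv rho o m then ?c * nrm x mu ta m else 0)"
   if b: "b : M" for b
  proof -
   have "perm_map r rho o b = m \<longleftrightarrow> b = pinv rho o m"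
    unfolding perm_map_comp(1)[OF young_r[OF mu r] M_tau[OF b]] using young_cancel(1,2)[OF mu r] by metis
   then show ?thesis using nrm_young(1)[OF x mu ta m i id_young] by simp
  qed
  then have "(\<Sum>b\<in>M. if perm_map r rho o b = m then ?c * nrm x mu ta b else 0) =
    (\<Sum>b\<in>M. if b = pinv rho o m then ?c * nrm x mu ta m else 0)" by (rule sum_eq)
  also have "... = ?c * nrm x mu ta m" using finite_M young_M(1)[OF mu i m] by (simp add: sum.delta)
  finally show "(\<Sum>b\<in>M. if perm_map r rho o b = m then ?c * nrm x mu ta b else 0) = ?c * nrm x mu ta m" .
 qed
 also have "... = nrm x mu ta m" using cpos by simp
 finally show "mconv (nrm \<one>D) (nrm x) mu ta m = nrm x mu ta m" .
 have "mconv (nrm x) (nrm \<one>D) mu ta m =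
   (\<Sum>nu\<in>Comp. if nu = ta then \<Sum>b\<in>M. if b : perm_map r ` young ta then \<Sum>a\<in>M. if a o b = m then nrm x mu ta a * ?d else 0 else 0 else 0)"
  unfolding mconv_def
 proof (rule sum_eq)
  fix nu assume nu: "nu : Comp"
  have "(\<Sum>a\<in>M. if a o b = m then nrm x mu nu a * nrm \<one>D nu ta b else 0) =
    (if nu = ta then if b : perm_map r ` young ta then \<Sum>a\<in>M. if a o b = m then nrm x mu ta a * ?d else 0 else 0 else 0)"
   if "b : M" for b using nrm_one[OF nu that, of ta] by (auto intro!: sum.neutral sum.cong)
  then show "(\<Sum>a\<in>M. \<Sum>b\<in>M. if a o b = m then nrm x mu nu a * nrm \<one>D nu ta b else 0) =
    (if nu = ta then \<Sum>b\<in>M. if b : perm_map r ` young ta then \<Sum>a\<in>M. if a o b = m then nrm x mu ta a * ?d else 0 else 0 else 0)"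
   by (subst sum.swap) (cases "nu = ta"; simp)
 qed
 also have "... = (\<Sum>rho\<in>young ta. \<Sum>a\<in>M. if a o perm_map r rho = m then nrm x mu ta a * ?d else 0)"
  using finite_compositions ta av[OF ta] by (simp add: sum.delta)
 also have "... = (\<Sum>rho\<in>young ta. nrm x mu ta m * ?d)"
 proof (rule sum_eq)
  fix rho assume r: "rho : young ta"
  note i = young_inv[OF r]
  have "(if a o perm_map r rho = m then nrm x mu ta a * ?d else 0) = (if a = m o pinv rho then nrm x mu ta m * ?d else 0)"
   if a: "a : M" for a
  proof -
   have "a o perm_map r rho = m \<longleftrightarrow> a = m o pinv rho"
    unfolding perm_map_comp(2)[OF young_r[OF ta r] M_tau[OF a]] using young_cancel(3,4)[OF ta r] by metis
   then show ?thesis using nrm_young(2)[OF x mu ta m id_young i] by simp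
  qed
  then have "(\<Sum>a\<in>M. if a o perm_map r rho = m then nrm x mu ta a * ?d else 0) =
    (\<Sum>a\<in>M. if a = m o pinv rho then nrm x mu ta m * ?d else 0)" by (rule sum_eq)
  also have "... = nrm x mu ta m * ?d" using finite_M young_M(2)[OF ta i m] by (simp add: sum.delta)
  finally show "(\<Sum>a\<in>M. if a o perm_map r rho = m then nrm x mu ta a * ?d else 0) = nrm x mu ta m * ?d" .
 qed
 also have "... = nrm x mu ta m" using cpos by simp
 finally show "mconv (nrm x) (nrm \<one>D) mu ta m = nrm x mu ta m" .
qed

text \<open>Both sides are expanded to one sum over two intermediate compositions and three factors;
  the sum over the inner product collapses because \<open>M\<close> is closed under
  composition.\<close>

lemma mconv_assoc:
 "mconv (mconv F G) H mu ta m = mconv F (mconv G H) mu ta m"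
proof -
 have l: "mconv (mconv F G) H mu ta m = (\<Sum>nu\<in>Comp. \<Sum>kap\<in>Comp. \<Sum>a\<in>M. \<Sum>d\<in>M. \<Sum>b\<in>M.
   if a o d o b = m then F mu kap a * G kap nu d * H nu ta b else 0)" unfolding mconv_def
 proof (rule sum_eq)
  fix nu
  have "(\<Sum>c\<in>M. \<Sum>b\<in>M. if c o b = m then (\<Sum>kap\<in>Comp. \<Sum>a\<in>M. \<Sum>d\<in>M. if a o d = c then F mu kap a * G kap nu d else 0) * H nu ta b else 0) =
    (\<Sum>c\<in>M. \<Sum>b\<in>M. \<Sum>kap\<in>Comp. \<Sum>a\<in>M. \<Sum>d\<in>M. if c = a o d then if a o d o b = m then F mu kap a * G kap nu d * H nu ta b else 0 else 0)"
  proof (intro sum.cong refl)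
   fix c b
   show "(if c o b = m then (\<Sum>kap\<in>Comp. \<Sum>a\<in>M. \<Sum>d\<in>M. if a o d = c then F mu kap a * G kap nu d else 0) * H nu ta b else 0) =
     (\<Sum>kap\<in>Comp. \<Sum>a\<in>M. \<Sum>d\<in>M. if c = a o d then if a o d o b = m then F mu kap a * G kap nu d * H nu ta b else 0 else 0)"
   proof (cases "c o b = m")
    case True
    then show ?thesis unfolding if_P[OF True] sum_distrib_right by (intro sum.cong refl) auto
   next
    case False
    show ?thesis unfolding if_not_P[OF False] by (rule sym, intro sum.neutral ballI) (use False in auto)
   qed
  qed
  also have "... = (\<Sum>kap\<in>Comp. \<Sum>a\<in>M. \<Sum>d\<in>M. \<Sum>b\<in>M. \<Sum>c\<in>M. if c = a o d then if a o d o b = m then F mu kap a * G kap nu d * H nu ta b else 0 else 0)"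
   by (rule trans[OF sum_pull], rule sum_eq, rule trans[OF sum_pull], rule sum_eq,
     rule trans[OF sum_pull], rule sum_eq, rule sum.swap)
  also have "... = (\<Sum>kap\<in>Comp. \<Sum>a\<in>M. \<Sum>d\<in>M. \<Sum>b\<in>M. if a o d o b = m then F mu kap a * G kap nu d * H nu ta b else 0)"
   using finite_M M_comp by (intro sum.cong refl) (simp add: sum.delta)
  finally show "(\<Sum>c\<in>M. \<Sum>b\<in>M. if c o b = m then (\<Sum>kap\<in>Comp. \<Sum>a\<in>M. \<Sum>d\<in>M. if a o d = c then F mu kap a * G kap nu d else 0) * H nu ta b else 0) =
    (\<Sum>kap\<in>Comp. \<Sum>a\<in>M. \<Sum>d\<in>M. \<Sum>b\<in>M. if a o d o b = m then F mu kap a * G kap nu d * H nu ta b else 0)" .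
 qed
 have rr: "mconv F (mconv G H) mu ta m = (\<Sum>kap\<in>Comp. \<Sum>nu\<in>Comp. \<Sum>a\<in>M. \<Sum>d\<in>M. \<Sum>b\<in>M.
   if a o d o b = m then F mu kap a * G kap nu d * H nu ta b else 0)" unfolding mconv_def
 proof (rule sum_eq)
  fix kap
  have "(\<Sum>a\<in>M. \<Sum>c\<in>M. if a o c = m then F mu kap a * (\<Sum>nu\<in>Comp. \<Sum>d\<in>M. \<Sum>b\<in>M. if d o b = c then G kap nu d * H nu ta b else 0) else 0) =
    (\<Sum>a\<in>M. \<Sum>c\<in>M. \<Sum>nu\<in>Comp. \<Sum>d\<in>M. \<Sum>b\<in>M. if c = d o b then if a o d o b = m then F mu kap a * G kap nu d * H nu ta b else 0 else 0)"
  proof (intro sum.cong refl)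
   fix a c
   show "(if a o c = m then F mu kap a * (\<Sum>nu\<in>Comp. \<Sum>d\<in>M. \<Sum>b\<in>M. if d o b = c then G kap nu d * H nu ta b else 0) else 0) =
     (\<Sum>nu\<in>Comp. \<Sum>d\<in>M. \<Sum>b\<in>M. if c = d o b then if a o d o b = m then F mu kap a * G kap nu d * H nu ta b else 0 else 0)"
   proof (cases "a o c = m")
    case True
    then show ?thesis unfolding if_P[OF True] sum_distrib_left by (intro sum.cong refl) (auto simp: comp_assoc)
   next
    case False
    show ?thesis unfolding if_not_P[OF False] by (rule sym, intro sum.neutral ballI) (use False in \<open>auto simp: comp_assoc\<close>)
   qed
  qed
  also have "... = (\<Sum>a\<in>M. \<Sum>nu\<in>Comp. \<Sum>d\<in>M. \<Sum>b\<in>M. \<Sum>c\<in>M. if c = d o b then if a o d o b = m then F mu kap a * G kap nu d * H nu ta b else 0 else 0)"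
   by (rule sum_eq, rule trans[OF sum.swap], rule sum_eq, rule trans[OF sum.swap],
     rule sum_eq, rule sum.swap)
  also have "... = (\<Sum>a\<in>M. \<Sum>nu\<in>Comp. \<Sum>d\<in>M. \<Sum>b\<in>M. if a o d o b = m then F mu kap a * G kap nu d * H nu ta b else 0)"
   using finite_M M_comp by (intro sum.cong refl) (simp add: sum.delta)
  also have "... = (\<Sum>nu\<in>Comp. \<Sum>a\<in>M. \<Sum>d\<in>M. \<Sum>b\<in>M. if a o d o b = m then F mu kap a * G kap nu d * H nu ta b else 0)"
   by (rule sum.swap)
  finally show "(\<Sum>a\<in>M. \<Sum>c\<in>M. if a o c = m then F mu kap a * (\<Sum>nu\<in>Comp. \<Sum>d\<in>M. \<Sum>b\<in>M. if d o b = c then G kap nu d * H nu ta b else 0) else 0) =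
    (\<Sum>nu\<in>Comp. \<Sum>a\<in>M. \<Sum>d\<in>M. \<Sum>b\<in>M. if a o d o b = m then F mu kap a * G kap nu d * H nu ta b else 0)" .
 qed
 show ?thesis unfolding l rr by (rule sum.swap)
qed

lemma mconv_cong:
 assumes "!!nu a. nu : Comp ==> a : M ==> F mu nu a = F' mu nu a" "!!nu b. nu : Comp ==> b : M ==> G nu ta b = G' nu ta b"
 shows "mconv F G mu ta m = mconv F' G' mu ta m" unfolding mconv_def using assms by (intro sum.cong refl) simp

lemma add_closed: "x : carrier DR ==> y : carrier DR ==> x \<oplus>D y : carrier DR"
proof -
 assume x: "x : carrier DR" and y: "y : carrier DR"
 show ?thesis
 proof (rule carrierI)
  fix mu nu assume c: "mu : Comp" "nu : Comp"
  show "(x \<oplus>D y) mu nu : Inv mu nu" using invariants_map2[OF c carrierD(1)[OF x c] carrierD(1)[OF y c], of "(+)"]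
   by (simp add: double_coset_ring_def)
 qed (use carrierD(2)[OF x] carrierD(2)[OF y] in \<open>simp add: double_coset_ring_def\<close>)
qed

lemma nrm_add: "nrm (x \<oplus>D y) = (%mu nu m. nrm x mu nu m + nrm y mu nu m)"
 by (intro ext) (simp add: nrm_def double_coset_ring_def add_divide_distrib)

lemma mult_eq: "x \<otimes>D y = star_mult w r n M x y" by (simp add: double_coset_ring_def)

lemma uminus_closed: assumes x: "x : carrier DR" shows "(%mu nu m. - x mu nu m) : carrier DR"
proof (rule carrierI)
 fix mu nu assume c: "mu : Comp" "nu : Comp"
 show "(%m. - x mu nu m) : Inv mu nu"
  using invariants_map2[OF c carrierD(1)[OF x c] carrierD(1)[OF x c], of "%a b. - a"] by simp
qed (use carrierD(2)[OF x] in simp)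

text \<open>Elements of the carrier are determined by \<open>nrm\<close>, which turns the product
  into convolution, so the ring laws are inherited from \<open>mconv_assoc\<close> and
  \<open>mconv_one\<close>.\<close>

lemma ring_DR: "ring DR"
proof (rule ringI)
 show "abelian_group DR"
 proof (rule abelian_groupI)
  show "\<exists>y\<in>carrier DR. y \<oplus>D x = \<zero>D" if "x : carrier DR" for x
   by (rule bexI[OF _ uminus_closed[OF that]]) (simp add: double_coset_ring_def)
  show "\<zero>D : carrier DR" by (rule carrierI) (simp_all add: invariants_iff, simp_all add: double_coset_ring_def)
 qed (rule add_closed, assumption+, simp_all add: double_coset_ring_def fun_eq_iff)
 show "Group.monoid DR"
 proof (rule Group.monoidI)
  fix x y z assume x: "x : carrier DR" and y: "y : carrier DR" and z: "z : carrier DR"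
  show "(x \<otimes>D y) \<otimes>D z = x \<otimes>D (y \<otimes>D z)" unfolding mult_eq
  proof (rule carrier_eqI[OF star_closed star_closed])
   fix mu ta m assume h: "mu : Comp" "ta : Comp" "m : M"
   have "nrm (star_mult w r n M (star_mult w r n M x y) z) mu ta m = mconv (mconv (nrm x) (nrm y)) (nrm z) mu ta m"
    unfolding nrm_star[OF star_closed z h] by (rule mconv_cong) (simp_all add: nrm_star[OF x y h(1)])
   also have "... = mconv (nrm x) (mconv (nrm y) (nrm z)) mu ta m" by (rule mconv_assoc)
   also have "... = nrm (star_mult w r n M x (star_mult w r n M y z)) mu ta m"
    unfolding nrm_star[OF x star_closed h] by (rule mconv_cong) (simp_all add: nrm_star[OF y z _ h(2)])
   finally show "nrm (star_mult w r n M (star_mult w r n M x y) z) mu ta m =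
    nrm (star_mult w r n M x (star_mult w r n M y z)) mu ta m" .
  qed
 next
  fix x assume x: "x : carrier DR"
  show "\<one>D \<otimes>D x = x" unfolding mult_eq
   by (rule carrier_eqI[OF star_closed x]) (simp add: nrm_star[OF one_closed x] mconv_one(1)[OF x])
  show "x \<otimes>D \<one>D = x" unfolding mult_eq
   by (rule carrier_eqI[OF star_closed x]) (simp add: nrm_star[OF x one_closed] mconv_one(2)[OF x])
 qed (simp_all only: mult_eq star_closed one_closed)
 fix x y z assume x: "x : carrier DR" and y: "y : carrier DR" and z: "z : carrier DR"
 show "(x \<oplus>D y) \<otimes>D z = x \<otimes>D z \<oplus>D y \<otimes>D z" unfolding mult_eq
 proof (rule carrier_eqI[OF star_closed add_closed[OF star_closed star_closed]])
  fix mu ta m assume h: "mu : Comp" "ta : Comp" "m : M"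
  show "nrm (star_mult w r n M (x \<oplus>D y) z) mu ta m = nrm (star_mult w r n M x z \<oplus>D star_mult w r n M y z) mu ta m"
   unfolding nrm_star[OF add_closed[OF x y] z h] nrm_add nrm_star[OF x z h] nrm_star[OF y z h] mconv_def
   unfolding sum.distrib[symmetric] by (intro sum.cong refl) (simp add: distrib_right)
 qed
 show "z \<otimes>D (x \<oplus>D y) = z \<otimes>D x \<oplus>D z \<otimes>D y" unfolding mult_eq
 proof (rule carrier_eqI[OF star_closed add_closed[OF star_closed star_closed]])
  fix mu ta m assume h: "mu : Comp" "ta : Comp" "m : M"
  show "nrm (star_mult w r n M z (x \<oplus>D y)) mu ta m = nrm (star_mult w r n M z x \<oplus>D star_mult w r n M z y) mu ta m"
   unfolding nrm_star[OF z add_closed[OF x y] h] nrm_add nrm_star[OF z x h] nrm_star[OF z y h] mconv_def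
   unfolding sum.distrib[symmetric] by (intro sum.cong refl) (simp add: distrib_left)
 qed
qed

end

section \<open>Orbit sizes and integrality of the structure constants\<close>

context gs_data
begin

text \<open>The size of the left orbit of any map with image \<open>C\<close>, since
  \<open>rho o m\<close> depends precisely on the restriction of \<open>rho\<close> to the image
  (\<open>card_orbL\<close>). In this form it is visibly a function of the image.\<close>

definition uL :: "nat list => nat set => nat" where
 "uL mu C = card ((%rho. restrict rho C) ` young mu)"

text \<open>The size of the right orbit of any map with fibre family \<open>D\<close>, since
  \<open>m o ta\<close> depends precisely on the preimages of the fibres
  (\<open>card_orbR\<close>).\<close>

definition vR :: "nat list => nat set set => nat" where
 "vR nu D = card ((%ta. restrict (%d. ta -` d) D) ` young nu)"

lemma restrict_eq_iff: "restrict f A = restrict g A \<longleftrightarrow> (\<forall>x\<in>A. f x = g x)"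
 by (metis restrict_apply' restrict_ext)

lemma uL_pos: "0 < uL mu C" and vR_pos: "0 < vR nu D" using finite_young id_young by (auto simp: uL_def vR_def card_gt_0_iff)

lemma uL_young: assumes "sig : young mu" shows "uL mu (sig ` C) = uL mu C"
proof -
 have "uL mu (sig ` C) = card ((%rho. restrict (rho o sig) C) ` young mu)"
  unfolding uL_def by (rule card_image_cong_ker) (simp add: restrict_eq_iff)
 also have "(%rho. restrict (rho o sig) C) ` young mu = (%rho. restrict rho C) ` (%rho. rho o sig) ` young mu"
  by (simp only: image_image)
 finally show ?thesis unfolding young_translate(1)[OF assms] uL_def .
qed

lemma vR_young: assumes "sig : young nu" shows "vR nu ((%d. sig -` d) ` D) = vR nu D"
proof -
 have "vR nu ((%d. sig -` d) ` D) = card ((%ta. restrict (%d. (sig o ta) -` d) D) ` young nu)"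
  unfolding vR_def by (rule card_image_cong_ker) (simp add: restrict_eq_iff vimage_comp)
 also have "(%ta. restrict (%d. (sig o ta) -` d) D) ` young nu =
   (%ta. restrict (%d. ta -` d) D) ` (%ta. sig o ta) ` young nu" by (simp only: image_image)
 finally show ?thesis unfolding young_translate(2)[OF assms] vR_def .
qed

definition orbL :: "nat list => (nat => nat) => (nat => nat) set" where "orbL mu m = (%rho. rho o m) ` young mu"
definition orbR :: "nat list => (nat => nat) => (nat => nat) set" where "orbR nu m = (%ta. m o ta) ` young nu"

lemma card_orbL: assumes mu: "mu : Comp" and m: "m : M" shows "card (orbL mu m) = uL mu (im m)" unfolding orbL_def uL_def
proof (rule card_image_cong_ker)
 fix rho rho' assume r: "rho : young mu" "rho' : young mu"
 note mt = M_tau[OF m]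
 have z: "rho 0 = 0" "rho' 0 = 0" using perm_0 young_r[OF mu] r by auto
 show "rho o m = rho' o m \<longleftrightarrow> restrict rho (im m) = restrict rho' (im m)" unfolding restrict_eq_iff
 proof
  assume e: "rho o m = rho' o m"
  show "\<forall>y\<in>im m. rho y = rho' y"
  proof
   fix y assume "y : im m"
   then obtain x where "m x = y" using im_iff[OF mt] by blast
   then show "rho y = rho' y" using fun_cong[OF e, of x] by simp
  qed
 next
  assume e: "\<forall>y\<in>im m. rho y = rho' y"
  show "rho o m = rho' o m"
  proof
   fix x show "(rho o m) x = (rho' o m) x" using e z im_iff[OF mt, of "m x"] by (cases "m x = 0") auto
  qed
 qed
qed

lemma card_orbR: assumes nu: "nu : Comp" and m: "m : M" shows "card (orbR nu m) = vR nu (fam m)" unfolding orbR_def vR_def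
proof (rule card_image_cong_ker)
 fix ta ta' assume r: "ta : young nu" "ta' : young nu"
 note mt = M_tau[OF m]
 show "m o ta = m o ta' \<longleftrightarrow> restrict (%d. ta -` d) (fam m) = restrict (%d. ta' -` d) (fam m)"
  unfolding restrict_eq_iff
 proof
  assume e: "m o ta = m o ta'"
  have "ta -` (m -` {y}) = ta' -` (m -` {y})" for y using e by (simp add: vimage_comp)
  then show "\<forall>d\<in>fam m. ta -` d = ta' -` d" by (auto simp: fam_def)
 next
  assume e: "\<forall>d\<in>fam m. ta -` d = ta' -` d"
  have k: "m (ta x) = y \<longleftrightarrow> m (ta' x) = y" if "y ~= 0" for x y
  proof (cases "y : im m")
   case True
   then have "ta -` (m -` {y}) = ta' -` (m -` {y})" using e by (simp add: fam_def)
   then have "x : ta -` (m -` {y}) \<longleftrightarrow> x : ta' -` (m -` {y})" by simp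
   then show ?thesis by simp
  next
   case False
   then show ?thesis using im_iff[OF mt, of y] that by auto
  qed
  show "m o ta = m o ta'"
  proof
   fix x show "(m o ta) x = (m o ta') x" using k[of "m (ta x)" x] k[of "m (ta' x)" x] by (cases "m (ta x) = 0") auto
  qed
 qed
qed

lemma fam_comp:
 assumes "rho permutes {1..r}" "ta permutes {1..r}" "m : tau r"
 shows "fam (rho o m o ta) = (%d. ta -` d) ` fam m"
proof -
 have "fam (rho o m o ta) = (%y. (rho o m o ta) -` {rho y}) ` im m"
  unfolding fam_def im_comp(1)[OF assms] by (rule image_image)
 also have "... = (%y. ta -` (m -` {y})) ` im m"
  by (rule image_cong[OF refl], rule im_comp(2)[OF assms]) (auto simp: im_def)
 also have "... = (%d. ta -` d) ` fam m" unfolding fam_def by (rule image_image[symmetric])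
 finally show ?thesis .
qed

text \<open>The weights are evaluated at a chosen representative of the double coset;
  \<open>uL_young\<close> and \<open>vR_young\<close> make the choice irrelevant.\<close>

lemma n_weights:
 assumes mu: "mu : Comp" and nu: "nu : Comp" and m: "m : M"
 shows "n_left mu nu (dcoset mu nu m) = uL mu (im m)" "n_right mu nu (dcoset mu nu m) = vR nu (fam m)"
proof -
 define m' where "m' = (SOME y. y : dcoset mu nu m)"
 have md: "m' : dcoset mu nu m" unfolding m'_def by (rule someI[where P = "%y. y : dcoset mu nu m"], rule dcoset_M(3)[OF mu nu m])
 then have mM: "m' : M" using dcoset_M(1)[OF mu nu m] by blast
 obtain rho ta where p: "rho : young mu" "ta : young nu" "m' = rho o m o ta" using md by (auto simp: dcoset_def)
 note pp = young_r[OF mu p(1)] young_r[OF nu p(2)] M_tau[OF m]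
 have "n_left mu nu (dcoset mu nu m) = card (orbL mu m')"
  unfolding n_left_def m'_def[symmetric] orbL_def by (rule arg_cong[where f = card]) blast
 also have "... = uL mu (im m)" unfolding card_orbL[OF mu mM] unfolding p(3) im_comp(1)[OF pp] by (rule uL_young[OF p(1)])
 finally show "n_left mu nu (dcoset mu nu m) = uL mu (im m)" .
 have "n_right mu nu (dcoset mu nu m) = card (orbR nu m')"
  unfolding n_right_def m'_def[symmetric] orbR_def by (rule arg_cong[where f = card]) blast
 also have "... = vR nu (fam m)" unfolding card_orbR[OF nu mM] unfolding p(3) fam_comp[OF pp] by (rule vR_young[OF p(2)])
 finally show "n_right mu nu (dcoset mu nu m) = vR nu (fam m)" .
qed

lemma orbL_eq: assumes "mu : Comp" shows "orbL mu m' = orbL mu m \<longleftrightarrow> m' : orbL mu m"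
proof
 assume "m' : orbL mu m"
 then obtain rho where r: "rho : young mu" "m' = rho o m" by (auto simp: orbL_def)
 have "orbL mu m' = (%sig. sig o m) ` (%sig. sig o rho) ` young mu" unfolding orbL_def r(2) by (simp only: image_image comp_assoc)
 then show "orbL mu m' = orbL mu m" unfolding young_translate(1)[OF r(1)] orbL_def .
next
 have "m' : orbL mu m'" unfolding orbL_def by (rule image_eqI[of _ _ id]) (simp_all add: id_young)
 then show "orbL mu m' = orbL mu m ==> m' : orbL mu m" by simp
qed

lemma orbR_eq: assumes "nu : Comp" shows "orbR nu m' = orbR nu m \<longleftrightarrow> m' : orbR nu m"
proof
 assume "m' : orbR nu m"
 then obtain rho where r: "rho : young nu" "m' = m o rho" by (auto simp: orbR_def)
 have "orbR nu m' = (%sig. m o sig) ` (%sig. rho o sig) ` young nu" unfolding orbR_def r(2) by (simp add: image_image comp_def)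
 then show "orbR nu m' = orbR nu m" unfolding young_translate(2)[OF r(1)] orbR_def .
next
 have "m' : orbR nu m'" unfolding orbR_def by (rule image_eqI[of _ _ id]) (simp_all add: id_young)
 then show "orbR nu m' = orbR nu m ==> m' : orbR nu m" by simp
qed

lemma dcoset_closed:
 assumes "a : dcoset mu nu m"
 shows "rho : young mu ==> rho o a : dcoset mu nu m" "ta : young nu ==> a o ta : dcoset mu nu m"
proof -
 obtain rho' ta' where a: "rho' : young mu" "ta' : young nu" "a = rho' o m o ta'" using assms by (auto simp: dcoset_def)
 have "rho o a = (rho o rho') o m o ta'" "a o ta = rho' o m o (ta' o ta)" unfolding a(3) by (simp_all only: comp_assoc)
 then show "rho : young mu ==> rho o a : dcoset mu nu m" "ta : young nu ==> a o ta : dcoset mu nu m"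
  using a young_comp unfolding dcoset_def by blast+
qed

text \<open>Summed over \<open>U\<close>, the convolution counts pairs with product in
  \<open>U\<close>; the two forms fix the right factor and the left factor first,
  respectively.\<close>

lemma sum_conv_cosets:
 assumes mu: "mu : Comp" and nu: "nu : Comp" and ta: "ta : Comp"
  and m: "m1 : M" "m2 : M" and U: "finite U"
 defines "D1 == dcoset mu nu m1" and "D2 == dcoset nu ta m2"
 shows "(\<Sum>m'\<in>U. conv M (coset_sum D1) (coset_sum D2) m') = (\<Sum>b\<in>D2. int (card {a\<in>D1. a o b : U}))"
  "(\<Sum>m'\<in>U. conv M (coset_sum D1) (coset_sum D2) m') = (\<Sum>a\<in>D1. int (card {b\<in>D2. a o b : U}))"
proof -
 have D: "M \<inter> D1 = D1" "M \<inter> D2 = D2" "finite D1" "finite D2"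
  using dcoset_M(1,2)[OF mu nu m(1)] dcoset_M(1,2)[OF nu ta m(2)] by (auto simp: D1_def D2_def)
 have c: "conv M (coset_sum D1) (coset_sum D2) m' = (\<Sum>a\<in>D1. \<Sum>b\<in>D2. if a o b = m' then 1 else 0)" for m'
 proof -
  have "conv M (coset_sum D1) (coset_sum D2) m' = (\<Sum>a\<in>M. if a : D1 then \<Sum>b\<in>M. if b : D2 then if a o b = m' then 1 else 0 else 0 else 0)"
   unfolding conv_sum D1_def D2_def coset_sum_eq[OF mu nu m(1)] coset_sum_eq[OF nu ta m(2)]
  proof (rule sum_eq)
   fix a
   show "(\<Sum>b\<in>M. if a o b = m' then (if a : dcoset mu nu m1 then 1 else 0) * (if b : dcoset nu ta m2 then 1 else 0) else 0) =
     (if a : dcoset mu nu m1 then \<Sum>b\<in>M. if b : dcoset nu ta m2 then if a o b = m' then 1 else 0 else 0 else 0 :: int)"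
    by (cases "a : dcoset mu nu m1") (auto intro!: sum.cong sum.neutral)
  qed
  also have "... = (\<Sum>a\<in>D1. \<Sum>b\<in>D2. if a o b = m' then 1 else 0)"
   by (simp only: sum.inter_restrict[OF finite_M, symmetric] D)
  finally show ?thesis .
 qed
 have "(\<Sum>m'\<in>U. conv M (coset_sum D1) (coset_sum D2) m') = (\<Sum>a\<in>D1. \<Sum>b\<in>D2. \<Sum>m'\<in>U. if a o b = m' then 1 else 0)"
  unfolding c by (rule trans[OF sum.swap], rule sum_eq, rule sum.swap)
 also have "... = (\<Sum>a\<in>D1. \<Sum>b\<in>D2. if a o b : U then 1 else 0)"
  using U by (intro sum.cong refl) (simp add: sum.delta')
 finally have s: "(\<Sum>m'\<in>U. conv M (coset_sum D1) (coset_sum D2) m') = (\<Sum>a\<in>D1. \<Sum>b\<in>D2. if a o b : U then 1 else 0)" .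
 show "(\<Sum>m'\<in>U. conv M (coset_sum D1) (coset_sum D2) m') = (\<Sum>a\<in>D1. int (card {b\<in>D2. a o b : U}))"
  unfolding s sum.inter_filter[OF D(4), symmetric] by simp
 show "(\<Sum>m'\<in>U. conv M (coset_sum D1) (coset_sum D2) m') = (\<Sum>b\<in>D2. int (card {a\<in>D1. a o b : U}))"
  unfolding s unfolding sum.swap[of _ D2 D1] sum.inter_filter[OF D(3), symmetric] by simp
qed

text \<open>By invariance the right-hand side is the number of pairs \<open>(a, b)\<close> whose
  product lies in the left orbit of \<open>m\<close>. The shift to
  \<open>(a o pinv sig, sig o b)\<close> keeps the product, so the number of partners is constant on
  left orbits of \<open>b\<close>, and for fixed \<open>b\<close> the partners \<open>a\<close> form
  whole left orbits.\<close>

lemma n_left_dvd: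
 assumes mu: "mu : Comp" and nu: "nu : Comp" and ta: "ta : Comp"
  and m1: "m1 : M" and m2: "m2 : M" and m: "m : M"
 shows "int (n_left mu nu (dcoset mu nu m1)) * int (n_left nu ta (dcoset nu ta m2)) dvd
   int (n_left mu ta (dcoset mu ta m)) * conv M (coset_sum (dcoset mu nu m1)) (coset_sum (dcoset nu ta m2)) m"
proof -
 let ?D1 = "dcoset mu nu m1" and ?D2 = "dcoset nu ta m2" and ?U = "orbL mu m"
 let ?c = "conv M (coset_sum ?D1) (coset_sum ?D2)"
 have finU: "finite ?U" by (simp add: orbL_def finite_young)
 have cM: "a : M" if "a : ?D1 \<or> a : ?D2" for a using dcoset_M(1)[OF mu nu m1] dcoset_M(1)[OF nu ta m2] that by blast
 note inv = conv_invariants[OF mu nu ta coset_sum_invariants[OF mu nu m1] coset_sum_invariants[OF nu ta m2]]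
 have "?c m' = ?c m" if "m' : ?U" for m' using that invariants_young[OF mu ta inv _ id_young m] by (auto simp: orbL_def)
 then have "(\<Sum>m'\<in>?U. ?c m') = (\<Sum>m'\<in>?U. ?c m)" by (rule sum_eq)
 then have "int (n_left mu ta (dcoset mu ta m)) * ?c m = (\<Sum>b\<in>?D2. int (card {a\<in>?D1. a o b : ?U}))"
  using sum_conv_cosets(1)[OF mu nu ta m1 m2 finU] by (simp add: n_weights(1)[OF mu ta m] card_orbL[OF mu m])
 also have "int (n_left nu ta ?D2) * int (n_left mu nu ?D1) dvd ..."
 proof (rule dvd_card_pairs[where ?orb1.0 = "orbL mu" and ?orb2.0 = "orbL nu"])
  show "finite ?D1" "finite ?D2" by (rule dcoset_M(2)[OF mu nu m1] dcoset_M(2)[OF nu ta m2])+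
 next
  fix a b assume h: "a : ?D1" "b : ?D2" "a o b : ?U"
  have "{a'\<in>?D1. a' o b : ?U & orbL mu a' = orbL mu a} = orbL mu a"
  proof (intro equalityI subsetI)
   fix a' assume a': "a' : orbL mu a"
   then obtain rho where r: "rho : young mu" "a' = rho o a" by (auto simp: orbL_def)
   have "a' o b : orbL mu (a o b)" unfolding orbL_def r(2) using r(1) by (intro image_eqI[of _ _ rho]) (simp_all only: comp_assoc)
   then have "a' o b : ?U" using h(3) orbL_eq[OF mu] by blast
   then show "a' : {a'\<in>?D1. a' o b : ?U & orbL mu a' = orbL mu a}"
    using a' orbL_eq[OF mu] dcoset_closed(1)[OF h(1) r(1)] r(2) by blast
  qed (use orbL_eq[OF mu] in blast)
  moreover have "card (orbL mu a) = n_left mu nu ?D1"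
   using card_orbL[OF mu cM] n_weights(1)[OF mu nu cM, of a] dcoset_M(4,5)[OF mu nu m1, of a] h(1) cM by simp
  ultimately show "card {a'\<in>?D1. a' o b : ?U & orbL mu a' = orbL mu a} = n_left mu nu ?D1" by simp
 next
  fix b b' assume h: "b : ?D2" "b' : ?D2" "orbL nu b' = orbL nu b"
  then obtain sig where s: "sig : young nu" "b' = sig o b" using orbL_eq[OF nu] by (auto simp: orbL_def)
  have "bij_betw (%a. a o sig) {a\<in>?D1. a o b' : ?U} {a\<in>?D1. a o b : ?U}"
  proof (rule bij_betw_byWitness[where f' = "%a. a o pinv sig"])
   have e: "(a o pinv sig) o b' = a o b" "(a o sig) o b = a o b'" for a :: "nat => nat"
    unfolding s(2) using young_cancel(1)[OF nu s(1), of b] by (simp_all only: comp_assoc)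
   show "(%a. a o sig) ` {a\<in>?D1. a o b' : ?U} <= {a\<in>?D1. a o b : ?U}"
    using e(2) dcoset_closed(2)[OF _ s(1)] by (auto simp del: comp_apply)
   show "(%a. a o pinv sig) ` {a\<in>?D1. a o b : ?U} <= {a\<in>?D1. a o b' : ?U}"
    using e(1) dcoset_closed(2)[OF _ young_inv[OF s(1)]] by (auto simp del: comp_apply)
  qed (use young_cancel(3,4)[OF nu s(1)] in blast)+
  then show "card {a\<in>?D1. a o b' : ?U} = card {a\<in>?D1. a o b : ?U}" by (rule bij_betw_same_card)
 next
  fix b assume b: "b : ?D2"
  have "{b'\<in>?D2. orbL nu b' = orbL nu b} = orbL nu b"
   using orbL_eq[OF nu] dcoset_closed(1)[OF b] by (auto simp: orbL_def)
  moreover have "card (orbL nu b) = n_left nu ta ?D2"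
   using card_orbL[OF nu cM] n_weights(1)[OF nu ta cM, of b] dcoset_M(4,5)[OF nu ta m2, of b] b cM by simp
  ultimately show "card {b'\<in>?D2. orbL nu b' = orbL nu b} = n_left nu ta ?D2" by simp
 qed
 finally show ?thesis by (simp add: mult.commute)
qed

text \<open>Here the factors exchange places: \<open>a\<close> is grouped into right orbits under
  \<open>young nu\<close>, and for fixed \<open>a\<close> the partners \<open>b\<close> form whole
  right orbits under \<open>young ta\<close>.\<close>

lemma n_right_dvd:
 assumes mu: "mu : Comp" and nu: "nu : Comp" and ta: "ta : Comp"
  and m1: "m1 : M" and m2: "m2 : M" and m: "m : M"
 shows "int (n_right mu nu (dcoset mu nu m1)) * int (n_right nu ta (dcoset nu ta m2)) dvd
   int (n_right mu ta (dcoset mu ta m)) * conv M (coset_sum (dcoset mu nu m1)) (coset_sum (dcoset nu ta m2)) m"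
proof -
 let ?D1 = "dcoset mu nu m1" and ?D2 = "dcoset nu ta m2" and ?U = "orbR ta m"
 let ?c = "conv M (coset_sum ?D1) (coset_sum ?D2)"
 have finU: "finite ?U" by (simp add: orbR_def finite_young)
 have cM: "a : M" if "a : ?D1 \<or> a : ?D2" for a using dcoset_M(1)[OF mu nu m1] dcoset_M(1)[OF nu ta m2] that by blast
 note inv = conv_invariants[OF mu nu ta coset_sum_invariants[OF mu nu m1] coset_sum_invariants[OF nu ta m2]]
 have "?c m' = ?c m" if "m' : ?U" for m' using that invariants_young[OF mu ta inv id_young _ m] by (auto simp: orbR_def)
 then have "(\<Sum>m'\<in>?U. ?c m') = (\<Sum>m'\<in>?U. ?c m)" by (rule sum_eq)
 then have "int (n_right mu ta (dcoset mu ta m)) * ?c m = (\<Sum>a\<in>?D1. int (card {b\<in>?D2. a o b : ?U}))"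
  using sum_conv_cosets(2)[OF mu nu ta m1 m2 finU] by (simp add: n_weights(2)[OF mu ta m] card_orbR[OF ta m])
 also have "int (n_right mu nu ?D1) * int (n_right nu ta ?D2) dvd ..."
 proof (rule dvd_card_pairs[where P = "%b a. a o b : orbR ta m" and ?orb1.0 = "orbR ta" and ?orb2.0 = "orbR nu"])
  show "finite ?D1" "finite ?D2" by (rule dcoset_M(2)[OF mu nu m1] dcoset_M(2)[OF nu ta m2])+
 next
  fix b a assume h: "b : ?D2" "a : ?D1" "a o b : ?U"
  have "{b'\<in>?D2. a o b' : ?U & orbR ta b' = orbR ta b} = orbR ta b"
  proof (intro equalityI subsetI)
   fix b' assume b': "b' : orbR ta b"
   then obtain rho where r: "rho : young ta" "b' = b o rho" by (auto simp: orbR_def)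
   have "a o b' : orbR ta (a o b)" unfolding orbR_def r(2) using r(1) by (intro image_eqI[of _ _ rho]) (simp_all only: comp_assoc)
   then have "a o b' : ?U" using h(3) orbR_eq[OF ta] by blast
   then show "b' : {b'\<in>?D2. a o b' : ?U & orbR ta b' = orbR ta b}"
    using b' orbR_eq[OF ta] dcoset_closed(2)[OF h(1) r(1)] r(2) by blast
  qed (use orbR_eq[OF ta] in blast)
  moreover have "card (orbR ta b) = n_right nu ta ?D2"
   using card_orbR[OF ta cM] n_weights(2)[OF nu ta cM, of b] dcoset_M(4,5)[OF nu ta m2, of b] h(1) cM by simp
  ultimately show "card {b'\<in>?D2. a o b' : ?U & orbR ta b' = orbR ta b} = n_right nu ta ?D2" by simp
 next
  fix a a' assume h: "a : ?D1" "a' : ?D1" "orbR nu a' = orbR nu a"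
  then obtain sig where s: "sig : young nu" "a' = a o sig" using orbR_eq[OF nu] by (auto simp: orbR_def)
  have "bij_betw (%b. sig o b) {b\<in>?D2. a' o b : ?U} {b\<in>?D2. a o b : ?U}"
  proof (rule bij_betw_byWitness[where f' = "%b. pinv sig o b"])
   have e: "a' o (pinv sig o b) = a o b" "a o (sig o b) = a' o b" for b :: "nat => nat"
    unfolding s(2) using young_cancel(2)[OF nu s(1), of b] by (simp_all only: comp_assoc)
   show "(%b. sig o b) ` {b\<in>?D2. a' o b : ?U} <= {b\<in>?D2. a o b : ?U}"
    using e(2) dcoset_closed(1)[OF _ s(1)] by (auto simp del: comp_apply)
   show "(%b. pinv sig o b) ` {b\<in>?D2. a o b : ?U} <= {b\<in>?D2. a' o b : ?U}"
    using e(1) dcoset_closed(1)[OF _ young_inv[OF s(1)]] by (auto simp del: comp_apply)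
  qed (use young_cancel(1,2)[OF nu s(1)] in blast)+
  then show "card {b\<in>?D2. a' o b : ?U} = card {b\<in>?D2. a o b : ?U}" by (rule bij_betw_same_card)
 next
  fix a assume a: "a : ?D1"
  have "{a'\<in>?D1. orbR nu a' = orbR nu a} = orbR nu a"
   using orbR_eq[OF nu] dcoset_closed(2)[OF a] by (auto simp: orbR_def)
  moreover have "card (orbR nu a) = n_right mu nu ?D1"
   using card_orbR[OF nu cM] n_weights(2)[OF mu nu cM, of a] dcoset_M(4,5)[OF mu nu m1, of a] a cM by simp
  ultimately show "card {a'\<in>?D1. orbR nu a' = orbR nu a} = n_right mu nu ?D1" by simp
 qed
 finally show ?thesis .
qed

lemma weighted_left: "weighted_gs r n M orbs ord n_left uL (%_ _. 1)"
proof
 fix mu assume mu: "mu : Comp"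
 have "orbL mu (perm_map r id) = perm_map r ` young mu"
  unfolding orbL_def using one_coset(3)[OF mu] by (intro image_cong refl) blast
 then show "n_left mu mu (dcoset mu mu (perm_map r id)) = card (young mu)"
  using n_weights(1)[OF mu mu perm_map_M[OF mu id_young]] card_orbL[OF mu perm_map_M[OF mu id_young]]
   card_image[OF one_coset(2)[OF mu]] by simp
qed (rule n_left_dvd, assumption+ | simp add: n_weights(1) uL_pos uL_young)+

lemma weighted_right: "weighted_gs r n M orbs ord n_right (%_ _. 1) vR"
proof
 fix mu assume mu: "mu : Comp"
 have "orbR mu (perm_map r id) = perm_map r ` young mu"
  unfolding orbR_def using one_coset(4)[OF mu] by (intro image_cong refl) blast
 then show "n_right mu mu (dcoset mu mu (perm_map r id)) = card (young mu)"
  using n_weights(2)[OF mu mu perm_map_M[OF mu id_young]] card_orbR[OF mu perm_map_M[OF mu id_young]]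
   card_image[OF one_coset(2)[OF mu]] by simp
qed (rule n_right_dvd, assumption+ | simp add: n_weights(2) vR_pos vR_young)+

end

section \<open>Coordinates in the cell basis\<close>

context gs_data
begin

text \<open>Each pair of orbits is treated separately, because on it the colour matrices are exactly
  those with the margins of \<open>Q\<close> and \<open>Q'\<close> (\<open>cm_in_MM\<close>,
  \<open>realize\<close>).\<close>

definition local_expansion where
 "local_expansion mu nu Q Q' f z \<longleftrightarrow> (\<forall>m\<in>M. im m : Q & fam m : Q' -->
  of_int (f m) = (\<Sum>b\<in>BT mu nu Q Q'. z b * of_nat (bival b (cm mu nu m)) :: rat))"

text \<open>An invariant \<open>f\<close> is a function of the colour matrix, so
  \<open>bival_span\<close> supplies integral coefficients.\<close>

lemma local_expansion_exists:
 assumes mu: "mu : Comp" and nu: "nu : Comp"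
  and Q: "Q : LO mu i" and Q': "Q' : RO nu i"
  and f: "f : Inv mu nu"
 shows "\<exists>z. local_expansion mu nu Q Q' f (%b. of_int (z b))"
proof -
 define g where "g N = f (SOME m. m : M & cm mu nu m = N)" for N
 obtain z where z: "\<forall>N\<in>MM mu nu Q Q'. g N = (\<Sum>b\<in>BT mu nu Q Q'. z b * int (bival b N))"
  using bival_span by blast
 have "local_expansion mu nu Q Q' f (%b. of_int (z b))" unfolding local_expansion_def
 proof (intro ballI impI)
  fix m assume m: "m : M" "im m : Q & fam m : Q'"
  let ?m = "SOME m'. m' : M & cm mu nu m' = cm mu nu m"
  have "?m : M & cm mu nu ?m = cm mu nu m"
   by (rule someI[where P = "%m'. m' : M & cm mu nu m' = cm mu nu m" and x = m]) (simp add: m(1))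
  then have "g (cm mu nu m) = f m" unfolding g_def using f m(1) unfolding invariants_iff[OF mu nu] by blast
  moreover have "cm mu nu m : MM mu nu Q Q'" using cm_in_MM[OF mu nu Q Q' m(1)] m(2) by blast
  ultimately have "f m = (\<Sum>b\<in>BT mu nu Q Q'. z b * int (bival b (cm mu nu m)))" using z by simp
  then show "rat_of_int (f m) = (\<Sum>b\<in>BT mu nu Q Q'. of_int (z b) * of_nat (bival b (cm mu nu m)))"
   by (simp add: of_int_sum)
 qed
 then show ?thesis by (rule exI[of _ z])
qed

text \<open>Every matrix with these margins is attained by \<open>realize\<close>, so two expansions
  agree as functions on matrices and \<open>bival_independent\<close> applies.\<close>

lemma local_expansion_unique:
 assumes mu: "mu : Comp" and nu: "nu : Comp"
  and Q: "Q : LO mu i" and Q': "Q' : RO nu i"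
  and z: "local_expansion mu nu Q Q' f z" "local_expansion mu nu Q Q' f z'" and b: "b : BT mu nu Q Q'"
 shows "z b = z' b"
proof -
 have "(\<Sum>b\<in>BT mu nu Q Q'. (z b - z' b) * of_nat (bival b N)) = 0" if N: "N : MM mu nu Q Q'" for N
 proof -
  obtain m where "m : M" "im m : Q" "fam m : Q'" "cm mu nu m = N" using realize[OF mu nu Q Q' N] by blast
  then show ?thesis using z unfolding local_expansion_def left_diff_distrib sum_subtractf by auto
 qed
 from bival_independent[OF this b] show ?thesis by simp
qed

definition coords where
 "coords mu nu Q Q' f = (SOME z. local_expansion mu nu Q Q' f (%b. rat_of_int (z b)))"

abbreviation "Index == (SIGMA xi:Lam r M. Ls xi \<times> Rs xi)"

text \<open>The value 0 off \<open>Index\<close> keeps \<open>coord\<close> additive at every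
  index.\<close>

definition coord where
 "coord x i = (if i : Index then case i of (xi, (mu, Q, S), (nu, Q', T)) =>
  coords mu nu Q Q' (x mu nu) (lf xi, S, T) else 0)"

lemma coords_expansion:
 assumes "mu : Comp" "nu : Comp" "Q : LO mu i"
  "Q' : RO nu i" "f : Inv mu nu"
 shows "local_expansion mu nu Q Q' f (%b. of_int (coords mu nu Q Q' f b))"
 unfolding coords_def by (rule someI_ex[where P = "%z. local_expansion mu nu Q Q' f (%b. rat_of_int (z b))"]) (rule local_expansion_exists[OF assms])

lemma Lam_partition: "xi : Lam r M ==> xi : partitions (sum_list xi)" by (auto simp: Lam_def partitions_def)

lemma Index_D:
 assumes xi: "xi : Lam r M" and L: "(mu, Q, S) : Ls xi" and R: "(nu, Q', T) : Rs xi"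
 shows "(lf xi, S, T) : BT mu nu Q Q'"
 using lf_Par(1)[OF Lam_partition[OF xi]] L_set_D(3)[OF L] R_set_D(3)[OF R] by (simp add: bitableaux_def)

lemma coord_eqI:
 assumes xi: "xi : Lam r M" and L: "(mu, Q, S) : Ls xi" and R: "(nu, Q', T) : Rs xi"
  and x: "x mu nu : Inv mu nu" and z: "local_expansion mu nu Q Q' (x mu nu) z"
 shows "of_int (coord x (xi, (mu, Q, S), (nu, Q', T))) = z (lf xi, S, T)"
proof -
 have "coord x (xi, (mu, Q, S), (nu, Q', T)) = coords mu nu Q Q' (x mu nu) (lf xi, S, T)"
  using xi L R by (simp add: coord_def)
 then show ?thesis using local_expansion_unique[OF L_set_D(1)[OF L] R_set_D(1)[OF R] L_set_D(2)[OF L] R_set_D(2)[OF R]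
    coords_expansion[OF L_set_D(1)[OF L] R_set_D(1)[OF R] L_set_D(2)[OF L] R_set_D(2)[OF R] x] z Index_D[OF xi L R]]
  by simp
qed

lemma bival_cnt: "bival (l, S, T) (cm mu nu m) = cnt (im m) (blk mu) (vf nu m) (rt l S) (rt l T)"
 by (simp add: bival_def cm_vf cnt_eq_cntm[OF finite_im])

text \<open>On its own pair of orbits a cell element is a single bitableau function; it vanishes on
  the other pairs because distinct orbits are disjoint.\<close>

lemma cell_elt_expansion:
 assumes xi: "xi : Lam r M" and L: "(mu, Q, S) : Ls xi" and R: "(nu, Q', T) : Rs xi"
  and mu1: "mu1 : Comp" and nu1: "nu1 : Comp"
  and Q1: "Q1 : LO mu1 i1" and Q1': "Q1' : RO nu1 i1"
 shows "local_expansion mu1 nu1 Q1 Q1' (Cell xi (mu, Q, S) (nu, Q', T) mu1 nu1)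
  (%b. if mu1 = mu & nu1 = nu & Q1 = Q & Q1' = Q' & b = (lf xi, S, T) then 1 else 0)" unfolding local_expansion_def
proof (intro ballI impI)
 fix m assume m: "m : M" "im m : Q1 & fam m : Q1'"
 let ?c = "Cell xi (mu, Q, S) (nu, Q', T) mu1 nu1 m"
 let ?e = "%b. if mu1 = mu & nu1 = nu & Q1 = Q & Q1' = Q' & b = (lf xi, S, T) then 1 else (0 :: rat)"
 show "of_int ?c = (\<Sum>b\<in>BT mu1 nu1 Q1 Q1'. ?e b * of_nat (bival b (cm mu1 nu1 m)))"
 proof (cases "mu1 = mu & nu1 = nu & Q1 = Q & Q1' = Q'")
  case True
  then have "(\<Sum>b\<in>BT mu1 nu1 Q1 Q1'. ?e b * of_nat (bival b (cm mu1 nu1 m))) =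
    (\<Sum>b\<in>BT mu nu Q Q'. if b = (lf xi, S, T) then of_nat (bival (lf xi, S, T) (cm mu nu m)) else 0)"
   by (intro sum.cong) auto
  also have "... = of_nat (bival (lf xi, S, T) (cm mu nu m))"
   using Index_D[OF xi L R] by (simp add: sum.delta finite_bitableaux)
  also have "... = of_int ?c" using True cell_elt_cnt(1)[OF L R Lam_partition[OF xi] m(1)] by (simp add: bival_cnt)
  finally show ?thesis by simp
 next
  case False
  have "?c = 0"
  proof (cases "mu1 = mu & nu1 = nu")
   case True
   show ?thesis
   proof (rule ccontr)
    assume "?c ~= 0"
    then have "im m : Q & fam m : Q'" using cell_elt_cnt[OF L R Lam_partition[OF xi] m(1)] True by (metis of_nat_0)
    then have "Q1 = Q" "Q1' = Q'"
     using left_orbits_eq(1)[OF L_set_D(1,2)[OF L], of Q1 i1 "im m"] right_orbits_eq(1)[OF R_set_D(1,2)[OF R], of Q1' i1 "fam m"]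
      Q1 Q1' True m(2) by auto
    then show False using False True by simp
   qed
  qed (rule cell_elt_off)
  moreover have "(\<Sum>b\<in>BT mu1 nu1 Q1 Q1'. ?e b * of_nat (bival b (cm mu1 nu1 m))) = 0"
   using False by (intro sum.neutral) auto
  ultimately show ?thesis by simp
 qed
qed

lemma cell_elt_invariant:
 assumes xi: "xi : Lam r M" and L: "(mu, Q, S) : Ls xi" and R: "(nu, Q', T) : Rs xi"
  and mu1: "mu1 : Comp" and nu1: "nu1 : Comp"
 shows "Cell xi (mu, Q, S) (nu, Q', T) mu1 nu1 : Inv mu1 nu1"
proof (cases "mu1 = mu & nu1 = nu")
 case True
 note p = Lam_partition[OF xi]
 have "Cell xi (mu, Q, S) (nu, Q', T) mu nu m = 0" if "m ~: M" for m unfolding cell_elt_orbit[OF L R p] using that by simp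
 moreover have "Cell xi (mu, Q, S) (nu, Q', T) mu nu m' = Cell xi (mu, Q, S) (nu, Q', T) mu nu m"
  if "m : M" "m' : M" "cm mu nu m' = cm mu nu m" for m m'
  unfolding cell_elt_cnt(1)[OF L R p that(1)] cell_elt_cnt(1)[OF L R p that(2)] bival_cnt[symmetric] that(3) ..
 ultimately show ?thesis unfolding invariants_iff[OF mu1 nu1] using True by blast
next
 case False
 show ?thesis unfolding invariants_iff[OF mu1 nu1] using cell_elt_off[OF False] by simp
qed

lemma coord_cell_elt:
 assumes xi: "xi : Lam r M" and s: "s : Ls xi" and t: "t : Rs xi" and i: "i : Index"
 shows "coord (Cell xi s t) i = (if i = (xi, s, t) then 1 else 0)"
proof -
 obtain mu Q S where s': "s = (mu, Q, S)" by (cases s)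
 obtain nu Q' T where t': "t = (nu, Q', T)" by (cases t)
 obtain xi1 mu1 Q1 S1 nu1 Q1' T1 where i': "i = (xi1, (mu1, Q1, S1), (nu1, Q1', T1))" by (metis prod_cases3)
 have xi1: "xi1 : Lam r M" and L1: "(mu1, Q1, S1) : Ls xi1" and R1: "(nu1, Q1', T1) : Rs xi1" using i i' by auto
 note L = s[unfolded s'] and R = t[unfolded t']
 note m1 = L_set_D(1)[OF L1] and n1 = R_set_D(1)[OF R1]
 have "of_int (coord (Cell xi s t) i) =
   (if mu1 = mu & nu1 = nu & Q1 = Q & Q1' = Q' & (lf xi1, S1, T1) = (lf xi, S, T) then 1 else (0 :: rat))"
  unfolding i' s' t'
  by (rule coord_eqI[where x = "Cell xi (mu, Q, S) (nu, Q', T)", OF xi1 L1 R1 cell_elt_invariant[OF xi L R m1 n1]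
    cell_elt_expansion[OF xi L R m1 n1 L_set_D(2)[OF L1] R_set_D(2)[OF R1]]])
 moreover have "lf xi1 = lf xi \<longleftrightarrow> xi1 = xi" using lf_inj[OF Lam_partition[OF xi1] Lam_partition[OF xi]] by auto
 ultimately have "of_int (coord (Cell xi s t) i) = (if i = (xi, s, t) then 1 else (0 :: rat))"
  unfolding i' s' t' by (auto split: if_splits)
 then show ?thesis by (auto split: if_splits)
qed

text \<open>Each map lies in some pair of orbits, and a bitableau with nonzero value at it is an
  index of the cell basis: its shape has size \<open>card (im m)\<close>, which belongs to
  \<open>index_set r M\<close>.\<close>

lemma coord_zero:
 assumes x: "!!mu nu. mu : Comp ==> nu : Comp ==> x mu nu : Inv mu nu"
  and z: "!!i. i : Index ==> coord x i = 0"
  and mu: "mu : Comp" and nu: "nu : Comp" and m: "m : M"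
 shows "x mu nu m = 0"
proof -
 obtain Q Q' where Q: "Q : LO mu (card (im m))" "im m : Q"
  and Q': "Q' : RO nu (card (im m))" "fam m : Q'" using orbits_exist[OF mu nu m] by blast
 let ?z = "coords mu nu Q Q' (x mu nu)"
 have "local_expansion mu nu Q Q' (x mu nu) (%b. of_int (?z b))" by (rule coords_expansion[OF mu nu Q(1) Q'(1) x[OF mu nu]])
 then have "of_int (x mu nu m) = (\<Sum>b\<in>BT mu nu Q Q'. rat_of_int (?z b) * of_nat (bival b (cm mu nu m)))"
  unfolding local_expansion_def using m Q(2) Q'(2) by blast
 also have "... = 0"
 proof (intro sum.neutral ballI)
  fix b assume b: "b : BT mu nu Q Q'"
  obtain l S T where b': "b = (l, S, T)" by (cases b)
  have l: "l : Par" and S: "S : SST l n (nf (left_orbit_comp mu Q))"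
   and T: "T : SST l (length (orbs nu)) (nf (right_orbit_comp (orbs nu) Q'))"
   using b unfolding b' by (auto simp: bitableaux_def)
  show "rat_of_int (?z b) * of_nat (bival b (cm mu nu m)) = 0"
  proof (cases "bival b (cm mu nu m) = 0")
   case False
   then have "card (im m) = psize l" unfolding b' bival_cnt by (rule cnt_margins(3)[OF finite_im l])
   then obtain xi where xi: "xi : partitions (card (im m))" "lf xi = l" using Par_lf[OF l] by auto
   have sl: "sum_list xi = card (im m)" using xi(1) by (simp add: partitions_def)
   have "card (im m) : index_set r M" unfolding index_set_def by (rule image_eqI[OF _ m]) (rule index_im[OF M_tau[OF m], symmetric])
   then have "xi : Lam r M" using xi(1) by (auto simp: Lam_def)
   moreover have "(mu, Q, S) : Ls xi"
    using mu Q(1) S left_orbit_comp_length[OF mu, of Q] by (simp add: L_set_def sl semistandard_SST xi(2))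
   moreover have "(nu, Q', T) : Rs xi"
    using nu Q'(1) T right_orbit_comp_length[of "orbs nu" Q'] by (simp add: R_set_def sl semistandard_SST xi(2))
   ultimately have i: "(xi, (mu, Q, S), (nu, Q', T)) : Index" by simp
   have "?z b = coord x (xi, (mu, Q, S), (nu, Q', T))" using i xi(2) by (simp add: coord_def b')
   then show ?thesis using z[OF i] by simp
  qed simp
 qed
 finally show ?thesis by simp
qed

lemma coord_add:
 assumes x: "!!mu nu. mu : Comp ==> nu : Comp ==> x mu nu : Inv mu nu"
  and y: "!!mu nu. mu : Comp ==> nu : Comp ==> y mu nu : Inv mu nu"
 shows "coord (%mu nu m. x mu nu m + y mu nu m) i = coord x i + coord y i"
proof (cases "i : Index")
 case True
 obtain xi mu Q S nu Q' T where i: "i = (xi, (mu, Q, S), (nu, Q', T))" by (metis prod_cases3)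
 have xi: "xi : Lam r M" and L: "(mu, Q, S) : Ls xi" and R: "(nu, Q', T) : Rs xi" using True i by auto
 note mu = L_set_D(1)[OF L] and nu = R_set_D(1)[OF R]
 let ?zx = "coords mu nu Q Q' (x mu nu)" and ?zy = "coords mu nu Q Q' (y mu nu)"
 note ex = coords_expansion[OF mu nu L_set_D(2)[OF L] R_set_D(2)[OF R]]
 have "local_expansion mu nu Q Q' (%m. x mu nu m + y mu nu m) (%b. of_int (?zx b) + of_int (?zy b))"
  using ex[OF x[OF mu nu]] ex[OF y[OF mu nu]] unfolding local_expansion_def by (simp add: distrib_right sum.distrib)
 from coord_eqI[where x = "%mu nu m. x mu nu m + y mu nu m", OF xi L R _ this] invariants_map2[OF mu nu x[OF mu nu] y[OF mu nu], of "(+)"]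
 have "rat_of_int (coord (%mu nu m. x mu nu m + y mu nu m) i) = of_int (?zx (lf xi, S, T)) + of_int (?zy (lf xi, S, T))"
  unfolding i by simp
 then show ?thesis using True unfolding i coord_def by simp
qed (simp add: coord_def)

end

section \<open>The cell property\<close>

lemma sum_by_value:
 assumes "finite H" "finite K" "!!h. h : H ==> g h : K" "!!h. h : H ==> e h = ep (g h)"
 shows "(\<Sum>h\<in>H. e h) = (\<Sum>A\<in>K. ep A * of_nat (card {h\<in>H. g h = A}) :: rat)"
proof -
 have "(\<Sum>h\<in>H. e h) = (\<Sum>A\<in>K. \<Sum>h\<in>{h\<in>H. g h = A}. e h)"
  by (rule sum.group[symmetric]) (use assms in auto)
 also have "... = (\<Sum>A\<in>K. ep A * of_nat (card {h\<in>H. g h = A}))"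
 proof (rule sum_eq)
  fix A
  have "(\<Sum>h\<in>{h\<in>H. g h = A}. e h) = (\<Sum>h\<in>{h\<in>H. g h = A}. ep A)"
   by (rule sum_eq) (use assms(4) in auto)
  then show "(\<Sum>h\<in>{h\<in>H. g h = A}. e h) = ep A * of_nat (card {h\<in>H. g h = A})" by simp
 qed
 finally show ?thesis .
qed

lemma sum_indicator_card: "finite H ==> (\<Sum>h\<in>H. if P h then 1 else 0) = (of_nat (card {h\<in>H. P h}) :: rat)"
 by (simp add: sum.inter_filter[symmetric])

text \<open>Bounds the rows in use by the length of \<open>xi\<close>, so that the row contents
  range over one finite set for all maps \<open>m\<close>.\<close>

lemma stat_rows:
 assumes "finite Z" "h : extensional Z" "stat Z h w = rt (lf xi) T"
 shows "h : Z \<rightarrow>\<^sub>E {..<length xi}"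
proof (rule PiE_I)
 fix y assume "y : Z"
 then have "stat Z h w (h y) (w y) ~= 0" using stat_pos_iff[OF assms(1)] by blast
 then have "rt (lf xi) T (h y) (w y) ~= 0" using assms(3) by simp
 then have "{p\<in>fdiag (lf xi). fst p = h y & T p = w y} ~= {}" unfolding stat_def by (metis card.empty)
 then obtain p where "p : fdiag (lf xi)" "fst p = h y" by blast
 then show "h y : {..<length xi}" by (auto simp: diagram_fdiag[symmetric] diagram_def)
qed (use assms(2) in \<open>simp add: extensional_def\<close>)

lemma stat_cmat: "stat Z h u = cmat Z h u" by (simp add: stat_def cmat_def)

context gs_data
begin

text \<open>Left multiplication by \<open>a\<close> can only merge or annihilate image points of
  \<open>b\<close>. If the index does not drop, neither happens and the fibres of \<open>b\<close>
  survive.\<close>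

lemma comp_index:
 assumes a: "a : M" and b: "b : M"
 shows "im (a o b) <= im a" "card (im (a o b)) <= card (im b)"
  and "card (im (a o b)) = card (im b) ==> bij_betw a (im b) (im (a o b))"
  and "card (im (a o b)) = card (im b) ==> y : im b ==> (a o b) -` {a y} = b -` {y}"
  and "card (im (a o b)) = card (im b) ==> fam (a o b) = fam b"
proof -
 note at = M_tau[OF a] and bt = M_tau[OF b] and abt = M_tau[OF M_comp[OF a b]]
 have a0: "a 0 = 0" by (rule tau_D(1)[OF at])
 show "im (a o b) <= im a" using im_iff[OF abt] im_iff[OF at] by auto
 have sub: "im (a o b) <= a ` im b"
 proof
  fix y assume "y : im (a o b)"
  then obtain x where x: "a (b x) = y" "y ~= 0" using im_iff[OF abt] by auto
  then have "b x : im b" using im_iff[OF bt, of "b x"] a0 by (cases "b x = 0") auto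
  then show "y : a ` im b" using x by blast
 qed
 have c1: "card (im (a o b)) <= card (a ` im b)" by (rule card_mono[OF _ sub]) (simp add: finite_im)
 have c2: "card (a ` im b) <= card (im b)" by (rule card_image_le[OF finite_im])
 show "card (im (a o b)) <= card (im b)" using c1 c2 by simp
 show bij: "bij_betw a (im b) (im (a o b))" if e: "card (im (a o b)) = card (im b)"
 proof (rule bij_betw_imageI)
  show "inj_on a (im b)" by (rule eq_card_imp_inj_on[OF finite_im]) (use c1 c2 e in simp)
  show "a ` im b = im (a o b)" by (rule card_subset_eq[symmetric, OF _ sub]) (use c1 c2 e finite_im in auto)
 qed
 show fib: "(a o b) -` {a y} = b -` {y}" if e: "card (im (a o b)) = card (im b)" and y: "y : im b" for y
 proof (intro equalityI subsetI)
  fix x assume "x : (a o b) -` {a y}"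
  then have x: "a (b x) = a y" by simp
  have "a y : im (a o b)" using bij_betwE[OF bij[OF e]] y by blast
  then have "a y ~= 0" using im_iff[OF abt] by blast
  then have "b x : im b" using x im_iff[OF bt, of "b x"] a0 by (cases "b x = 0") auto
  then have "b x = y" using inj_onD[OF bij_betw_imp_inj_on[OF bij[OF e]] x] y by blast
  then show "x : b -` {y}" by simp
 qed simp
 show "fam (a o b) = fam b" if e: "card (im (a o b)) = card (im b)"
  unfolding fam_def bij_betw_imp_surj_on[OF bij[OF e], symmetric] image_image
  by (rule image_cong[OF refl]) (rule fib[OF e])
qed

lemma sum_M_perm:
 assumes p: "p permutes {1..r}"
 shows "(\<Sum>a\<in>M. F (p o a)) = (\<Sum>a\<in>M. F a)"
proof (rule sum.reindex_bij_betw)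
 show "bij_betw (%a. p o a) M M"
 proof (rule bij_betw_byWitness[where f' = "%a. pinv p o a"])
  show "\<forall>a\<in>M. pinv p o (p o a) = a" "\<forall>a\<in>M. p o (pinv p o a) = a"
   using permutes_inv_o[OF p] by (simp_all only: comp_assoc[symmetric]) simp_all
  show "(%a. p o a) ` M <= M" "(%a. pinv p o a) ` M <= M" using M_left[OF p] M_left[OF permutes_inv[OF p]] by auto
 qed
qed

text \<open>If the index is kept, \<open>b\<close> is determined by its image \<open>C\<close>,
  being the lift of \<open>m\<close> along the bijection from \<open>C\<close> to
  \<open>im m\<close> induced by \<open>a\<close>. Conversely every such \<open>C\<close> admits a
  lift of the form \<open>rho o m\<close>, which lies in \<open>M\<close>. The sum over
  \<open>C\<close> no longer sees the fibres of \<open>m\<close>.\<close>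

lemma sum_factorizations_left:
 assumes a: "a : M" and m: "m : M"
 shows "(\<Sum>b\<in>M. if a o b = m & card (im b) = card (im m) & g (im b) then k else 0) =
  (\<Sum>C\<in>Pow {1..r}. if bij_betw a C (im m) & g C then k else (0 :: rat))"
proof -
 note at = M_tau[OF a] and mt = M_tau[OF m]
 have a0: "a 0 = 0" by (rule tau_D(1)[OF at])
 let ?F = "{b\<in>M. a o b = m & card (im b) = card (im m)}" and ?G = "{C\<in>Pow {1..r}. bij_betw a C (im m)}"
 have bij: "bij_betw a (im b) (im m)" if "b : ?F" for b using comp_index(3)[OF a, of b] that by auto
 have "bij_betw im ?F ?G"
 proof (rule bij_betw_imageI)
  show "inj_on im ?F"
  proof (rule inj_onI, rule ext)
   fix b b' x assume h: "b : ?F" "b' : ?F" "im b = im b'"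
   have "a o b = m" "a o b' = m" using h(1,2) by blast+
   then have ab: "a (b x) = m x" "a (b' x) = m x" by (metis comp_apply)+
   have z: "c x = 0 \<or> c x : im b & m x ~= 0" if "c : ?F" "im c = im b" for c
   proof (cases "c x = 0")
    case False
    then have cx: "c x : im c" using im_iff[OF M_tau, of c "c x"] that by auto
    then have "a (c x) : im m" using bij_betwE[OF bij[OF that(1)]] by blast
    moreover have "a (c x) = m x" using that(1) by auto
    ultimately show ?thesis using cx that(2) im_iff[OF mt] by auto
   qed simp
   show "b x = b' x"
   proof (cases "m x = 0")
    case True
    then show ?thesis using z[OF h(1) refl] z[OF h(2) h(3)[symmetric]] by simp
   next
    case False
    then have "b x ~= 0" "b' x ~= 0" using ab a0 by metis+
    then have "b x : im b" "b' x : im b" using z[OF h(1) refl] z[OF h(2) h(3)[symmetric]] by auto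
    then show ?thesis using inj_onD[OF bij_betw_imp_inj_on[OF bij[OF h(1)]], of "b x" "b' x"] ab by simp
   qed
  qed
  show "im ` ?F = ?G"
  proof (intro equalityI subsetI)
   fix C assume "C : im ` ?F"
   then obtain b where b: "b : ?F" "C = im b" by blast
   then show "C : ?G" using bij[OF b(1)] im_subset[OF M_tau, of b] by simp
  next
   fix C assume C: "C : ?G"
   then have ab: "bij_betw a C (im m)" by simp
   have ib: "bij_betw (inv_into C a) (im m) C" by (rule bij_betw_inv_into[OF ab])
   obtain rho where rho: "rho permutes {1..r}" "\<forall>y\<in>im m. rho y = inv_into C a y"
    using extend_permutation[OF ib im_subset[OF mt]] C by blast
   have im: "im (rho o m) = rho ` im m" using im_comp(1)[OF rho(1) permutes_id mt] by simp
   also have "... = inv_into C a ` im m" using rho(2) by (intro image_cong) auto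
   also have "... = C" by (rule bij_betw_imp_surj_on[OF ib])
   finally have imC: "im (rho o m) = C" .
   have "a o (rho o m) = m"
   proof
    fix x
    show "(a o (rho o m)) x = m x"
    proof (cases "m x = 0")
     case True
     then show ?thesis using perm_0[OF rho(1)] a0 by simp
    next
     case False
     then have "m x : im m" using im_iff[OF mt] by blast
     then show ?thesis using rho(2) bij_betw_inv_into_right[OF ab] by simp
    qed
   qed
   moreover have "card C = card (im m)" by (rule bij_betw_same_card[OF ab])
   ultimately have "rho o m : ?F" using M_left[OF rho(1) m] imC by simp
   then show "C : im ` ?F" using imC by blast
  qed
 qed
 then have "(\<Sum>b\<in>?F. if g (im b) then k else 0) = (\<Sum>C\<in>?G. if g C then k else 0)"
  by (rule sum.reindex_bij_betw)
 moreover have "(\<Sum>b\<in>M. if a o b = m & card (im b) = card (im m) & g (im b) then k else 0) = (\<Sum>b\<in>?F. if g (im b) then k else 0)"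
  unfolding sum.inter_filter[OF finite_M] by (rule sum_eq) simp
 moreover have "(\<Sum>C\<in>Pow {1..r}. if bij_betw a C (im m) & g C then k else 0) = (\<Sum>C\<in>?G. if g C then k else 0)"
 proof -
  have "finite (Pow {1..r})" by simp
  then show ?thesis unfolding sum.inter_filter[OF \<open>finite (Pow {1..r})\<close>] by (intro sum.cong refl) simp
 qed
 ultimately show ?thesis by simp
qed

end

context weighted_gs
begin

lemma u_orbit:
 assumes "mu : Comp" "Q : LO mu i" "C : Q" "C' : Q"
 shows "u mu C = u mu C'"
proof -
 obtain C0 where "Q = {rho ` C0 | rho. rho : young mu}" using assms(2) by (auto simp: left_orbits_def)
 then have "u mu E = u mu C0" if "E : Q" for E using that u_young[OF assms(1)] by auto
 then show ?thesis using assms(3,4) by simp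
qed

lemma v_orbit:
 assumes "nu : Comp" "Q : right_orbits leq M nu i r" "D : Q" "D' : Q"
 shows "v nu D = v nu D'"
proof -
 obtain D0 where "Q = {(%d. ta -` d) ` D0 | ta. ta : young nu}" using assms(2) by (auto simp: right_orbits_def)
 then have "v nu E = v nu D0" if "E : Q" for E using that v_young[OF assms(1)] by auto
 then show ?thesis using assms(3,4) by simp
qed

lemma W_uv: "mu : Comp ==> nu : Comp ==> m : M ==> W mu nu m = of_nat (u mu (im m)) * of_nat (v nu (fam m))"
 by (simp add: W_def weight_eq)

lemma cell_carrier:
 assumes xi: "xi : Lam r M" and L: "(mu, Q, S) : Ls xi" and R: "(nu, Q', T) : Rs xi"
 shows "Cell xi (mu, Q, S) (nu, Q', T) : carrier DR"
proof (rule carrierI)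
 fix mu1 nu1 m assume "~ (mu1 : Comp & nu1 : Comp)"
 then show "Cell xi (mu, Q, S) (nu, Q', T) mu1 nu1 m = 0"
  using L_set_D(1)[OF L] R_set_D(1)[OF R] by (intro cell_elt_off) auto
qed (rule cell_elt_invariant[OF xi L R])

lemma star_eq:
 assumes "x : carrier DR" "y : carrier DR" "mu : Comp" "ta : Comp" "m : M"
 shows "of_int ((x \<otimes>D y) mu ta m) = W mu ta m * mconv (nrm x) (nrm y) mu ta m"
 unfolding nrm_star[OF assms, symmetric] mult_eq nrm_def using W_pos[OF assms(3-5)] by simp

text \<open>The factor at row assignment \<open>h\<close>: it does not see the right index of the cell element.\<close>

definition left_coeff where
 "left_coeff x mu nu A C' h = (\<Sum>a\<in>M. \<Sum>C\<in>Pow {1..r}.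
  if bij_betw a C C' & stat C (h o a) (blk nu) = A then nrm x mu nu a else 0)"

text \<open>Assignments with the same row content under \<open>blk mu\<close> are related by an
  element of \<open>young mu\<close>, and \<open>nrm x\<close> is invariant under left translation
  by it.\<close>

lemma left_coeff_cong:
 assumes x: "x : carrier DR" and mu: "mu : Comp" and nu: "nu : Comp"
  and C: "C' <= {1..r}" "C'' <= {1..r}" and st: "stat C' h' (blk mu) = stat C'' h'' (blk mu)"
 shows "left_coeff x mu nu A C'' h'' = left_coeff x mu nu A C' h'"
proof -
 have fin: "finite C'" "finite C''" using C finite_subset by auto
 obtain b where b: "bij_betw b C' C''" "\<forall>y\<in>C'. h'' (b y) = h' y & blk mu (b y) = blk mu y"
  using cmat_match[OF fin st[unfolded stat_cmat]] by blast
 have "\<exists>rho\<in>young mu. \<forall>y\<in>C'. rho y = b y"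
  by (rule extend_young[OF b(1)]) (use C b(2) comps_D(1)[OF mu] in auto)
 then obtain rho where rho: "rho : young mu" "\<forall>y\<in>C'. rho y = b y" by blast
 have rb: "bij_betw rho C' C''" using b(1) bij_betw_cong[of C' rho b C''] rho(2) by simp
 have rinv: "pinv rho (rho y) = y" for y using permutes_inverses(2)[OF young_r[OF mu rho(1)]] .
 have irb: "bij_betw (pinv rho) C'' C'" by (rule bij_betw_imageI)
   (auto simp: bij_betw_imp_surj_on[OF rb, symmetric] image_image rinv intro!: inj_onI)
 have "left_coeff x mu nu A C'' h'' = (\<Sum>a\<in>M. \<Sum>C\<in>Pow {1..r}.
   if bij_betw (rho o a) C C'' & stat C (h'' o (rho o a)) (blk nu) = A then nrm x mu nu (rho o a) else 0)"
  unfolding left_coeff_def by (rule sum_M_translate(1)[OF mu rho(1), symmetric, where F = "%a. \<Sum>C\<in>Pow {1..r}.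
   if bij_betw a C C'' & stat C (h'' o a) (blk nu) = A then nrm x mu nu a else 0"])
 also have "... = left_coeff x mu nu A C' h'" unfolding left_coeff_def
 proof (intro sum.cong refl)
  fix a C assume a: "a : M"
  have i: "bij_betw (rho o a) C C'' \<longleftrightarrow> bij_betw a C C'"
  proof
   assume "bij_betw (rho o a) C C''"
   then have "bij_betw (pinv rho o (rho o a)) C C'" by (rule bij_betw_trans[OF _ irb])
   then show "bij_betw a C C'" by (simp add: young_cancel(1)[OF mu rho(1)])
  qed (rule bij_betw_trans[OF _ rb])
  have "stat C (h'' o (rho o a)) (blk nu) = stat C (h' o a) (blk nu)" if "bij_betw a C C'"
  proof (rule stat_cong)
   fix y assume "y : C"
   then have "a y : C'" using bij_betwE[OF \<open>bij_betw a C C'\<close>] by blast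
   then show "(h'' o (rho o a)) y = (h' o a) y" using rho(2) b(2) by simp
  qed simp
  then show "(if bij_betw (rho o a) C C'' & stat C (h'' o (rho o a)) (blk nu) = A then nrm x mu nu (rho o a) else 0) =
    (if bij_betw a C C' & stat C (h' o a) (blk nu) = A then nrm x mu nu a else 0)"
   using i nrm_young(1)[OF x mu nu a rho(1) id_young] by auto
 qed
 finally show ?thesis .
qed

text \<open>At maps of index \<open>sum_list xi\<close> only factorisations that keep the index
  contribute, and these keep the fibres and thus the right colours. Transporting the row assignments
  from \<open>im b\<close> to \<open>im m\<close> separates the two sides: the right content is a
  condition on \<open>h\<close> alone, and the rest depends on \<open>h\<close> only through its
  content \<open>A\<close> under \<open>blk mu\<close>. Hence one \<open>K\<close> and one
  \<open>c\<close> serve all right indices.\<close>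

lemma left_product:
 assumes x: "x : carrier DR" and xi: "xi : Lam r M" and L: "(nu, Q, S) : Ls xi" and mu: "mu : Comp"
 shows "\<exists>(K :: (nat => nat => nat) set) c. \<forall>ta Q' T m. (ta, Q', T) : Rs xi --> m : M --> card (im m) = sum_list xi -->
  of_int ((x \<otimes>D Cell xi (nu, Q, S) (ta, Q', T)) mu ta m) =
  of_nat (u mu (im m)) * (\<Sum>A\<in>K. c A * of_nat (cntm A (rt (lf xi) T) (cm mu ta m)) :: rat)"
proof -
 let ?l = "lf xi"
 note nu = L_set_D(1)[OF L] and Q = L_set_D(2)[OF L] and part = Lam_partition[OF xi]
 obtain C0 where C0: "C0 : Q" using left_orbit_nonempty[OF Q] by blast
 define K where "K = (\<Union>C\<in>Pow {1..r}. (%h. stat C h (blk mu)) ` (C \<rightarrow>\<^sub>E {..<length xi}))"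
 have finK: "finite K" unfolding K_def by (intro finite_UN_I finite_imageI finite_PiE) (auto intro: finite_subset)
 define E where "E = left_coeff x mu nu (rt ?l S)"
 \<comment> \<open>By \<open>left_coeff_cong\<close> the factor \<open>E\<close> depends only on the
   row content; \<open>ep\<close> reads it off at any representative.\<close>
 define ep where "ep A = (let p = SOME p. fst p <= {1..r} & stat (fst p) (snd p) (blk mu) = A in E (fst p) (snd p))" for A
 have eps: "E C h = ep (stat C h (blk mu))" if "C <= {1..r}" for C h
 proof -
  let ?p = "SOME p. fst p <= {1..r} & stat (fst p) (snd p) (blk mu) = stat C h (blk mu)"
  have "fst ?p <= {1..r} & stat (fst ?p) (snd ?p) (blk mu) = stat C h (blk mu)"
   by (rule someI[of "%p. fst p <= {1..r} & stat (fst p) (snd p) (blk mu) = stat C h (blk mu)" "(C, h)"]) (use that in simp)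
  then have "E C h = E (fst ?p) (snd ?p)" unfolding E_def by (intro left_coeff_cong[OF x mu nu _ that]) auto
  then show ?thesis unfolding ep_def Let_def .
 qed
 have main: "of_int ((x \<otimes>D Cell xi (nu, Q, S) (ta, Q', T)) mu ta m) =
   of_nat (u mu (im m)) * (\<Sum>A\<in>K. ep A / of_nat (u nu C0) * of_nat (cntm A (rt ?l T) (cm mu ta m)))"
  if R: "(ta, Q', T) : Rs xi" and m: "m : M" and mi: "card (im m) = sum_list xi" for ta Q' T m
 proof -
  note ta = R_set_D(1)[OF R] and mt = M_tau[OF m]
  let ?f = "Cell xi (nu, Q, S) (ta, Q', T)"
  define cn where "cn b = cnt (im b) (blk nu) (vf ta b) (rt ?l S) (rt ?l T)" for b
  define H where "H = {h : extensional (im m). stat (im m) h (vf ta m) = rt ?l T}"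
  have finH: "finite H" unfolding H_def by (rule finite_stat_set[OF finite_im])
  \<comment> \<open>The weight of every contributing \<open>b\<close>: its image lies in the orbit
    of \<open>C0\<close>, and its fibres are those of \<open>m\<close>.\<close>
  define d where "d = rat_of_nat (u nu C0) * of_nat (v ta (fam m))"
  have t: "(if a o b = m then nrm x mu nu a * nrm ?f nu ta b else 0) =
    (\<Sum>h\<in>H. if a o b = m & card (im b) = card (im m) & stat (im b) (h o a) (blk nu) = rt ?l S then nrm x mu nu a else 0) / d"
   if a: "a : M" and b: "b : M" for a b
  proof (cases "a o b = m & card (im b) = card (im m)")
   case True
   then have ab: "a o b = m" and cb: "card (im (a o b)) = card (im b)" by auto
   note bj = comp_index(3)[OF a b cb, unfolded ab]
   have cnb: "cn b = card {h\<in>H. stat (im b) (h o a) (blk nu) = rt ?l S}"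
   proof -
    have "cn b = cnt (im m) (blk nu o inv_into (im b) a) (vf ta m) (rt ?l S) (rt ?l T)" unfolding cn_def
    proof (rule cnt_bij[OF bj])
     fix y assume y: "y : im b"
     show "blk nu y = (blk nu o inv_into (im b) a) (a y)" using bij_betw_inv_into_left[OF bj y] by simp
     show "vf ta b y = vf ta m (a y)" using comp_index(4)[OF a b cb y] ab by (simp add: vf_def)
    qed
    also have "... = card {h\<in>H. stat (im b) (h o a) (blk nu) = rt ?l S}"
    proof -
     have "stat (im b) (h o a) (blk nu) = stat (im m) h (blk nu o inv_into (im b) a)" for h
      by (rule stat_bij[OF bj]) (simp_all add: bij_betw_inv_into_left[OF bj])
     then show ?thesis unfolding cnt_def H_def by (intro arg_cong[where f = card]) auto
    qed
    finally show ?thesis .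
   qed
   have "nrm ?f nu ta b = of_nat (cn b) / d"
   proof (cases "cn b = 0")
    case True
    then show ?thesis using cell_elt_cnt(1)[OF L R part b] by (simp add: nrm_def cn_def)
   next
    case False
    then have "im b : Q" using cell_elt_cnt(2)[OF L R part b] by (simp add: cn_def)
    then have "u nu (im b) = u nu C0" by (rule u_orbit[OF nu Q _ C0])
    moreover have "fam b = fam m" using comp_index(5)[OF a b cb] ab by simp
    ultimately show ?thesis using cell_elt_cnt(1)[OF L R part b] W_uv[OF nu ta b] by (simp add: nrm_def cn_def d_def)
   qed
   moreover have "(\<Sum>h\<in>H. if a o b = m & card (im b) = card (im m) & stat (im b) (h o a) (blk nu) = rt ?l S then nrm x mu nu a else 0) =
     nrm x mu nu a * (\<Sum>h\<in>H. if stat (im b) (h o a) (blk nu) = rt ?l S then 1 else 0)"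
    unfolding sum_distrib_left using True by (intro sum.cong refl) simp
   ultimately show ?thesis using ab by (simp add: cnb sum_indicator_card[OF finH])
  next
   case False
   have "nrm ?f nu ta b = 0" if ab: "a o b = m"
   proof -
    have "cn b = 0" using cell_elt_cnt(2)[OF L R part b] False ab mi by (auto simp: cn_def)
    then show ?thesis using cell_elt_cnt(1)[OF L R part b] by (simp add: nrm_def cn_def)
   qed
   moreover have "(\<Sum>h\<in>H. if a o b = m & card (im b) = card (im m) & stat (im b) (h o a) (blk nu) = rt ?l S then nrm x mu nu a else 0) = 0"
    using False by (intro sum.neutral ballI) auto
   ultimately show ?thesis by simp
  qed
  have "mconv (nrm x) (nrm ?f) mu ta m =
    (\<Sum>kap\<in>Comp. if kap = nu then \<Sum>a\<in>M. \<Sum>b\<in>M. if a o b = m then nrm x mu nu a * nrm ?f nu ta b else 0 else 0)"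
   unfolding mconv_def
  proof (rule sum_eq)
   fix kap
   have "nrm ?f kap ta b = 0" if "kap ~= nu" for b using cell_elt_off[of kap nu ta ta] that by (simp add: nrm_def)
   then show "(\<Sum>a\<in>M. \<Sum>b\<in>M. if a o b = m then nrm x mu kap a * nrm ?f kap ta b else 0) =
     (if kap = nu then \<Sum>a\<in>M. \<Sum>b\<in>M. if a o b = m then nrm x mu nu a * nrm ?f nu ta b else 0 else 0)"
    by (cases "kap = nu") (simp_all cong: if_cong)
  qed
  also have "... = (\<Sum>a\<in>M. \<Sum>b\<in>M. if a o b = m then nrm x mu nu a * nrm ?f nu ta b else 0)"
   using finite_compositions nu by (simp add: sum.delta)
  also have "... = (\<Sum>a\<in>M. \<Sum>b\<in>M. (\<Sum>h\<in>H. if a o b = m & card (im b) = card (im m) &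
    stat (im b) (h o a) (blk nu) = rt ?l S then nrm x mu nu a else 0) / d)" by (intro sum.cong refl t)
  also have "... = (\<Sum>a\<in>M. \<Sum>b\<in>M. \<Sum>h\<in>H. if a o b = m & card (im b) = card (im m) &
    stat (im b) (h o a) (blk nu) = rt ?l S then nrm x mu nu a else 0) / d" by (simp only: sum_divide_distrib)
  also have "... = (\<Sum>h\<in>H. \<Sum>a\<in>M. \<Sum>b\<in>M. if a o b = m & card (im b) = card (im m) &
    stat (im b) (h o a) (blk nu) = rt ?l S then nrm x mu nu a else 0) / d"
   by (rule arg_cong[where f = "%s. s / d"], rule sum_pull)
  also have "... = (\<Sum>h\<in>H. E (im m) h) / d"
  proof (rule arg_cong[where f = "%s. s / d"], rule sum_eq)
   fix h
   show "(\<Sum>a\<in>M. \<Sum>b\<in>M. if a o b = m & card (im b) = card (im m) & stat (im b) (h o a) (blk nu) = rt ?l S then nrm x mu nu a else 0) = E (im m) h"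
    unfolding E_def left_coeff_def by (rule sum_eq)
     (rule sum_factorizations_left[OF _ m, where g = "%C. stat C (h o _) (blk nu) = rt ?l S"])
  qed
  also have "(\<Sum>h\<in>H. E (im m) h) = (\<Sum>A\<in>K. ep A * of_nat (card {h\<in>H. stat (im m) h (blk mu) = A}))"
  proof (rule sum_by_value[OF finH finK])
   fix h assume h: "h : H"
   show "E (im m) h = ep (stat (im m) h (blk mu))" by (rule eps[OF im_subset[OF mt]])
   have "h : extensional (im m)" "stat (im m) h (vf ta m) = rt ?l T" using h by (auto simp: H_def)
   then have "h : im m \<rightarrow>\<^sub>E {..<length xi}" by (rule stat_rows[OF finite_im])
   then show "stat (im m) h (blk mu) : K" unfolding K_def using im_subset[OF mt] by blast
  qed
  also have "... = (\<Sum>A\<in>K. ep A * of_nat (cntm A (rt ?l T) (cm mu ta m)))"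
  proof (intro sum.cong refl)
   fix A
   have "{h\<in>H. stat (im m) h (blk mu) = A} = {h : extensional (im m). stat (im m) h (blk mu) = A & stat (im m) h (vf ta m) = rt ?l T}"
    by (auto simp: H_def)
   then have "card {h\<in>H. stat (im m) h (blk mu) = A} = cntm A (rt ?l T) (cm mu ta m)"
    unfolding cm_vf cnt_eq_cntm[OF finite_im, symmetric] cnt_def by simp
   then show "ep A * of_nat (card {h\<in>H. stat (im m) h (blk mu) = A}) = ep A * of_nat (cntm A (rt ?l T) (cm mu ta m))" by simp
  qed
  finally have mc: "mconv (nrm x) (nrm ?f) mu ta m = (\<Sum>A\<in>K. ep A * of_nat (cntm A (rt ?l T) (cm mu ta m))) / d" .
  have "of_int ((x \<otimes>D ?f) mu ta m) = W mu ta m * mconv (nrm x) (nrm ?f) mu ta m"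
   by (rule star_eq[OF x cell_carrier[OF xi L R] mu ta m])
  \<comment> \<open>The factor \<open>v ta (fam m)\<close> occurs in \<open>W mu ta m\<close> and in
    \<open>d\<close> and cancels, which frees the coefficients from the right index.\<close>
  also have "... = of_nat (u mu (im m)) * ((\<Sum>A\<in>K. ep A * of_nat (cntm A (rt ?l T) (cm mu ta m))) / of_nat (u nu C0))"
   unfolding mc W_uv[OF mu ta m] d_def using v_pos[of ta "fam m"] u_pos[of nu C0] by simp
  finally show ?thesis by (simp add: sum_divide_distrib mult.assoc)
 qed
 then show ?thesis by (intro exI[of _ K] exI[of _ "%A. ep A / of_nat (u nu C0)"]) blast
qed

text \<open>Left multiplication never raises the index, and at equal index it keeps the family of
  fibres, so the product does not reach these maps.\<close>

lemma left_product_zero: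
 assumes x: "x : carrier DR" and xi: "xi : Lam r M" and L: "(nu, Q, S) : Ls xi"
  and R: "(ta0, Q', T) : Rs xi" and mu: "mu : Comp" and ta: "ta : Comp" and m: "m : M"
  and h: "ta ~= ta0 \<or> sum_list xi < card (im m) \<or> card (im m) = sum_list xi & fam m ~: Q'"
 shows "(x \<otimes>D Cell xi (nu, Q, S) (ta0, Q', T)) mu ta m = 0"
proof -
 let ?f = "Cell xi (nu, Q, S) (ta0, Q', T)"
 have "(if a o b = m then nrm x mu kap a * nrm ?f kap ta b else 0) = 0" if a: "a : M" and b: "b : M" for a b kap
 proof (cases "a o b = m & kap = nu & ta = ta0")
  case True
  have "?f nu ta0 b = 0"
  proof (rule ccontr)
   assume "?f nu ta0 b ~= 0"
   then have "fam b : Q' & card (im b) = sum_list xi"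
    using cell_elt_cnt[OF L R Lam_partition[OF xi] b] by (metis of_nat_0)
   then show False using h True comp_index(2,5)[OF a b] by auto
  qed
  then show ?thesis using True by (simp add: nrm_def)
 next
  case False
  then show ?thesis using cell_elt_off[of kap nu ta ta0] by (auto simp: nrm_def)
 qed
 then have "mconv (nrm x) (nrm ?f) mu ta m = 0" unfolding mconv_def by (intro sum.neutral ballI) blast
 then show ?thesis using star_eq[OF x cell_carrier[OF xi L R] mu ta m] by simp
qed

end

section \<open>Multiplication of cell elements from the right\<close>

context weighted_gs
begin

text \<open>What survives here is the image: factors \<open>a\<close> with
  \<open>im a = im m\<close> keep the left colours. The sum runs over pairs of maps, not over
  subsets, because the right colours of \<open>a\<close> are read off from its fibres.\<close>

definition right_coeff where
 "right_coeff x nu ta A m h = (\<Sum>a\<in>M. \<Sum>b\<in>M.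
  if a o b = m & im a = im m & stat (im m) h (vf nu a) = A then nrm x nu ta b else 0)"

text \<open>Equal contents give \<open>m' o sig = rho o m\<close> with \<open>sig\<close> in
  \<open>young ta\<close> and a permutation \<open>rho\<close>. The summation variables are moved by
  \<open>rho\<close> and \<open>sig\<close>. No block condition on \<open>rho\<close> arises, since
  left colours do not enter \<open>right_coeff\<close>.\<close>

lemma right_coeff_cong:
 assumes x: "x : carrier DR" and nu: "nu : Comp" and ta: "ta : Comp"
  and m: "m : M" "m' : M" and st: "stat (im m) h (vf ta m) = stat (im m') h' (vf ta m')"
 shows "right_coeff x nu ta A m' h' = right_coeff x nu ta A m h"
proof -
 note mt = M_tau[OF m(1)] and mt' = M_tau[OF m(2)]
 obtain th where th: "bij_betw th (im m) (im m')" "\<forall>y\<in>im m. h' (th y) = h y & vf ta m' (th y) = vf ta m y"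
  using cmat_match[OF finite_im finite_im st[unfolded stat_cmat]] by blast
 have "\<exists>sig\<in>young ta. \<forall>x. m' (sig x) = (if m x = 0 then 0 else th (m x))"
  by (rule match_right[OF ta mt mt' th(1)]) (use th(2) in \<open>simp add: vf_def\<close>)
 then obtain sig where sig: "sig : young ta" "\<forall>x. m' (sig x) = (if m x = 0 then 0 else th (m x))" by blast
 obtain rho where rho: "rho permutes {1..r}" "\<forall>y\<in>im m. rho y = th y"
  using extend_permutation[OF th(1) im_subset[OF mt] im_subset[OF mt']] by blast
 have ms: "m' o sig = rho o m"
 proof
  fix z
  show "(m' o sig) z = (rho o m) z" using sig(2) rho(2) perm_0[OF rho(1)] im_iff[OF mt, of "m z"] by (cases "m z = 0") auto
 qed
 have inj: "rho o f = rho o g \<longleftrightarrow> f = g" for f g :: "nat => nat"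
  using permutes_inj[OF rho(1)] by (simp add: fun.inj_map_strong inj_compose fun_eq_iff inj_eq)
 have rb: "bij_betw rho (im m) (im m')" using th(1) bij_betw_cong[of "im m" rho th "im m'"] rho(2) by simp
 have eq: "rho o a o b = m' \<longleftrightarrow> a o (b o sig) = m" for a b
 proof -
  have "rho o a o b = m' \<longleftrightarrow> rho o a o b o sig = m' o sig" using young_cancel(3)[OF ta sig(1)] by metis
  also have "... \<longleftrightarrow> rho o (a o (b o sig)) = rho o m" unfolding ms by (simp only: comp_assoc)
  finally show ?thesis unfolding inj .
 qed
 have "right_coeff x nu ta A m' h' = (\<Sum>a\<in>M. \<Sum>b\<in>M.
  if rho o a o b = m' & im (rho o a) = im m' & stat (im m') h' (vf nu (rho o a)) = A then nrm x nu ta b else 0)"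
  unfolding right_coeff_def by (rule sum_M_perm[OF rho(1), symmetric, where F = "%a. \<Sum>b\<in>M.
  if a o b = m' & im a = im m' & stat (im m') h' (vf nu a) = A then nrm x nu ta b else 0"])
 also have "... = (\<Sum>a\<in>M. \<Sum>b\<in>M.
  if a o (b o sig) = m & im a = im m & stat (im m) h (vf nu a) = A then nrm x nu ta (b o sig) else 0)"
 proof (intro sum.cong refl)
  fix a b assume a: "a : M" and b: "b : M"
  note at = M_tau[OF a]
  have i: "im (rho o a) = im m' \<longleftrightarrow> im a = im m"
   unfolding im_comp(1)[OF rho(1) permutes_id at, simplified] bij_betw_imp_surj_on[OF rb, symmetric]
   by (rule inj_image_eq_iff[OF permutes_inj[OF rho(1)]])
  have "stat (im m) h (vf nu a) = stat (im m') h' (vf nu (rho o a))" if "im a = im m"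
  proof (rule stat_bij[OF rb])
   fix y assume y: "y : im m"
   then show "h y = h' (rho y)" using th(2) rho(2) by simp
   have "y ~= 0" using y im_subset[OF mt] by auto
   then show "vf nu a y = vf nu (rho o a) (rho y)" using im_comp(2)[OF rho(1) permutes_id at, of y] by (simp add: vf_def)
  qed
  then show "(if rho o a o b = m' & im (rho o a) = im m' & stat (im m') h' (vf nu (rho o a)) = A then nrm x nu ta b else 0) =
    (if a o (b o sig) = m & im a = im m & stat (im m) h (vf nu a) = A then nrm x nu ta (b o sig) else 0)"
   unfolding eq i using nrm_young(2)[OF x nu ta b id_young sig(1)] by auto
 qed
 also have "... = right_coeff x nu ta A m h" unfolding right_coeff_def
 proof (rule sum_eq)
  fix a
  show "(\<Sum>b\<in>M. if a o (b o sig) = m & im a = im m & stat (im m) h (vf nu a) = A then nrm x nu ta (b o sig) else 0) =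
    (\<Sum>b\<in>M. if a o b = m & im a = im m & stat (im m) h (vf nu a) = A then nrm x nu ta b else 0)"
   by (rule sum_M_translate(2)[OF ta sig(1), where F = "%b. if a o b = m & im a = im m & stat (im m) h (vf nu a) = A then nrm x nu ta b else 0"])
 qed
 finally show ?thesis .
qed

text \<open>The image of \<open>a\<close> contains that of the product, so at equal index the two
  images agree and the row assignments already live on \<open>im m\<close>. This time the factor
  \<open>u mu (im m)\<close> of the weights cancels, which makes \<open>K\<close> and
  \<open>c\<close> independent of the left index.\<close>

lemma right_product:
 assumes x: "x : carrier DR" and xi: "xi : Lam r M" and R: "(nu, Q', T) : Rs xi" and ta: "ta : Comp"
 shows "\<exists>(K :: (nat => nat => nat) set) c. \<forall>mu Q S m. (mu, Q, S) : Ls xi --> m : M --> card (im m) = sum_list xi -->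
  of_int ((Cell xi (mu, Q, S) (nu, Q', T) \<otimes>D x) mu ta m) =
  of_nat (v ta (fam m)) * (\<Sum>A\<in>K. c A * of_nat (cntm (rt (lf xi) S) A (cm mu ta m)) :: rat)"
proof -
 let ?l = "lf xi"
 note nu = R_set_D(1)[OF R] and Q' = R_set_D(2)[OF R] and part = Lam_partition[OF xi]
 obtain D0 where D0: "D0 : Q'" using right_orbit_nonempty[OF Q'] by blast
 define K where "K = (\<Union>m\<in>M. (%h. stat (im m) h (vf ta m)) ` (im m \<rightarrow>\<^sub>E {..<length xi}))"
 have finK: "finite K" unfolding K_def by (intro finite_UN_I finite_imageI finite_PiE finite_M finite_im) simp
 define E where "E = right_coeff x nu ta (rt ?l T)"
 define ep where "ep A = (let p = SOME p. fst p : M & stat (im (fst p)) (snd p) (vf ta (fst p)) = A in E (fst p) (snd p))" for A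
 have eps: "E m h = ep (stat (im m) h (vf ta m))" if "m : M" for m h
 proof -
  let ?p = "SOME p. fst p : M & stat (im (fst p)) (snd p) (vf ta (fst p)) = stat (im m) h (vf ta m)"
  have p: "fst ?p : M & stat (im (fst ?p)) (snd ?p) (vf ta (fst ?p)) = stat (im m) h (vf ta m)"
   by (rule someI[of "%p. fst p : M & stat (im (fst p)) (snd p) (vf ta (fst p)) = stat (im m) h (vf ta m)" "(m, h)"]) (use that in simp)
  have "E m h = E (fst ?p) (snd ?p)" unfolding E_def by (rule right_coeff_cong[OF x nu ta _ that]) (use p in blast)+
  then show ?thesis unfolding ep_def Let_def .
 qed
 have main: "of_int ((Cell xi (mu, Q, S) (nu, Q', T) \<otimes>D x) mu ta m) =
   of_nat (v ta (fam m)) * (\<Sum>A\<in>K. ep A / of_nat (v nu D0) * of_nat (cntm (rt ?l S) A (cm mu ta m)))"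
  if L: "(mu, Q, S) : Ls xi" and m: "m : M" and mi: "card (im m) = sum_list xi" for mu Q S m
 proof -
  note mu = L_set_D(1)[OF L] and mt = M_tau[OF m]
  let ?f = "Cell xi (mu, Q, S) (nu, Q', T)"
  define cn where "cn a = cnt (im a) (blk mu) (vf nu a) (rt ?l S) (rt ?l T)" for a
  define H where "H = {h : extensional (im m). stat (im m) h (blk mu) = rt ?l S}"
  have finH: "finite H" unfolding H_def by (rule finite_stat_set[OF finite_im])
  define d where "d = rat_of_nat (u mu (im m)) * of_nat (v nu D0)"
  have t: "(if a o b = m then nrm ?f mu nu a * nrm x nu ta b else 0) =
    (\<Sum>h\<in>H. if a o b = m & im a = im m & stat (im m) h (vf nu a) = rt ?l T then nrm x nu ta b else 0) / d"
   if a: "a : M" and b: "b : M" for a b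
  proof (cases "a o b = m & im a = im m")
   case True
   have "cn a = card {h\<in>H. stat (im m) h (vf nu a) = rt ?l T}"
    using True unfolding cn_def cnt_def H_def by (intro arg_cong[where f = card]) auto
   moreover have "nrm ?f mu nu a = of_nat (cn a) / d"
   proof (cases "cn a = 0")
    case True
    then show ?thesis using cell_elt_cnt(1)[OF L R part a] by (simp add: nrm_def cn_def)
   next
    case False
    then have "fam a : Q'" using cell_elt_cnt(2)[OF L R part a] by (simp add: cn_def)
    then have "v nu (fam a) = v nu D0" by (rule v_orbit[OF nu Q' _ D0])
    then show ?thesis using cell_elt_cnt(1)[OF L R part a] W_uv[OF mu nu a] True by (simp add: nrm_def cn_def d_def)
   qed
   moreover have "(\<Sum>h\<in>H. if a o b = m & im a = im m & stat (im m) h (vf nu a) = rt ?l T then nrm x nu ta b else 0) =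
     nrm x nu ta b * (\<Sum>h\<in>H. if stat (im m) h (vf nu a) = rt ?l T then 1 else 0)"
    unfolding sum_distrib_left using True by (intro sum.cong refl) simp
   ultimately show ?thesis using True by (simp add: sum_indicator_card[OF finH] mult.commute)
  next
   case False
   have "nrm ?f mu nu a = 0" if ab: "a o b = m"
   proof -
    have "card (im a) ~= sum_list xi"
    proof
     assume "card (im a) = sum_list xi"
     then have "im m = im a" using comp_index(1)[OF a b] ab mi by (intro card_subset_eq[OF finite_im]) auto
     then show False using False ab by simp
    qed
    then have "cn a = 0" using cell_elt_cnt(2)[OF L R part a] by (auto simp: cn_def)
    then show ?thesis using cell_elt_cnt(1)[OF L R part a] by (simp add: nrm_def cn_def)
   qed
   moreover have "(\<Sum>h\<in>H. if a o b = m & im a = im m & stat (im m) h (vf nu a) = rt ?l T then nrm x nu ta b else 0) = 0"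
    using False by (intro sum.neutral ballI) auto
   ultimately show ?thesis by simp
  qed
  have "mconv (nrm ?f) (nrm x) mu ta m =
    (\<Sum>kap\<in>Comp. if kap = nu then \<Sum>a\<in>M. \<Sum>b\<in>M. if a o b = m then nrm ?f mu nu a * nrm x nu ta b else 0 else 0)"
   unfolding mconv_def
  proof (rule sum_eq)
   fix kap
   have "nrm ?f mu kap b = 0" if "kap ~= nu" for b using cell_elt_off[of mu mu kap nu] that by (simp add: nrm_def)
   then show "(\<Sum>a\<in>M. \<Sum>b\<in>M. if a o b = m then nrm ?f mu kap a * nrm x kap ta b else 0) =
     (if kap = nu then \<Sum>a\<in>M. \<Sum>b\<in>M. if a o b = m then nrm ?f mu nu a * nrm x nu ta b else 0 else 0)"
    by (cases "kap = nu") (simp_all cong: if_cong)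
  qed
  also have "... = (\<Sum>a\<in>M. \<Sum>b\<in>M. if a o b = m then nrm ?f mu nu a * nrm x nu ta b else 0)"
   using finite_compositions nu by (simp add: sum.delta)
  also have "... = (\<Sum>a\<in>M. \<Sum>b\<in>M. (\<Sum>h\<in>H. if a o b = m & im a = im m &
    stat (im m) h (vf nu a) = rt ?l T then nrm x nu ta b else 0) / d)" by (intro sum.cong refl t)
  also have "... = (\<Sum>a\<in>M. \<Sum>b\<in>M. \<Sum>h\<in>H. if a o b = m & im a = im m &
    stat (im m) h (vf nu a) = rt ?l T then nrm x nu ta b else 0) / d" by (simp only: sum_divide_distrib)
  also have "... = (\<Sum>h\<in>H. E m h) / d"
   unfolding E_def right_coeff_def by (rule arg_cong[where f = "%s. s / d"], rule sum_pull)
  also have "(\<Sum>h\<in>H. E m h) = (\<Sum>A\<in>K. ep A * of_nat (card {h\<in>H. stat (im m) h (vf ta m) = A}))"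
  proof (rule sum_by_value[OF finH finK])
   fix h assume h: "h : H"
   show "E m h = ep (stat (im m) h (vf ta m))" by (rule eps[OF m])
   have "h : extensional (im m)" "stat (im m) h (blk mu) = rt ?l S" using h by (auto simp: H_def)
   then have "h : im m \<rightarrow>\<^sub>E {..<length xi}" by (rule stat_rows[OF finite_im])
   then show "stat (im m) h (vf ta m) : K" unfolding K_def using m by blast
  qed
  also have "... = (\<Sum>A\<in>K. ep A * of_nat (cntm (rt ?l S) A (cm mu ta m)))"
  proof (intro sum.cong refl)
   fix A
   have "{h\<in>H. stat (im m) h (vf ta m) = A} = {h : extensional (im m). stat (im m) h (blk mu) = rt ?l S & stat (im m) h (vf ta m) = A}"
    by (auto simp: H_def)
   then have "card {h\<in>H. stat (im m) h (vf ta m) = A} = cntm (rt ?l S) A (cm mu ta m)"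
    unfolding cm_vf cnt_eq_cntm[OF finite_im, symmetric] cnt_def by simp
   then show "ep A * of_nat (card {h\<in>H. stat (im m) h (vf ta m) = A}) = ep A * of_nat (cntm (rt ?l S) A (cm mu ta m))" by simp
  qed
  finally have mc: "mconv (nrm ?f) (nrm x) mu ta m = (\<Sum>A\<in>K. ep A * of_nat (cntm (rt ?l S) A (cm mu ta m))) / d" .
  have "of_int ((?f \<otimes>D x) mu ta m) = W mu ta m * mconv (nrm ?f) (nrm x) mu ta m"
   by (rule star_eq[OF cell_carrier[OF xi L R] x mu ta m])
  also have "... = of_nat (v ta (fam m)) * ((\<Sum>A\<in>K. ep A * of_nat (cntm (rt ?l S) A (cm mu ta m))) / of_nat (v nu D0))"
   unfolding mc W_uv[OF mu ta m] d_def using u_pos[of mu "im m"] v_pos[of nu D0] by simp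
  finally show ?thesis by (simp add: sum_divide_distrib mult.assoc)
 qed
 then show ?thesis by (intro exI[of _ K] exI[of _ "%A. ep A / of_nat (v nu D0)"]) blast
qed

text \<open>The image of a product lies in the image of its left factor, so the index cannot rise
  and at equal index the image stays in \<open>Q\<close>.\<close>

lemma right_product_zero:
 assumes x: "x : carrier DR" and xi: "xi : Lam r M" and L: "(mu0, Q, S) : Ls xi"
  and R: "(nu, Q', T) : Rs xi" and mu: "mu : Comp" and ta: "ta : Comp" and m: "m : M"
  and h: "mu ~= mu0 \<or> sum_list xi < card (im m) \<or> card (im m) = sum_list xi & im m ~: Q"
 shows "(Cell xi (mu0, Q, S) (nu, Q', T) \<otimes>D x) mu ta m = 0"
proof -
 let ?f = "Cell xi (mu0, Q, S) (nu, Q', T)"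
 have "(if a o b = m then nrm ?f mu kap a * nrm x kap ta b else 0) = 0" if a: "a : M" and b: "b : M" for a b kap
 proof (cases "a o b = m & kap = nu & mu = mu0")
  case True
  have "?f mu0 nu a = 0"
  proof (rule ccontr)
   assume "?f mu0 nu a ~= 0"
   then have a1: "im a : Q" "card (im a) = sum_list xi"
    using cell_elt_cnt[OF L R Lam_partition[OF xi] a] by (metis of_nat_0)+
   have sub: "im m <= im a" using comp_index(1)[OF a b] True by simp
   then have "card (im m) <= sum_list xi" using card_mono[OF finite_im sub] a1(2) by simp
   moreover have "im m = im a" if "card (im m) = sum_list xi"
    by (rule card_subset_eq[OF finite_im sub]) (simp add: that a1(2))
   ultimately show False using h True a1(1) by auto
  qed
  then show ?thesis using True by (simp add: nrm_def)
 next
  case False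
  then show ?thesis using cell_elt_off[of mu mu0 kap nu] by (auto simp: nrm_def)
 qed
 then have "mconv (nrm ?f) (nrm x) mu ta m = 0" unfolding mconv_def by (intro sum.neutral ballI) blast
 then show ?thesis using star_eq[OF cell_carrier[OF xi L R] x mu ta m] by simp
qed

end

section \<open>Finiteness, the poset of partitions, and the integral cell datum\<close>

lemma finite_partitions: "finite (partitions i)"
proof (rule inj_on_finite)
 show "inj_on lf (partitions i)" using lf_inj by (auto intro: inj_onI)
 show "lf ` partitions i <= {l : Par. psize l = i}" using lf_Par by auto
qed (rule finite_Par_eq)

lemma finite_diagram: "finite (diagram xi)"
proof -
 have "diagram xi = (SIGMA i:{..<length xi}. {..<xi ! i})" by (auto simp: diagram_def)
 then show ?thesis by simp
qed

lemma Lam_le_partial_order: "partial_order_on (Lam r M) (Lam_le r M)"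
proof -
 have "antisym (Lam_le r M)"
 proof (rule antisymI)
  fix mu xi assume h: "(mu, xi) : Lam_le r M" "(xi, mu) : Lam_le r M"
  then have d: "dom (lf xi) (lf mu)" "dom (lf mu) (lf xi)" by (auto simp: Lam_le_def dominates_dom)
  obtain i j where "mu : partitions i" "xi : partitions j" using h by (auto simp: Lam_le_def Lam_def)
  then show "mu = xi" using dom_antisym[OF d] lf_inj by metis
 qed
 moreover have "trans (Lam_le r M)"
 proof (rule transI)
  fix a b c assume h: "(a, b) : Lam_le r M" "(b, c) : Lam_le r M"
  have "dominates c a" if "dominates b a" "dominates c b" using that unfolding dominates_def by (meson le_trans)
  then show "(a, c) : Lam_le r M" using h by (auto simp: Lam_le_def)
 qed
 moreover have "refl_on (Lam r M) (Lam_le r M)" "Lam_le r M <= Lam r M \<times> Lam r M"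
  by (auto simp: refl_on_def Lam_le_def dominates_def)
 ultimately show ?thesis by (simp add: partial_order_on_def preorder_on_def)
qed

context gs_data
begin

lemma finite_Lam: "finite (Lam r M)" unfolding Lam_def index_set_def using finite_M finite_partitions by blast

lemma finite_L_set: "finite (Ls xi)"
proof (rule finite_subset)
 show "Ls xi <= (SIGMA mu:Comp. SIGMA Q:LO mu (sum_list xi).
   diagram xi \<rightarrow>\<^sub>E {..<length (left_orbit_comp mu Q)})" by (auto simp: L_set_def semistandard_def)
 have "finite (LO mu (sum_list xi))" for mu unfolding left_orbits_def subsets_def by simp
 then show "finite (SIGMA mu:Comp. SIGMA Q:LO mu (sum_list xi).
   diagram xi \<rightarrow>\<^sub>E {..<length (left_orbit_comp mu Q)})"
  by (intro finite_SigmaI finite_compositions finite_PiE finite_diagram) auto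
qed

lemma finite_R_set: "finite (Rs xi)"
proof (rule finite_subset)
 show "Rs xi <= (SIGMA nu:Comp. SIGMA Q:RO nu (sum_list xi).
   diagram xi \<rightarrow>\<^sub>E {..<length (right_orbit_comp (orbs nu) Q)})"
  by (auto simp: R_set_def semistandard_def)
 have "finite (monoid_families leq M i r)" for leq i
  by (rule finite_subset[of _ "Pow (Pow {1..r})"]) (auto simp: monoid_families_def disjoint_families_def)
 then have "finite (RO nu (sum_list xi))" for nu unfolding right_orbits_def by simp
 then show "finite (SIGMA nu:Comp. SIGMA Q:RO nu (sum_list xi).
   diagram xi \<rightarrow>\<^sub>E {..<length (right_orbit_comp (orbs nu) Q)})"
  by (intro finite_SigmaI finite_compositions finite_PiE finite_diagram) auto
qed

lemma left_orbit_card: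
 "mu : Comp ==> Q : LO mu i ==> C : Q ==> card C = i" using left_orbit_iff(1)[of mu Q i C] by (simp add: subsets_def)

lemma coord_coords:
 "(xi, (mu, Q, S), (nu, Q', T)) : Index ==>
  coord x (xi, (mu, Q, S), (nu, Q', T)) = coords mu nu Q Q' (x mu nu) (lf xi, S, T)" by (simp add: coord_def)

lemma Lam_leI:
 assumes "xi : Lam r M" "xi' : Lam r M" "~ ((xi, xi') : Lam_le r M & xi ~= xi')"
 shows "sum_list xi <= sum_list xi'" "sum_list xi' = sum_list xi ==> xi' ~= xi ==> ~ dom (lf xi') (lf xi)"
 using assms by (auto simp: Lam_le_def dominates_dom not_le)

end

context weighted_gs
begin

lemma mult_carrier: "x \<otimes>D y : carrier DR" unfolding mult_eq by (rule star_closed)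

text \<open>Since \<open>u mu\<close> is constant on the orbit \<open>Q1\<close>, the formula of
  \<open>left_product\<close> becomes an identity between functions of the colour matrix, which is
  the hypothesis of \<open>bival_expansion\<close>.\<close>

lemma left_expansion:
 assumes x: "x : carrier DR" and xi: "xi : Lam r M" and L: "(nu, Q, S) : Ls xi"
  and mu: "mu : Comp" and Q1: "Q1 : LO mu (sum_list xi)"
 shows "\<exists>(K :: (nat => nat => nat) set) c. \<forall>ta Q' T. (ta, Q', T) : Rs xi --> (\<forall>N\<in>MM mu ta Q1 Q'.
  (\<Sum>b\<in>BT mu ta Q1 Q'. of_int (coords mu ta Q1 Q' ((x \<otimes>D Cell xi (nu, Q, S) (ta, Q', T)) mu ta) b) * of_nat (bival b N)) =
  (\<Sum>A\<in>K. c A * of_nat (cntm A (rt (lf xi) T) N) :: rat))"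
proof -
 obtain K :: "(nat => nat => nat) set" and c where c: "!!ta Q' T m. (ta, Q', T) : Rs xi ==> m : M ==> card (im m) = sum_list xi ==>
  of_int ((x \<otimes>D Cell xi (nu, Q, S) (ta, Q', T)) mu ta m) =
  of_nat (u mu (im m)) * (\<Sum>A\<in>K. c A * of_nat (cntm A (rt (lf xi) T) (cm mu ta m)) :: rat)"
  using left_product[OF x xi L mu] by blast
 obtain C1 where C1: "C1 : Q1" using left_orbit_nonempty[OF Q1] by blast
 have "(\<Sum>b\<in>BT mu ta Q1 Q'. of_int (coords mu ta Q1 Q' ((x \<otimes>D Cell xi (nu, Q, S) (ta, Q', T)) mu ta) b) * of_nat (bival b N)) =
  (\<Sum>A\<in>K. (of_nat (u mu C1) * c A) * of_nat (cntm A (rt (lf xi) T) N))"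
  if R: "(ta, Q', T) : Rs xi" and N: "N : MM mu ta Q1 Q'" for ta Q' T N
 proof -
  let ?p = "x \<otimes>D Cell xi (nu, Q, S) (ta, Q', T)"
  note ta = R_set_D(1)[OF R] and Q' = R_set_D(2)[OF R]
  obtain m where m: "m : M" "im m : Q1" "fam m : Q'" "cm mu ta m = N" using realize[OF mu ta Q1 Q' N] by blast
  have "local_expansion mu ta Q1 Q' (?p mu ta) (%b. of_int (coords mu ta Q1 Q' (?p mu ta) b))"
   by (rule coords_expansion[OF mu ta Q1 Q' carrierD(1)[OF mult_carrier mu ta]])
  then have "of_int (?p mu ta m) = (\<Sum>b\<in>BT mu ta Q1 Q'. rat_of_int (coords mu ta Q1 Q' (?p mu ta) b) * of_nat (bival b N))"
   unfolding local_expansion_def using m by blast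
  moreover have "of_int (?p mu ta m) = (\<Sum>A\<in>K. (of_nat (u mu C1) * c A) * of_nat (cntm A (rt (lf xi) T) N) :: rat)"
   unfolding c[OF R m(1) left_orbit_card[OF mu Q1 m(2)]] u_orbit[OF mu Q1 m(2) C1] m(4)
   by (simp add: sum_distrib_left mult.assoc)
  ultimately show ?thesis by simp
 qed
 then show ?thesis by (intro exI[of _ K] exI[of _ "%A. of_nat (u mu C1) * c A"]) blast
qed

lemma right_expansion:
 assumes x: "x : carrier DR" and xi: "xi : Lam r M" and R: "(nu, Q', T) : Rs xi"
  and ta: "ta : Comp" and Q1: "Q1 : RO ta (sum_list xi)"
 shows "\<exists>(K :: (nat => nat => nat) set) c. \<forall>mu Q S. (mu, Q, S) : Ls xi --> (\<forall>N\<in>MM mu ta Q Q1.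
  (\<Sum>b\<in>BT mu ta Q Q1. of_int (coords mu ta Q Q1 ((Cell xi (mu, Q, S) (nu, Q', T) \<otimes>D x) mu ta) b) * of_nat (bival b N)) =
  (\<Sum>A\<in>K. c A * of_nat (cntm (rt (lf xi) S) A N) :: rat))"
proof -
 obtain K :: "(nat => nat => nat) set" and c where c: "!!mu Q S m. (mu, Q, S) : Ls xi ==> m : M ==> card (im m) = sum_list xi ==>
  of_int ((Cell xi (mu, Q, S) (nu, Q', T) \<otimes>D x) mu ta m) =
  of_nat (v ta (fam m)) * (\<Sum>A\<in>K. c A * of_nat (cntm (rt (lf xi) S) A (cm mu ta m)) :: rat)"
  using right_product[OF x xi R ta] by blast
 obtain D1 where D1: "D1 : Q1" using right_orbit_nonempty[OF Q1] by blast
 have "(\<Sum>b\<in>BT mu ta Q Q1. of_int (coords mu ta Q Q1 ((Cell xi (mu, Q, S) (nu, Q', T) \<otimes>D x) mu ta) b) * of_nat (bival b N)) =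
  (\<Sum>A\<in>K. (of_nat (v ta D1) * c A) * of_nat (cntm (rt (lf xi) S) A N))"
  if L: "(mu, Q, S) : Ls xi" and N: "N : MM mu ta Q Q1" for mu Q S N
 proof -
  let ?p = "Cell xi (mu, Q, S) (nu, Q', T) \<otimes>D x"
  note mu = L_set_D(1)[OF L] and Q = L_set_D(2)[OF L]
  obtain m where m: "m : M" "im m : Q" "fam m : Q1" "cm mu ta m = N" using realize[OF mu ta Q Q1 N] by blast
  have "local_expansion mu ta Q Q1 (?p mu ta) (%b. of_int (coords mu ta Q Q1 (?p mu ta) b))"
   by (rule coords_expansion[OF mu ta Q Q1 carrierD(1)[OF mult_carrier mu ta]])
  then have "of_int (?p mu ta m) = (\<Sum>b\<in>BT mu ta Q Q1. rat_of_int (coords mu ta Q Q1 (?p mu ta) b) * of_nat (bival b N))"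
   unfolding local_expansion_def using m by blast
  moreover have "of_int (?p mu ta m) = (\<Sum>A\<in>K. (of_nat (v ta D1) * c A) * of_nat (cntm (rt (lf xi) S) A N) :: rat)"
   unfolding c[OF L m(1) left_orbit_card[OF mu Q m(2)]] v_orbit[OF ta Q1 m(3) D1] m(4)
   by (simp add: sum_distrib_left mult.assoc)
  ultimately show ?thesis by simp
 qed
 then show ?thesis by (intro exI[of _ K] exI[of _ "%A. of_nat (v ta D1) * c A"]) blast
qed

text \<open>An index that is not strictly above \<open>xi\<close> has size at least that of
  \<open>xi\<close>. Larger sizes and foreign right orbits are excluded by
  \<open>left_product_zero\<close>; for equal size and the same right orbit,
  \<open>bival_expansion\<close> decides by shape and right tableau.\<close>

lemma left_coord_zero:
 assumes x: "x : carrier DR" and xi: "xi : Lam r M" and s: "s : Ls xi" and t: "t : Rs xi"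
  and xi': "xi' : Lam r M" and s': "s' : Ls xi'" and t': "t' : Rs xi'"
  and up: "~ ((xi, xi') : Lam_le r M & xi ~= xi')" and ne: "~ (xi' = xi & t' = t)"
 shows "coord (x \<otimes>D Cell xi s t) (xi', s', t') = 0"
proof -
 obtain nu Q S where ss: "s = (nu, Q, S)" by (cases s)
 obtain ta0 Q' T where tt: "t = (ta0, Q', T)" by (cases t)
 obtain mu Q1 U where ss': "s' = (mu, Q1, U)" by (cases s')
 obtain ta Q1' V where tt': "t' = (ta, Q1', V)" by (cases t')
 note L = s[unfolded ss] and R = t[unfolded tt] and L' = s'[unfolded ss'] and R' = t'[unfolded tt']
 note mu = L_set_D(1)[OF L'] and ta = R_set_D(1)[OF R'] and Q1 = L_set_D(2)[OF L'] and Q1' = R_set_D(2)[OF R']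
 let ?p = "x \<otimes>D Cell xi (nu, Q, S) (ta0, Q', T)"
 have ge: "sum_list xi <= sum_list xi'" by (rule Lam_leI(1)[OF xi xi' up])
 show ?thesis
 proof (cases "ta ~= ta0 \<or> sum_list xi < sum_list xi' \<or> Q1' ~= Q'")
  case True
  have "?p mu ta m = 0" if m: "m : M" "im m : Q1" "fam m : Q1'" for m
  proof (rule left_product_zero[OF x xi L R mu ta m(1)])
   have ci: "card (im m) = sum_list xi'" by (rule left_orbit_card[OF mu Q1 m(2)])
   have "fam m ~: Q'" if "ta = ta0" "Q1' ~= Q'"
    using right_orbits_eq(1)[OF ta Q1' _ m(3), of Q' "sum_list xi"] R_set_D(2)[OF R] that by auto
   then show "ta ~= ta0 \<or> sum_list xi < card (im m) \<or> card (im m) = sum_list xi & fam m ~: Q'"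
    using True ge ci by auto
  qed
  then have "local_expansion mu ta Q1 Q1' (?p mu ta) (%_. 0)" by (simp add: local_expansion_def)
  from coord_eqI[where x = ?p, OF xi' L' R' carrierD(1)[OF mult_carrier mu ta] this]
  show ?thesis unfolding ss tt ss' tt' by simp
 next
  case False
  then have eq: "ta = ta0" "sum_list xi' = sum_list xi" "Q1' = Q'" using ge by auto
  note Q1i = Q1[unfolded eq(2)]
  obtain K :: "(nat => nat => nat) set" and c where g: "!!N. N : MM mu ta0 Q1 Q' ==>
   (\<Sum>b\<in>BT mu ta0 Q1 Q'. of_int (coords mu ta0 Q1 Q' (?p mu ta0) b) * of_nat (bival b N)) =
   (\<Sum>A\<in>K. c A * of_nat (cntm A (rt (lf xi) T) N) :: rat)" using left_expansion[OF x xi L mu Q1i] R by blast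
  note be = bival_expansion[OF lf_Par(1)[OF Lam_partition[OF xi]] R_set_D(3)[OF R] g]
  have "rat_of_int (coords mu ta0 Q1 Q' (?p mu ta0) (lf xi', U, V)) = 0"
  proof (cases "xi' = xi")
   case True
   then have "V ~= T" using ne eq unfolding tt tt' by simp
   then show ?thesis using be(2) L_set_D(3)[OF L'] R_set_D(3)[OF R'] unfolding eq True by blast
  next
   case F: False
   show ?thesis using be(1) Index_D[OF xi' L' R'] Lam_leI(2)[OF xi xi' up eq(2) F] unfolding eq by blast
  qed
  moreover have "coord ?p (xi', s', t') = coords mu ta0 Q1 Q' (?p mu ta0) (lf xi', U, V)"
   unfolding ss' tt' using coord_coords[of xi' mu Q1 U ta Q1' V ?p] xi' L' R' eq by simp
  ultimately show ?thesis unfolding ss tt by simp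
 qed
qed

text \<open>The coefficients \<open>K\<close> and \<open>c\<close> from
  \<open>left_expansion\<close> are the same for all right indices, so
  \<open>bival_expansion_coeff_unique\<close> compares \<open>t1\<close> and \<open>t2\<close> even
  if their orbits and compositions differ.\<close>

lemma left_coord_eq:
 assumes x: "x : carrier DR" and xi: "xi : Lam r M" and s: "s : Ls xi" and s': "s' : Ls xi"
  and t: "t1 : Rs xi" "t2 : Rs xi"
 shows "coord (x \<otimes>D Cell xi s t1) (xi, s', t1) = coord (x \<otimes>D Cell xi s t2) (xi, s', t2)"
proof -
 obtain nu Q S where ss: "s = (nu, Q, S)" by (cases s)
 obtain mu Q1 U where ss': "s' = (mu, Q1, U)" by (cases s')
 obtain ta1 Q1' T1 where tt1: "t1 = (ta1, Q1', T1)" by (cases t1)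
 obtain ta2 Q2' T2 where tt2: "t2 = (ta2, Q2', T2)" by (cases t2)
 note L = s[unfolded ss] and L' = s'[unfolded ss'] and R1 = t(1)[unfolded tt1] and R2 = t(2)[unfolded tt2]
 let ?p1 = "x \<otimes>D Cell xi (nu, Q, S) (ta1, Q1', T1)" and ?p2 = "x \<otimes>D Cell xi (nu, Q, S) (ta2, Q2', T2)"
 obtain K :: "(nat => nat => nat) set" and c where g: "!!ta Q' T N. (ta, Q', T) : Rs xi ==> N : MM mu ta Q1 Q' ==>
  (\<Sum>b\<in>BT mu ta Q1 Q'. of_int (coords mu ta Q1 Q' ((x \<otimes>D Cell xi (nu, Q, S) (ta, Q', T)) mu ta) b) * of_nat (bival b N)) =
  (\<Sum>A\<in>K. c A * of_nat (cntm A (rt (lf xi) T) N) :: rat)"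
  using left_expansion[OF x xi L L_set_D(1,2)[OF L']] by blast
 have "rat_of_int (coords mu ta1 Q1 Q1' (?p1 mu ta1) (lf xi, U, T1)) = of_int (coords mu ta2 Q1 Q2' (?p2 mu ta2) (lf xi, U, T2))"
  by (rule bival_expansion_coeff_unique[where ?z1.0 = "%b. rat_of_int (coords mu ta1 Q1 Q1' (?p1 mu ta1) b)"
    and ?z2.0 = "%b. rat_of_int (coords mu ta2 Q1 Q2' (?p2 mu ta2) b)",
    OF lf_Par(1)[OF Lam_partition[OF xi]] R_set_D(3)[OF R1] R_set_D(3)[OF R2] g[OF R1] g[OF R2] L_set_D(3)[OF L']])
 then show ?thesis unfolding ss ss' tt1 tt2 using xi L' R1 R2 by (simp add: coord_coords)
qed

lemma right_coord_zero:
 assumes x: "x : carrier DR" and xi: "xi : Lam r M" and s: "s : Ls xi" and t: "t : Rs xi"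
  and xi': "xi' : Lam r M" and s': "s' : Ls xi'" and t': "t' : Rs xi'"
  and up: "~ ((xi, xi') : Lam_le r M & xi ~= xi')" and ne: "~ (xi' = xi & s' = s)"
 shows "coord (Cell xi s t \<otimes>D x) (xi', s', t') = 0"
proof -
 obtain mu0 Q S where ss: "s = (mu0, Q, S)" by (cases s)
 obtain nu Q' T where tt: "t = (nu, Q', T)" by (cases t)
 obtain mu Q1 U where ss': "s' = (mu, Q1, U)" by (cases s')
 obtain ta Q1' V where tt': "t' = (ta, Q1', V)" by (cases t')
 note L = s[unfolded ss] and R = t[unfolded tt] and L' = s'[unfolded ss'] and R' = t'[unfolded tt']
 note mu = L_set_D(1)[OF L'] and ta = R_set_D(1)[OF R'] and Q1 = L_set_D(2)[OF L'] and Q1' = R_set_D(2)[OF R']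
 let ?p = "Cell xi (mu0, Q, S) (nu, Q', T) \<otimes>D x"
 have ge: "sum_list xi <= sum_list xi'" by (rule Lam_leI(1)[OF xi xi' up])
 show ?thesis
 proof (cases "mu ~= mu0 \<or> sum_list xi < sum_list xi' \<or> Q1 ~= Q")
  case True
  have "?p mu ta m = 0" if m: "m : M" "im m : Q1" "fam m : Q1'" for m
  proof (rule right_product_zero[OF x xi L R mu ta m(1)])
   have ci: "card (im m) = sum_list xi'" by (rule left_orbit_card[OF mu Q1 m(2)])
   have "im m ~: Q" if "mu = mu0" "Q1 ~= Q"
    using left_orbits_eq(1)[OF mu Q1 _ m(2), of Q "sum_list xi"] L_set_D(2)[OF L] that by auto
   then show "mu ~= mu0 \<or> sum_list xi < card (im m) \<or> card (im m) = sum_list xi & im m ~: Q"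
    using True ge ci by auto
  qed
  then have "local_expansion mu ta Q1 Q1' (?p mu ta) (%_. 0)" by (simp add: local_expansion_def)
  from coord_eqI[where x = ?p, OF xi' L' R' carrierD(1)[OF mult_carrier mu ta] this]
  show ?thesis unfolding ss tt ss' tt' by simp
 next
  case False
  then have eq: "mu = mu0" "sum_list xi' = sum_list xi" "Q1 = Q" using ge by auto
  note Q1i = Q1'[unfolded eq(2)]
  obtain K :: "(nat => nat => nat) set" and c where g: "!!N. N : MM mu0 ta Q Q1' ==>
   (\<Sum>b\<in>BT mu0 ta Q Q1'. of_int (coords mu0 ta Q Q1' (?p mu0 ta) b) * of_nat (bival b N)) =
   (\<Sum>A\<in>K. c A * of_nat (cntm (rt (lf xi) S) A N) :: rat)" using right_expansion[OF x xi R ta Q1i] L by blast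
  note be = bival_expansion_right[OF lf_Par(1)[OF Lam_partition[OF xi]] L_set_D(3)[OF L] g]
  have "rat_of_int (coords mu0 ta Q Q1' (?p mu0 ta) (lf xi', U, V)) = 0"
  proof (cases "xi' = xi")
   case True
   then have "U ~= S" using ne eq unfolding ss ss' by simp
   then show ?thesis using be(2) L_set_D(3)[OF L'] R_set_D(3)[OF R'] unfolding eq True by blast
  next
   case F: False
   show ?thesis using be(1) Index_D[OF xi' L' R'] Lam_leI(2)[OF xi xi' up eq(2) F] unfolding eq by blast
  qed
  moreover have "coord ?p (xi', s', t') = coords mu0 ta Q Q1' (?p mu0 ta) (lf xi', U, V)"
   unfolding ss' tt' using coord_coords[of xi' mu Q1 U ta Q1' V ?p] xi' L' R' eq by simp
  ultimately show ?thesis unfolding ss tt by simp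
 qed
qed

lemma right_coord_eq:
 assumes x: "x : carrier DR" and xi: "xi : Lam r M" and t: "t : Rs xi" and t': "t' : Rs xi"
  and s: "s1 : Ls xi" "s2 : Ls xi"
 shows "coord (Cell xi s1 t \<otimes>D x) (xi, s1, t') = coord (Cell xi s2 t \<otimes>D x) (xi, s2, t')"
proof -
 obtain nu Q' T where tt: "t = (nu, Q', T)" by (cases t)
 obtain ta Q1 V where tt': "t' = (ta, Q1, V)" by (cases t')
 obtain mu1 Q1' S1 where ss1: "s1 = (mu1, Q1', S1)" by (cases s1)
 obtain mu2 Q2' S2 where ss2: "s2 = (mu2, Q2', S2)" by (cases s2)
 note R = t[unfolded tt] and R' = t'[unfolded tt'] and L1 = s(1)[unfolded ss1] and L2 = s(2)[unfolded ss2]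
 let ?p1 = "Cell xi (mu1, Q1', S1) (nu, Q', T) \<otimes>D x" and ?p2 = "Cell xi (mu2, Q2', S2) (nu, Q', T) \<otimes>D x"
 obtain K :: "(nat => nat => nat) set" and c where g: "!!mu Q S N. (mu, Q, S) : Ls xi ==> N : MM mu ta Q Q1 ==>
  (\<Sum>b\<in>BT mu ta Q Q1. of_int (coords mu ta Q Q1 ((Cell xi (mu, Q, S) (nu, Q', T) \<otimes>D x) mu ta) b) * of_nat (bival b N)) =
  (\<Sum>A\<in>K. c A * of_nat (cntm (rt (lf xi) S) A N) :: rat)"
  using right_expansion[OF x xi R R_set_D(1,2)[OF R']] by blast
 have "rat_of_int (coords mu1 ta Q1' Q1 (?p1 mu1 ta) (lf xi, S1, V)) = of_int (coords mu2 ta Q2' Q1 (?p2 mu2 ta) (lf xi, S2, V))"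
  by (rule bival_expansion_coeff_unique_right[where ?z1.0 = "%b. rat_of_int (coords mu1 ta Q1' Q1 (?p1 mu1 ta) b)"
    and ?z2.0 = "%b. rat_of_int (coords mu2 ta Q2' Q1 (?p2 mu2 ta) b)",
    OF lf_Par(1)[OF Lam_partition[OF xi]] L_set_D(3)[OF L1] L_set_D(3)[OF L2] g[OF L1] g[OF L2] R_set_D(3)[OF R']])
 then show ?thesis unfolding tt tt' ss1 ss2 using xi R' L1 L2 by (simp add: coord_coords)
qed

lemma Cell_carrier: "xi : Lam r M ==> s : Ls xi ==> t : Rs xi ==> Cell xi s t : carrier DR"
 by (cases s, cases t) (auto intro: cell_carrier)

lemma cell_datum:
 fixes R :: "('a, 'm) ring_scheme"
 assumes "domain R"
 shows "integral_cell_datum R DR (Lam r M) (Lam_le r M) (L_set r n) (Rs) Cell coord"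
proof (intro integral_cell_datum.intro base_change_setting.intro integral_cell_datum_axioms.intro)
 show "cring R" using assms by (rule domain.axioms(1))
 show "ring DR" by (rule ring_DR)
 show "coord (a \<oplus>D b) i = coord a i + coord b i" if "a : carrier DR" "b : carrier DR" for a b i
  using coord_add[of a b i] carrierD(1)[OF that(1)] carrierD(1)[OF that(2)] by (simp add: double_coset_ring_def)
 show "a = \<zero>D" if a: "a : carrier DR" and z: "!!i. i : Index ==> coord a i = 0" for a
 proof -
  have "a mu nu m = 0" for mu nu m
  proof (cases "mu : Comp & nu : Comp & m : M")
   case True
   then show ?thesis using coord_zero[where x = a, OF carrierD(1)[OF a] z] by blast
  next
   case False
   then show ?thesis using carrierD(2,3)[OF a] by blast
  qed
  then show ?thesis by (simp add: double_coset_ring_def fun_eq_iff)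
 qed
next
 fix a xi s assume h: "a : carrier DR" "xi : Lam r M" "s : Ls xi"
 \<comment> \<open>By \<open>left_coord_eq\<close> any right index may be used to define the
   coefficients; if there is none, the claim is vacuous.\<close>
 let ?t = "SOME t. t : Rs xi"
 show "\<exists>rho. \<forall>t\<in>Rs xi. \<forall>xi'\<in>Lam r M. \<forall>s'\<in>Ls xi'. \<forall>t'\<in>Rs xi'.
   ~ ((xi, xi') : Lam_le r M & xi ~= xi') -->
   coord (a \<otimes>D Cell xi s t) (xi', s', t') = (if xi' = xi & t' = t then rho s' else 0)"
 proof (intro exI[of _ "%s'. coord (a \<otimes>D Cell xi s ?t) (xi, s', ?t)"] ballI impI)
  fix t xi' s' t' assume k: "t : Rs xi" "xi' : Lam r M" "s' : Ls xi'"
   "t' : Rs xi'" "~ ((xi, xi') : Lam_le r M & xi ~= xi')"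
  have t: "?t : Rs xi" by (rule someI[of "%t. t : Rs xi", OF k(1)])
  show "coord (a \<otimes>D Cell xi s t) (xi', s', t') =
    (if xi' = xi & t' = t then coord (a \<otimes>D Cell xi s ?t) (xi, s', ?t) else 0)"
  proof (cases "xi' = xi & t' = t")
   case True
   then show ?thesis using left_coord_eq[OF h _ k(1) t, of s'] k(3) by simp
  next
   case False
   then show ?thesis using left_coord_zero[OF h(1,2,3) k(1-5) False] by auto
  qed
 qed
next
 fix a xi t assume h: "a : carrier DR" "xi : Lam r M" "t : Rs xi"
 let ?s = "SOME s. s : Ls xi"
 show "\<exists>rho. \<forall>s\<in>Ls xi. \<forall>xi'\<in>Lam r M. \<forall>s'\<in>Ls xi'. \<forall>t'\<in>Rs xi'.
   ~ ((xi, xi') : Lam_le r M & xi ~= xi') -->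
   coord (Cell xi s t \<otimes>D a) (xi', s', t') = (if xi' = xi & s' = s then rho t' else 0)"
 proof (intro exI[of _ "%t'. coord (Cell xi ?s t \<otimes>D a) (xi, ?s, t')"] ballI impI)
  fix s xi' s' t' assume k: "s : Ls xi" "xi' : Lam r M" "s' : Ls xi'"
   "t' : Rs xi'" "~ ((xi, xi') : Lam_le r M & xi ~= xi')"
  have s: "?s : Ls xi" by (rule someI[of "%s. s : Ls xi", OF k(1)])
  show "coord (Cell xi s t \<otimes>D a) (xi', s', t') =
    (if xi' = xi & s' = s then coord (Cell xi ?s t \<otimes>D a) (xi, ?s, t') else 0)"
  proof (cases "xi' = xi & s' = s")
   case True
   then show ?thesis using right_coord_eq[OF h(1,2,3) _ k(1) s, of t'] k(4) by simp
  next
   case False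
   then show ?thesis using right_coord_zero[OF h(1,2) k(1) h(3) k(2-5) False] by auto
  qed
 qed
qed (use assms in \<open>simp_all add: finite_Lam Lam_le_partial_order finite_L_set finite_R_set Cell_carrier coord_cell_elt\<close>)

lemma base_change_cells:
 fixes R :: "('a, 'm) ring_scheme"
 assumes "domain R"
 shows "cell_algebra R (base_change R DR) (Lam r M) (Lam_le r M) (L_set r n) (Rs)
  (%xi s t. pure_tensor R DR \<one>\<^bsub>R\<^esub> (Cell xi s t))"
 by (rule integral_cell_datum.base_change_cell_algebra[OF cell_datum[OF assms]])

end

theorem corollary4p3:
  fixes R :: "('a, 'm) ring_scheme"
    and r n :: nat
    and M :: "(nat \<Rightarrow> nat) set"
    and orbs :: "nat list \<Rightarrow> nat set set list"
    and ord :: "nat list \<Rightarrow> nat set rel"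
  assumes "domain R"
    and "1 \<le> r" and "r \<le> n"
    and "intermediate_monoid r M"
    and "compatible_orders r n orbs ord"
  shows "cell_algebra R (LGS R r n M) (Lam r M) (Lam_le r M)
           (L_set r n) (R_set r n M orbs ord)
           (\<lambda>\<xi> s t. pure_tensor R (A_L r n M) \<one>\<^bsub>R\<^esub> (cell_elt orbs ord \<xi> s t)) \<and>
         cell_algebra R (RGS R r n M) (Lam r M) (Lam_le r M)
           (L_set r n) (R_set r n M orbs ord)
           (\<lambda>\<xi> s t. pure_tensor R (A_R r n M) \<one>\<^bsub>R\<^esub> (cell_elt orbs ord \<xi> s t))"
proof -
  interpret gs_data r n M orbs ord by (rule gs_data.intro) (fact assms)+
  show ?thesis
    unfolding LGS_def RGS_def A_L_def A_R_def
    by (intro conjI weighted_gs.base_change_cells[OF weighted_left assms(1)]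
        weighted_gs.base_change_cells[OF weighted_right assms(1)])
qed

end
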